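(* Let $E^\otimes=(E_t)_{t\in(0,\infty)}$ be an Arveson system and let $e\in E_1$ be a unit vector. Let $R=\left(\int_0^1E_\alpha\,d\alpha\right)\otimes\breve R$ with unitaries $w_t\colon E_t\otimes R\to R$ ($t>0$) be the first construction, and let $H$ with isometries $v_t\colon E_t\otimes H\to H$ ($t>0$) be the second construction, both formed with the same unit vector $e$, as defined in the context. Then there is a unitary $V\colon R\to H$, determined by $$V\bigl(f\otimes i_m(y)\bigr)=\widetilde g+\mathcal N,\qquad g(\alpha)=f(\alpha-m)\,y\quad(\alpha\in(m,m+1]),$$ for all $m\in\mathbb N$, $f\in\int_0^1E_\alpha\,d\alpha$ and $y\in E_m$, such that $$V\,w_t=v_t\,(\mathrm{id}_{E_t}\otimes V)\qquad\text{for all }t>0.$$ Consequently, the unitaries $w_t$ iterate associatively, i.e. $w_{t+s}(xy\otimes h)=w_t\bigl(x\otimes w_s(y\otimes h)\bigr)$ for all $s,t>0$, $x\in E_t$, $y\in E_s$, $h\in R$, and the isometries $v_t$ are unitary for all $t>0$.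
   Context: Arveson system. An Arveson system $E^\otimes=(E_t)_{t\in(0,\infty)}$ is a family of Hilbert spaces with unitaries $u_{t,s}\colon E_t\otimes E_s\to E_{t+s}$ ($s,t>0$) such that the product $xy:=u_{t,s}(x\otimes y)$ ($x\in E_t$, $y\in E_s$) is associative. Moreover, the bundle $E^\otimes$ has a Borel structure isomorphic to that of the trivial bundle $(0,\infty)\times H_0$ for an infinite-dimensional separable Hilbert space $H_0$ (as a bundle of Hilbert spaces), and for all measurable sections $t\mapsto x(t)\in E_t$ and $t\mapsto y(t)\in E_t$ the function $(t,s)\mapsto x(t)y(s)\in E_{t+s}$ is measurable. Direct integrals $\int_a^bE_\alpha\,d\alpha$ are the Hilbert spaces of (classes of) square integrable measurable sections over $(a,b]$, with respect to Lebesgue measure. Put $E_0:=\mathbb C$, with $u_{t,0}$ and $u_{0,t}$ the canonical identifications. Here $\mathbb N=\{1,2,\dots\}$ and $\mathbb N_0=\{0,1,2,\dots\}$. For $s>0$, $\{s\}$ denotes the unique integer $n$ with $s-n\in(0,1]$ (not the fractional part). Powers $e^n\in E_n$ are taken in the product of $E^\otimes$, and multiplying by $e^0$ is the identity. First construction. Let $\breve R$ be the completed inductive limit of the Hilbert spaces $E_m$ ($m\in\mathbb N$) under the isometric embeddings $E_m\to E_{m+n}$, $x\mapsto xe^n$, and let $i_m\colon E_m\to\breve R$ be the canonical isometries, so $i_{m+n}(xe^n)=i_m(x)$. For $n\in\mathbb N$ let $\breve w_n\colon E_n\otimes\breve R\to\breve R$ be the unitary determined by $\breve w_n(x\otimes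 i_m(y))=i_{n+m}(xy)$, and let $\breve w_0$ be the canonical identification $\mathbb C\otimes\breve R=\breve R$. Put $R:=\left(\int_0^1E_\alpha\,d\alpha\right)\otimes\breve R$, identified with the square integrable sections over $(0,1]$ with values in $E_\alpha\otimes\breve R$. For $t>0$, the unitary $w_t\colon E_t\otimes R\to R$ is defined pointwise on sections: for $x\in E_t$, $f\in\int_0^1E_\alpha\,d\alpha$ and $y\in\breve R$, $w_t(x\otimes f\otimes y)$ is the section whose value at $\beta=t+\alpha-n\in(0,1]$, where $\alpha\in(0,1]$ and $n=\{t+\alpha\}$, is $$(\mathrm{id}_{E_{t+\alpha-n}}\otimes\breve w_n)\bigl(u_{t+\alpha-n,n}^*(xf(\alpha))\otimes y\bigr)\in E_{t+\alpha-n}\otimes\breve R.$$ (For fixed $t$, $\alpha\mapsto\beta$ is a bijection of $(0,1]$.) Second construction. Let $\mathcal S$ be the space of all locally square integrable measurable sections $f=(f(\alpha))_{\alpha\in(0,\infty)}$, $f(\alpha)\in E_\alpha$ (i.e. $\int_0^T\|f(\alpha)\|^2d\alpha<\infty$ for all $T>0$), for which there is $\alpha_0>0$ with $f(\alpha+1)=f(\alpha)e$ for all $\alpha\ge\alpha_0$. Let $\mathcal N\subset\mathcal S$ be the subspace of those $f$ for which there is $\alpha_0>0$ with $f(\alpha)=0$ for almost all $\alpha\ge\alpha_0$. The formula $\langle f,g\rangle:=\lim_{m\to\infty}\int_m^{m+1}\langle f(\alpha),g(\alpha)\rangle\,d\alpha$ defines a semi-inner product on $\mathcal S$ with $\langle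 f,f\rangle=0$ if and only if $f\in\mathcal N$. $H$ is the completion of the pre-Hilbert space $\mathcal S/\mathcal N$. For $t>0$, $v_t\colon E_t\otimes H\to H$ is the isometry determined by $x\otimes(f+\mathcal N)\mapsto xf+\mathcal N$, where $(xf)(\alpha)=xf(\alpha-t)$ for $\alpha>t$ and $(xf)(\alpha)=0$ otherwise. The extension $\widetilde g$. For $m\in\mathbb N$ and $g=(g(\alpha))_{\alpha\in(m,m+1]}\in\int_m^{m+1}E_\alpha\,d\alpha$, the section $\widetilde g\in\mathcal S$ is defined by $\widetilde g(\alpha)=0$ for $\alpha\le m$ and $\widetilde g(\alpha)=g(\alpha-n)e^n$ for $m+n<\alpha\le m+n+1$, $n\in\mathbb N_0$. *)

theory Defs
  imports
    "HOL-Analysis.Analysis"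
    "HOL-Algebra.AbelCoset"
    "HOL-Algebra.Module"
    "HOL-Library.Poly_Mapping"
begin

section \<open>Complex Hilbert spaces with explicit carriers\<close>

definition complex_field :: "complex ring" where
  "complex_field = \<lparr>carrier = UNIV, mult = (*), one = 1, zero = 0, add = (+)\<rparr>"

text \<open>
  A complex vector space is a module of HOL-Algebra over \<^const>\<open>complex_field\<close>; the record is extended
  by an inner product, linear in the second argument.  The ring fields \<open>mult\<close> and \<open>one\<close> inherited by
  the module record carry no meaning and are left unspecified.
\<close>

record 'a hspace = "(complex, 'a) module" +
  inn :: "'a \<Rightarrow> 'a \<Rightarrow> complex"

definition mk_hspace ::
  "'a set \<Rightarrow> 'a \<Rightarrow> ('a \<Rightarrow> 'a \<Rightarrow> 'a) \<Rightarrow> (complex \<Rightarrow> 'a \<Rightarrow> 'a) \<Rightarrow> ('a \<Rightarrow> 'a \<Rightarrow> complex) \<Rightarrow> 'a hspace" where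
  "mk_hspace C z a s i =
    \<lparr>carrier = C, mult = undefined, one = undefined, zero = z, add = a, smult = s, inn = i\<rparr>"

definition hnorm :: "'a hspace \<Rightarrow> 'a \<Rightarrow> real" where
  "hnorm X x = sqrt (Re (inn X x x))"

text \<open>The value outside the carrier is chosen so that the locale \<^locale>\<open>Metric_space\<close> applies,
  which requires symmetry and nonnegativity on the whole type.\<close>

definition hdist :: "'a hspace \<Rightarrow> 'a \<Rightarrow> 'a \<Rightarrow> real" where
  "hdist X x y = (if x \<in> carrier X \<and> y \<in> carrier X then hnorm X (x \<ominus>\<^bsub>X\<^esub> y) else 0)"

definition hilbert_space :: "'a hspace \<Rightarrow> bool" where
  "hilbert_space X \<longleftrightarrow>
     Module.module complex_field X \<and>
     (\<forall>x\<in>carrier X. \<forall>y\<in>carrier X. inn X y x = cnj (inn X x y)) \<and>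
     (\<forall>x\<in>carrier X. \<forall>y\<in>carrier X. \<forall>z\<in>carrier X. inn X x (y \<oplus>\<^bsub>X\<^esub> z) = inn X x y + inn X x z) \<and>
     (\<forall>c. \<forall>x\<in>carrier X. \<forall>y\<in>carrier X. inn X x (c \<odot>\<^bsub>X\<^esub> y) = c * inn X x y) \<and>
     (\<forall>x\<in>carrier X. 0 \<le> Re (inn X x x)) \<and>
     (\<forall>x\<in>carrier X. inn X x x = 0 \<longrightarrow> x = \<zero>\<^bsub>X\<^esub>) \<and>
     Metric_space.mcomplete (carrier X) (hdist X)"

definition htopology :: "'a hspace \<Rightarrow> 'a topology" where
  "htopology X = Metric_space.mtopology (carrier X) (hdist X)"

definition hborel :: "'a hspace \<Rightarrow> 'a measure" where
  "hborel X = sigma (carrier X) {U. openin (htopology X) U}"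

definition infinite_dimensional :: "'a hspace \<Rightarrow> bool" where
  "infinite_dimensional X \<longleftrightarrow>
     \<not> (\<exists>S. finite S \<and> S \<subseteq> carrier X \<and>
          \<Inter>{N. submodule N complex_field X \<and> S \<subseteq> N} = carrier X)"

definition lin_isometry :: "'a hspace \<Rightarrow> 'b hspace \<Rightarrow> ('a \<Rightarrow> 'b) \<Rightarrow> bool" where
  "lin_isometry X Y T \<longleftrightarrow>
     T \<in> carrier X \<rightarrow> carrier Y \<and>
     (\<forall>x\<in>carrier X. \<forall>y\<in>carrier X. T (x \<oplus>\<^bsub>X\<^esub> y) = T x \<oplus>\<^bsub>Y\<^esub> T y) \<and>
     (\<forall>c. \<forall>x\<in>carrier X. T (c \<odot>\<^bsub>X\<^esub> x) = c \<odot>\<^bsub>Y\<^esub> T x) \<and>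
     (\<forall>x\<in>carrier X. \<forall>y\<in>carrier X. inn Y (T x) (T y) = inn X x y)"

definition unitary :: "'a hspace \<Rightarrow> 'b hspace \<Rightarrow> ('a \<Rightarrow> 'b) \<Rightarrow> bool" where
  "unitary X Y T \<longleftrightarrow> lin_isometry X Y T \<and> T ` carrier X = carrier Y"

definition hadjoint :: "'a hspace \<Rightarrow> 'b hspace \<Rightarrow> ('a \<Rightarrow> 'b) \<Rightarrow> 'b \<Rightarrow> 'a" where
  "hadjoint X Y T y =
     (THE x. x \<in> carrier X \<and> (\<forall>z\<in>carrier X. inn X z x = inn Y (T z) y))"


section \<open>Quotients, completions and tensor products\<close>

text \<open>The quotient \<open>X / N\<close> of a semi-inner product space by a subspace \<open>N\<close> of null vectors; its
  elements are the cosets \<open>N +> x\<close>.  Scalar multiples and inner products are computed on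
  representatives.\<close>

definition qspace :: "'a hspace \<Rightarrow> 'a set \<Rightarrow> 'a set hspace" where
  "qspace X N =
     mk_hspace (a_rcosets\<^bsub>X\<^esub> N) N (\<lambda>A B. A <+>\<^bsub>X\<^esub> B)
       (\<lambda>c A. N +>\<^bsub>X\<^esub> (c \<odot>\<^bsub>X\<^esub> (SOME a. a \<in> A)))
       (\<lambda>A B. inn X (SOME a. a \<in> A) (SOME b. b \<in> B))"

definition cauchy_seqs :: "'a hspace \<Rightarrow> (nat \<Rightarrow> 'a) hspace" where
  "cauchy_seqs X =
     mk_hspace
       {s. range s \<subseteq> carrier X \<and>
           (\<forall>\<epsilon>>0. \<exists>K. \<forall>m\<ge>K. \<forall>n\<ge>K. hnorm X (s m \<ominus>\<^bsub>X\<^esub> s n) < \<epsilon>)}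
       (\<lambda>_. \<zero>\<^bsub>X\<^esub>) (\<lambda>s r n. s n \<oplus>\<^bsub>X\<^esub> r n) (\<lambda>c s n. c \<odot>\<^bsub>X\<^esub> s n)
       (\<lambda>s r. lim (\<lambda>n. inn X (s n) (r n)))"

definition null_seqs :: "'a hspace \<Rightarrow> (nat \<Rightarrow> 'a) set" where
  "null_seqs X = {s \<in> carrier (cauchy_seqs X). (\<lambda>n. hnorm X (s n)) \<longlonglongrightarrow> 0}"

text \<open>The completion of a semi-inner product space: Cauchy sequences modulo null sequences.  It also
  divides out the vectors of length zero.\<close>

definition completion :: "'a hspace \<Rightarrow> (nat \<Rightarrow> 'a) set hspace" where
  "completion X = qspace (cauchy_seqs X) (null_seqs X)"

definition to_completion :: "'a hspace \<Rightarrow> 'a \<Rightarrow> (nat \<Rightarrow> 'a) set" where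
  "to_completion X x = null_seqs X +>\<^bsub>cauchy_seqs X\<^esub> (\<lambda>_. x)"

text \<open>The free vector space over \<open>X \<times> Y\<close> with the semi-inner product
  \<open>\<langle>(x,y),(x',y')\<rangle> = \<langle>x,x'\<rangle>\<langle>y,y'\<rangle>\<close>.  Its quotient by the vectors of length zero is the algebraic tensor
  product, and its completion is the Hilbert space tensor product.\<close>

definition free_tensor :: "'a hspace \<Rightarrow> 'b hspace \<Rightarrow> ('a \<times> 'b \<Rightarrow>\<^sub>0 complex) hspace" where
  "free_tensor X Y =
     mk_hspace {c. Poly_Mapping.keys c \<subseteq> carrier X \<times> carrier Y} 0 (+)
       (\<lambda>a c. Poly_Mapping.map ((*) a) c)
       (\<lambda>c d. \<Sum>(x, y)\<in>Poly_Mapping.keys c. \<Sum>(x', y')\<in>Poly_Mapping.keys d.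
          cnj (Poly_Mapping.lookup c (x, y)) * Poly_Mapping.lookup d (x', y') *
          (inn X x x' * inn Y y y'))"

type_synonym ('a, 'b) tensor = "(nat \<Rightarrow> ('a \<times> 'b \<Rightarrow>\<^sub>0 complex)) set"

definition htensor :: "'a hspace \<Rightarrow> 'b hspace \<Rightarrow> ('a, 'b) tensor hspace" (infixr \<open>\<otimes>\<^sub>H\<close> 75) where
  "X \<otimes>\<^sub>H Y = completion (free_tensor X Y)"

definition tens :: "'a hspace \<Rightarrow> 'b hspace \<Rightarrow> 'a \<Rightarrow> 'b \<Rightarrow> ('a, 'b) tensor" where
  "tens X Y x y = to_completion (free_tensor X Y) (Poly_Mapping.single (x, y) 1)"

text \<open>\<open>id \<otimes> T\<close> for an isometry \<open>T : Y \<rightarrow> Z\<close>.\<close>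

definition id_tensor ::
  "'a hspace \<Rightarrow> 'b hspace \<Rightarrow> 'c hspace \<Rightarrow> ('b \<Rightarrow> 'c) \<Rightarrow> ('a, 'b) tensor \<Rightarrow> ('a, 'c) tensor" where
  "id_tensor X Y Z T =
     (THE W. W \<in> extensional (carrier (X \<otimes>\<^sub>H Y)) \<and> lin_isometry (X \<otimes>\<^sub>H Y) (X \<otimes>\<^sub>H Z) W \<and>
        (\<forall>x\<in>carrier X. \<forall>y\<in>carrier Y. W (tens X Y x y) = tens X Z x (T y)))"

definition tensor_assoc ::
  "'a hspace \<Rightarrow> 'b hspace \<Rightarrow> 'c hspace \<Rightarrow>
    (('a, 'b) tensor, 'c) tensor \<Rightarrow> ('a, ('b, 'c) tensor) tensor" where
  "tensor_assoc X Y Z =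
     (THE W. W \<in> extensional (carrier ((X \<otimes>\<^sub>H Y) \<otimes>\<^sub>H Z)) \<and>
        unitary ((X \<otimes>\<^sub>H Y) \<otimes>\<^sub>H Z) (X \<otimes>\<^sub>H (Y \<otimes>\<^sub>H Z)) W \<and>
        (\<forall>x\<in>carrier X. \<forall>y\<in>carrier Y. \<forall>z\<in>carrier Z.
           W (tens (X \<otimes>\<^sub>H Y) Z (tens X Y x y) z) = tens X (Y \<otimes>\<^sub>H Z) x (tens Y Z y z)))"


section \<open>Direct integrals\<close>

text \<open>\<open>X\<close> is a field of Hilbert spaces over \<open>I\<close> and \<open>M\<close> its set of measurable sections.\<close>

definition l2_sections :: "real set \<Rightarrow> (real \<Rightarrow> 'a hspace) \<Rightarrow> (real \<Rightarrow> 'a) set \<Rightarrow> (real \<Rightarrow> 'a) hspace" where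
  "l2_sections I X M =
     mk_hspace {f \<in> M. set_integrable lborel I (\<lambda>\<alpha>. (hnorm (X \<alpha>) (f \<alpha>))\<^sup>2)}
       (\<lambda>\<alpha>\<in>I. \<zero>\<^bsub>X \<alpha>\<^esub>) (\<lambda>f g. \<lambda>\<alpha>\<in>I. f \<alpha> \<oplus>\<^bsub>X \<alpha>\<^esub> g \<alpha>) (\<lambda>c f. \<lambda>\<alpha>\<in>I. c \<odot>\<^bsub>X \<alpha>\<^esub> f \<alpha>)
       (\<lambda>f g. LINT \<alpha>:I|lborel. inn (X \<alpha>) (f \<alpha>) (g \<alpha>))"

definition ae_null_sections :: "real set \<Rightarrow> (real \<Rightarrow> 'a hspace) \<Rightarrow> (real \<Rightarrow> 'a) set \<Rightarrow> (real \<Rightarrow> 'a) set" where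
  "ae_null_sections I X M =
     {f \<in> carrier (l2_sections I X M). AE \<alpha> in lborel. \<alpha> \<in> I \<longrightarrow> f \<alpha> = \<zero>\<^bsub>X \<alpha>\<^esub>}"

definition direct_integral ::
  "real set \<Rightarrow> (real \<Rightarrow> 'a hspace) \<Rightarrow> (real \<Rightarrow> 'a) set \<Rightarrow> (real \<Rightarrow> 'a) set hspace" where
  "direct_integral I X M = qspace (l2_sections I X M) (ae_null_sections I X M)"

definition section_class ::
  "real set \<Rightarrow> (real \<Rightarrow> 'a hspace) \<Rightarrow> (real \<Rightarrow> 'a) set \<Rightarrow> (real \<Rightarrow> 'a) \<Rightarrow> (real \<Rightarrow> 'a) set" where
  "section_class I X M f = ae_null_sections I X M +>\<^bsub>l2_sections I X M\<^esub> f"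


section \<open>Arveson systems\<close>

record 'a arveson =
  fib :: "real \<Rightarrow> 'a hspace"
  umap :: "real \<Rightarrow> real \<Rightarrow> ('a, 'a) tensor \<Rightarrow> 'a"
  bundle_borel :: "(real \<times> 'a) measure"

definition aprod :: "'a arveson \<Rightarrow> real \<Rightarrow> real \<Rightarrow> 'a \<Rightarrow> 'a \<Rightarrow> 'a" where
  "aprod E t s x y = umap E t s (tens (fib E t) (fib E s) x y)"

definition sections :: "'a arveson \<Rightarrow> real set \<Rightarrow> (real \<Rightarrow> 'a) set" where
  "sections E I =
     {f \<in> (\<Pi>\<^sub>E \<alpha>\<in>I. carrier (fib E \<alpha>)). (\<lambda>\<alpha>. (\<alpha>, f \<alpha>)) \<in> restrict_space borel I \<rightarrow>\<^sub>M bundle_borel E}"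

text \<open>\<open>H0\<close> is the typical fibre of the bundle.  Only the sigma-algebra of \<^const>\<open>bundle_borel\<close> is relevant.
  Only the fibres over positive reals are relevant.\<close>

definition arveson_system :: "'h hspace \<Rightarrow> 'a arveson \<Rightarrow> bool" where
  "arveson_system H0 E \<longleftrightarrow>
     (\<forall>t>0. hilbert_space (fib E t)) \<and>
     (\<forall>t>0. \<forall>s>0. unitary (fib E t \<otimes>\<^sub>H fib E s) (fib E (t + s)) (umap E t s)) \<and>
     (\<forall>r>0. \<forall>s>0. \<forall>t>0. \<forall>x\<in>carrier (fib E r). \<forall>y\<in>carrier (fib E s). \<forall>z\<in>carrier (fib E t).
        aprod E (r + s) t (aprod E r s x y) z = aprod E r (s + t) x (aprod E s t y z)) \<and>
     hilbert_space H0 \<and> separable_space (htopology H0) \<and> infinite_dimensional H0 \<and>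
     space (bundle_borel E) = (SIGMA t:{0<..}. carrier (fib E t)) \<and>
     (\<exists>\<theta>. (\<forall>t>0. unitary (fib E t) H0 (\<theta> t)) \<and>
        (\<lambda>(t, x). (t, \<theta> t x)) \<in> bundle_borel E \<rightarrow>\<^sub>M restrict_space borel {0<..} \<Otimes>\<^sub>M hborel H0 \<and>
        (\<lambda>(t, y). (t, inv_into (carrier (fib E t)) (\<theta> t) y))
          \<in> restrict_space borel {0<..} \<Otimes>\<^sub>M hborel H0 \<rightarrow>\<^sub>M bundle_borel E) \<and>
     (\<forall>x\<in>sections E {0<..}. \<forall>y\<in>sections E {0<..}.
        (\<lambda>(t, s). (t + s, aprod E t s (x t) (y s)))
          \<in> restrict_space borel {0<..} \<Otimes>\<^sub>M restrict_space borel {0<..} \<rightarrow>\<^sub>M bundle_borel E)"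

definition unit_index :: "real \<Rightarrow> int" where
  "unit_index s = (THE n. s - of_int n \<in> {0<..1})"

text \<open>\<open>e\<^sup>n \<in> E\<^sub>n\<close> for \<open>n \<ge> 1\<close>.  The case \<open>e\<^sup>0 = 1 \<in> \<complex>\<close> does not live in \<open>E\<close> and is treated in
  \<open>mult_pow\<close>, which is \<open>x \<mapsto> x e\<^sup>n\<close> on \<open>E\<^sub>t\<close>.\<close>

primrec epow :: "'a arveson \<Rightarrow> 'a \<Rightarrow> nat \<Rightarrow> 'a" where
  "epow E e 0 = undefined"
| "epow E e (Suc n) = (if n = 0 then e else aprod E (real n) 1 (epow E e n) e)"

definition mult_pow :: "'a arveson \<Rightarrow> 'a \<Rightarrow> real \<Rightarrow> 'a \<Rightarrow> nat \<Rightarrow> 'a" where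
  "mult_pow E e t x n = (if n = 0 then x else aprod E t (real n) x (epow E e n))"

abbreviation E_integral :: "'a arveson \<Rightarrow> real \<Rightarrow> real \<Rightarrow> (real \<Rightarrow> 'a) set hspace" where
  "E_integral E a b \<equiv> direct_integral {a<..b} (fib E) (sections E {a<..b})"

abbreviation E_l2 :: "'a arveson \<Rightarrow> real \<Rightarrow> real \<Rightarrow> (real \<Rightarrow> 'a) set" where
  "E_l2 E a b \<equiv> carrier (l2_sections {a<..b} (fib E) (sections E {a<..b}))"

abbreviation E_class :: "'a arveson \<Rightarrow> real \<Rightarrow> real \<Rightarrow> (real \<Rightarrow> 'a) \<Rightarrow> (real \<Rightarrow> 'a) set" where
  "E_class E a b \<equiv> section_class {a<..b} (fib E) (sections E {a<..b})"


section \<open>First construction\<close>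

text \<open>The inductive limit of \<open>E\<^sub>1 \<rightarrow> E\<^sub>2 \<rightarrow> \<dots>\<close> along \<open>x \<mapsto> x e\<close>: sequences \<open>(x\<^sub>m)\<^sub>m\<^sub>\<ge>\<^sub>1\<close> that eventually satisfy
  \<open>x\<^sub>m\<^sub>+\<^sub>1 = x\<^sub>m e\<close>.  Those that are eventually \<open>0\<close> are exactly the ones of length zero and are divided out
  by the completion.\<close>

definition ind_limit :: "'a arveson \<Rightarrow> 'a \<Rightarrow> (nat \<Rightarrow> 'a) hspace" where
  "ind_limit E e =
     mk_hspace
       {s \<in> (\<Pi>\<^sub>E m\<in>{1..}. carrier (fib E (real m))).
          \<exists>m0\<ge>1. \<forall>m\<ge>m0. s (m + 1) = aprod E (real m) 1 (s m) e}
       (\<lambda>m\<in>{1..}. \<zero>\<^bsub>fib E (real m)\<^esub>)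
       (\<lambda>s r. \<lambda>m\<in>{1..}. s m \<oplus>\<^bsub>fib E (real m)\<^esub> r m)
       (\<lambda>c s. \<lambda>m\<in>{1..}. c \<odot>\<^bsub>fib E (real m)\<^esub> s m)
       (\<lambda>s r. lim (\<lambda>m. inn (fib E (real m)) (s m) (r m)))"

type_synonym 'a rbreve = "(nat \<Rightarrow> nat \<Rightarrow> 'a) set"

definition Rbreve :: "'a arveson \<Rightarrow> 'a \<Rightarrow> 'a rbreve hspace" where
  "Rbreve E e = completion (ind_limit E e)"

definition incl :: "'a arveson \<Rightarrow> 'a \<Rightarrow> nat \<Rightarrow> 'a \<Rightarrow> 'a rbreve" where
  "incl E e m x =
     to_completion (ind_limit E e)
       (\<lambda>k\<in>{1..}. if m \<le> k then mult_pow E e (real m) x (k - m) else \<zero>\<^bsub>fib E (real k)\<^esub>)"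

definition wbreve :: "'a arveson \<Rightarrow> 'a \<Rightarrow> nat \<Rightarrow> ('a, 'a rbreve) tensor \<Rightarrow> 'a rbreve" where
  "wbreve E e n =
     (THE W. W \<in> extensional (carrier (fib E (real n) \<otimes>\<^sub>H Rbreve E e)) \<and>
        unitary (fib E (real n) \<otimes>\<^sub>H Rbreve E e) (Rbreve E e) W \<and>
        (\<forall>m\<ge>1. \<forall>x\<in>carrier (fib E (real n)). \<forall>y\<in>carrier (fib E (real m)).
           W (tens (fib E (real n)) (Rbreve E e) x (incl E e m y)) =
             incl E e (n + m) (aprod E (real n) (real m) x y)))"

type_synonym 'a rspace = "((real \<Rightarrow> 'a) set, 'a rbreve) tensor"

definition R_space :: "'a arveson \<Rightarrow> 'a \<Rightarrow> 'a rspace hspace" where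
  "R_space E e = E_integral E 0 1 \<otimes>\<^sub>H Rbreve E e"

definition R_tens :: "'a arveson \<Rightarrow> 'a \<Rightarrow> (real \<Rightarrow> 'a) \<Rightarrow> 'a rbreve \<Rightarrow> 'a rspace" where
  "R_tens E e f y = tens (E_integral E 0 1) (Rbreve E e) (E_class E 0 1 f) y"

text \<open>The field \<open>E\<^sub>\<alpha> \<otimes> Rbreve\<close>, \<open>\<alpha> \<in> (0,1]\<close>, with second factor the constant field \<^const>\<open>Rbreve\<close>.  Its measurable
  structure is the one generated by the sections \<open>\<alpha> \<mapsto> h(\<alpha>) \<otimes> y\<close> with \<open>h\<close> a measurable section of \<open>E\<close>.\<close>

definition R_field :: "'a arveson \<Rightarrow> 'a \<Rightarrow> real \<Rightarrow> ('a, 'a rbreve) tensor hspace" where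
  "R_field E e \<alpha> = fib E \<alpha> \<otimes>\<^sub>H Rbreve E e"

definition R_sections :: "'a arveson \<Rightarrow> 'a \<Rightarrow> (real \<Rightarrow> ('a, 'a rbreve) tensor) set" where
  "R_sections E e =
     {F \<in> (\<Pi>\<^sub>E \<alpha>\<in>{0<..1}. carrier (R_field E e \<alpha>)).
        \<forall>h\<in>sections E {0<..1}. \<forall>y\<in>carrier (Rbreve E e).
          (\<lambda>\<alpha>. inn (R_field E e \<alpha>) (tens (fib E \<alpha>) (Rbreve E e) (h \<alpha>) y) (F \<alpha>))
            \<in> borel_measurable (restrict_space borel {0<..1})}"

text \<open>The identification of \<^const>\<open>R_space\<close> with the square integrable sections with values in \<open>E\<^sub>\<alpha> \<otimes> Rbreve\<close>.\<close>

definition R_ident :: "'a arveson \<Rightarrow> 'a \<Rightarrow> 'a rspace \<Rightarrow> (real \<Rightarrow> ('a, 'a rbreve) tensor) set" where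
  "R_ident E e =
     (THE J. J \<in> extensional (carrier (R_space E e)) \<and>
        unitary (R_space E e) (direct_integral {0<..1} (R_field E e) (R_sections E e)) J \<and>
        (\<forall>f\<in>E_l2 E 0 1. \<forall>y\<in>carrier (Rbreve E e).
           J (R_tens E e f y) =
             section_class {0<..1} (R_field E e) (R_sections E e)
               (\<lambda>\<alpha>\<in>{0<..1}. tens (fib E \<alpha>) (Rbreve E e) (f \<alpha>) y)))"

text \<open>The vector \<open>(id \<otimes> w\<^sub>n) (u\<^sup>*\<^sub>\<beta>\<^sub>,\<^sub>n z \<otimes> y)\<close> of \<open>E\<^sub>\<beta> \<otimes> Rbreve\<close>, for \<open>z \<in> E\<^sub>\<beta>\<^sub>+\<^sub>n\<close> and \<open>y\<close> in \<^const>\<open>Rbreve\<close>.  For \<open>n = 0\<close> the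
  maps \<open>u\<^sub>\<beta>\<^sub>,\<^sub>0\<close> and \<open>w\<^sub>0\<close> are the canonical identifications, so the vector is \<open>z \<otimes> y\<close>.\<close>

definition w_value :: "'a arveson \<Rightarrow> 'a \<Rightarrow> real \<Rightarrow> nat \<Rightarrow> 'a \<Rightarrow> 'a rbreve \<Rightarrow> ('a, 'a rbreve) tensor" where
  "w_value E e \<beta> n z y =
     (let B = fib E \<beta>; N = fib E (real n); K = Rbreve E e in
      if n = 0 then tens B K z y
      else id_tensor B (N \<otimes>\<^sub>H K) K (wbreve E e n)
             (tensor_assoc B N K
               (tens (B \<otimes>\<^sub>H N) K (hadjoint (B \<otimes>\<^sub>H N) (fib E (\<beta> + real n)) (umap E \<beta> (real n)) z) y)))"

definition w_section ::
  "'a arveson \<Rightarrow> 'a \<Rightarrow> real \<Rightarrow> 'a \<Rightarrow> (real \<Rightarrow> 'a) \<Rightarrow> 'a rbreve \<Rightarrow> real \<Rightarrow> ('a, 'a rbreve) tensor" where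
  "w_section E e t x f y =
     (\<lambda>\<beta>\<in>{0<..1}.
        let \<alpha> = inv_into {0<..1} (\<lambda>\<alpha>. t + \<alpha> - of_int (unit_index (t + \<alpha>))) \<beta>
        in w_value E e \<beta> (nat (unit_index (t + \<alpha>))) (aprod E t \<alpha> x (f \<alpha>)) y)"

definition w_map :: "'a arveson \<Rightarrow> 'a \<Rightarrow> real \<Rightarrow> ('a, 'a rspace) tensor \<Rightarrow> 'a rspace" where
  "w_map E e t =
     (THE W. W \<in> extensional (carrier (fib E t \<otimes>\<^sub>H R_space E e)) \<and>
        unitary (fib E t \<otimes>\<^sub>H R_space E e) (R_space E e) W \<and>
        (\<forall>x\<in>carrier (fib E t). \<forall>f\<in>E_l2 E 0 1. \<forall>y\<in>carrier (Rbreve E e).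
           R_ident E e (W (tens (fib E t) (R_space E e) x (R_tens E e f y))) =
             section_class {0<..1} (R_field E e) (R_sections E e) (w_section E e t x f y)))"


section \<open>Second construction\<close>

definition S_space :: "'a arveson \<Rightarrow> 'a \<Rightarrow> (real \<Rightarrow> 'a) hspace" where
  "S_space E e =
     mk_hspace
       {f \<in> sections E {0<..}.
          (\<forall>T>0. set_integrable lborel {0<..T} (\<lambda>\<alpha>. (hnorm (fib E \<alpha>) (f \<alpha>))\<^sup>2)) \<and>
          (\<exists>\<alpha>0>0. \<forall>\<alpha>\<ge>\<alpha>0. f (\<alpha> + 1) = aprod E \<alpha> 1 (f \<alpha>) e)}
       (\<lambda>\<alpha>\<in>{0<..}. \<zero>\<^bsub>fib E \<alpha>\<^esub>)
       (\<lambda>f g. \<lambda>\<alpha>\<in>{0<..}. f \<alpha> \<oplus>\<^bsub>fib E \<alpha>\<^esub> g \<alpha>)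
       (\<lambda>c f. \<lambda>\<alpha>\<in>{0<..}. c \<odot>\<^bsub>fib E \<alpha>\<^esub> f \<alpha>)
       (\<lambda>f g. lim (\<lambda>m::nat. LINT \<alpha>:{real m<..real m + 1}|lborel. inn (fib E \<alpha>) (f \<alpha>) (g \<alpha>)))"

definition N_space :: "'a arveson \<Rightarrow> 'a \<Rightarrow> (real \<Rightarrow> 'a) set" where
  "N_space E e =
     {f \<in> carrier (S_space E e).
        \<exists>\<alpha>0>0. AE \<alpha> in lborel. \<alpha> \<ge> \<alpha>0 \<longrightarrow> f \<alpha> = \<zero>\<^bsub>fib E \<alpha>\<^esub>}"

type_synonym 'a hcompl = "(nat \<Rightarrow> (real \<Rightarrow> 'a) set) set"

definition H_space :: "'a arveson \<Rightarrow> 'a \<Rightarrow> 'a hcompl hspace" where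
  "H_space E e = completion (qspace (S_space E e) (N_space E e))"

definition H_class :: "'a arveson \<Rightarrow> 'a \<Rightarrow> (real \<Rightarrow> 'a) \<Rightarrow> 'a hcompl" where
  "H_class E e f =
     to_completion (qspace (S_space E e) (N_space E e)) (N_space E e +>\<^bsub>S_space E e\<^esub> f)"

definition shift_section :: "'a arveson \<Rightarrow> real \<Rightarrow> 'a \<Rightarrow> (real \<Rightarrow> 'a) \<Rightarrow> real \<Rightarrow> 'a" where
  "shift_section E t x f =
     (\<lambda>\<alpha>\<in>{0<..}. if \<alpha> > t then aprod E t (\<alpha> - t) x (f (\<alpha> - t)) else \<zero>\<^bsub>fib E \<alpha>\<^esub>)"

definition v_map :: "'a arveson \<Rightarrow> 'a \<Rightarrow> real \<Rightarrow> ('a, 'a hcompl) tensor \<Rightarrow> 'a hcompl" where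
  "v_map E e t =
     (THE W. W \<in> extensional (carrier (fib E t \<otimes>\<^sub>H H_space E e)) \<and>
        lin_isometry (fib E t \<otimes>\<^sub>H H_space E e) (H_space E e) W \<and>
        (\<forall>x\<in>carrier (fib E t). \<forall>f\<in>carrier (S_space E e).
           W (tens (fib E t) (H_space E e) x (H_class E e f)) = H_class E e (shift_section E t x f)))"

definition tilde :: "'a arveson \<Rightarrow> 'a \<Rightarrow> nat \<Rightarrow> (real \<Rightarrow> 'a) \<Rightarrow> real \<Rightarrow> 'a" where
  "tilde E e m g =
     (\<lambda>\<alpha>\<in>{0<..}.
        if \<alpha> \<le> real m then \<zero>\<^bsub>fib E \<alpha>\<^esub>
        else let n = nat (unit_index \<alpha>) - m in mult_pow E e (\<alpha> - real n) (g (\<alpha> - real n)) n)"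

definition V_formula :: "'a arveson \<Rightarrow> 'a \<Rightarrow> ('a rspace \<Rightarrow> 'a hcompl) \<Rightarrow> bool" where
  "V_formula E e V \<longleftrightarrow>
     (\<forall>m\<ge>1. \<forall>f\<in>E_l2 E 0 1. \<forall>y\<in>carrier (fib E (real m)).
        V (R_tens E e f (incl E e m y)) =
          H_class E e (tilde E e m
            (\<lambda>\<alpha>\<in>{real m<..real m + 1}. aprod E (\<alpha> - real m) (real m) (f (\<alpha> - real m)) y)))"

end

theory Submission
  imports Defs
begin

text \<open>
  Both spaces are compared with the direct integral of the fibres \<open>E\<^sub>\<beta> \<otimes> Rbreve\<close> over \<open>\<beta> \<in> (0,1]\<close>.  A section
  \<open>f\<close> with \<open>f(\<alpha> + 1) = f(\<alpha>) e\<close> for \<open>\<alpha> \<ge> m\<close> is sent to the section with value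
  \<open>(id \<otimes> i\<^sub>m) (u\<^sup>*\<^sub>\<beta>\<^sub>,\<^sub>m f(\<beta> + m))\<close> at \<open>\<beta>\<close>.  This does not depend on \<open>m\<close>, preserves inner products by periodicity,
  and has total range because the elementary tensors \<open>f(\<beta>) \<otimes> i\<^sub>m(y)\<close> are attained at \<open>f(\<alpha> - m) y\<close>, extended
  periodically.  So it identifies \<open>H\<close> with the direct integral, and \<open>V\<close> is its inverse after the
  identification of \<open>R\<close>.  Fibrewise, \<open>v\<^sub>t\<close> then takes the form by which \<open>w\<^sub>t\<close> is defined, so that \<open>w\<^sub>t\<close> is conjugate
  to \<open>v\<^sub>t\<close> under \<open>V\<close>.

  It remains to see that \<open>v\<^sub>t\<close> is onto.  For integers \<open>n\<close> the range of \<open>v\<^sub>n\<close> contains the sections with value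
  \<open>c(\<beta>) b\<^sub>i b\<^sub>j(\<beta>) b\<^sub>k\<close> in \<open>E\<^sub>n E\<^sub>\<beta> E\<^sub>m\<close>, where \<open>b\<close> is a measurable field of orthonormal bases and \<open>c\<close> is scalar; they are
  total because \<open>c\<close> is arbitrary and the \<open>b\<^sub>i b\<^sub>j(\<beta>) b\<^sub>k\<close> are total in each fibre.  For \<open>t + s = n\<close> the identity
  \<open>v\<^sub>n(xy \<otimes> h) = v\<^sub>t(x \<otimes> v\<^sub>s(y \<otimes> h))\<close>, which is associativity in \<open>E\<close>, shows that the range of \<open>v\<^sub>t\<close> contains that of \<open>v\<^sub>n\<close>.
\<close>

section \<open>Semi-inner product spaces\<close>

text \<open>Most maps of the statement are definite descriptions (\<open>id_tensor\<close>,
  \<open>wbreve\<close>, \<open>R_ident\<close>, \<open>v_map\<close>, \<open>w_map\<close>), so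
  unique existence has to be shown for each. One principle covers nearly all of them: two families
  with equal Gram matrices, the first of them total, are joined by exactly one isometry, which is
  unitary if both are total (locale \<open>gram\<close>). What remains each time is an inner product
  computation and a totality claim. Totality in a direct integral is decided through orthogonal
  complements, hence rests on completeness of \<open>direct_integral\<close>.

  The obstacle is measurability. Sections of the field with fibres E_\<beta> \<otimes> Rbreve are
  tested against elementary tensors, whereas the sections that occur are produced by maps chosen
  separately in each fibre and by limits in Rbreve. Their coefficients are first computed on vectors
  i_k(x), where they are inner products of products in E and the measurability axiom for products
  applies; closed spans then give the rest.\<close>

lemma tendsto_0_real_le:
  fixes f :: "nat \<Rightarrow> real"
  assumes "g \<longlonglongrightarrow> 0" "\<And>n. 0 \<le> f n" "\<And>n. f n \<le> g n"
  shows "f \<longlonglongrightarrow> 0"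
  using tendsto_sandwich[OF always_eventually always_eventually tendsto_const assms(1)] assms(2,3) by blast

text \<open>Definiteness is left out on purpose: sections, Cauchy sequences, eventually coherent
  sequences and formal tensors all admit nonzero vectors of length zero, and they are treated here
  before these are divided out.\<close>

locale sip =
  fixes X :: "'a hspace" (structure)
  assumes module_axiom: "Module.module complex_field X"
    and inn_cnj: "x \<in> carrier X \<Longrightarrow> y \<in> carrier X \<Longrightarrow> inn X y x = cnj (inn X x y)"
    and inn_add_right [simp]: "x \<in> carrier X \<Longrightarrow> y \<in> carrier X \<Longrightarrow> z \<in> carrier X \<Longrightarrow>
      inn X x (y \<oplus> z) = inn X x y + inn X x z"
    and inn_smult_right [simp]: "x \<in> carrier X \<Longrightarrow> y \<in> carrier X \<Longrightarrow> inn X x (c \<odot> y) = c * inn X x y"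
    and inn_nonneg [simp]: "x \<in> carrier X \<Longrightarrow> 0 \<le> Re (inn X x x)"

lemma carrier_complex_field [simp]: "carrier complex_field = UNIV"
  and add_complex_field [simp]: "x \<oplus>\<^bsub>complex_field\<^esub> y = x + y"
  and mult_complex_field [simp]: "x \<otimes>\<^bsub>complex_field\<^esub> y = x * y"
  and one_complex_field [simp]: "\<one>\<^bsub>complex_field\<^esub> = 1"
  and zero_complex_field [simp]: "\<zero>\<^bsub>complex_field\<^esub> = 0"
  by (simp_all add: complex_field_def)

lemma cring_complex_field: "cring complex_field"
proof (rule cringI)
  show "abelian_group complex_field"
  proof (rule abelian_groupI)
    show "\<exists>y\<in>carrier complex_field. y \<oplus>\<^bsub>complex_field\<^esub> x = \<zero>\<^bsub>complex_field\<^esub>" for x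
      by (rule bexI[of _ "- x"]) simp_all
  qed simp_all
  show "comm_monoid complex_field"
    by (rule comm_monoidI) simp_all
qed (simp add: distrib_right)

context sip
begin

lemma mod: "Module.module complex_field X" by (rule module_axiom)

sublocale M: Module.module complex_field X by (rule module_axiom)

lemma add_in [simp, intro]: "x \<in> carrier X \<Longrightarrow> y \<in> carrier X \<Longrightarrow> x \<oplus> y \<in> carrier X"
  by (rule M.M.add.m_closed)
lemma zero_in [simp, intro]: "\<zero> \<in> carrier X" by (rule M.M.zero_closed)
lemma smult_in [simp, intro]: "x \<in> carrier X \<Longrightarrow> c \<odot> x \<in> carrier X" by (simp add: M.smult_closed)
lemma uminus_in [simp, intro]: "x \<in> carrier X \<Longrightarrow> \<ominus> x \<in> carrier X" by (rule M.M.a_inv_closed)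
lemma minus_in [simp, intro]: "x \<in> carrier X \<Longrightarrow> y \<in> carrier X \<Longrightarrow> x \<ominus> y \<in> carrier X"
  by (simp add: a_minus_def)

lemma inn_zero_right [simp]: "x \<in> carrier X \<Longrightarrow> inn X x \<zero> = 0"
  using inn_add_right[of x \<zero> \<zero>] by simp

lemma inn_uminus_right [simp]: "x \<in> carrier X \<Longrightarrow> y \<in> carrier X \<Longrightarrow> inn X x (\<ominus> y) = - inn X x y"
  using inn_add_right[of x y "\<ominus> y"] by (simp add: M.M.r_neg eq_neg_iff_add_eq_0 add.commute)

lemma inn_minus_right [simp]: "x \<in> carrier X \<Longrightarrow> y \<in> carrier X \<Longrightarrow> z \<in> carrier X \<Longrightarrow>
    inn X x (y \<ominus> z) = inn X x y - inn X x z"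
  by (simp add: a_minus_def)

lemma inn_add_left [simp]: "x \<in> carrier X \<Longrightarrow> y \<in> carrier X \<Longrightarrow> z \<in> carrier X \<Longrightarrow>
    inn X (y \<oplus> z) x = inn X y x + inn X z x"
  by (subst (1 2 3) inn_cnj) auto
lemma inn_smult_left [simp]: "x \<in> carrier X \<Longrightarrow> y \<in> carrier X \<Longrightarrow> inn X (c \<odot> y) x = cnj c * inn X y x"
  by (subst (1 2) inn_cnj) auto
lemma inn_zero_left [simp]: "x \<in> carrier X \<Longrightarrow> inn X \<zero> x = 0"
  by (subst inn_cnj) auto
lemma inn_uminus_left [simp]: "x \<in> carrier X \<Longrightarrow> y \<in> carrier X \<Longrightarrow> inn X (\<ominus> y) x = - inn X y x"
  by (subst (1 2) inn_cnj) auto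
lemma inn_minus_left [simp]: "x \<in> carrier X \<Longrightarrow> y \<in> carrier X \<Longrightarrow> z \<in> carrier X \<Longrightarrow>
    inn X (y \<ominus> z) x = inn X y x - inn X z x"
  by (simp add: a_minus_def)

lemma inn_self: "x \<in> carrier X \<Longrightarrow> inn X x x = of_real ((hnorm X x)\<^sup>2)"
  using inn_cnj[of x x] by (simp add: hnorm_def complex_eq_iff)

lemma hnorm_sq: "x \<in> carrier X \<Longrightarrow> (hnorm X x)\<^sup>2 = Re (inn X x x)"
  by (simp add: hnorm_def)

lemma hnorm_nonneg [simp]: "x \<in> carrier X \<Longrightarrow> 0 \<le> hnorm X x"
  by (simp add: hnorm_def)

lemma hnorm_zero [simp]: "hnorm X \<zero> = 0" by (simp add: hnorm_def)

lemma hnorm_eq_0_iff: "x \<in> carrier X \<Longrightarrow> hnorm X x = 0 \<longleftrightarrow> inn X x x = 0"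
  by (simp add: inn_self)

lemma hnorm_smult [simp]: "x \<in> carrier X \<Longrightarrow> hnorm X (c \<odot> x) = cmod c * hnorm X x"
proof (rule power2_eq_imp_eq)
  assume x: "x \<in> carrier X"
  have "inn X (c \<odot> x) (c \<odot> x) = of_real ((cmod c * hnorm X x)\<^sup>2)"
    using x by (simp add: inn_self[OF x] power_mult_distrib flip: complex_norm_square of_real_power)
  then show "(hnorm X (c \<odot> x))\<^sup>2 = (cmod c * hnorm X x)\<^sup>2"
    using x by (simp add: hnorm_sq)
qed auto

lemma hnorm_minus_commute: "x \<in> carrier X \<Longrightarrow> y \<in> carrier X \<Longrightarrow> hnorm X (x \<ominus> y) = hnorm X (y \<ominus> x)"
  by (simp add: hnorm_def algebra_simps)

text \<open>Without definiteness, the case that y has length zero needs an argument of its own. Both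
  cases come from nonnegativity of the squared length of s x - r w y, where w =
  \<langle>y,x\<rangle> and s, r are independent real parameters.\<close>

lemma cauchy_schwarz:
  assumes x: "x \<in> carrier X" and y: "y \<in> carrier X"
  shows "cmod (inn X x y) \<le> hnorm X x * hnorm X y"
proof -
  define a where "a = (hnorm X x)\<^sup>2"
  define b where "b = (hnorm X y)\<^sup>2"
  define w where "w = inn X y x"
  have yx: "inn X x y = cnj w" using inn_cnj[OF y x] by (simp add: w_def)
  have xx: "inn X x x = of_real a" and yy: "inn X y y = of_real b"
    using x y by (simp_all add: inn_self a_def b_def)
  have q: "0 \<le> s\<^sup>2 * a - 2 * s * r * (cmod w)\<^sup>2 + r\<^sup>2 * (cmod w)\<^sup>2 * b" for s r :: real
  proof -
    let ?z = "of_real s \<odot> x \<ominus> (of_real r * w) \<odot> y"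
    have "0 \<le> Re (inn X ?z ?z)" using x y by (intro inn_nonneg) auto
    also have "inn X ?z ?z = of_real (s\<^sup>2 * a) - 2 * of_real (s * r) * (w * cnj w) + of_real (r\<^sup>2 * b) * (w * cnj w)"
      using x y yx by (simp add: xx yy w_def[symmetric] algebra_simps power2_eq_square)
    finally show ?thesis by (simp add: complex_mult_cnj cmod_power2 algebra_simps)
  qed
  have "(cmod w)\<^sup>2 \<le> a * b"
  proof (cases "b = 0")
    case False
    then have "b > 0" by (simp add: b_def)
    \<comment> \<open>The choice s = b, r = 1.\<close>
    have "0 \<le> b * (a * b - (cmod w)\<^sup>2)" using q[of b 1] by (simp add: algebra_simps power2_eq_square)
    then show ?thesis using \<open>b > 0\<close> by (simp add: zero_le_mult_iff)
  next
    case True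
    have "w = 0"
    proof (rule ccontr)
      assume "w \<noteq> 0"
      then have "(cmod w)\<^sup>2 > 0" by simp
      \<comment> \<open>With b = 0 and s = 1 the inequality reads a - 2 r |w|^2 \<ge> 0 for every r;
        the value r = (a + 1)/|w|^2 makes the left side negative.\<close>
      then have "2 * ((a + 1) / (cmod w)\<^sup>2) * (cmod w)\<^sup>2 = 2 * a + 2" by (simp add: field_simps)
      then show False using q[of 1 "(a + 1) / (cmod w)\<^sup>2"] True q[of 1 0] by simp
    qed
    then show ?thesis using True by simp
  qed
  then have "(cmod w)\<^sup>2 \<le> (hnorm X x * hnorm X y)\<^sup>2" by (simp add: a_def b_def power_mult_distrib)
  then show ?thesis using x y yx by (simp add: power2_le_iff_abs_le)
qed

lemma hnorm_triangle:
  assumes x: "x \<in> carrier X" and y: "y \<in> carrier X"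
  shows "hnorm X (x \<oplus> y) \<le> hnorm X x + hnorm X y"
proof (rule power2_le_imp_le)
  have "(hnorm X (x \<oplus> y))\<^sup>2 = (hnorm X x)\<^sup>2 + 2 * Re (inn X x y) + (hnorm X y)\<^sup>2"
    using x y inn_cnj[OF x y] by (simp add: hnorm_sq)
  also have "Re (inn X x y) \<le> hnorm X x * hnorm X y"
    using cauchy_schwarz[OF x y] complex_Re_le_cmod order_trans by blast
  finally show "(hnorm X (x \<oplus> y))\<^sup>2 \<le> (hnorm X x + hnorm X y)\<^sup>2" by (simp add: power2_sum)
qed (use x y in auto)

lemma hnorm_triangle3:
  assumes "x \<in> carrier X" "y \<in> carrier X" "z \<in> carrier X"
  shows "hnorm X (x \<ominus> y) \<le> hnorm X (x \<ominus> z) + hnorm X (z \<ominus> y)"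
proof -
  have "hnorm X (x \<ominus> y) = hnorm X ((x \<ominus> z) \<oplus> (z \<ominus> y))"
    using assms by (simp add: hnorm_def algebra_simps)
  then show ?thesis using hnorm_triangle[of "x \<ominus> z" "z \<ominus> y"] assms by simp
qed

lemma hnorm_triangle_diff:
  assumes "x \<in> carrier X" "y \<in> carrier X"
  shows "\<bar>hnorm X x - hnorm X y\<bar> \<le> hnorm X (x \<ominus> y)"
proof -
  have *: "hnorm X (x \<ominus> \<zero>) = hnorm X x" if "x \<in> carrier X" for x
    using that by (simp add: hnorm_def)
  show ?thesis
    using hnorm_triangle3[of x \<zero> y] hnorm_triangle3[of y \<zero> x] assms *[of x] *[of y]
    by (simp add: hnorm_minus_commute[of x y])
qed

lemma parallelogram:
  assumes "x \<in> carrier X" "y \<in> carrier X"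
  shows "(hnorm X (x \<oplus> y))\<^sup>2 + (hnorm X (x \<ominus> y))\<^sup>2 = 2 * (hnorm X x)\<^sup>2 + 2 * (hnorm X y)\<^sup>2"
  using assms by (simp add: hnorm_sq)

end

section \<open>Convergence and Cauchy sequences for the seminorm\<close>

definition hlim :: "'a hspace \<Rightarrow> (nat \<Rightarrow> 'a) \<Rightarrow> 'a \<Rightarrow> bool" where
  "hlim X s x \<longleftrightarrow> (\<lambda>n. hnorm X (s n \<ominus>\<^bsub>X\<^esub> x)) \<longlonglongrightarrow> 0"

definition hcauchy :: "'a hspace \<Rightarrow> (nat \<Rightarrow> 'a) \<Rightarrow> bool" where
  "hcauchy X s \<longleftrightarrow> (\<forall>\<epsilon>>0. \<exists>K. \<forall>m\<ge>K. \<forall>n\<ge>K. hnorm X (s m \<ominus>\<^bsub>X\<^esub> s n) < \<epsilon>)"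

context sip
begin

lemma hlim_const [simp]: "x \<in> carrier X \<Longrightarrow> hlim X (\<lambda>_. x) x"
  by (simp add: hlim_def a_minus_def M.M.r_neg)

lemma hlim_add:
  assumes "\<And>n. s n \<in> carrier X" "\<And>n. r n \<in> carrier X" "x \<in> carrier X" "y \<in> carrier X" "hlim X s x" "hlim X r y"
  shows "hlim X (\<lambda>n. s n \<oplus> r n) (x \<oplus> y)"
proof -
  have "hnorm X ((s n \<oplus> r n) \<ominus> (x \<oplus> y)) \<le> hnorm X (s n \<ominus> x) + hnorm X (r n \<ominus> y)" for n
  proof -
    have "hnorm X ((s n \<oplus> r n) \<ominus> (x \<oplus> y)) = hnorm X ((s n \<ominus> x) \<oplus> (r n \<ominus> y))"
      using assms(1-4) by (simp add: hnorm_def algebra_simps)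
    then show ?thesis using hnorm_triangle[of "s n \<ominus> x" "r n \<ominus> y"] assms(1-4) by simp
  qed
  moreover have "(\<lambda>n. hnorm X (s n \<ominus> x) + hnorm X (r n \<ominus> y)) \<longlonglongrightarrow> 0"
    using tendsto_add[OF assms(5,6)[unfolded hlim_def]] by simp
  ultimately show ?thesis unfolding hlim_def
    by (rule tendsto_0_real_le[rotated -1]) (use assms(1-4) in auto)
qed

lemma hlim_hnorm:
  assumes "\<And>n. s n \<in> carrier X" "x \<in> carrier X" "hlim X s x"
  shows "(\<lambda>n. hnorm X (s n)) \<longlonglongrightarrow> hnorm X x"
proof (rule LIM_zero_cancel, rule tendsto_norm_zero_cancel, rule tendsto_0_real_le)
  show "(\<lambda>n. hnorm X (s n \<ominus> x)) \<longlonglongrightarrow> 0" using assms(3) by (simp add: hlim_def)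
  show "norm (hnorm X (s n) - hnorm X x) \<le> hnorm X (s n \<ominus> x)" for n
    using hnorm_triangle_diff assms(1,2) by auto
qed auto

lemma hlim_inn_left:
  assumes "\<And>n. s n \<in> carrier X" "x \<in> carrier X" "hlim X s x" "y \<in> carrier X"
  shows "(\<lambda>n. inn X (s n) y) \<longlonglongrightarrow> inn X x y"
proof -
  have "(\<lambda>n. inn X (s n \<ominus> x) y) \<longlonglongrightarrow> 0"
  proof (rule tendsto_norm_zero_cancel, rule tendsto_0_real_le)
    show "norm (inn X (s n \<ominus> x) y) \<le> hnorm X (s n \<ominus> x) * hnorm X y" for n
      using assms by (intro cauchy_schwarz) auto
    show "(\<lambda>n. hnorm X (s n \<ominus> x) * hnorm X y) \<longlonglongrightarrow> 0"
      using assms(3) by (simp add: hlim_def tendsto_mult_left_zero)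
  qed auto
  then show ?thesis using assms by (simp add: LIM_zero_iff)
qed

lemma hlim_inn_right:
  assumes "\<And>n. s n \<in> carrier X" "x \<in> carrier X" "hlim X s x" "y \<in> carrier X"
  shows "(\<lambda>n. inn X y (s n)) \<longlonglongrightarrow> inn X y x"
  using tendsto_cnj[OF hlim_inn_left[OF assms]] assms
  by (simp add: inn_cnj[OF assms(1) assms(4), symmetric] inn_cnj[OF assms(2) assms(4), symmetric])

lemma hlim_cauchy:
  assumes "\<And>n. s n \<in> carrier X" "x \<in> carrier X" "hlim X s x"
  shows "hcauchy X s"
  unfolding hcauchy_def
proof (intro allI impI)
  fix \<epsilon> :: real assume "\<epsilon> > 0"
  then have "eventually (\<lambda>n. hnorm X (s n \<ominus> x) < \<epsilon>/2) sequentially"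
    using order_tendstoD(2)[OF assms(3)[unfolded hlim_def], of "\<epsilon>/2"] by simp
  then obtain K where K: "\<And>n. n \<ge> K \<Longrightarrow> hnorm X (s n \<ominus> x) < \<epsilon>/2"
    by (auto simp: eventually_sequentially)
  have "hnorm X (s m \<ominus> s n) < \<epsilon>" if "m \<ge> K" "n \<ge> K" for m n
    using hnorm_triangle3[of "s m" "s n" x] K[OF that(1)] K[OF that(2)] assms(1,2)
    by (simp add: hnorm_minus_commute[of x])
  then show "\<exists>K. \<forall>m\<ge>K. \<forall>n\<ge>K. hnorm X (s m \<ominus> s n) < \<epsilon>" by blast
qed

end

locale ips = sip +
  assumes definite: "x \<in> carrier X \<Longrightarrow> inn X x x = 0 \<Longrightarrow> x = \<zero>"
begin

lemma eq_iff_hnorm: "x \<in> carrier X \<Longrightarrow> y \<in> carrier X \<Longrightarrow> x = y \<longleftrightarrow> hnorm X (x \<ominus> y) = 0"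
proof
  assume *: "x \<in> carrier X" "y \<in> carrier X" "hnorm X (x \<ominus> y) = 0"
  then have "x \<ominus> y = \<zero>" using definite[of "x \<ominus> y"] by (simp add: hnorm_eq_0_iff)
  then show "x = y" using * M.M.minus_equality[of x "\<ominus> y"] by (simp add: a_minus_def)
qed (simp add: a_minus_def M.M.r_neg)

lemma vec_eqI:
  assumes "x \<in> carrier X" "y \<in> carrier X" "\<And>z. z \<in> carrier X \<Longrightarrow> inn X z x = inn X z y"
  shows "x = y"
  using assms(3)[of "x \<ominus> y"] assms(1,2) by (simp add: eq_iff_hnorm hnorm_eq_0_iff)

lemma hlim_unique:
  assumes "\<And>n. s n \<in> carrier X" "x \<in> carrier X" "hlim X s x" "y \<in> carrier X" "hlim X s y"
  shows "x = y"
  by (rule vec_eqI[OF assms(2,4)], rule LIMSEQ_unique)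
   (rule hlim_inn_right[OF assms(1,2,3)], assumption, rule hlim_inn_right[OF assms(1,4,5)])

sublocale Metric_space "carrier X" "hdist X"
proof
  show "0 \<le> hdist X x y" for x y by (simp add: hdist_def)
  show "hdist X x y = hdist X y x" for x y by (auto simp: hdist_def intro: hnorm_minus_commute)
  show "x \<in> carrier X \<Longrightarrow> y \<in> carrier X \<Longrightarrow> (hdist X x y = 0) = (x = y)" for x y
    by (simp add: hdist_def eq_iff_hnorm)
  show "x \<in> carrier X \<Longrightarrow> y \<in> carrier X \<Longrightarrow> z \<in> carrier X \<Longrightarrow> hdist X x z \<le> hdist X x y + hdist X y z" for x y z
    by (simp add: hdist_def hnorm_triangle3)
qed

lemma MCauchy_iff: "MCauchy s \<longleftrightarrow> range s \<subseteq> carrier X \<and> hcauchy X s"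
  unfolding MCauchy_def hcauchy_def hdist_def image_subset_iff by (auto; metis rangeI)

lemma limitin_iff:
  assumes "range s \<subseteq> carrier X" shows "limitin mtopology s x sequentially \<longleftrightarrow> x \<in> carrier X \<and> hlim X s x"
proof -
  have s: "s n \<in> carrier X" for n using assms by auto
  then show ?thesis
    by (auto simp: limit_metric_sequentially hlim_def LIMSEQ_def hdist_def dist_real_def)
qed

lemma mcomplete_iff:
  "mcomplete \<longleftrightarrow> (\<forall>s. range s \<subseteq> carrier X \<longrightarrow> hcauchy X s \<longrightarrow> (\<exists>x\<in>carrier X. hlim X s x))"
  unfolding mcomplete_def MCauchy_iff Bex_def using limitin_iff by blast

end

locale hilb = ips +
  assumes complete: "(\<And>n::nat. s n \<in> carrier X) \<Longrightarrow> hcauchy X s \<Longrightarrow> \<exists>x\<in>carrier X. hlim X s x"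

lemma hilbert_space_iff: "hilbert_space X \<longleftrightarrow> hilb X"
proof
  assume h: "hilbert_space X"
  have "sip X" using h unfolding hilbert_space_def by (intro sip.intro) blast+
  then have "ips X" using h unfolding hilbert_space_def by (intro ips.intro ips_axioms.intro) blast+
  then interpret ips X .
  have "mcomplete" using h unfolding hilbert_space_def by blast
  then have *: "\<exists>x\<in>carrier X. hlim X s x" if "\<And>n. s n \<in> carrier X" "hcauchy X s" for s
    using that mcomplete_iff by (simp add: image_subset_iff)
  show "hilb X" by (intro hilb.intro hilb_axioms.intro ips_axioms) (rule *)
next
  assume "hilb X"
  then interpret hilb X .
  have mc: "mcomplete" unfolding mcomplete_iff using complete by (simp add: image_subset_iff)
  show "hilbert_space X"
    unfolding hilbert_space_def
    by (intro conjI ballI allI impI mod inn_cnj inn_add_right inn_smult_right inn_nonneg definite mc)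
qed

subsection \<open>Closed linear spans\<close>

text \<open>The rule for limits builds closedness into the generation, so a property that passes to
  linear combinations and to norm limits is proved by a single rule induction, without a separate
  closure of finite combinations.\<close>

inductive_set cspan :: "'a hspace \<Rightarrow> 'a set \<Rightarrow> 'a set" for X A where
  zero: "\<zero>\<^bsub>X\<^esub> \<in> cspan X A"
| base: "a \<in> A \<Longrightarrow> a \<in> carrier X \<Longrightarrow> a \<in> cspan X A"
| add: "x \<in> cspan X A \<Longrightarrow> y \<in> cspan X A \<Longrightarrow> x \<oplus>\<^bsub>X\<^esub> y \<in> cspan X A"
| smult: "x \<in> cspan X A \<Longrightarrow> c \<odot>\<^bsub>X\<^esub> x \<in> cspan X A"
| lim: "(\<And>n::nat. s n \<in> cspan X A) \<Longrightarrow> x \<in> carrier X \<Longrightarrow> hlim X s x \<Longrightarrow> x \<in> cspan X A"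

lemmas cspan_intros = cspan.zero cspan.base cspan.add cspan.smult

definition total :: "'a hspace \<Rightarrow> 'a set \<Rightarrow> bool" where
  "total X A \<longleftrightarrow> A \<subseteq> carrier X \<and> carrier X \<subseteq> cspan X A"

context sip
begin

lemma cspan_carrier: "x \<in> cspan X A \<Longrightarrow> x \<in> carrier X"
  by (induction rule: cspan.induct) auto

lemma cspan_subset:
  assumes "A \<subseteq> cspan X B" shows "cspan X A \<subseteq> cspan X B"
proof
  fix x assume "x \<in> cspan X A"
  then show "x \<in> cspan X B"
  proof (induction rule: cspan.induct)
    case (lim s x)
    then show ?case using cspan.lim[OF lim.IH lim.hyps(2,3)] by simp
  qed (use assms in \<open>auto intro: cspan_intros\<close>)
qed

lemma total_mono: "total X A \<Longrightarrow> A \<subseteq> cspan X B \<Longrightarrow> B \<subseteq> carrier X \<Longrightarrow> total X B"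
  unfolding total_def using cspan_subset by blast

lemma total_carrier: "total X (carrier X)"
  by (auto simp: total_def intro: cspan.base)

lemma uminus_eq: assumes x: "x \<in> carrier X" shows "\<ominus> x = (-1) \<odot> x"
proof (rule M.M.minus_equality[OF _ x])
  show "(-1) \<odot> x \<oplus> x = \<zero>"
    using M.smult_l_distr[of "-1" 1 x] M.smult_one[OF x] M.smult_l_null[OF x] x by simp
qed (use x in simp)

end

text \<open>The vectors z with the same inner product against x and y form a closed subspace; if it
  contains a total set it is everything, and definiteness gives x = y.\<close>

lemma (in ips) total_eqI:
  assumes A: "total X A" and x: "x \<in> carrier X" and y: "y \<in> carrier X"
    and eq: "\<And>a. a \<in> A \<Longrightarrow> inn X a x = inn X a y"
  shows "x = y"
proof (rule vec_eqI[OF x y])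
  fix z assume "z \<in> carrier X"
  then have "z \<in> cspan X A" using A by (auto simp: total_def)
  then show "inn X z x = inn X z y"
  proof (induction rule: cspan.induct)
    case (lim s z)
    then have s: "\<And>n. s n \<in> carrier X" by (blast intro: cspan_carrier)
    show ?case
      by (rule LIMSEQ_unique[OF hlim_inn_left[OF s lim.hyps(2,3) x]])
        (use hlim_inn_left[OF s lim.hyps(2,3) y] lim.IH in simp)
  qed (use x y eq cspan_carrier in auto)
qed

subsection \<open>Bounded linear maps\<close>

text \<open>The constant is existential because what matters is continuity: isometries, the maps y
  \<mapsto> x \<otimes> y and their composites all fall under this notion, and equations between
  them can then be checked on total sets.\<close>

definition hbdd :: "'a hspace \<Rightarrow> 'b hspace \<Rightarrow> ('a \<Rightarrow> 'b) \<Rightarrow> bool" where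
  "hbdd X Y T \<longleftrightarrow> T \<in> carrier X \<rightarrow> carrier Y \<and>
     (\<forall>x\<in>carrier X. \<forall>y\<in>carrier X. T (x \<oplus>\<^bsub>X\<^esub> y) = T x \<oplus>\<^bsub>Y\<^esub> T y) \<and>
     (\<forall>c. \<forall>x\<in>carrier X. T (c \<odot>\<^bsub>X\<^esub> x) = c \<odot>\<^bsub>Y\<^esub> T x) \<and>
     (\<exists>C\<ge>0. \<forall>x\<in>carrier X. hnorm Y (T x) \<le> C * hnorm X x)"

lemma lin_isometry_hbdd: "lin_isometry X Y T \<Longrightarrow> hbdd X Y T"
  unfolding lin_isometry_def hbdd_def hnorm_def by (auto intro: exI[of _ 1])

lemma unitary_isometry: "unitary X Y T \<Longrightarrow> lin_isometry X Y T" by (simp add: unitary_def)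

lemma hbdd_in: "hbdd X Y T \<Longrightarrow> x \<in> carrier X \<Longrightarrow> T x \<in> carrier Y"
  and hbdd_add: "hbdd X Y T \<Longrightarrow> x \<in> carrier X \<Longrightarrow> y \<in> carrier X \<Longrightarrow> T (x \<oplus>\<^bsub>X\<^esub> y) = T x \<oplus>\<^bsub>Y\<^esub> T y"
  and hbdd_smult: "hbdd X Y T \<Longrightarrow> x \<in> carrier X \<Longrightarrow> T (c \<odot>\<^bsub>X\<^esub> x) = c \<odot>\<^bsub>Y\<^esub> T x"
  by (auto simp: hbdd_def)

lemma lin_isometry_in: "lin_isometry X Y T \<Longrightarrow> x \<in> carrier X \<Longrightarrow> T x \<in> carrier Y"
  and lin_isometry_inn: "lin_isometry X Y T \<Longrightarrow> x \<in> carrier X \<Longrightarrow> y \<in> carrier X \<Longrightarrow> inn Y (T x) (T y) = inn X x y"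
  by (auto simp: lin_isometry_def)

lemma lin_isometry_comp: "lin_isometry X Y S \<Longrightarrow> lin_isometry Y Z T \<Longrightarrow> lin_isometry X Z (\<lambda>x. T (S x))"
  unfolding lin_isometry_def by (auto simp: Pi_iff)

lemma unitary_comp: "unitary X Y S \<Longrightarrow> unitary Y Z T \<Longrightarrow> unitary X Z (\<lambda>x. T (S x))"
  unfolding unitary_def by (metis image_image lin_isometry_comp)

lemma hbdd_comp:
  assumes S: "hbdd X Y S" and T: "hbdd Y Z T"
  shows "hbdd X Z (\<lambda>x. T (S x))"
proof -
  obtain C where C: "C \<ge> 0" "\<And>x. x \<in> carrier X \<Longrightarrow> hnorm Y (S x) \<le> C * hnorm X x" using S by (auto simp: hbdd_def)
  obtain D where D: "D \<ge> 0" "\<And>x. x \<in> carrier Y \<Longrightarrow> hnorm Z (T x) \<le> D * hnorm Y x" using T by (auto simp: hbdd_def)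
  have "hnorm Z (T (S x)) \<le> (D * C) * hnorm X x" if "x \<in> carrier X" for x
    using D(2)[OF hbdd_in[OF S that]] mult_left_mono[OF C(2)[OF that] D(1)] by (simp add: mult.assoc)
  then show ?thesis using S T C(1) D(1) unfolding hbdd_def by (auto simp: Pi_iff intro!: exI[of _ "D * C"])
qed

lemma hbdd_hlim:
  assumes "sip X" "sip Y" and T: "hbdd X Y T" and s: "\<And>n. s n \<in> carrier X" "x \<in> carrier X" "hlim X s x"
  shows "hlim Y (\<lambda>n. T (s n)) (T x)"
proof -
  interpret X: sip X by fact
  interpret Y: sip Y by fact
  obtain C where C: "\<And>x. x \<in> carrier X \<Longrightarrow> hnorm Y (T x) \<le> C * hnorm X x" using T unfolding hbdd_def by blast
  have "hnorm Y (T (s n) \<ominus>\<^bsub>Y\<^esub> T x) \<le> C * hnorm X (s n \<ominus>\<^bsub>X\<^esub> x)" for n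
  proof -
    have "T (\<ominus>\<^bsub>X\<^esub> x) = (-1) \<odot>\<^bsub>Y\<^esub> T x" using T s by (simp add: X.uminus_eq hbdd_smult)
    then have "hnorm Y (T (s n \<ominus>\<^bsub>X\<^esub> x)) = hnorm Y (T (s n) \<ominus>\<^bsub>Y\<^esub> T x)"
      using T s by (simp add: a_minus_def[of X] hbdd_add hbdd_in hnorm_def)
    then show ?thesis using C[of "s n \<ominus>\<^bsub>X\<^esub> x"] s by simp
  qed
  moreover have "(\<lambda>n. C * hnorm X (s n \<ominus>\<^bsub>X\<^esub> x)) \<longlonglongrightarrow> 0"
    using s(3) by (simp add: hlim_def tendsto_mult_right_zero)
  ultimately show ?thesis
    unfolding hlim_def by (rule_tac tendsto_0_real_le[rotated -1]) (use s hbdd_in[OF T] in auto)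
qed

text \<open>The density argument of the development: two bounded linear maps agree on a closed
  subspace.\<close>

lemma hbdd_eq:
  assumes "sip X" "ips Y" and T: "hbdd X Y T" and S: "hbdd X Y S" and A: "total X A"
    and eq: "\<And>a. a \<in> A \<Longrightarrow> T a = S a" and x: "x \<in> carrier X"
  shows "T x = S x"
proof -
  interpret X: sip X by fact
  interpret Y: ips Y by fact
  have "x \<in> cspan X A" using A x by (auto simp: total_def)
  then show ?thesis
  proof (induction rule: cspan.induct)
    case zero
    have "\<zero>\<^bsub>X\<^esub> = 0 \<odot>\<^bsub>X\<^esub> \<zero>\<^bsub>X\<^esub>" using X.M.smult_l_null[of "\<zero>\<^bsub>X\<^esub>"] by simp
    then show ?case using hbdd_smult[OF T, of "\<zero>\<^bsub>X\<^esub>" 0] hbdd_smult[OF S, of "\<zero>\<^bsub>X\<^esub>" 0]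
       hbdd_in[OF T] hbdd_in[OF S] Y.M.smult_l_null by simp
  next
    case (lim s x)
    then have s: "\<And>n. s n \<in> carrier X" by (blast intro: X.cspan_carrier)
    have "hlim Y (\<lambda>n. S (s n)) (T x)"
      using hbdd_hlim[OF \<open>sip X\<close> Y.sip_axioms T s lim.hyps(2,3)] lim.IH by simp
    then show ?case
      by (rule Y.hlim_unique[OF hbdd_in[OF S s] hbdd_in[OF T lim.hyps(2)] _ hbdd_in[OF S lim.hyps(2)]
        hbdd_hlim[OF \<open>sip X\<close> Y.sip_axioms S s lim.hyps(2,3)]])
  qed (use eq T S X.cspan_carrier in \<open>auto simp: hbdd_add hbdd_smult\<close>)
qed

subsection \<open>Extension of isometries\<close>

text \<open>A relation and not a function, since a vector may be a combination of the a_i in several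
  ways. It is the graph of the would-be closed linear extension of a_i \<mapsto> b_i; the Gram
  condition makes it single-valued.\<close>

inductive_set gram_graph :: "'a hspace \<Rightarrow> 'b hspace \<Rightarrow> ('i \<Rightarrow> 'a) \<Rightarrow> ('i \<Rightarrow> 'b) \<Rightarrow> 'i set \<Rightarrow> ('a \<times> 'b) set"
  for K L a b I where
  zero: "(\<zero>\<^bsub>K\<^esub>, \<zero>\<^bsub>L\<^esub>) \<in> gram_graph K L a b I"
| base: "i \<in> I \<Longrightarrow> (a i, b i) \<in> gram_graph K L a b I"
| add: "(x, y) \<in> gram_graph K L a b I \<Longrightarrow> (x', y') \<in> gram_graph K L a b I \<Longrightarrow>
    (x \<oplus>\<^bsub>K\<^esub> x', y \<oplus>\<^bsub>L\<^esub> y') \<in> gram_graph K L a b I"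
| smult: "(x, y) \<in> gram_graph K L a b I \<Longrightarrow> (c \<odot>\<^bsub>K\<^esub> x, c \<odot>\<^bsub>L\<^esub> y) \<in> gram_graph K L a b I"
| lim: "(\<And>n::nat. (s n, r n) \<in> gram_graph K L a b I) \<Longrightarrow> x \<in> carrier K \<Longrightarrow> y \<in> carrier L \<Longrightarrow>
    hlim K s x \<Longrightarrow> hlim L r y \<Longrightarrow> (x, y) \<in> gram_graph K L a b I"

text \<open>The construction is symmetric in the two families, so surjectivity of the extension
  becomes totality of the reversed graph.\<close>

lemma gram_graph_swap: "(x, y) \<in> gram_graph K L a b I \<Longrightarrow> (y, x) \<in> gram_graph L K b a I"
proof (induction rule: gram_graph.induct)
  case (lim s r x y)
  show ?case by (rule gram_graph.lim[OF lim.IH lim.hyps(3,2,5,4)])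
qed (auto intro: gram_graph.zero gram_graph.base gram_graph.add gram_graph.smult)

locale gram =
  K: ips K + L: ips L for K :: "'a hspace" and L :: "'b hspace" +
  fixes a :: "'i \<Rightarrow> 'a" and b :: "'i \<Rightarrow> 'b" and I :: "'i set"
  assumes a_in: "i \<in> I \<Longrightarrow> a i \<in> carrier K" and b_in: "i \<in> I \<Longrightarrow> b i \<in> carrier L"
    and gram_eq: "i \<in> I \<Longrightarrow> j \<in> I \<Longrightarrow> inn L (b i) (b j) = inn K (a i) (a j)"
begin

abbreviation "G \<equiv> gram_graph K L a b I"

lemma G_in: "(x, y) \<in> G \<Longrightarrow> x \<in> carrier K \<and> y \<in> carrier L"
  by (induction rule: gram_graph.induct) (use a_in b_in in auto)

lemma G_inn_base: "(x, y) \<in> G \<Longrightarrow> i \<in> I \<Longrightarrow> inn L (b i) y = inn K (a i) x"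
proof (induction rule: gram_graph.induct)
  case (lim s r x y)
  have s: "\<And>n. s n \<in> carrier K" "\<And>n. r n \<in> carrier L" using lim.hyps(1) G_in by blast+
  show ?case
    by (rule LIMSEQ_unique[OF L.hlim_inn_right[OF s(2) lim.hyps(3,5) b_in[OF lim.prems]]])
      (use K.hlim_inn_right[OF s(1) lim.hyps(2,4) a_in[OF lim.prems]] lim.IH[OF lim.prems] in simp)
qed (use gram_eq a_in b_in G_in in auto)

text \<open>Equality of Gram matrices spreads from the generators to the whole graph one argument at
  a time; \<open>G_inn_base\<close> has already treated the right one.\<close>

lemma G_inn: "(x, y) \<in> G \<Longrightarrow> (x', y') \<in> G \<Longrightarrow> inn L y y' = inn K x x'"
proof (induction rule: gram_graph.induct)
  case (lim s r x y)
  have s: "\<And>n. s n \<in> carrier K" "\<And>n. r n \<in> carrier L" using lim.hyps(1) G_in by blast+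
  have z: "x' \<in> carrier K" "y' \<in> carrier L" using lim.prems G_in by blast+
  show ?case
    by (rule LIMSEQ_unique[OF L.hlim_inn_left[OF s(2) lim.hyps(3,5) z(2)]])
      (use K.hlim_inn_left[OF s(1) lim.hyps(2,4) z(1)] lim.IH[OF lim.prems] in simp)
qed (use G_inn_base G_in in auto)

lemma G_unique: assumes "(x, y) \<in> G" "(x, y') \<in> G" shows "y = y'"
proof -
  have "inn L (y \<ominus>\<^bsub>L\<^esub> y') (y \<ominus>\<^bsub>L\<^esub> y') = 0"
    using G_in[OF assms(1)] G_in[OF assms(2)] G_inn[OF assms(1) assms(1)] G_inn[OF assms(1) assms(2)]
      G_inn[OF assms(2) assms(1)] G_inn[OF assms(2) assms(2)] by simp
  then show ?thesis using G_in[OF assms(1)] G_in[OF assms(2)] by (simp add: L.eq_iff_hnorm L.hnorm_eq_0_iff)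
qed

text \<open>The images of a convergent sequence form a Cauchy sequence because the graph preserves
  inner products; completeness of the target supplies the limit.\<close>

lemma G_total:
  assumes "hilb L" "x \<in> cspan K (a ` I)" shows "\<exists>y. (x, y) \<in> G"
  using assms(2)
proof (induction rule: cspan.induct)
  case (lim s x)
  interpret L: hilb L by fact
  obtain r where r: "\<And>n. (s n, r n) \<in> G" using lim.IH by metis
  have s: "\<And>n. s n \<in> carrier K" and rc: "\<And>n. r n \<in> carrier L" using r G_in by blast+
  have "hnorm L (r m \<ominus>\<^bsub>L\<^esub> r n) = hnorm K (s m \<ominus>\<^bsub>K\<^esub> s n)" for m n
    using s rc by (simp add: hnorm_def G_inn[OF r r])
  then have "hcauchy L r" using K.hlim_cauchy[OF s lim.hyps(2,3)] by (simp add: hcauchy_def)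
  then obtain y where "y \<in> carrier L" "hlim L r y" using L.complete rc by blast
  then show ?case using gram_graph.lim[OF r lim.hyps(2) _ lim.hyps(3)] by blast
qed (auto intro: gram_graph.zero gram_graph.base gram_graph.add gram_graph.smult)

lemma isometry_ex:
  assumes "hilb L" "total K (a ` I)"
  shows "\<exists>W. W \<in> extensional (carrier K) \<and> lin_isometry K L W \<and> (\<forall>i\<in>I. W (a i) = b i) \<and>
    (\<forall>x\<in>carrier K. (x, W x) \<in> G)"
proof -
  have ex: "\<exists>y. (x, y) \<in> G" if "x \<in> carrier K" for x
    using G_total[OF assms(1)] assms(2) that by (auto simp: total_def)
  define W where "W = (\<lambda>x\<in>carrier K. SOME y. (x, y) \<in> G)"
  have W: "(x, W x) \<in> G" if "x \<in> carrier K" for x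
    using someI_ex[OF ex[OF that]] that by (simp add: W_def)
  have Weq: "W x = y" if "(x, y) \<in> G" for x y
    using G_unique[OF that W] G_in[OF that] by simp
  have "lin_isometry K L W"
    unfolding lin_isometry_def using W G_in G_inn
    by (auto intro!: Weq gram_graph.add gram_graph.smult)
  moreover have "\<forall>i\<in>I. W (a i) = b i" by (auto intro: Weq gram_graph.base)
  ultimately show ?thesis using W by (intro exI[of _ W]) (auto simp: W_def)
qed

lemma isometry_ex1:
  assumes "hilb L" "total K (a ` I)"
  shows "\<exists>!W. W \<in> extensional (carrier K) \<and> lin_isometry K L W \<and> (\<forall>i\<in>I. W (a i) = b i)"
proof -
  have eq: "W x = W' x" if "lin_isometry K L W" "\<forall>i\<in>I. W (a i) = b i" "lin_isometry K L W'" "\<forall>i\<in>I. W' (a i) = b i"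
     "x \<in> carrier K" for W W' x
    by (rule hbdd_eq[OF K.sip_axioms L.ips_axioms _ _ assms(2)]) (use that in \<open>auto intro: lin_isometry_hbdd\<close>)
  obtain W where W: "W \<in> extensional (carrier K)" "lin_isometry K L W" "\<forall>i\<in>I. W (a i) = b i"
    using isometry_ex[OF assms] by blast
  show ?thesis
  proof (rule ex1I[of _ W])
    fix W' assume W': "W' \<in> extensional (carrier K) \<and> lin_isometry K L W' \<and> (\<forall>i\<in>I. W' (a i) = b i)"
    then show "W' = W" using W by (intro extensionalityI[of W' _ W] eq) auto
  qed (use W in blast)
qed

lemma unitary_ex1:
  assumes "hilb K" "hilb L" "total K (a ` I)" "total L (b ` I)"
  shows "\<exists>!W. W \<in> extensional (carrier K) \<and> unitary K L W \<and> (\<forall>i\<in>I. W (a i) = b i)"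
proof -
  obtain W where W: "W \<in> extensional (carrier K)" "lin_isometry K L W" "\<forall>i\<in>I. W (a i) = b i"
    "\<And>x. x \<in> carrier K \<Longrightarrow> (x, W x) \<in> G" using isometry_ex[OF assms(2,3)] by blast
  \<comment> \<open>The reversed graph is defined on all of L, since the b_i are total and K is
    complete; read backwards it gives preimages.\<close>
  interpret g': gram L K b a I by unfold_locales (auto simp: a_in b_in gram_eq)
  have "y \<in> W ` carrier K" if y: "y \<in> carrier L" for y
  proof -
    have "y \<in> cspan L (b ` I)" using y assms(4) by (auto simp: total_def)
    then obtain x where "(y, x) \<in> g'.G" using g'.G_total[OF assms(1)] by blast
    then have "(x, y) \<in> G" by (rule gram_graph_swap)
    then have "W x = y" "x \<in> carrier K" using G_unique W(4) G_in by blast+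
    then show ?thesis by blast
  qed
  moreover have "W ` carrier K \<subseteq> carrier L" using lin_isometry_in[OF W(2)] by blast
  ultimately have "unitary K L W" using W(2) unfolding unitary_def by blast
  with W(1,3) isometry_ex1[OF assms(2,3)] show ?thesis
    by (auto simp: unitary_def intro!: ex1I[of _ W])
qed

end

text \<open>The range of an isometry on a complete space is a closed subspace, so it is everything
  as soon as it contains a total set.\<close>

lemma isometry_surj:
  assumes "hilb K" "ips L" and W: "lin_isometry K L W" and B: "total L B" "B \<subseteq> W ` carrier K"
  shows "unitary K L W"
proof -
  interpret K: hilb K by fact
  interpret L: ips L by fact
  note Wb = lin_isometry_hbdd[OF W]
  have "y \<in> W ` carrier K" if "y \<in> carrier L" for y
  proof -
    have "y \<in> cspan L B" using B that by (auto simp: total_def)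
    then show ?thesis
    proof (induction rule: cspan.induct)
      case zero
      have "W (0 \<odot>\<^bsub>K\<^esub> \<zero>\<^bsub>K\<^esub>) = \<zero>\<^bsub>L\<^esub>"
        using hbdd_smult[OF Wb, of "\<zero>\<^bsub>K\<^esub>" 0] L.M.smult_l_null[OF hbdd_in[OF Wb K.zero_in]] by simp
      then show ?case by (metis K.smult_in K.zero_in imageI)
    next
      case (add x y)
      then show ?case by (auto simp: hbdd_add[OF Wb, symmetric])
    next
      case (smult x c)
      then show ?case by (auto simp: hbdd_smult[OF Wb, symmetric])
    next
      case (lim s y)
      have "\<forall>n. \<exists>x. x \<in> carrier K \<and> s n = W x" using lim.IH by blast
      then obtain r where r: "\<And>n. r n \<in> carrier K" "\<And>n. s n = W (r n)" by metis
      have "hnorm L (s m \<ominus>\<^bsub>L\<^esub> s n) = hnorm K (r m \<ominus>\<^bsub>K\<^esub> r n)" for m n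
        using r lin_isometry_in[OF W] by (simp add: hnorm_def lin_isometry_inn[OF W])
      moreover have sc: "\<And>n. s n \<in> carrier L" using r lin_isometry_in[OF W] by simp
      ultimately have "hcauchy K r" using L.hlim_cauchy[OF sc lim.hyps(2,3)] by (simp add: hcauchy_def)
      then obtain x where x: "x \<in> carrier K" "hlim K r x" using K.complete r by blast
      have "hlim L s (W x)" using hbdd_hlim[OF K.sip_axioms L.sip_axioms Wb r(1) x] by (simp flip: r(2))
      then show ?case using L.hlim_unique[OF sc lim.hyps(2,3) lin_isometry_in[OF W x(1)]] x(1) by blast
    qed (use B in auto)
  qed
  then show ?thesis using W lin_isometry_in[OF W] unfolding unitary_def by blast
qed

lemma total_image:
  assumes "sip K" "sip L" and W: "unitary K L W" and A: "total K A"
  shows "total L (W ` A)"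
proof -
  interpret K: sip K by fact
  interpret L: sip L by fact
  have Wi: "lin_isometry K L W" using W by (simp add: unitary_def)
  note Wb = lin_isometry_hbdd[OF Wi]
  have "W x \<in> cspan L (W ` A)" if "x \<in> cspan K A" for x
    using that
  proof (induction rule: cspan.induct)
    case zero
    have "W (0 \<odot>\<^bsub>K\<^esub> \<zero>\<^bsub>K\<^esub>) = \<zero>\<^bsub>L\<^esub>"
      using hbdd_smult[OF Wb, of "\<zero>\<^bsub>K\<^esub>" 0] L.M.smult_l_null[OF hbdd_in[OF Wb K.zero_in]] by simp
    then show ?case using K.M.smult_l_null[OF K.zero_in] by (simp add: cspan.zero)
  next
    case (lim s x)
    then have "\<And>n. s n \<in> carrier K" by (blast intro: K.cspan_carrier)
    then show ?case
      using cspan.lim[of "\<lambda>n. W (s n)"] lim hbdd_hlim[OF K.sip_axioms L.sip_axioms Wb _ lim.hyps(2,3)] hbdd_in[OF Wb] by blast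
  qed (use K.cspan_carrier hbdd_in[OF Wb] in \<open>auto simp: hbdd_add[OF Wb] hbdd_smult[OF Wb] intro: cspan_intros\<close>)
  moreover have "A \<subseteq> carrier K" "carrier K \<subseteq> cspan K A" using A by (auto simp: total_def)
  moreover have "carrier L = W ` carrier K" using W by (simp add: unitary_def)
  ultimately show ?thesis unfolding total_def by auto
qed

subsection \<open>Orthogonal projection\<close>

text \<open>A nearest point p to x in the closed span exists by completeness and the parallelogram
  law. The remainder x - p is orthogonal to A, hence zero by assumption.\<close>

lemma (in hilb) total_if_orthogonal:
  assumes A: "A \<subseteq> carrier X" and orth: "\<And>x. x \<in> carrier X \<Longrightarrow> (\<And>a. a \<in> A \<Longrightarrow> inn X a x = 0) \<Longrightarrow> x = \<zero>"
  shows "total X A"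
  unfolding total_def
proof (intro conjI A, intro subsetI)
  fix x assume x: "x \<in> carrier X"
  define D where "D = (\<lambda>m. (hnorm X (x \<ominus> m))\<^sup>2) ` cspan X A"
  define d where "d = Inf D"
  have D: "D \<noteq> {}" "bdd_below D" by (auto simp: D_def intro!: bdd_belowI[of _ 0] cspan.zero)
  have d: "d \<le> (hnorm X (x \<ominus> m))\<^sup>2" if "m \<in> cspan X A" for m
    unfolding d_def by (rule cInf_lower) (use D that in \<open>auto simp: D_def\<close>)
  have "\<exists>m\<in>cspan X A. (hnorm X (x \<ominus> m))\<^sup>2 < d + 1 / real (Suc n)" for n
    using cInf_lessD[OF D(1), of "d + 1 / real (Suc n)"] unfolding d_def[symmetric] by (auto simp: D_def)
  then obtain m where m: "\<And>n. m n \<in> cspan X A" "\<And>n. (hnorm X (x \<ominus> m n))\<^sup>2 < d + 1 / real (Suc n)" by metis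
  have mc: "m n \<in> carrier X" for n using m(1) cspan_carrier by blast
  have mm: "(hnorm X (m k \<ominus> m n))\<^sup>2 \<le> 2 / real (Suc k) + 2 / real (Suc n)" for k n
  proof -
    \<comment> \<open>The midpoint of two members of the minimising sequence lies in the span, so
      its squared distance to x is at least d; the parallelogram law turns this into a bound on
      their distance.\<close>
    let ?h = "(1/2) \<odot> (m k \<oplus> m n)"
    have "(hnorm X ((x \<ominus> m k) \<oplus> (x \<ominus> m n)))\<^sup>2 = 4 * (hnorm X (x \<ominus> ?h))\<^sup>2"
      using x mc by (simp add: hnorm_sq algebra_simps)
    moreover have "d \<le> (hnorm X (x \<ominus> ?h))\<^sup>2" using m(1) by (intro d cspan.add cspan.smult)
    moreover have "(hnorm X ((x \<ominus> m k) \<ominus> (x \<ominus> m n)))\<^sup>2 = (hnorm X (m k \<ominus> m n))\<^sup>2"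
      using x mc by (simp add: hnorm_sq algebra_simps)
    ultimately show ?thesis
      using parallelogram[of "x \<ominus> m k" "x \<ominus> m n"] x mc m(2)[of k] m(2)[of n] by simp
  qed
  have "hcauchy X m" unfolding hcauchy_def
  proof (intro allI impI)
    fix \<epsilon> :: real assume "\<epsilon> > 0"
    then obtain K where K: "inverse (real (Suc K)) < \<epsilon>\<^sup>2 / 4" using reals_Archimedean[of "\<epsilon>\<^sup>2/4"] by auto
    have "hnorm X (m k \<ominus> m n) < \<epsilon>" if "k \<ge> K" "n \<ge> K" for k n
    proof (rule power2_less_imp_less)
      have "2 / real (Suc k) \<le> 2 * inverse (real (Suc K))" "2 / real (Suc n) \<le> 2 * inverse (real (Suc K))"
        using that by (auto simp: field_simps)
      then show "(hnorm X (m k \<ominus> m n))\<^sup>2 < \<epsilon>\<^sup>2" using mm[of k n] K by simp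
    qed (use \<open>\<epsilon> > 0\<close> in simp)
    then show "\<exists>K. \<forall>k\<ge>K. \<forall>n\<ge>K. hnorm X (m k \<ominus> m n) < \<epsilon>" by blast
  qed
  then obtain p where p: "p \<in> carrier X" "hlim X m p" using complete mc by blast
  have pA: "p \<in> cspan X A" by (rule cspan.lim[OF m(1) p])
  define r where "r = x \<ominus> p"
  have r: "r \<in> carrier X" using x p by (simp add: r_def)
  have "hlim X (\<lambda>n. x \<ominus> m n) r"
  proof -
    have "hnorm X ((x \<ominus> m n) \<ominus> r) = hnorm X (m n \<ominus> p)" for n
      using x p mc by (simp add: hnorm_def r_def algebra_simps)
    then show ?thesis using p(2) by (simp add: hlim_def)
  qed
  then have "(\<lambda>n. (hnorm X (x \<ominus> m n))\<^sup>2) \<longlonglongrightarrow> (hnorm X r)\<^sup>2"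
    using x mc r by (intro tendsto_power hlim_hnorm) auto
  moreover have "(\<lambda>n. d + 1 / real (Suc n)) \<longlonglongrightarrow> d + 0"
    using LIMSEQ_inverse_real_of_nat by (intro tendsto_add tendsto_const) (simp add: inverse_eq_divide)
  ultimately have rd: "(hnorm X r)\<^sup>2 \<le> d"
    by (rule_tac LIMSEQ_le[where Y="\<lambda>n. d + 1 / real (Suc n)"]) (use m(2) in \<open>auto intro: less_imp_le\<close>)
  have "inn X a r = 0" if a: "a \<in> A" for a
  proof -
    have ac: "a \<in> carrier X" using a A by blast
    define w where "w = inn X a r"
    have ra: "inn X r a = cnj w" using inn_cnj[OF ac r] by (simp add: w_def)
    \<comment> \<open>Moving p by t w a cannot shorten the remainder r; comparing squared lengths
      gives this inequality for every real t.\<close>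
    have q: "2 * t * (cmod w)\<^sup>2 \<le> t\<^sup>2 * (cmod w)\<^sup>2 * (hnorm X a)\<^sup>2" for t :: real
    proof -
      have "(hnorm X r)\<^sup>2 \<le> (hnorm X (x \<ominus> (p \<oplus> (of_real t * w) \<odot> a)))\<^sup>2"
        using rd d[of "p \<oplus> (of_real t * w) \<odot> a"] pA a ac by (force intro: cspan_intros)
      also have "hnorm X (x \<ominus> (p \<oplus> (of_real t * w) \<odot> a)) = hnorm X (r \<ominus> (of_real t * w) \<odot> a)"
        using x p ac by (simp add: r_def hnorm_def algebra_simps)
      also have "(hnorm X (r \<ominus> (of_real t * w) \<odot> a))\<^sup>2 =
          (hnorm X r)\<^sup>2 - 2 * t * (cmod w)\<^sup>2 + t\<^sup>2 * (cmod w)\<^sup>2 * (hnorm X a)\<^sup>2"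
      proof -
        have "inn X (r \<ominus> (of_real t * w) \<odot> a) (r \<ominus> (of_real t * w) \<odot> a) =
          inn X r r - 2 * of_real t * (w * cnj w) + of_real (t\<^sup>2) * (w * cnj w) * inn X a a"
          using r ac ra by (simp add: w_def[symmetric] algebra_simps power2_eq_square)
        also have "\<dots> = of_real ((hnorm X r)\<^sup>2 - 2 * t * (cmod w)\<^sup>2 + t\<^sup>2 * (cmod w)\<^sup>2 * (hnorm X a)\<^sup>2)"
          using r ac by (simp add: inn_self complex_norm_square[symmetric])
        finally show ?thesis using r ac by (simp add: hnorm_sq)
      qed
      finally show ?thesis by simp
    qed
    have "w = 0"
    proof (rule ccontr)
      assume "w \<noteq> 0"
      then have w: "(cmod w)\<^sup>2 > 0" by simp
      have q': "2 * t \<le> t\<^sup>2 * (hnorm X a)\<^sup>2" for t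
        using q[of t] w by (simp add: mult.commute mult.left_commute)
      define b where "b = (hnorm X a)\<^sup>2"
      have "b \<ge> 0" by (simp add: b_def)
      \<comment> \<open>Small enough that t b < 1, whereas the inequality above would force 2 \<le>
        t b.\<close>
      define t where "t = 1 / (1 + b)"
      have t: "t > 0" "t * b < 1" using \<open>b \<ge> 0\<close> by (auto simp: t_def field_simps)
      have "t * 2 \<le> t * (t * b)" using q'[of t] by (simp add: b_def power2_eq_square algebra_simps)
      then show False using t by simp
    qed
    then show ?thesis by (simp add: w_def)
  qed
  then have "r = \<zero>" using orth r by blast
  then have "x = p" using x p r eq_iff_hnorm[OF x p(1)] by (simp add: r_def)
  then show "x \<in> cspan X A" using pA by simp
qed

subsection \<open>Orthonormal bases\<close>

text \<open>Zero vectors are allowed in the sequence, so that finite-dimensional spaces are covered.\<close>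

definition onb :: "'a hspace \<Rightarrow> (nat \<Rightarrow> 'a) \<Rightarrow> bool" where
  "onb X u \<longleftrightarrow> total X (range u) \<and> (\<forall>i j. i \<noteq> j \<longrightarrow> inn X (u i) (u j) = 0) \<and>
     (\<forall>i. inn X (u i) (u i) = 0 \<or> inn X (u i) (u i) = 1)"

primrec psum :: "'a hspace \<Rightarrow> (nat \<Rightarrow> complex) \<Rightarrow> (nat \<Rightarrow> 'a) \<Rightarrow> nat \<Rightarrow> 'a" where
  "psum X c u 0 = \<zero>\<^bsub>X\<^esub>"
| "psum X c u (Suc n) = psum X c u n \<oplus>\<^bsub>X\<^esub> (c n \<odot>\<^bsub>X\<^esub> u n)"

context sip
begin

lemma psum_in: "(\<And>i. i < n \<Longrightarrow> u i \<in> carrier X) \<Longrightarrow> psum X c u n \<in> carrier X"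
  by (induction n) auto

lemma psum_cspan: "(\<And>i. i < n \<Longrightarrow> u i \<in> cspan X A) \<Longrightarrow> psum X c u n \<in> cspan X A"
  by (induction n) (auto intro: cspan_intros)

lemma psum_cong: "(\<And>i. i < n \<Longrightarrow> u i = u' i \<and> c i = c' i) \<Longrightarrow> psum X c u n = psum X c' u' n"
  by (induction n) auto

lemma inn_psum_right: "(\<And>i. i < n \<Longrightarrow> u i \<in> carrier X) \<Longrightarrow> y \<in> carrier X \<Longrightarrow> inn X y (psum X c u n) = (\<Sum>i<n. c i * inn X y (u i))"
  by (induction n) (auto simp: psum_in)

lemma inn_psum_left: "(\<And>i. i < n \<Longrightarrow> u i \<in> carrier X) \<Longrightarrow> y \<in> carrier X \<Longrightarrow> inn X (psum X c u n) y = (\<Sum>i<n. cnj (c i) * inn X (u i) y)"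
  by (induction n) (auto simp: psum_in)

lemma onb_in: "onb X u \<Longrightarrow> u i \<in> carrier X" by (auto simp: onb_def total_def)

text \<open>For a zero member of the sequence both sides vanish by Cauchy-Schwarz, otherwise the
  first factor is 1. The identity lets the two kinds of members be handled alike.\<close>

lemma onb_inn: assumes "onb X u" "x \<in> carrier X" shows "inn X (u i) (u i) * inn X (u i) x = inn X (u i) x"
proof (cases "inn X (u i) (u i) = 0")
  case True
  then have "inn X (u i) x = 0" using cauchy_schwarz[OF onb_in[OF assms(1)] assms(2), of i]
    by (simp add: hnorm_eq_0_iff[OF onb_in[OF assms(1)], symmetric])
  then show ?thesis by simp
qed (use assms in \<open>auto simp: onb_def\<close>)

text \<open>The partial sum p has the same coefficients as x below n, so its squared norm equals
  \<langle>p,x\<rangle>, which Cauchy-Schwarz bounds by the product of the norms.\<close>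

lemma bessel:
  assumes u: "onb X u" and x: "x \<in> carrier X"
  shows "hnorm X (psum X (\<lambda>i. inn X (u i) x) u n) \<le> hnorm X x"
proof -
  let ?p = "psum X (\<lambda>i. inn X (u i) x) u n"
  note uc = onb_in[OF u]
  have p: "?p \<in> carrier X" by (rule psum_in) (rule uc)
  have "inn X (u i) ?p = inn X (u i) x" if "i < n" for i
  proof -
    have "inn X (u i) ?p = (\<Sum>j<n. inn X (u j) x * inn X (u i) (u j))" by (rule inn_psum_right) (use uc in auto)
    also have "\<dots> = (\<Sum>j<n. if j = i then inn X (u i) (u i) * inn X (u i) x else 0)"
      using u by (intro sum.cong) (auto simp: onb_def)
    also have "\<dots> = inn X (u i) x" using that onb_inn[OF u x] by simp
    finally show ?thesis .
  qed
  then have "inn X ?p ?p = inn X ?p x"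
    using p x by (simp add: inn_psum_left uc)
  then have "(hnorm X ?p)\<^sup>2 = cmod (inn X ?p x)" using p by (simp add: inn_self flip: of_real_power) (metis norm_of_real abs_power2 of_real_power)
  also have "\<dots> \<le> hnorm X ?p * hnorm X x" using p x by (rule cauchy_schwarz)
  finally show ?thesis using p x by (cases "hnorm X ?p = 0") (auto simp: power2_eq_square less_le)
qed

text \<open>Induction on y in the closed span of the basis. The partial sums are bounded by the
  product of the norms of x and y, uniformly in n by Bessel's inequality, and this uniformity
  carries convergence through limits of y.\<close>

lemma parseval:
  assumes u: "onb X u" and x: "x \<in> carrier X" and y: "y \<in> carrier X"
  shows "(\<lambda>i. cnj (inn X (u i) x) * inn X (u i) y) sums inn X x y"
proof -
  note uc = onb_in[OF u]
  let ?B = "\<lambda>n y. \<Sum>i<n. cnj (inn X (u i) x) * inn X (u i) y"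
  have B: "?B n y = inn X (psum X (\<lambda>i. inn X (u i) x) u n) y" if "y \<in> carrier X" for n y
    using that by (simp add: inn_psum_left uc)
  have B_le: "cmod (?B n y) \<le> hnorm X x * hnorm X y" if "y \<in> carrier X" for n y
    unfolding B[OF that] using bessel[OF u x, of n] that
    by (intro order_trans[OF cauchy_schwarz] mult_right_mono) (auto intro: psum_in uc)
  have "y \<in> cspan X (range u)" using u y by (auto simp: onb_def total_def)
  then have "(\<lambda>n. ?B n y) \<longlonglongrightarrow> inn X x y"
  proof (induction rule: cspan.induct)
    case (base a)
    then obtain j where a: "a = u j" by blast
    have e: "?B n a = inn X x a" if "n > j" for n
    proof -
      have "?B n a = (\<Sum>i<n. if i = j then cnj (inn X (u j) (u j) * inn X (u j) x) else 0)"
        using u inn_cnj[OF uc uc, of j j] by (intro sum.cong) (auto simp: onb_def a)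
      also have "\<dots> = cnj (inn X (u j) x)" using that by (simp del: complex_cnj_mult add: onb_inn[OF u x])
      also have "\<dots> = inn X x a" using inn_cnj[OF uc x, of j] by (simp add: a)
      finally show ?thesis .
    qed
    show ?case by (rule tendsto_eventually) (use e in \<open>auto simp: eventually_sequentially intro: exI[of _ "Suc j"]\<close>)
  next
    case (add y z)
    then show ?case using x uc cspan_carrier tendsto_add[OF add.IH] by (simp add: algebra_simps sum.distrib)
  next
    case (smult y c)
    have "?B n (c \<odot> y) = c * ?B n y" for n
      using uc cspan_carrier[OF smult.hyps] by (simp add: sum_distrib_left algebra_simps)
    then show ?case using x cspan_carrier[OF smult.hyps] tendsto_mult_left[OF smult.IH, of c] by simp
  next
    case (lim s y)
    have s: "\<And>n. s n \<in> carrier X" using lim.hyps(1) by (blast intro: cspan_carrier)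
    show ?case
    proof (rule LIMSEQ_I)
      fix r :: real assume r: "r > 0"
      define q where "q = hnorm X x"
      have q: "q \<ge> 0" using x by (simp add: q_def)
      \<comment> \<open>Dividing by q + 1 and not by q covers the case that x has length
        zero.\<close>
      have "eventually (\<lambda>k. hnorm X (s k \<ominus> y) < r / (3 * (q + 1))) sequentially"
        using order_tendstoD(2)[OF lim.hyps(3)[unfolded hlim_def]] r q by simp
      then obtain k where k: "hnorm X (s k \<ominus> y) < r / (3 * (q + 1))" by (auto simp: eventually_sequentially)
      have k': "q * hnorm X (s k \<ominus> y) < r / 3"
      proof -
        have "q * hnorm X (s k \<ominus> y) \<le> (q + 1) * hnorm X (s k \<ominus> y)"
          using s lim.hyps(2) by (intro mult_right_mono) auto
        also have "\<dots> < (q + 1) * (r / (3 * (q + 1)))" using k q by (intro mult_strict_left_mono) auto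
        also have "\<dots> = r / 3" using q by (simp add: field_simps)
        finally show ?thesis .
      qed
      obtain N where N: "\<And>n. n \<ge> N \<Longrightarrow> cmod (?B n (s k) - inn X x (s k)) < r / 3"
        using LIMSEQ_D[OF lim.IH, of "r/3" k] r by auto
      have "cmod (?B n y - inn X x y) < r" if "n \<ge> N" for n
      proof -
        have "?B n y - inn X x y = (?B n (s k) - inn X x (s k)) - ?B n (s k \<ominus> y) + inn X x (s k \<ominus> y)"
          using s lim.hyps(2) x uc by (simp add: algebra_simps sum_subtractf)
        also have "cmod \<dots> \<le> cmod (?B n (s k) - inn X x (s k)) + cmod (?B n (s k \<ominus> y)) + cmod (inn X x (s k \<ominus> y))"
          by (meson norm_triangle_ineq norm_triangle_ineq4 order_trans add_right_mono)
        also have "\<dots> < r / 3 + r / 3 + r / 3"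
        proof -
          have sy: "s k \<ominus> y \<in> carrier X" using s lim.hyps(2) by simp
          show ?thesis using N[OF that] k' B_le[OF sy, of n] cauchy_schwarz[OF x sy] unfolding q_def by linarith
        qed
        finally show ?thesis by simp
      qed
      then show "\<exists>N. \<forall>n\<ge>N. cmod (?B n y - inn X x y) < r" by blast
    qed
  qed (use x uc in auto)
  then show ?thesis by (simp add: sums_def)
qed

lemma parseval_norm:
  assumes u: "onb X u" and x: "x \<in> carrier X"
  shows "(\<lambda>i. (cmod (inn X (u i) x))\<^sup>2) sums (hnorm X x)\<^sup>2"
proof -
  have "(\<lambda>i. Re (cnj (inn X (u i) x) * inn X (u i) x)) sums Re (inn X x x)"
    by (rule sums_Re[OF parseval[OF u x x]])
  then show ?thesis unfolding hnorm_sq[OF x] cmod_power2 by (simp add: power2_eq_square)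
qed

end

text \<open>Stage n is a whole function whose values below n are final, so that the recursion can
  refer to all earlier vectors. If the remainder r has norm zero, 1 / 0 = 0 produces the zero
  vector, which \<open>onb\<close> admits.\<close>

primrec gram_schmidt_aux :: "'a hspace \<Rightarrow> (nat \<Rightarrow> 'a) \<Rightarrow> nat \<Rightarrow> nat \<Rightarrow> 'a" where
  "gram_schmidt_aux X a 0 = (\<lambda>_. \<zero>\<^bsub>X\<^esub>)"
| "gram_schmidt_aux X a (Suc n) = (gram_schmidt_aux X a n)(n :=
     (let r = a n \<ominus>\<^bsub>X\<^esub> psum X (\<lambda>i. inn X (gram_schmidt_aux X a n i) (a n)) (gram_schmidt_aux X a n) n
      in of_real (1 / hnorm X r) \<odot>\<^bsub>X\<^esub> r))"

definition gram_schmidt :: "'a hspace \<Rightarrow> (nat \<Rightarrow> 'a) \<Rightarrow> nat \<Rightarrow> 'a" where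
  "gram_schmidt X a n = gram_schmidt_aux X a (Suc n) n"

lemma gram_schmidt_aux_eq: "i < n \<Longrightarrow> gram_schmidt_aux X a n i = gram_schmidt X a i"
proof (induction n)
  case (Suc n)
  show ?case
  proof (cases "i = n")
    case False
    then show ?thesis using Suc by simp
  qed (simp add: gram_schmidt_def)
qed simp

lemma (in ips) onb_gram_schmidt:
  assumes a: "total X (range a)"
  shows "onb X (gram_schmidt X a)"
proof -
  define u where "u = gram_schmidt X a"
  define r where "r n = a n \<ominus> psum X (\<lambda>i. inn X (u i) (a n)) u n" for n
  have ac: "a n \<in> carrier X" for n using a by (auto simp: total_def)
  have u: "u n = of_real (1 / hnorm X (r n)) \<odot> r n" for n
  proof -
    have "psum X (\<lambda>i. inn X (gram_schmidt_aux X a n i) (a n)) (gram_schmidt_aux X a n) n =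
      psum X (\<lambda>i. inn X (u i) (a n)) u n"
      by (rule psum_cong) (simp add: gram_schmidt_aux_eq u_def)
    then show ?thesis by (simp add: u_def[of] gram_schmidt_def r_def Let_def)
  qed
  have uc: "u n \<in> carrier X" for n
  proof (induction n rule: less_induct)
    case (less n)
    have "r n \<in> carrier X" unfolding r_def using ac less by (intro minus_in psum_in) auto
    then show ?case unfolding u by simp
  qed
  have rc: "r n \<in> carrier X" for n unfolding r_def using ac uc by (intro minus_in psum_in) auto
  have uu: "inn X (u n) (u n) = 0 \<or> inn X (u n) (u n) = 1" for n
  proof (cases "hnorm X (r n) = 0")
    case True
    then show ?thesis unfolding u using rc by simp
  next
    case False
    have "inn X (u n) (u n) = of_real ((hnorm X (u n))\<^sup>2)" using uc by (rule inn_self)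
    also have "hnorm X (u n) = 1" unfolding u using rc False hnorm_nonneg[OF rc, of n] by (simp add: norm_divide)
    finally show ?thesis by simp
  qed
  have orth: "inn X (u i) (u n) = 0" if "i < n" for i n
    using that
  proof (induction n arbitrary: i rule: less_induct)
    case (less n)
    have *: "inn X (u i) (u j) = 0" if "j < n" "j \<noteq> i" for j
    proof (cases "i < j")
      case True
      then show ?thesis using less.IH that by blast
    next
      case False
      then have "inn X (u j) (u i) = 0" using less.IH[of i j] less.prems that by auto
      then show ?thesis using inn_cnj[OF uc uc, of j i] by simp
    qed
    have "inn X (u i) (r n) = inn X (u i) (a n) - (\<Sum>j<n. inn X (u j) (a n) * inn X (u i) (u j))"
      unfolding r_def using uc ac by (simp add: inn_psum_right psum_in)
    also have "(\<Sum>j<n. inn X (u j) (a n) * inn X (u i) (u j)) = (\<Sum>j<n. if j = i then inn X (u i) (a n) * inn X (u i) (u i) else 0)"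
      using * by (intro sum.cong) auto
    also have "\<dots> = inn X (u i) (a n) * inn X (u i) (u i)" using less.prems by simp
    also have "\<dots> = inn X (u i) (a n)"
      using uu[of i] cauchy_schwarz[OF uc ac, of i n] by (auto simp: hnorm_eq_0_iff[OF uc, symmetric])
    finally show ?case unfolding u[of n] using uc rc by simp
  qed
  have orth': "inn X (u i) (u j) = 0" if "i \<noteq> j" for i j
  proof (cases "i < j")
    case False
    then have "inn X (u j) (u i) = 0" using orth[of j i] that by simp
    then show ?thesis using inn_cnj[OF uc uc, of j i] by simp
  qed (rule orth)
  \<comment> \<open>The projection onto the earlier vectors plus the rescaled u n restores a n, also
    when the remainder vanishes; so nothing of the original span is lost.\<close>
  have "range a \<subseteq> cspan X (range u)"
  proof
    fix x assume "x \<in> range a"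
    then obtain n where x: "x = a n" by blast
    let ?y = "psum X (\<lambda>i. inn X (u i) (a n)) u n"
    have y: "?y \<in> carrier X" using uc by (intro psum_in) auto
    have *: "of_real (hnorm X (r n)) \<odot> u n = r n"
    proof (cases "hnorm X (r n) = 0")
      case True
      then have "r n = \<zero>" using definite rc hnorm_eq_0_iff by blast
      then show ?thesis using True M.smult_l_null[OF uc] by simp
    next
      case False
      then show ?thesis unfolding u using M.smult_assoc1[of "of_real (hnorm X (r n))" "of_real (1 / hnorm X (r n))" "r n"]
        M.smult_one[OF rc, of n] rc by simp
    qed
    have "?y \<oplus> of_real (hnorm X (r n)) \<odot> u n = a n"
      unfolding * by (rule vec_eqI) (use y rc ac in \<open>auto simp: r_def\<close>)
    moreover have "?y \<oplus> of_real (hnorm X (r n)) \<odot> u n \<in> cspan X (range u)"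
      using uc by (intro cspan.add cspan.smult psum_cspan cspan.base) auto
    ultimately show "x \<in> cspan X (range u)" by (simp add: x)
  qed
  then have "total X (range u)" using total_mono[OF a] uc by blast
  then show ?thesis using orth' uu unfolding onb_def u_def by blast
qed

section \<open>Quotients, completions and tensor products\<close>

lemma mk_hspace_simps [simp]:
  "carrier (mk_hspace C z a s i) = C" "\<zero>\<^bsub>mk_hspace C z a s i\<^esub> = z"
  "x \<oplus>\<^bsub>mk_hspace C z a s i\<^esub> y = a x y" "c \<odot>\<^bsub>mk_hspace C z a s i\<^esub> x = s c x"
  "inn (mk_hspace C z a s i) = i"
  by (simp_all add: mk_hspace_def)

lemma sip_mk_hspaceI:
  assumes C: "z \<in> C" "\<And>x y. x \<in> C \<Longrightarrow> y \<in> C \<Longrightarrow> a x y \<in> C" "\<And>c x. x \<in> C \<Longrightarrow> s c x \<in> C"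
    and a: "\<And>x y w. x \<in> C \<Longrightarrow> y \<in> C \<Longrightarrow> w \<in> C \<Longrightarrow> a (a x y) w = a x (a y w)"
       "\<And>x y. x \<in> C \<Longrightarrow> y \<in> C \<Longrightarrow> a x y = a y x" "\<And>x. x \<in> C \<Longrightarrow> a z x = x"
       "\<And>x. x \<in> C \<Longrightarrow> a (s (-1) x) x = z"
    and s: "\<And>c d x. x \<in> C \<Longrightarrow> s (c + d) x = a (s c x) (s d x)"
       "\<And>c x y. x \<in> C \<Longrightarrow> y \<in> C \<Longrightarrow> s c (a x y) = a (s c x) (s c y)"
       "\<And>c d x. x \<in> C \<Longrightarrow> s (c * d) x = s c (s d x)" "\<And>x. x \<in> C \<Longrightarrow> s 1 x = x"
    and i: "\<And>x y. x \<in> C \<Longrightarrow> y \<in> C \<Longrightarrow> i y x = cnj (i x y)"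
       "\<And>x y w. x \<in> C \<Longrightarrow> y \<in> C \<Longrightarrow> w \<in> C \<Longrightarrow> i x (a y w) = i x y + i x w"
       "\<And>c x y. x \<in> C \<Longrightarrow> y \<in> C \<Longrightarrow> i x (s c y) = c * i x y"
       "\<And>x. x \<in> C \<Longrightarrow> 0 \<le> Re (i x x)"
  shows "sip (mk_hspace C z a s i)"
proof (rule sip.intro)
  show "Module.module complex_field (mk_hspace C z a s i)"
  proof (rule moduleI[OF cring_complex_field])
    show "abelian_group (mk_hspace C z a s i)"
    proof (rule abelian_groupI)
      fix x assume x: "x \<in> carrier (mk_hspace C z a s i)"
      show "\<exists>y\<in>carrier (mk_hspace C z a s i). y \<oplus>\<^bsub>mk_hspace C z a s i\<^esub> x = \<zero>\<^bsub>mk_hspace C z a s i\<^esub>"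
        using x C(3) a(4) by (intro bexI[of _ "s (-1) x"]) simp_all
    next
      fix x y assume "x \<in> carrier (mk_hspace C z a s i)" "y \<in> carrier (mk_hspace C z a s i)"
      then show "x \<oplus>\<^bsub>mk_hspace C z a s i\<^esub> y = y \<oplus>\<^bsub>mk_hspace C z a s i\<^esub> x"
        using a(2)[of x y] by simp
    qed (simp_all add: C a(1,3))
  qed (simp_all add: C s)
next
  fix x y assume "x \<in> carrier (mk_hspace C z a s i)" "y \<in> carrier (mk_hspace C z a s i)"
  then show "inn (mk_hspace C z a s i) y x = cnj (inn (mk_hspace C z a s i) x y)"
    using i(1)[of x y] by simp
qed (simp_all add: i(2-4))

context sip
begin
lemma vadd_assoc: "x \<in> carrier X \<Longrightarrow> y \<in> carrier X \<Longrightarrow> z \<in> carrier X \<Longrightarrow> (x \<oplus> y) \<oplus> z = x \<oplus> (y \<oplus> z)"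
  by (rule M.M.a_assoc)
lemma vadd_comm: "x \<in> carrier X \<Longrightarrow> y \<in> carrier X \<Longrightarrow> x \<oplus> y = y \<oplus> x" by (rule M.M.a_comm)
lemma vadd_zero: "x \<in> carrier X \<Longrightarrow> \<zero> \<oplus> x = x" by (rule M.M.l_zero)
lemma vadd_neg: "x \<in> carrier X \<Longrightarrow> (-1) \<odot> x \<oplus> x = \<zero>" using M.M.l_neg[of x] by (simp add: uminus_eq)
lemma vsmult_l: "x \<in> carrier X \<Longrightarrow> (c + d) \<odot> x = c \<odot> x \<oplus> d \<odot> x" using M.smult_l_distr[of c d x] by simp
lemma vsmult_r: "x \<in> carrier X \<Longrightarrow> y \<in> carrier X \<Longrightarrow> c \<odot> (x \<oplus> y) = c \<odot> x \<oplus> c \<odot> y" using M.smult_r_distr[of c x y] by simp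
lemma vsmult_assoc: "x \<in> carrier X \<Longrightarrow> (c * d) \<odot> x = c \<odot> (d \<odot> x)" using M.smult_assoc1[of c d x] by simp
lemma vsmult_one: "x \<in> carrier X \<Longrightarrow> 1 \<odot> x = x" using M.smult_one[of x] by simp
lemma vsmult_zero: "x \<in> carrier X \<Longrightarrow> 0 \<odot> x = \<zero>" using M.smult_l_null[of x] by simp
end

text \<open>Cauchy sequences, the inductive limit, square integrable sections and
  \<open>S_space\<close> all carry pointwise operations. The vector space axioms are inherited from
  the fibres, which leaves closure of C and the properties of the form i.\<close>

lemma sip_pointwise:
  assumes X: "\<And>k. k \<in> I \<Longrightarrow> sip (X k)"
    and C: "C \<subseteq> (\<Pi>\<^sub>E k\<in>I. carrier (X k))" "(\<lambda>k\<in>I. \<zero>\<^bsub>X k\<^esub>) \<in> C"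
      "\<And>f g. f \<in> C \<Longrightarrow> g \<in> C \<Longrightarrow> (\<lambda>k\<in>I. f k \<oplus>\<^bsub>X k\<^esub> g k) \<in> C"
      "\<And>c f. f \<in> C \<Longrightarrow> (\<lambda>k\<in>I. c \<odot>\<^bsub>X k\<^esub> f k) \<in> C"
    and i: "\<And>f g. f \<in> C \<Longrightarrow> g \<in> C \<Longrightarrow> i g f = cnj (i f g)"
       "\<And>f g h. f \<in> C \<Longrightarrow> g \<in> C \<Longrightarrow> h \<in> C \<Longrightarrow> i f (\<lambda>k\<in>I. g k \<oplus>\<^bsub>X k\<^esub> h k) = i f g + i f h"
       "\<And>c f g. f \<in> C \<Longrightarrow> g \<in> C \<Longrightarrow> i f (\<lambda>k\<in>I. c \<odot>\<^bsub>X k\<^esub> g k) = c * i f g"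
       "\<And>f. f \<in> C \<Longrightarrow> 0 \<le> Re (i f f)"
  shows "sip (mk_hspace C (\<lambda>k\<in>I. \<zero>\<^bsub>X k\<^esub>) (\<lambda>f g. \<lambda>k\<in>I. f k \<oplus>\<^bsub>X k\<^esub> g k) (\<lambda>c f. \<lambda>k\<in>I. c \<odot>\<^bsub>X k\<^esub> f k) i)"
proof -
  have in1: "f k \<in> carrier (X k)" if "f \<in> C" "k \<in> I" for f k using C(1) that by (auto simp: PiE_iff)
  have in2: "(\<lambda>k\<in>I. f k) = f" if "f \<in> C" for f using C(1) that by (auto simp: PiE_iff extensional_restrict)
  show ?thesis
  proof (rule sip_mk_hspaceI, goal_cases)
    case (4 x y w) then show ?case by (simp add: sip.vadd_assoc[OF X] in1 cong: restrict_cong)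
  next case (5 x y) then show ?case by (intro restrict_ext sip.vadd_comm[OF X] in1)
  next case (6 x) then show ?case by (simp add: sip.vadd_zero[OF X] in1 in2 cong: restrict_cong)
  next case (7 x) then show ?case by (simp add: sip.vadd_neg[OF X] in1 cong: restrict_cong)
  next case (8 c d x) then show ?case by (simp add: sip.vsmult_l[OF X] in1 cong: restrict_cong)
  next case (9 c x y) then show ?case by (simp add: sip.vsmult_r[OF X] in1 cong: restrict_cong)
  next case (10 c d x) then show ?case by (simp add: sip.vsmult_assoc[OF X] in1 cong: restrict_cong)
  next case (11 x) then show ?case by (simp add: sip.vsmult_one[OF X] in1 in2 cong: restrict_cong)
  qed (rule C i; assumption)+
qed

definition null_vecs :: "'a hspace \<Rightarrow> 'a set" where
  "null_vecs X = {x \<in> carrier X. inn X x x = 0}"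

context sip
begin

abbreviation "N \<equiv> null_vecs X"

text \<open>By Cauchy-Schwarz a vector of length zero is orthogonal to everything. Hence such
  vectors form a subspace, and inner products of cosets do not depend on representatives.\<close>

lemma null_inn: "n \<in> N \<Longrightarrow> x \<in> carrier X \<Longrightarrow> inn X n x = 0"
  using cauchy_schwarz[of n x] by (auto simp: null_vecs_def hnorm_def)
lemma null_inn': "n \<in> N \<Longrightarrow> x \<in> carrier X \<Longrightarrow> inn X x n = 0"
  using cauchy_schwarz[of x n] by (auto simp: null_vecs_def hnorm_def)
lemma null_in: "n \<in> N \<Longrightarrow> n \<in> carrier X" by (simp add: null_vecs_def)

lemma null_smult: "n \<in> N \<Longrightarrow> c \<odot> n \<in> N" by (simp add: null_vecs_def)

lemma abelian_subgroup_null: "abelian_subgroup N X"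
proof (rule abelian_subgroupI3)
  show "additive_subgroup N X"
  proof (intro additive_subgroup.intro subgroup.intro)
    show "x \<otimes>\<^bsub>add_monoid X\<^esub> y \<in> N" if xy: "x \<in> N" "y \<in> N" for x y
    proof -
      have "x \<in> carrier X" "y \<in> carrier X" "inn X x x = 0" "inn X y y = 0"
        using xy by (simp_all add: null_vecs_def)
      moreover have "inn X x y = 0" "inn X y x = 0" using xy null_inn null_in by simp_all
      ultimately show ?thesis by (simp add: null_vecs_def)
    qed
    show "inv\<^bsub>add_monoid X\<^esub> x \<in> N" if "x \<in> N" for x
      using null_smult[OF that, of "-1"] unfolding a_inv_def[symmetric] uminus_eq[OF null_in[OF that]] .
  qed (auto simp: null_vecs_def)
qed (rule M.M.abelian_group_axioms)

lemma null_memI: "x \<in> carrier X \<Longrightarrow> inn X x x = 0 \<Longrightarrow> x \<in> N"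
  by (simp add: null_vecs_def)

interpretation Q: abelian_subgroup N X by (rule abelian_subgroup_null)

definition "cls x = N +> x"

lemma mem_cls: assumes "r \<in> cls x" "x \<in> carrier X" shows "\<exists>n\<in>N. r = n \<oplus> x"
  using assms by (auto simp: cls_def a_r_coset_def')

lemma cls_self: "x \<in> carrier X \<Longrightarrow> x \<in> cls x" unfolding cls_def by (rule Q.a_rcos_self)

lemma cls_eq: "x \<in> carrier X \<Longrightarrow> n \<in> N \<Longrightarrow> cls (n \<oplus> x) = cls x"
  unfolding cls_def by (rule Q.a_repr_independence'[symmetric]) (auto simp: a_r_coset_def' null_in)

text \<open>The operations of \<open>qspace\<close> use a representative picked by choice; it
  differs from any given one by a null vector, and this is how the choice is eliminated.\<close>

lemma cls_some: assumes "x \<in> carrier X" obtains n where "n \<in> N" "(SOME a. a \<in> cls x) = n \<oplus> x"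
  using mem_cls[OF someI[of "\<lambda>a. a \<in> cls x", OF cls_self[OF assms]] assms] by blast

lemma qspace_carrier: "carrier (qspace X N) = cls ` carrier X"
  by (auto simp: qspace_def A_RCOSETS_def' cls_def)
lemma qspace_add: "x \<in> carrier X \<Longrightarrow> y \<in> carrier X \<Longrightarrow> cls x \<oplus>\<^bsub>qspace X N\<^esub> cls y = cls (x \<oplus> y)"
  by (simp add: qspace_def cls_def Q.a_rcos_sum)
lemma qspace_smult: "x \<in> carrier X \<Longrightarrow> c \<odot>\<^bsub>qspace X N\<^esub> cls x = cls (c \<odot> x)"
proof -
  assume x: "x \<in> carrier X"
  obtain n where n: "n \<in> N" "(SOME a. a \<in> cls x) = n \<oplus> x" using cls_some[OF x] .
  have "c \<odot>\<^bsub>qspace X N\<^esub> cls x = cls (c \<odot> (n \<oplus> x))" by (simp add: qspace_def cls_def[symmetric] n(2))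
  also have "c \<odot> (n \<oplus> x) = c \<odot> n \<oplus> c \<odot> x" using x n null_in by (simp add: M.smult_r_distr)
  finally show ?thesis using cls_eq[of "c \<odot> x" "c \<odot> n"] x null_smult[OF n(1)] by simp
qed
lemma qspace_inn: "x \<in> carrier X \<Longrightarrow> y \<in> carrier X \<Longrightarrow> inn (qspace X N) (cls x) (cls y) = inn X x y"
proof -
  assume xy: "x \<in> carrier X" "y \<in> carrier X"
  obtain n where n: "n \<in> N" "(SOME a. a \<in> cls x) = n \<oplus> x" using cls_some[OF xy(1)] .
  obtain m where m: "m \<in> N" "(SOME a. a \<in> cls y) = m \<oplus> y" using cls_some[OF xy(2)] .
  have "inn (qspace X N) (cls x) (cls y) = inn X (n \<oplus> x) (m \<oplus> y)"
    by (simp add: qspace_def m n)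
  then show ?thesis using xy n(1) m(1) null_in by (simp add: null_inn null_inn')
qed
lemma qspace_zero: "\<zero>\<^bsub>qspace X N\<^esub> = cls \<zero>"
  using M.M.a_coset_add_zero[OF Q.a_subset] by (simp add: qspace_def cls_def)

lemma cls_in [simp, intro]: "x \<in> carrier X \<Longrightarrow> cls x \<in> carrier (qspace X N)"
  by (simp add: qspace_carrier)

lemma sip_qspace: "sip (qspace X N)"
proof -
  note q = qspace_carrier[unfolded qspace_def mk_hspace_simps] qspace_add[unfolded qspace_def mk_hspace_simps]
    qspace_smult[unfolded qspace_def mk_hspace_simps] qspace_inn[unfolded qspace_def mk_hspace_simps]
    qspace_zero[unfolded qspace_def mk_hspace_simps]
  show ?thesis unfolding qspace_def
  proof (rule sip_mk_hspaceI, goal_cases)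
    case 1 then show ?case unfolding q(1) unfolding q(5) by blast
  next case (2 x y) then show ?case unfolding q(1) by (auto simp: q(2))
  next case (3 c x) then show ?case unfolding q(1) by (auto simp: q(3))
  next case (4 x y w) then show ?case unfolding q(1) by (auto simp: q(2) vadd_assoc)
  next case (5 x y)
    then obtain x' y' where xy: "x = cls x'" "y = cls y'" "x' \<in> carrier X" "y' \<in> carrier X" unfolding q(1) by blast
    then show ?case using vadd_comm[OF xy(3,4)] by (simp add: q(2))
  next case (6 x) then show ?case unfolding q(1) unfolding q(5) by (auto simp: q(2))
  next case (7 x) then show ?case unfolding q(1) by (elim imageE) (simp add: q(2) q(3) vadd_neg q(5)[symmetric])
  next case (8 c d x) then show ?case unfolding q(1) by (auto simp: q(2) q(3) vsmult_l)
  next case (9 c x y) then show ?case unfolding q(1) by (auto simp: q(2) q(3) vsmult_r)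
  next case (10 c d x) then show ?case unfolding q(1) by (auto simp: q(3) vsmult_assoc)
  next case (11 x) then show ?case unfolding q(1) by (auto simp: q(3) vsmult_one)
  next case (12 x y) then show ?case unfolding q(1) by (elim imageE) (simp add: q(4), rule inn_cnj)
  next case (13 x y w) then show ?case unfolding q(1) by (auto simp: q(2) q(4))
  next case (14 c x y) then show ?case unfolding q(1) by (auto simp: q(3) q(4))
  next case (15 x) then show ?case unfolding q(1) by (auto simp: q(4))
  qed
qed

lemma cls_eq_zero: "x \<in> N \<Longrightarrow> cls x = \<zero>\<^bsub>qspace X N\<^esub>"
  unfolding qspace_zero using cls_eq[of \<zero> x] by (simp add: null_in)

lemma ips_qspace: "ips (qspace X N)"
proof (intro ips.intro ips_axioms.intro sip_qspace)
  fix x assume x: "x \<in> carrier (qspace X N)" "inn (qspace X N) x x = 0"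
  obtain y where y: "x = cls y" "y \<in> carrier X" using x(1) unfolding qspace_carrier by (rule imageE)
  have "inn X y y = 0" using x(2) unfolding y(1) qspace_inn[OF y(2) y(2)] .
  then have "y \<in> N" using y(2) by (intro null_memI)
  then show "x = \<zero>\<^bsub>qspace X N\<^esub>" unfolding y(1) by (rule cls_eq_zero)
qed

lemma cls_isometry: "lin_isometry X (qspace X N) cls"
  unfolding lin_isometry_def by (simp add: qspace_add qspace_smult qspace_inn)

end

lemma hbdd_minus:
  assumes "sip X" "sip Y" "hbdd X Y T" "x \<in> carrier X" "y \<in> carrier X"
  shows "T (x \<ominus>\<^bsub>X\<^esub> y) = T x \<ominus>\<^bsub>Y\<^esub> T y"
proof -
  interpret X: sip X by fact
  interpret Y: sip Y by fact
  show ?thesis using assms(3-5) by (simp add: a_minus_def X.uminus_eq Y.uminus_eq hbdd_add hbdd_smult hbdd_in)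
qed

lemma lin_isometry_hnorm: "lin_isometry X Y T \<Longrightarrow> x \<in> carrier X \<Longrightarrow> hnorm Y (T x) = hnorm X x"
  by (simp add: hnorm_def lin_isometry_inn)

subsection \<open>Completions\<close>

lemma carrier_cauchy_seqs: "carrier (cauchy_seqs X) = {s. range s \<subseteq> carrier X \<and> hcauchy X s}"
  by (simp add: cauchy_seqs_def hcauchy_def)

context sip
begin

lemma hcauchy_bounded: assumes s: "\<And>n. s n \<in> carrier X" "hcauchy X s" shows "\<exists>B. \<forall>n. hnorm X (s n) \<le> B"
proof -
  obtain K where K: "\<And>m n. m \<ge> K \<Longrightarrow> n \<ge> K \<Longrightarrow> hnorm X (s m \<ominus> s n) < 1"
    using s(2) unfolding hcauchy_def by (meson zero_less_one)
  have "hnorm X (s n) \<le> Max ((\<lambda>n. hnorm X (s n)) ` {..K}) + 1" for n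
  proof (cases "n \<le> K")
    case True
    then have "hnorm X (s n) \<le> Max ((\<lambda>n. hnorm X (s n)) ` {..K})" by (intro Max_ge) auto
    then show ?thesis by simp
  next
    case False
    then have "hnorm X (s n) \<le> hnorm X (s K) + 1"
      using hnorm_triangle_diff[OF s(1) s(1), of n K] K[of n K] by simp
    moreover have "hnorm X (s K) \<le> Max ((\<lambda>n. hnorm X (s n)) ` {..K})" by (intro Max_ge) auto
    ultimately show ?thesis by linarith
  qed
  then show ?thesis by blast
qed

text \<open>This makes the \<open>lim\<close> in the inner product of \<open>cauchy_seqs\<close> a
  genuine limit.\<close>

lemma hcauchy_inn_convergent:
  assumes s: "\<And>n. s n \<in> carrier X" "hcauchy X s" and r: "\<And>n. r n \<in> carrier X" "hcauchy X r"
  shows "convergent (\<lambda>n. inn X (s n) (r n))"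
proof (rule Cauchy_convergent, rule metric_CauchyI)
  fix e :: real assume e: "e > 0"
  obtain A where A: "\<And>n. hnorm X (s n) \<le> A" using hcauchy_bounded[OF s] by blast
  obtain B where B: "\<And>n. hnorm X (r n) \<le> B" using hcauchy_bounded[OF r] by blast
  have AB: "A \<ge> 0" "B \<ge> 0" using A[of 0] B[of 0] hnorm_nonneg[OF s(1), of 0] hnorm_nonneg[OF r(1), of 0] by auto
  \<comment> \<open>The summand 1 keeps the denominator positive and makes the final estimate
    strict.\<close>
  define d where "d = e / (A + B + 1)"
  have d: "d > 0" using AB e by (simp add: d_def)
  obtain K where K: "\<And>m n. m \<ge> K \<Longrightarrow> n \<ge> K \<Longrightarrow> hnorm X (s m \<ominus> s n) < d"
    using s(2) d unfolding hcauchy_def by meson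
  obtain L where L: "\<And>m n. m \<ge> L \<Longrightarrow> n \<ge> L \<Longrightarrow> hnorm X (r m \<ominus> r n) < d"
    using r(2) d unfolding hcauchy_def by meson
  have "dist (inn X (s m) (r m)) (inn X (s n) (r n)) < e" if "m \<ge> max K L" "n \<ge> max K L" for m n
  proof -
    have "inn X (s m) (r m) - inn X (s n) (r n) = inn X (s m) (r m \<ominus> r n) + inn X (s m \<ominus> s n) (r n)"
      using s r by simp
    also have "cmod \<dots> \<le> hnorm X (s m) * hnorm X (r m \<ominus> r n) + hnorm X (s m \<ominus> s n) * hnorm X (r n)"
      using s r by (intro norm_triangle_le add_mono cauchy_schwarz) auto
    also have "\<dots> \<le> A * d + d * B"
      using s r A B K[of m n] L[of m n] that AB d by (intro add_mono mult_mono) (auto simp: less_imp_le)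
    also have "\<dots> < d * (A + B + 1)" using d by (simp add: algebra_simps)
    also have "\<dots> = e" using AB by (simp add: d_def)
    finally show ?thesis by (simp add: dist_norm)
  qed
  then show "\<exists>M. \<forall>m\<ge>M. \<forall>n\<ge>M. dist (inn X (s m) (r m)) (inn X (s n) (r n)) < e" by blast
qed

lemma hcauchy_add:
  assumes s: "\<And>n. s n \<in> carrier X" "hcauchy X s" and r: "\<And>n. r n \<in> carrier X" "hcauchy X r"
  shows "hcauchy X (\<lambda>n. s n \<oplus> r n)"
  unfolding hcauchy_def
proof (intro allI impI)
  fix e :: real assume "e > 0"
  then have e: "e / 2 > 0" by simp
  obtain K where K: "\<And>m n. m \<ge> K \<Longrightarrow> n \<ge> K \<Longrightarrow> hnorm X (s m \<ominus> s n) < e / 2"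
    using s(2) e unfolding hcauchy_def by meson
  obtain L where L: "\<And>m n. m \<ge> L \<Longrightarrow> n \<ge> L \<Longrightarrow> hnorm X (r m \<ominus> r n) < e / 2"
    using r(2) e unfolding hcauchy_def by meson
  have "hnorm X ((s m \<oplus> r m) \<ominus> (s n \<oplus> r n)) < e" if "m \<ge> max K L" "n \<ge> max K L" for m n
  proof -
    have "hnorm X ((s m \<oplus> r m) \<ominus> (s n \<oplus> r n)) = hnorm X ((s m \<ominus> s n) \<oplus> (r m \<ominus> r n))"
      using s(1) r(1) by (simp add: hnorm_def algebra_simps)
    also have "\<dots> \<le> hnorm X (s m \<ominus> s n) + hnorm X (r m \<ominus> r n)" using s(1) r(1) by (intro hnorm_triangle) auto
    finally show ?thesis using K[of m n] L[of m n] that by simp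
  qed
  then show "\<exists>K. \<forall>m\<ge>K. \<forall>n\<ge>K. hnorm X ((s m \<oplus> r m) \<ominus> (s n \<oplus> r n)) < e" by blast
qed

lemma hcauchy_smult:
  assumes s: "\<And>n. s n \<in> carrier X" "hcauchy X s"
  shows "hcauchy X (\<lambda>n. c \<odot> s n)"
  unfolding hcauchy_def
proof (intro allI impI)
  fix e :: real assume "e > 0"
  then have e: "e / (cmod c + 1) > 0" by (intro divide_pos_pos add_nonneg_pos) auto
  obtain K where K: "\<And>m n. m \<ge> K \<Longrightarrow> n \<ge> K \<Longrightarrow> hnorm X (s m \<ominus> s n) < e / (cmod c + 1)"
    using s(2) e unfolding hcauchy_def by meson
  have "hnorm X ((c \<odot> s m) \<ominus> (c \<odot> s n)) < e" if "m \<ge> K" "n \<ge> K" for m n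
  proof -
    have "hnorm X ((c \<odot> s m) \<ominus> (c \<odot> s n)) = hnorm X (c \<odot> (s m \<ominus> s n))"
      using s(1) by (simp add: hnorm_def algebra_simps)
    also have "\<dots> \<le> (cmod c + 1) * hnorm X (s m \<ominus> s n)" using s(1) by (simp add: mult_right_mono)
    also have "\<dots> < (cmod c + 1) * (e / (cmod c + 1))"
      using K[OF that] by (intro mult_strict_left_mono) (auto simp: add_nonneg_pos)
    also have "\<dots> = e" by (simp add: add_nonneg_eq_0_iff)
    finally show ?thesis .
  qed
  then show "\<exists>K. \<forall>m\<ge>K. \<forall>n\<ge>K. hnorm X ((c \<odot> s m) \<ominus> (c \<odot> s n)) < e" by blast
qed

lemma cauchy_seqs_lim:
  assumes "s \<in> carrier (cauchy_seqs X)" "r \<in> carrier (cauchy_seqs X)"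
  shows "(\<lambda>n. inn X (s n) (r n)) \<longlonglongrightarrow> inn (cauchy_seqs X) s r"
proof -
  have "convergent (\<lambda>n. inn X (s n) (r n))"
    using assms by (intro hcauchy_inn_convergent) (auto simp: carrier_cauchy_seqs)
  then show ?thesis by (simp add: cauchy_seqs_def convergent_LIMSEQ_iff)
qed

lemma sip_cauchy_seqs: "sip (cauchy_seqs X)"
proof -
  let ?C = "carrier (cauchy_seqs X)"
  have inX: "s n \<in> carrier X" if "s \<in> ?C" for s n using that by (auto simp: carrier_cauchy_seqs)
  have add: "(\<lambda>n. s n \<oplus> r n) \<in> ?C" if "s \<in> ?C" "r \<in> ?C" for s r
    using that unfolding carrier_cauchy_seqs mem_Collect_eq by (intro conjI hcauchy_add) auto
  have smult: "(\<lambda>n. c \<odot> s n) \<in> ?C" if "s \<in> ?C" for s c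
    using that unfolding carrier_cauchy_seqs mem_Collect_eq by (intro conjI hcauchy_smult) auto
  have "sip (mk_hspace ?C (\<lambda>k\<in>UNIV. \<zero>) (\<lambda>f g. \<lambda>k\<in>UNIV. f k \<oplus> g k) (\<lambda>c f. \<lambda>k\<in>UNIV. c \<odot> f k) (inn (cauchy_seqs X)))"
  proof (rule sip_pointwise, goal_cases)
    case 1 show ?case by (rule sip_axioms)
  next case 2 then show ?case by (auto simp: carrier_cauchy_seqs)
  next case 3 then show ?case by (auto simp: carrier_cauchy_seqs hcauchy_def a_minus_def M.M.r_neg)
  next case (4 f g) then show ?case unfolding restrict_UNIV by (rule add)
  next case (5 c f) then show ?case unfolding restrict_UNIV by (rule smult)
  next case (6 f g)
    have "(\<lambda>n. cnj (inn X (f n) (g n))) \<longlonglongrightarrow> cnj (inn (cauchy_seqs X) f g)"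
      using cauchy_seqs_lim[OF 6] by (rule tendsto_cnj)
    then have "(\<lambda>n. inn X (g n) (f n)) \<longlonglongrightarrow> cnj (inn (cauchy_seqs X) f g)"
      by (simp only: inn_cnj[OF inX[OF 6(1)] inX[OF 6(2)], symmetric])
    then show ?case by (rule LIMSEQ_unique[OF cauchy_seqs_lim[OF 6(2,1)]])
  next case (7 f g h)
    have "(\<lambda>n. inn X (f n) (g n) + inn X (f n) (h n)) \<longlonglongrightarrow> inn (cauchy_seqs X) f g + inn (cauchy_seqs X) f h"
      by (intro tendsto_add cauchy_seqs_lim 7)
    then have "(\<lambda>n. inn X (f n) (g n \<oplus> h n)) \<longlonglongrightarrow> inn (cauchy_seqs X) f g + inn (cauchy_seqs X) f h"
      by (simp only: inn_add_right[OF inX[OF 7(1)] inX[OF 7(2)] inX[OF 7(3)]])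
    then show ?case unfolding restrict_UNIV by (rule LIMSEQ_unique[OF cauchy_seqs_lim[OF 7(1) add[OF 7(2,3)]]])
  next case (8 c f g)
    have "(\<lambda>n. c * inn X (f n) (g n)) \<longlonglongrightarrow> c * inn (cauchy_seqs X) f g"
      by (intro tendsto_mult_left cauchy_seqs_lim 8)
    then have "(\<lambda>n. inn X (f n) (c \<odot> g n)) \<longlonglongrightarrow> c * inn (cauchy_seqs X) f g"
      by (simp only: inn_smult_right[OF inX[OF 8(1)] inX[OF 8(2)]])
    then show ?case unfolding restrict_UNIV by (rule LIMSEQ_unique[OF cauchy_seqs_lim[OF 8(1) smult[OF 8(2)]]])
  next case (9 f)
    show ?case by (rule LIMSEQ_le_const[OF tendsto_Re[OF cauchy_seqs_lim[OF 9 9]]]) (use 9 inX in auto)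
  qed
  then show ?thesis by (simp add: cauchy_seqs_def restrict_UNIV)
qed

text \<open>Identifies the subspace divided out by \<open>completion\<close> with the vectors of
  length zero, so that the results on \<open>qspace\<close> apply to completions.\<close>

lemma null_seqs_eq: "null_seqs X = null_vecs (cauchy_seqs X)"
proof -
  have "(\<lambda>n. hnorm X (s n)) \<longlonglongrightarrow> 0 \<longleftrightarrow> inn (cauchy_seqs X) s s = 0" if s: "s \<in> carrier (cauchy_seqs X)" for s
  proof -
    have sc: "s n \<in> carrier X" for n using s by (auto simp: carrier_cauchy_seqs)
    have l: "(\<lambda>n. complex_of_real ((hnorm X (s n))\<^sup>2)) \<longlonglongrightarrow> inn (cauchy_seqs X) s s"
      using cauchy_seqs_lim[OF s s] by (simp only: inn_self[OF sc])
    show ?thesis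
    proof
      assume "(\<lambda>n. hnorm X (s n)) \<longlonglongrightarrow> 0"
      then have "(\<lambda>n. complex_of_real ((hnorm X (s n))\<^sup>2)) \<longlonglongrightarrow> of_real (0\<^sup>2)"
        by (intro tendsto_of_real tendsto_power)
      then show "inn (cauchy_seqs X) s s = 0" using LIMSEQ_unique[OF l] by simp
    next
      assume "inn (cauchy_seqs X) s s = 0"
      then have "(\<lambda>n. sqrt (Re (complex_of_real ((hnorm X (s n))\<^sup>2)))) \<longlonglongrightarrow> sqrt (Re 0)"
        using l by (intro tendsto_intros) simp
      then show "(\<lambda>n. hnorm X (s n)) \<longlonglongrightarrow> 0" using sc by (simp add: real_sqrt_abs abs_of_nonneg)
    qed
  qed
  then show ?thesis unfolding null_seqs_def null_vecs_def by auto
qed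

abbreviation "cseq \<equiv> cauchy_seqs X"

interpretation S: sip cseq by (rule sip_cauchy_seqs)

lemma completion_eq: "completion X = qspace cseq S.N"
  by (simp add: completion_def null_seqs_eq)

lemma to_completion_eq: "to_completion X x = S.cls (\<lambda>_. x)"
  by (simp add: to_completion_def S.cls_def null_seqs_eq)

lemma ips_completion: "ips (completion X)" unfolding completion_eq by (rule S.ips_qspace)

lemma const_seq: "x \<in> carrier X \<Longrightarrow> (\<lambda>_. x) \<in> carrier cseq"
  by (auto simp: carrier_cauchy_seqs hcauchy_def a_minus_def M.M.r_neg)

lemma cseq_simps [simp]: "s \<oplus>\<^bsub>cseq\<^esub> r = (\<lambda>n. s n \<oplus> r n)" "c \<odot>\<^bsub>cseq\<^esub> s = (\<lambda>n. c \<odot> s n)" "\<zero>\<^bsub>cseq\<^esub> = (\<lambda>_. \<zero>)"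
  by (simp_all add: cauchy_seqs_def)

lemma cseq_in: "s \<in> carrier cseq \<Longrightarrow> s n \<in> carrier X" by (auto simp: carrier_cauchy_seqs)

lemma cseq_minus: "s \<in> carrier cseq \<Longrightarrow> r \<in> carrier cseq \<Longrightarrow> s \<ominus>\<^bsub>cseq\<^esub> r = (\<lambda>n. s n \<ominus> r n)"
  using cseq_in[of r] by (simp add: a_minus_def S.uminus_eq uminus_eq)

lemma to_completion_isometry: "lin_isometry X (completion X) (to_completion X)"
  unfolding lin_isometry_def
proof (intro conjI ballI allI Pi_I)
  fix x y c assume x: "x \<in> carrier X"
  show "to_completion X x \<in> carrier (completion X)"
    unfolding to_completion_eq completion_eq by (intro S.cls_in const_seq x)
  show "to_completion X (c \<odot> x) = c \<odot>\<^bsub>completion X\<^esub> to_completion X x"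
    unfolding to_completion_eq completion_eq S.qspace_smult[OF const_seq[OF x]] by simp
  assume y: "y \<in> carrier X"
  show "to_completion X (x \<oplus> y) = to_completion X x \<oplus>\<^bsub>completion X\<^esub> to_completion X y"
    unfolding to_completion_eq completion_eq S.qspace_add[OF const_seq[OF x] const_seq[OF y]] by simp
  show "inn (completion X) (to_completion X x) (to_completion X y) = inn X x y"
    unfolding to_completion_eq completion_eq S.qspace_inn[OF const_seq[OF x] const_seq[OF y]]
    using LIMSEQ_unique[OF cauchy_seqs_lim[OF const_seq[OF x] const_seq[OF y]] tendsto_const] .
qed

lemma hnorm_cls: "s \<in> carrier cseq \<Longrightarrow> (\<lambda>n. hnorm X (s n)) \<longlonglongrightarrow> hnorm (completion X) (S.cls s)"
proof -
  assume s: "s \<in> carrier cseq"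
  show ?thesis unfolding hnorm_def completion_eq S.qspace_inn[OF s s]
    by (intro tendsto_intros cauchy_seqs_lim s)
qed

text \<open>The distance from the constant sequence s n to s is the limit over k of the distances
  from s n to s k, which is small by the Cauchy property.\<close>

lemma to_completion_lim:
  assumes s: "s \<in> carrier cseq"
  shows "hlim (completion X) (\<lambda>n. to_completion X (s n)) (S.cls s)"
  unfolding hlim_def
proof (rule LIMSEQ_I)
  fix e :: real assume e: "e > 0"
  then have "e / 2 > 0" by simp
  then obtain K where K: "\<And>m n. m \<ge> K \<Longrightarrow> n \<ge> K \<Longrightarrow> hnorm X (s m \<ominus> s n) < e / 2"
    using s unfolding carrier_cauchy_seqs hcauchy_def mem_Collect_eq by meson
  have "norm (hnorm (completion X) (to_completion X (s n) \<ominus>\<^bsub>completion X\<^esub> S.cls s) - 0) < e" if n: "n \<ge> K" for n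
  proof -
    note c = const_seq[OF cseq_in[OF s], of n]
    have "to_completion X (s n) \<ominus>\<^bsub>completion X\<^esub> S.cls s = S.cls (\<lambda>k. s n \<ominus> s k)"
      unfolding to_completion_eq completion_eq
      using hbdd_minus[OF S.sip_axioms S.sip_qspace lin_isometry_hbdd[OF S.cls_isometry] c s] cseq_minus[OF c s] by simp
    moreover have cc: "(\<lambda>k. s n \<ominus> s k) \<in> carrier cseq" using S.minus_in[OF c s] unfolding cseq_minus[OF c s] .
    ultimately have "(\<lambda>k. hnorm X (s n \<ominus> s k)) \<longlonglongrightarrow> hnorm (completion X) (to_completion X (s n) \<ominus>\<^bsub>completion X\<^esub> S.cls s)"
      using hnorm_cls[OF cc] by simp
    then have "hnorm (completion X) (to_completion X (s n) \<ominus>\<^bsub>completion X\<^esub> S.cls s) \<le> e / 2"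
      by (rule LIMSEQ_le_const2) (use K[OF n] in \<open>auto intro!: exI[of _ K] less_imp_le\<close>)
    moreover have "hnorm (completion X) (to_completion X (s n) \<ominus>\<^bsub>completion X\<^esub> S.cls s) \<ge> 0"
      by (rule LIMSEQ_le_const[OF \<open>(\<lambda>k. hnorm X (s n \<ominus> s k)) \<longlonglongrightarrow> _\<close>]) (use cseq_in[OF s] in auto)
    ultimately show ?thesis using e by simp
  qed
  then show "\<exists>K. \<forall>n\<ge>K. norm (hnorm (completion X) (to_completion X (s n) \<ominus>\<^bsub>completion X\<^esub> S.cls s) - 0) < e" by blast
qed

lemma completion_cases:
  assumes "z \<in> carrier (completion X)"
  obtains s where "s \<in> carrier cseq" "z = S.cls s" "hlim (completion X) (\<lambda>n. to_completion X (s n)) z"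
proof -
  obtain s where "s \<in> carrier cseq" "z = S.cls s" using assms unfolding completion_eq S.qspace_carrier by blast
  then show ?thesis using to_completion_lim that by simp
qed

lemma total_to_completion: "total (completion X) (to_completion X ` carrier X)"
  unfolding total_def
proof (intro conjI, goal_cases)
  case 1 show ?case using lin_isometry_in[OF to_completion_isometry] by blast
next
  case 2
  show ?case
  proof
    fix z assume z: "z \<in> carrier (completion X)"
    obtain s where s: "s \<in> carrier cseq" "z = S.cls s" "hlim (completion X) (\<lambda>n. to_completion X (s n)) z"
      using completion_cases[OF z] .
    show "z \<in> cspan (completion X) (to_completion X ` carrier X)"
      by (rule cspan.lim[OF _ z s(3)], rule cspan.base)
        (use cseq_in[OF s(1)] lin_isometry_in[OF to_completion_isometry] in auto)
  qed
qed

text \<open>A Cauchy sequence c of classes is approximated by vectors x n of X whose images are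
  within 1/(n+1) of c n. The sequence x is itself Cauchy, and its class is the limit of c.\<close>

lemma hilb_completion: "hilb (completion X)"
proof -
  interpret C: ips "completion X" by (rule ips_completion)
  note ti = to_completion_isometry
  note tb = lin_isometry_hbdd[OF ti]
  have "\<exists>x\<in>carrier (completion X). hlim (completion X) c x"
    if c: "\<And>n. c n \<in> carrier (completion X)" "hcauchy (completion X) c" for c
  proof -
    have "\<exists>x\<in>carrier X. hnorm (completion X) (to_completion X x \<ominus>\<^bsub>completion X\<^esub> c n) < 1 / real (Suc n)" for n
    proof -
      obtain s where s: "s \<in> carrier cseq" "c n = S.cls s" "hlim (completion X) (\<lambda>n. to_completion X (s n)) (c n)"
        using completion_cases[OF c(1)] .
      have "eventually (\<lambda>k. hnorm (completion X) (to_completion X (s k) \<ominus>\<^bsub>completion X\<^esub> c n) < 1 / real (Suc n)) sequentially"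
        using order_tendstoD(2)[OF s(3)[unfolded hlim_def], of "1 / real (Suc n)"] by simp
      then show ?thesis using cseq_in[OF s(1)] by (auto simp: eventually_sequentially)
    qed
    then obtain x where x: "\<And>n. x n \<in> carrier X"
      "\<And>n. hnorm (completion X) (to_completion X (x n) \<ominus>\<^bsub>completion X\<^esub> c n) < 1 / real (Suc n)" by metis
    let ?t = "\<lambda>n. to_completion X (x n)"
    have t: "?t n \<in> carrier (completion X)" for n by (rule hbdd_in[OF tb x(1)])
    have lim0: "(\<lambda>n. hnorm (completion X) (?t n \<ominus>\<^bsub>completion X\<^esub> c n)) \<longlonglongrightarrow> 0"
      by (rule tendsto_0_real_le[where g = "\<lambda>n. 1 / real (Suc n)"])
        (use LIMSEQ_inverse_real_of_nat x(2) t c(1) in \<open>auto simp: inverse_eq_divide intro: less_imp_le\<close>)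
    have "hcauchy X x" unfolding hcauchy_def
    proof (intro allI impI)
      fix e :: real assume "e > 0"
      then have e: "e / 3 > 0" by simp
      obtain K where K: "\<And>m n. m \<ge> K \<Longrightarrow> n \<ge> K \<Longrightarrow> hnorm (completion X) (c m \<ominus>\<^bsub>completion X\<^esub> c n) < e / 3"
        using c(2) e unfolding hcauchy_def by meson
      obtain L where L: "\<And>n. n \<ge> L \<Longrightarrow> hnorm (completion X) (?t n \<ominus>\<^bsub>completion X\<^esub> c n) < e / 3"
        using order_tendstoD(2)[OF lim0 e] by (auto simp: eventually_sequentially)
      have "hnorm X (x m \<ominus> x n) < e" if "m \<ge> max K L" "n \<ge> max K L" for m n
      proof -
        have "hnorm X (x m \<ominus> x n) = hnorm (completion X) (?t m \<ominus>\<^bsub>completion X\<^esub> ?t n)"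
          using lin_isometry_hnorm[OF ti, of "x m \<ominus> x n"] x(1) hbdd_minus[OF sip_axioms C.sip_axioms tb x(1) x(1)] by simp
        also have "\<dots> \<le> hnorm (completion X) (?t m \<ominus>\<^bsub>completion X\<^esub> c m) + hnorm (completion X) (c m \<ominus>\<^bsub>completion X\<^esub> ?t n)"
          by (rule C.hnorm_triangle3[OF t t c(1)])
        also have "hnorm (completion X) (c m \<ominus>\<^bsub>completion X\<^esub> ?t n) \<le>
            hnorm (completion X) (c m \<ominus>\<^bsub>completion X\<^esub> c n) + hnorm (completion X) (c n \<ominus>\<^bsub>completion X\<^esub> ?t n)"
          by (rule C.hnorm_triangle3[OF c(1) t c(1)])
        also have "hnorm (completion X) (c n \<ominus>\<^bsub>completion X\<^esub> ?t n) = hnorm (completion X) (?t n \<ominus>\<^bsub>completion X\<^esub> c n)"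
          by (rule C.hnorm_minus_commute[OF c(1) t])
        finally show ?thesis using K[of m n] L[of m] L[of n] that by simp
      qed
      then show "\<exists>K. \<forall>m\<ge>K. \<forall>n\<ge>K. hnorm X (x m \<ominus> x n) < e" by blast
    qed
    then have xs: "x \<in> carrier cseq" using x(1) by (auto simp: carrier_cauchy_seqs)
    then have z: "S.cls x \<in> carrier (completion X)" unfolding completion_eq by (rule S.cls_in)
    have "hlim (completion X) c (S.cls x)"
      unfolding hlim_def
    proof (rule tendsto_0_real_le)
      show "(\<lambda>n. hnorm (completion X) (?t n \<ominus>\<^bsub>completion X\<^esub> c n) + hnorm (completion X) (?t n \<ominus>\<^bsub>completion X\<^esub> S.cls x)) \<longlonglongrightarrow> 0"
        using tendsto_add[OF lim0 to_completion_lim[OF xs, unfolded hlim_def]] by simp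
      show "0 \<le> hnorm (completion X) (c n \<ominus>\<^bsub>completion X\<^esub> S.cls x)" for n
        by (intro C.hnorm_nonneg C.minus_in c z)
      show "hnorm (completion X) (c n \<ominus>\<^bsub>completion X\<^esub> S.cls x)
         \<le> hnorm (completion X) (?t n \<ominus>\<^bsub>completion X\<^esub> c n) + hnorm (completion X) (?t n \<ominus>\<^bsub>completion X\<^esub> S.cls x)" for n
        using C.hnorm_triangle3[OF c(1) z t, of n n] C.hnorm_minus_commute[OF c(1) t, of n n] by simp
    qed
    then show ?thesis using z by blast
  qed
  note * = this
  show ?thesis by (intro hilb.intro hilb_axioms.intro C.ips_axioms) (rule *)
qed

end

subsection \<open>Products of positive semidefinite kernels\<close>

lemma cnj_mult_self: "cnj z * z = complex_of_real ((cmod z)\<^sup>2)"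
  unfolding complex_norm_square by (rule mult.commute)

definition psd :: "'i set \<Rightarrow> ('i \<Rightarrow> 'i \<Rightarrow> complex) \<Rightarrow> bool" where
  "psd I K \<longleftrightarrow> (\<forall>i\<in>I. \<forall>j\<in>I. K j i = cnj (K i j)) \<and>
     (\<forall>c. 0 \<le> Re (\<Sum>i\<in>I. \<Sum>j\<in>I. cnj (c i) * c j * K i j))"

lemma psd_nonneg: "psd I K \<Longrightarrow> 0 \<le> Re (\<Sum>i\<in>I. \<Sum>j\<in>I. cnj (c i) * c j * K i j)"
  unfolding psd_def by blast

text \<open>A Cholesky factorisation by induction on I: one index p is split off and the rest is
  replaced by the Schur complement of the pivot K p p.\<close>

lemma psd_decomposition:
  assumes "finite I" "psd I K"
  shows "\<exists>(n::nat) a. \<forall>i\<in>I. \<forall>j\<in>I. K i j = (\<Sum>k<n. cnj (a k i) * a k j)"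
  using assms
proof (induction I arbitrary: K rule: finite_induct)
  case empty
  then show ?case by simp
next
  case (insert p I)
  have herm: "K j i = cnj (K i j)" if "i \<in> insert p I" "j \<in> insert p I" for i j
    using insert.prems that unfolding psd_def by blast
  define \<kappa> where "\<kappa> = Re (K p p)"
  have \<kappa>: "K p p = of_real \<kappa>" using herm[of p p] by (simp add: \<kappa>_def complex_eq_iff)
  define L where "L c = (\<Sum>j\<in>I. c j * K p j)" for c
  define Q where "Q c = (\<Sum>i\<in>I. \<Sum>j\<in>I. cnj (c i) * c j * K i j)" for c
  have Q: "0 \<le> (cmod w)\<^sup>2 * \<kappa> + 2 * Re (cnj w * L c) + Re (Q c)" for w c
  proof -
    let ?c = "c(p := w)"
    have pI: "p \<notin> I" by fact
    have c: "?c i = c i" if "i \<in> I" for i using that pI by auto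
    have "(\<Sum>i\<in>insert p I. \<Sum>j\<in>insert p I. cnj (?c i) * ?c j * K i j) =
      cnj w * w * K p p + cnj w * L c + (\<Sum>i\<in>I. cnj (c i) * w * K i p) + Q c"
      using insert.hyps by (simp add: c L_def Q_def sum_distrib_left sum.distrib algebra_simps del: fun_upd_apply)
        (simp add: algebra_simps)
    also have "(\<Sum>i\<in>I. cnj (c i) * w * K i p) = cnj (cnj w * L c)"
      by (auto simp: L_def sum_distrib_left herm[of p] intro!: sum.cong)
    finally have eq: "Re (\<Sum>i\<in>insert p I. \<Sum>j\<in>insert p I. cnj (?c i) * ?c j * K i j) =
      (cmod w)\<^sup>2 * \<kappa> + 2 * Re (cnj w * L c) + Re (Q c)"
      unfolding cmod_power2 by (simp add: \<kappa> power2_eq_square algebra_simps)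
    have "0 \<le> Re (\<Sum>i\<in>insert p I. \<Sum>j\<in>insert p I. cnj (c i) * c j * K i j)" for c
      using insert.prems unfolding psd_def by blast
    from this[of ?c] show ?thesis unfolding eq .
  qed
  have LK: "L (\<lambda>i. if i = j then 1 else 0) = K p j" if "j \<in> I" for j
  proof -
    have "L (\<lambda>i. if i = j then 1 else 0) = (\<Sum>i\<in>I. if i = j then K p j else 0)"
      unfolding L_def by (intro sum.cong) auto
    then show ?thesis using that insert.hyps by simp
  qed
  show ?case
  proof (cases "\<kappa> = 0")
    \<comment> \<open>A vanishing pivot forces its whole row to vanish, so p contributes nothing to
      the factorisation.\<close>
    case True
    have L0: "L c = 0" for c
    proof (rule ccontr)
      assume "L c \<noteq> 0"
      then have "(cmod (L c))\<^sup>2 > 0" by simp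
      \<comment> \<open>Chosen so that the quadratic form at w = - t L(c) would take the value
        -1.\<close>
      define t where "t = (Re (Q c) + 1) / (2 * (cmod (L c))\<^sup>2)"
      have e: "cnj (- of_real t * L c) * L c = of_real (- (t * (cmod (L c))\<^sup>2))"
      proof -
        have "cnj (- of_real t * L c) * L c = - of_real t * (cnj (L c) * L c)" by simp
        then show ?thesis unfolding cnj_mult_self by simp
      qed
      have "0 \<le> - 2 * (t * (cmod (L c))\<^sup>2) + Re (Q c)"
        using Q[of "- of_real t * L c" c] True unfolding e Re_complex_of_real by simp
      moreover have "2 * (t * (cmod (L c))\<^sup>2) = Re (Q c) + 1" using \<open>(cmod (L c))\<^sup>2 > 0\<close> by (simp add: t_def)
      ultimately show False by simp
    qed
    have Kp: "K p j = 0" "K j p = 0" if "j \<in> I" for j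
      using LK[OF that] L0 herm[of p j] that by simp_all
    have "psd I K" unfolding psd_def
    proof (intro conjI ballI allI)
      show "K j i = cnj (K i j)" if "i \<in> I" "j \<in> I" for i j using that by (intro herm) auto
      show "0 \<le> Re (\<Sum>i\<in>I. \<Sum>j\<in>I. cnj (c i) * c j * K i j)" for c
        using Q[of 0 c] by (simp add: Q_def)
    qed
    then obtain n :: nat and a where a: "\<And>i j. i \<in> I \<Longrightarrow> j \<in> I \<Longrightarrow> K i j = (\<Sum>k<n. cnj (a k i) * a k j)"
      using insert.IH by blast
    define b where "b k i = (if i = p then 0 else a k i)" for k i
    have bI: "b k i = a k i" if "i \<in> I" for k i using that insert.hyps by (auto simp: b_def)
    have "K i j = (\<Sum>k<n. cnj (b k i) * b k j)" if "i \<in> insert p I" "j \<in> insert p I" for i j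
    proof (cases "i = p \<or> j = p")
      case True
      then have "K i j = 0" using that Kp \<kappa> \<open>\<kappa> = 0\<close> by auto
      then show ?thesis using True by (auto simp: b_def)
    next
      case False
      then show ?thesis using that a bI by simp
    qed
    then show ?thesis by blast
  next
    case False
    have "\<kappa> > 0" using Q[of 1 "\<lambda>_. 0"] False by (simp add: L_def Q_def)
    \<comment> \<open>The Schur complement of the pivot.\<close>
    define K' where "K' i j = K i j - K i p * K p j / of_real \<kappa>" for i j
    have Q': "(\<Sum>i\<in>I. \<Sum>j\<in>I. cnj (c i) * c j * K' i j) = Q c - of_real ((cmod (L c))\<^sup>2 / \<kappa>)" for c
    proof -
      have "(\<Sum>i\<in>I. \<Sum>j\<in>I. cnj (c i) * c j * K' i j) = Q c - (\<Sum>i\<in>I. \<Sum>j\<in>I. (cnj (c i) * K i p) * (c j * K p j)) / of_real \<kappa>"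
        by (simp add: K'_def Q_def algebra_simps sum_subtractf sum_divide_distrib)
      also have "(\<Sum>i\<in>I. \<Sum>j\<in>I. (cnj (c i) * K i p) * (c j * K p j)) = (\<Sum>i\<in>I. cnj (c i) * K i p) * L c"
        by (simp add: L_def sum_product)
      also have "(\<Sum>i\<in>I. cnj (c i) * K i p) = cnj (L c)" by (auto simp: L_def herm[of p] intro!: sum.cong)
      finally show ?thesis by (simp add: cnj_mult_self mult.assoc)
    qed
    have "psd I K'" unfolding psd_def
    proof (intro conjI ballI allI)
      show "K' j i = cnj (K' i j)" if "i \<in> I" "j \<in> I" for i j
        using herm[of i j] herm[of p i] herm[of j p] that by (simp add: K'_def)
      show "0 \<le> Re (\<Sum>i\<in>I. \<Sum>j\<in>I. cnj (c i) * c j * K' i j)" for c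
      proof -
        \<comment> \<open>The minimiser over w of the form in \<open>Q\<close>; its minimum value is
          the form of the Schur complement at c.\<close>
        let ?w = "- L c / of_real \<kappa>"
        have e: "cnj ?w * L c = of_real (- ((cmod (L c))\<^sup>2 / \<kappa>))"
        proof -
          have "cnj ?w * L c = - (cnj (L c) * L c) / of_real \<kappa>" by simp
          then show ?thesis unfolding cnj_mult_self by simp
        qed
        have "(cmod ?w)\<^sup>2 * \<kappa> = (cmod (L c))\<^sup>2 / \<kappa>"
          using \<open>\<kappa> > 0\<close> by (simp add: norm_divide power_divide power2_eq_square)
        then show ?thesis unfolding Q' using Q[of ?w c] unfolding e Re_complex_of_real by simp
      qed
    qed
    then obtain n :: nat and a where a: "\<And>i j. i \<in> I \<Longrightarrow> j \<in> I \<Longrightarrow> K' i j = (\<Sum>k<n. cnj (a k i) * a k j)"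
      using insert.IH by blast
    \<comment> \<open>The additional row n is the pivot row divided by the square root of the pivot;
      the rows from the induction hypothesis are continued by zero at p.\<close>
    define b where "b k i = (if k = n then K p i / of_real (sqrt \<kappa>) else if i = p then 0 else a k i)" for k i
    have ss: "complex_of_real (sqrt \<kappa>) * of_real (sqrt \<kappa>) = of_real \<kappa>" using \<open>\<kappa> > 0\<close> by (simp flip: of_real_mult)
    have "K i j = (\<Sum>k<Suc n. cnj (b k i) * b k j)" if ij: "i \<in> insert p I" "j \<in> insert p I" for i j
    proof -
      have "cnj (b n i) * b n j = cnj (K p i) * K p j / of_real \<kappa>" by (simp add: b_def ss)
      also have "cnj (K p i) = K i p" using herm[of p i] ij by simp
      finally have bn: "cnj (b n i) * b n j = K i p * K p j / of_real \<kappa>" .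
      show ?thesis
      proof (cases "i = p \<or> j = p")
        case True
        then have "K i j = K i p * K p j / of_real \<kappa>" using \<kappa> \<open>\<kappa> > 0\<close> by auto
        moreover have "(\<Sum>k<n. cnj (b k i) * b k j) = 0" using True by (auto simp: b_def intro!: sum.neutral)
        ultimately show ?thesis using bn by simp
      next
        case False
        then have "(\<Sum>k<n. cnj (b k i) * b k j) = K' i j" using a ij by (simp add: b_def)
        then show ?thesis using bn by (simp add: K'_def)
      qed
    qed
    then show ?thesis by blast
  qed
qed

text \<open>The Schur product theorem: with A factored into rank one kernels, the form of the
  product at c is a sum over k of forms of B at the coefficients c_i a_k(i). It is what makes the
  inner product on formal tensors nonnegative.\<close>

lemma psd_mult:
  assumes "finite I" "psd I A" "psd I B"
  shows "psd I (\<lambda>i j. A i j * B i j)"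
  unfolding psd_def
proof (intro conjI ballI allI)
  show "A j i * B j i = cnj (A i j * B i j)" if "i \<in> I" "j \<in> I" for i j
  proof -
    have "A j i = cnj (A i j)" "B j i = cnj (B i j)" using assms(2,3) that unfolding psd_def by blast+
    then show ?thesis by (simp only: complex_cnj_mult)
  qed
  fix c
  obtain n :: nat and a where a: "\<And>i j. i \<in> I \<Longrightarrow> j \<in> I \<Longrightarrow> A i j = (\<Sum>k<n. cnj (a k i) * a k j)"
    using psd_decomposition[OF assms(1,2)] by blast
  have "(\<Sum>i\<in>I. \<Sum>j\<in>I. cnj (c i) * c j * (A i j * B i j)) =
     (\<Sum>i\<in>I. \<Sum>j\<in>I. \<Sum>k<n. cnj (c i * a k i) * (c j * a k j) * B i j)"
    by (intro sum.cong refl) (simp add: a sum_distrib_left sum_distrib_right mult_ac)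
  also have "\<dots> = (\<Sum>i\<in>I. \<Sum>k<n. \<Sum>j\<in>I. cnj (c i * a k i) * (c j * a k j) * B i j)"
    by (intro sum.cong refl sum.swap)
  also have "\<dots> = (\<Sum>k<n. \<Sum>i\<in>I. \<Sum>j\<in>I. cnj (c i * a k i) * (c j * a k j) * B i j)"
    by (rule sum.swap)
  also have "Re \<dots> \<ge> 0"
    unfolding Re_sum[of _ "{..<n}"] by (rule sum_nonneg) (rule psd_nonneg[OF assms(3)])
  finally show "0 \<le> Re (\<Sum>i\<in>I. \<Sum>j\<in>I. cnj (c i) * c j * (A i j * B i j))" .
qed

text \<open>The form at c is the squared length of the combination v of the x_i with coefficients
  c_i; v enters only through its inner products with all y.\<close>

lemma (in sip) psd_gram:
  assumes "finite I" "\<And>i. i \<in> I \<Longrightarrow> x i \<in> carrier X"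
  shows "psd I (\<lambda>i j. inn X (x i) (x j))"
  unfolding psd_def
proof (intro conjI ballI allI)
  show "inn X (x j) (x i) = cnj (inn X (x i) (x j))" if "i \<in> I" "j \<in> I" for i j
    using assms(2) that by (intro inn_cnj)
  fix c
  have "\<exists>v\<in>carrier X. \<forall>y\<in>carrier X. inn X y v = (\<Sum>i\<in>I. c i * inn X y (x i))"
    using assms
  proof (induction I rule: finite_induct)
    case empty
    then show ?case by (intro bexI[of _ \<zero>]) auto
  next
    case (insert p I)
    then obtain v where "v \<in> carrier X" "\<forall>y\<in>carrier X. inn X y v = (\<Sum>i\<in>I. c i * inn X y (x i))" by auto
    then show ?case using insert by (intro bexI[of _ "c p \<odot> x p \<oplus> v"]) auto
  qed
  then obtain v where v: "v \<in> carrier X" "\<And>y. y \<in> carrier X \<Longrightarrow> inn X y v = (\<Sum>i\<in>I. c i * inn X y (x i))" by blast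
  have "inn X v (x j) = (\<Sum>i\<in>I. cnj (c i) * inn X (x i) (x j))" if "j \<in> I" for j
  proof -
    have "inn X v (x j) = cnj (\<Sum>i\<in>I. c i * inn X (x j) (x i))"
      unfolding v(2)[OF assms(2)[OF that], symmetric] by (rule inn_cnj[OF assms(2)[OF that] v(1)])
    also have "\<dots> = (\<Sum>i\<in>I. cnj (c i) * cnj (inn X (x j) (x i)))" by simp
    also have "\<dots> = (\<Sum>i\<in>I. cnj (c i) * inn X (x i) (x j))"
    proof (rule sum.cong[OF refl])
      fix i assume "i \<in> I"
      then have "inn X (x i) (x j) = cnj (inn X (x j) (x i))" using assms(2) that by (intro inn_cnj) auto
      then show "cnj (c i) * cnj (inn X (x j) (x i)) = cnj (c i) * inn X (x i) (x j)" by (simp only:)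
    qed
    finally show ?thesis .
  qed
  then have "inn X v v = (\<Sum>j\<in>I. \<Sum>i\<in>I. cnj (c i) * c j * inn X (x i) (x j))"
    unfolding v(2)[OF v(1)] by (auto simp: sum_distrib_left mult_ac intro!: sum.cong)
  also have "\<dots> = (\<Sum>i\<in>I. \<Sum>j\<in>I. cnj (c i) * c j * inn X (x i) (x j))" by (rule sum.swap)
  finally show "0 \<le> Re (\<Sum>i\<in>I. \<Sum>j\<in>I. cnj (c i) * c j * inn X (x i) (x j))"
    using inn_nonneg[OF v(1)] by simp
qed

subsection \<open>Tensor products\<close>

lemma lookup_scale: "Poly_Mapping.lookup (Poly_Mapping.map ((*) a) c) k = a * Poly_Mapping.lookup c k" for a :: complex
  by (simp add: Poly_Mapping.map.rep_eq when_def)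

lemma keys_scale: "Poly_Mapping.keys (Poly_Mapping.map ((*) a) c) \<subseteq> Poly_Mapping.keys c" for a :: complex
  by (auto simp: in_keys_iff lookup_scale)

text \<open>By continuity and linearity it is enough to locate the images of generators. This is how
  totality statements are moved between spaces below.\<close>

lemma hbdd_cspan:
  assumes "sip X" "sip Y" and T: "hbdd X Y T" and A: "\<And>a. a \<in> A \<Longrightarrow> T a \<in> cspan Y B" and x: "x \<in> cspan X A"
  shows "T x \<in> cspan Y B"
proof -
  interpret X: sip X by fact
  interpret Y: sip Y by fact
  show ?thesis using x
  proof (induction rule: cspan.induct)
    case zero
    have "T (0 \<odot>\<^bsub>X\<^esub> \<zero>\<^bsub>X\<^esub>) = \<zero>\<^bsub>Y\<^esub>"
      unfolding hbdd_smult[OF T X.zero_in] by (rule Y.vsmult_zero[OF hbdd_in[OF T X.zero_in]])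
    then show ?case unfolding X.vsmult_zero[OF X.zero_in] by (simp add: cspan.zero)
  next
    case (lim s x)
    have s: "\<And>n. s n \<in> carrier X" using lim.hyps(1) by (rule X.cspan_carrier)
    show ?case
      by (rule cspan.lim[OF lim.IH hbdd_in[OF T lim.hyps(2)]], rule hbdd_hlim[OF assms(1,2) T s lim.hyps(2,3)])
  qed (use A X.cspan_carrier in \<open>auto simp: hbdd_add[OF T] hbdd_smult[OF T] intro: cspan_intros\<close>)
qed

locale tensor_pair = X: sip X + Y: sip Y for X :: "'a hspace" and Y :: "'b hspace"
begin

abbreviation "F \<equiv> free_tensor X Y"

definition kern :: "'a \<times> 'b \<Rightarrow> 'a \<times> 'b \<Rightarrow> complex" where
  "kern p q = inn X (fst p) (fst q) * inn Y (snd p) (snd q)"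

lemma carrier_F: "c \<in> carrier F \<longleftrightarrow> Poly_Mapping.keys c \<subseteq> carrier X \<times> carrier Y"
  by (simp add: free_tensor_def)

lemma F_simps [simp]: "c \<oplus>\<^bsub>F\<^esub> d = c + d" "a \<odot>\<^bsub>F\<^esub> c = Poly_Mapping.map ((*) a) c" "\<zero>\<^bsub>F\<^esub> = 0"
  by (simp_all add: free_tensor_def)

lemma inn_F:
  assumes "finite S" "Poly_Mapping.keys c \<subseteq> S" "finite T" "Poly_Mapping.keys d \<subseteq> T"
  shows "inn F c d = (\<Sum>p\<in>S. \<Sum>q\<in>T. cnj (Poly_Mapping.lookup c p) * Poly_Mapping.lookup d q * kern p q)"
proof -
  have "inn F c d = (\<Sum>p\<in>Poly_Mapping.keys c. \<Sum>q\<in>Poly_Mapping.keys d. cnj (Poly_Mapping.lookup c p) * Poly_Mapping.lookup d q * kern p q)"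
    by (simp add: free_tensor_def kern_def case_prod_unfold)
  also have "\<dots> = (\<Sum>p\<in>Poly_Mapping.keys c. \<Sum>q\<in>T. cnj (Poly_Mapping.lookup c p) * Poly_Mapping.lookup d q * kern p q)"
    using assms by (intro sum.cong refl sum.mono_neutral_left) (auto simp: in_keys_iff)
  also have "\<dots> = (\<Sum>p\<in>S. \<Sum>q\<in>T. cnj (Poly_Mapping.lookup c p) * Poly_Mapping.lookup d q * kern p q)"
    using assms by (intro sum.mono_neutral_left) (auto simp: in_keys_iff)
  finally show ?thesis .
qed

lemma psd_kern: "finite S \<Longrightarrow> S \<subseteq> carrier X \<times> carrier Y \<Longrightarrow> psd S kern"
  unfolding kern_def by (intro psd_mult X.psd_gram Y.psd_gram) auto

lemma sip_F: "sip F"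
proof -
  have C: "carrier F = {c. Poly_Mapping.keys c \<subseteq> carrier X \<times> carrier Y}" by (auto simp: carrier_F)
  have "sip (mk_hspace (carrier F) 0 (+) (\<lambda>a c. Poly_Mapping.map ((*) a) c) (inn F))"
  proof (rule sip_mk_hspaceI, goal_cases)
    case (2 c d) then show ?case using keys_add[of c d] by (auto simp: carrier_F)
  next case (3 a c) then show ?case using keys_scale[of a c] by (auto simp: carrier_F)
  next case (12 c d)
    let ?S = "Poly_Mapping.keys c \<union> Poly_Mapping.keys d"
    \<comment> \<open>Hermitian symmetry of the kernel is part of \<open>psd\<close>; it is taken on
      the union of the two supports.\<close>
    have p: "psd ?S kern" using 12 by (intro psd_kern) (auto simp: carrier_F)
    have "inn F d c = (\<Sum>p\<in>?S. \<Sum>q\<in>?S. cnj (Poly_Mapping.lookup d p) * Poly_Mapping.lookup c q * kern p q)"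
      by (rule inn_F) auto
    also have "\<dots> = (\<Sum>q\<in>?S. \<Sum>p\<in>?S. cnj (Poly_Mapping.lookup d p) * Poly_Mapping.lookup c q * kern p q)"
      by (rule sum.swap)
    also have "\<dots> = (\<Sum>q\<in>?S. \<Sum>p\<in>?S. cnj (cnj (Poly_Mapping.lookup c q) * Poly_Mapping.lookup d p * kern q p))"
    proof (intro sum.cong refl)
      fix p q assume "q \<in> ?S" "p \<in> ?S"
      then have "kern p q = cnj (kern q p)" using p unfolding psd_def by blast
      then show "cnj (Poly_Mapping.lookup d p) * Poly_Mapping.lookup c q * kern p q = cnj (cnj (Poly_Mapping.lookup c q) * Poly_Mapping.lookup d p * kern q p)"
        by simp
    qed
    also have "\<dots> = cnj (inn F c d)"
      by (subst inn_F[of ?S c ?S d]) auto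
    finally show ?case .
  next case (13 c d f)
    let ?S = "Poly_Mapping.keys c" and ?T = "Poly_Mapping.keys d \<union> Poly_Mapping.keys f"
    have k: "Poly_Mapping.keys (d + f) \<subseteq> ?T" by (rule keys_add)
    show ?case
      by (subst (1 2 3) inn_F[of ?S _ ?T]) (use k in \<open>auto simp: lookup_add sum.distrib algebra_simps\<close>)
  next case (14 a c d)
    show ?case
      by (subst (1 2) inn_F[of "Poly_Mapping.keys c" _ "Poly_Mapping.keys d"])
        (use keys_scale[of a d] in \<open>auto simp: lookup_scale sum_distrib_left mult_ac\<close>)
  next case (15 c)
    have p: "psd (Poly_Mapping.keys c) kern" using 15 by (intro psd_kern) (auto simp: carrier_F)
    show ?case unfolding inn_F[OF finite_keys order_refl finite_keys order_refl] by (rule psd_nonneg[OF p])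
  qed (auto simp: carrier_F lookup_scale lookup_add algebra_simps intro!: poly_mapping_eqI)
  then show ?thesis by (simp add: free_tensor_def)
qed

sublocale F: sip F by (rule sip_F)

abbreviation "T \<equiv> X \<otimes>\<^sub>H Y"

lemma hilb_T: "hilb T" unfolding htensor_def by (rule F.hilb_completion)

sublocale T: hilb T by (rule hilb_T)

lemma single_in: "x \<in> carrier X \<Longrightarrow> y \<in> carrier Y \<Longrightarrow> Poly_Mapping.single (x, y) 1 \<in> carrier F"
  by (simp add: carrier_F)

lemma tens_in [simp, intro]: "x \<in> carrier X \<Longrightarrow> y \<in> carrier Y \<Longrightarrow> tens X Y x y \<in> carrier T"
  unfolding tens_def htensor_def by (rule lin_isometry_in[OF F.to_completion_isometry single_in])

lemma inn_tens [simp]: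
  assumes "x \<in> carrier X" "y \<in> carrier Y" "x' \<in> carrier X" "y' \<in> carrier Y"
  shows "inn T (tens X Y x y) (tens X Y x' y') = inn X x x' * inn Y y y'"
proof -
  have "inn T (tens X Y x y) (tens X Y x' y') = inn F (Poly_Mapping.single (x, y) 1) (Poly_Mapping.single (x', y') 1)"
    unfolding tens_def htensor_def
    by (rule lin_isometry_inn[OF F.to_completion_isometry single_in single_in]) (use assms in auto)
  also have "\<dots> = inn X x x' * inn Y y y'"
    by (subst inn_F[of "{(x,y)}" _ "{(x',y')}"]) (auto simp: kern_def)
  finally show ?thesis .
qed

lemma hnorm_tens [simp]: "x \<in> carrier X \<Longrightarrow> y \<in> carrier Y \<Longrightarrow> hnorm T (tens X Y x y) = hnorm X x * hnorm Y y"
proof -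
  assume xy: "x \<in> carrier X" "y \<in> carrier Y"
  have "hnorm T (tens X Y x y) = sqrt (Re (of_real ((hnorm X x)\<^sup>2) * of_real ((hnorm Y y)\<^sup>2)))"
    unfolding hnorm_def[of T] inn_tens[OF xy xy] X.inn_self[OF xy(1)] Y.inn_self[OF xy(2)] ..
  then show ?thesis using xy by (simp add: real_sqrt_mult)
qed

lemma total_tens: "total T ((\<lambda>(x, y). tens X Y x y) ` (carrier X \<times> carrier Y))"
proof -
  let ?A = "(\<lambda>(x, y). tens X Y x y) ` (carrier X \<times> carrier Y)"
  note ti = lin_isometry_hbdd[OF F.to_completion_isometry, folded htensor_def]
  have "to_completion F c \<in> cspan T ?A" if "finite S" "S \<subseteq> carrier X \<times> carrier Y" "Poly_Mapping.keys c \<subseteq> S" for S c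
    using that
  proof (induction S arbitrary: c rule: finite_induct)
    case empty
    then have "c = 0" by simp
    have "to_completion F (0 \<odot>\<^bsub>F\<^esub> 0) = \<zero>\<^bsub>T\<^esub>"
      unfolding hbdd_smult[OF ti F.zero_in, unfolded F_simps(3)] by (rule T.vsmult_zero[OF hbdd_in[OF ti F.zero_in, unfolded F_simps(3)]])
    moreover have "0 \<odot>\<^bsub>F\<^esub> 0 = 0" using F.vsmult_zero[OF F.zero_in] by simp
    ultimately show ?case using \<open>c = 0\<close> cspan.zero[of T ?A] by (simp only:)
  next
    case (insert p S)
    \<comment> \<open>Removing the term at p leaves a formal tensor supported in S, to which the
      induction hypothesis applies.\<close>
    define a where "a = Poly_Mapping.lookup c p"
    define c' where "c' = c - Poly_Mapping.single p a"
    have k: "Poly_Mapping.keys c' \<subseteq> S"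
      using insert.prems(2) by (auto simp: c'_def in_keys_iff lookup_minus lookup_single a_def when_def split: if_splits)
    obtain x y where p: "p = (x, y)" "x \<in> carrier X" "y \<in> carrier Y" using insert.prems(1) by auto
    have c: "c = c' \<oplus>\<^bsub>F\<^esub> (a \<odot>\<^bsub>F\<^esub> Poly_Mapping.single p 1)"
      by (auto intro!: poly_mapping_eqI simp: c'_def lookup_add lookup_minus lookup_scale lookup_single when_def)
    have c'F: "c' \<in> carrier F" using k insert.prems(1) by (auto simp: carrier_F)
    have sF: "Poly_Mapping.single p 1 \<in> carrier F" unfolding p(1) by (rule single_in[OF p(2,3)])
    have "to_completion F c = to_completion F c' \<oplus>\<^bsub>T\<^esub> (a \<odot>\<^bsub>T\<^esub> tens X Y x y)"
      unfolding c hbdd_add[OF ti c'F F.smult_in[OF sF]] hbdd_smult[OF ti sF] by (simp add: tens_def p(1))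
    moreover have "tens X Y x y \<in> cspan T ?A" using p by (intro cspan.base tens_in) auto
    moreover have "to_completion F c' \<in> cspan T ?A" using insert.IH[of c'] k insert.prems(1) by blast
    ultimately show ?case by (simp add: cspan.add cspan.smult)
  qed
  from this[OF finite_keys _ order_refl] have "to_completion F ` carrier F \<subseteq> cspan T ?A"
    by (intro image_subsetI) (simp add: carrier_F)
  then show ?thesis using T.total_mono[OF F.total_to_completion[folded htensor_def]] tens_in by fastforce
qed

lemma tens_eqI:
  assumes "z \<in> carrier T" "z' \<in> carrier T"
    "\<And>x y. x \<in> carrier X \<Longrightarrow> y \<in> carrier Y \<Longrightarrow> inn T (tens X Y x y) z = inn T (tens X Y x y) z'"
  shows "z = z'"
  by (rule T.total_eqI[OF total_tens assms(1,2)]) (use assms(3) in auto)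

lemma hbdd_tens_left: "y \<in> carrier Y \<Longrightarrow> hbdd X T (\<lambda>x. tens X Y x y)"
  unfolding hbdd_def
proof (intro conjI ballI allI exI[of _ "hnorm Y y"])
  assume y: "y \<in> carrier Y"
  show "(\<lambda>x. tens X Y x y) \<in> carrier X \<rightarrow> carrier T" using y by auto
  show "tens X Y (x \<oplus>\<^bsub>X\<^esub> x') y = tens X Y x y \<oplus>\<^bsub>T\<^esub> tens X Y x' y" if "x \<in> carrier X" "x' \<in> carrier X" for x x'
    by (rule tens_eqI) (use y that in \<open>auto simp: algebra_simps\<close>)
  show "tens X Y (c \<odot>\<^bsub>X\<^esub> x) y = c \<odot>\<^bsub>T\<^esub> tens X Y x y" if "x \<in> carrier X" for x c
    by (rule tens_eqI) (use y that in \<open>auto simp: algebra_simps\<close>)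
qed (simp_all add: mult.commute)

lemma hbdd_tens_right: "x \<in> carrier X \<Longrightarrow> hbdd Y T (tens X Y x)"
  unfolding hbdd_def
proof (intro conjI ballI allI exI[of _ "hnorm X x"])
  assume y: "x \<in> carrier X"
  show "tens X Y x \<in> carrier Y \<rightarrow> carrier T" using y by auto
  show "tens X Y x (z \<oplus>\<^bsub>Y\<^esub> z') = tens X Y x z \<oplus>\<^bsub>T\<^esub> tens X Y x z'" if "z \<in> carrier Y" "z' \<in> carrier Y" for z z'
    by (rule tens_eqI) (use y that in \<open>auto simp: algebra_simps\<close>)
  show "tens X Y x (c \<odot>\<^bsub>Y\<^esub> z) = c \<odot>\<^bsub>T\<^esub> tens X Y x z" if "z \<in> carrier Y" for z c
    by (rule tens_eqI) (use y that in \<open>auto simp: algebra_simps\<close>)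
qed simp_all

text \<open>One factor at a time: with the other one fixed, tensoring is bounded and linear, so it
  respects closed spans.\<close>

lemma total_tens_image:
  assumes A: "total X A" and B: "total Y B"
  shows "total T ((\<lambda>(x, y). tens X Y x y) ` (A \<times> B))"
proof (rule T.total_mono[OF total_tens])
  let ?S = "(\<lambda>(x, y). tens X Y x y) ` (A \<times> B)"
  have AB: "A \<subseteq> carrier X" "B \<subseteq> carrier Y" using A B by (auto simp: total_def)
  show "?S \<subseteq> carrier T" using AB by auto
  have 1: "tens X Y x y \<in> cspan T ?S" if "x \<in> carrier X" "y \<in> B" for x y
  proof (rule hbdd_cspan[OF X.sip_axioms T.sip_axioms hbdd_tens_left, of y A])
    show "y \<in> carrier Y" using that AB by auto
    show "x \<in> cspan X A" using that A by (auto simp: total_def)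
    show "tens X Y a y \<in> cspan T ?S" if "a \<in> A" for a
      using \<open>y \<in> B\<close> that AB by (intro cspan.base tens_in) auto
  qed
  have "tens X Y x y \<in> cspan T ?S" if "x \<in> carrier X" "y \<in> carrier Y" for x y
  proof (rule hbdd_cspan[OF Y.sip_axioms T.sip_axioms hbdd_tens_right, of x B])
    show "x \<in> carrier X" by fact
    show "y \<in> cspan Y B" using that B by (auto simp: total_def)
    show "tens X Y x b \<in> cspan T ?S" if "b \<in> B" for b by (rule 1[OF \<open>x \<in> carrier X\<close> that])
  qed
  then show "(\<lambda>(x, y). tens X Y x y) ` (carrier X \<times> carrier Y) \<subseteq> cspan T ?S" by auto
qed

end

text \<open>The vectors x \<otimes> y and x \<otimes> T y have the same Gram matrix because T is
  isometric, so the description in \<open>id_tensor\<close> has exactly one solution.\<close>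

lemma id_tensor_props:
  assumes "sip X" "sip Y" "sip Z" and T: "lin_isometry Y Z T"
  shows "lin_isometry (X \<otimes>\<^sub>H Y) (X \<otimes>\<^sub>H Z) (id_tensor X Y Z T)"
    and "x \<in> carrier X \<Longrightarrow> y \<in> carrier Y \<Longrightarrow> id_tensor X Y Z T (tens X Y x y) = tens X Z x (T y)"
proof -
  interpret XY: tensor_pair X Y using assms by (simp add: tensor_pair_def)
  interpret XZ: tensor_pair X Z using assms by (simp add: tensor_pair_def)
  interpret gram "X \<otimes>\<^sub>H Y" "X \<otimes>\<^sub>H Z" "\<lambda>(x, y). tens X Y x y" "\<lambda>(x, y). tens X Z x (T y)" "carrier X \<times> carrier Y"
    by unfold_locales (auto simp: lin_isometry_in[OF T] lin_isometry_inn[OF T])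
  have ex: "\<exists>!W. W \<in> extensional (carrier (X \<otimes>\<^sub>H Y)) \<and> lin_isometry (X \<otimes>\<^sub>H Y) (X \<otimes>\<^sub>H Z) W \<and>
        (\<forall>x\<in>carrier X. \<forall>y\<in>carrier Y. W (tens X Y x y) = tens X Z x (T y))"
    using isometry_ex1[OF XZ.hilb_T XY.total_tens] by simp
  from theI'[OF ex] show "lin_isometry (X \<otimes>\<^sub>H Y) (X \<otimes>\<^sub>H Z) (id_tensor X Y Z T)"
    and "x \<in> carrier X \<Longrightarrow> y \<in> carrier Y \<Longrightarrow> id_tensor X Y Z T (tens X Y x y) = tens X Z x (T y)"
    unfolding id_tensor_def[symmetric] by blast+
qed

lemma id_tensor_unitary:
  assumes "sip X" "sip Y" "sip Z" and T: "unitary Y Z T"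
  shows "unitary (X \<otimes>\<^sub>H Y) (X \<otimes>\<^sub>H Z) (id_tensor X Y Z T)"
proof -
  interpret XY: tensor_pair X Y using assms by (simp add: tensor_pair_def)
  interpret XZ: tensor_pair X Z using assms by (simp add: tensor_pair_def)
  note props = id_tensor_props[OF assms(1-3) unitary_isometry[OF T]]
  show ?thesis
  proof (rule isometry_surj[OF XY.hilb_T XZ.T.ips_axioms props(1) XZ.total_tens], clarsimp)
    fix x z assume xz: "x \<in> carrier X" "z \<in> carrier Z"
    then obtain y where "y \<in> carrier Y" "z = T y" using T by (auto simp: unitary_def)
    then show "tens X Z x z \<in> id_tensor X Y Z T ` carrier (X \<otimes>\<^sub>H Y)"
      using props(2)[OF xz(1)] xz(1) by (intro image_eqI[of _ _ "tens X Y x y"]) auto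
  qed
qed

lemma tensor_assoc_props:
  assumes "sip X" "sip Y" "sip Z"
  shows "unitary ((X \<otimes>\<^sub>H Y) \<otimes>\<^sub>H Z) (X \<otimes>\<^sub>H (Y \<otimes>\<^sub>H Z)) (tensor_assoc X Y Z)"
    and "x \<in> carrier X \<Longrightarrow> y \<in> carrier Y \<Longrightarrow> z \<in> carrier Z \<Longrightarrow>
      tensor_assoc X Y Z (tens (X \<otimes>\<^sub>H Y) Z (tens X Y x y) z) = tens X (Y \<otimes>\<^sub>H Z) x (tens Y Z y z)"
proof -
  interpret XY: tensor_pair X Y using assms by (simp add: tensor_pair_def)
  interpret YZ: tensor_pair Y Z using assms by (simp add: tensor_pair_def)
  interpret XY_Z: tensor_pair "X \<otimes>\<^sub>H Y" Z using assms XY.T.sip_axioms by (simp add: tensor_pair_def)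
  interpret X_YZ: tensor_pair X "Y \<otimes>\<^sub>H Z" using assms YZ.T.sip_axioms by (simp add: tensor_pair_def)
  let ?a = "\<lambda>(x, y, z). tens (X \<otimes>\<^sub>H Y) Z (tens X Y x y) z" and ?b = "\<lambda>(x, y, z). tens X (Y \<otimes>\<^sub>H Z) x (tens Y Z y z)"
  let ?I = "carrier X \<times> carrier Y \<times> carrier Z"
  interpret gram "(X \<otimes>\<^sub>H Y) \<otimes>\<^sub>H Z" "X \<otimes>\<^sub>H (Y \<otimes>\<^sub>H Z)" ?a ?b ?I
    by unfold_locales auto
  have t1: "total ((X \<otimes>\<^sub>H Y) \<otimes>\<^sub>H Z) (?a ` ?I)"
  proof -
    have "(\<lambda>(w, z). tens (X \<otimes>\<^sub>H Y) Z w z) ` ((\<lambda>(x, y). tens X Y x y) ` (carrier X \<times> carrier Y) \<times> carrier Z) = ?a ` ?I"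
      by force
    then show ?thesis using XY_Z.total_tens_image[OF XY.total_tens YZ.Y.total_carrier] by simp
  qed
  have t2: "total (X \<otimes>\<^sub>H (Y \<otimes>\<^sub>H Z)) (?b ` ?I)"
  proof -
    have "(\<lambda>(x, w). tens X (Y \<otimes>\<^sub>H Z) x w) ` (carrier X \<times> (\<lambda>(y, z). tens Y Z y z) ` (carrier Y \<times> carrier Z)) = ?b ` ?I"
      by force
    then show ?thesis using X_YZ.total_tens_image[OF XY.X.total_carrier YZ.total_tens] by simp
  qed
  have ex: "\<exists>!W. W \<in> extensional (carrier ((X \<otimes>\<^sub>H Y) \<otimes>\<^sub>H Z)) \<and>
        unitary ((X \<otimes>\<^sub>H Y) \<otimes>\<^sub>H Z) (X \<otimes>\<^sub>H (Y \<otimes>\<^sub>H Z)) W \<and>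
        (\<forall>x\<in>carrier X. \<forall>y\<in>carrier Y. \<forall>z\<in>carrier Z.
           W (tens (X \<otimes>\<^sub>H Y) Z (tens X Y x y) z) = tens X (Y \<otimes>\<^sub>H Z) x (tens Y Z y z))"
    using unitary_ex1[OF XY_Z.hilb_T X_YZ.hilb_T t1 t2] by simp
  from theI'[OF ex] show "unitary ((X \<otimes>\<^sub>H Y) \<otimes>\<^sub>H Z) (X \<otimes>\<^sub>H (Y \<otimes>\<^sub>H Z)) (tensor_assoc X Y Z)"
    and "x \<in> carrier X \<Longrightarrow> y \<in> carrier Y \<Longrightarrow> z \<in> carrier Z \<Longrightarrow>
      tensor_assoc X Y Z (tens (X \<otimes>\<^sub>H Y) Z (tens X Y x y) z) = tens X (Y \<otimes>\<^sub>H Z) x (tens Y Z y z)"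
    unfolding tensor_assoc_def[symmetric] by blast+
qed

text \<open>On the range of T the defining equation is solved by the preimage, and definiteness
  excludes any other solution. So the adjoint of \<open>umap\<close> inside \<open>w_value\<close>
  acts as its inverse.\<close>

lemma hadjoint_unitary:
  assumes "ips X" "sip Y" and T: "unitary X Y T"
  shows "x \<in> carrier X \<Longrightarrow> hadjoint X Y T (T x) = x"
proof -
  interpret X: ips X by fact
  assume x: "x \<in> carrier X"
  note Ti = unitary_isometry[OF T]
  show ?thesis unfolding hadjoint_def
  proof (rule the_equality)
    show "x \<in> carrier X \<and> (\<forall>z\<in>carrier X. inn X z x = inn Y (T z) (T x))"
      using x lin_isometry_inn[OF Ti] by simp
    fix x' assume "x' \<in> carrier X \<and> (\<forall>z\<in>carrier X. inn X z x' = inn Y (T z) (T x))"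
    then show "x' = x" using x lin_isometry_inn[OF Ti] by (intro X.vec_eqI) auto
  qed
qed

lemma hadjoint_isometry:
  assumes "ips X" "sip Y" and T: "unitary X Y T"
  shows "lin_isometry Y X (hadjoint X Y T)"
proof -
  interpret X: ips X by fact
  note Ti = unitary_isometry[OF T]
  note Tb = lin_isometry_hbdd[OF Ti]
  have Y: "carrier Y = T ` carrier X" using T by (simp add: unitary_def)
  note H = hadjoint_unitary[OF assms]
  show ?thesis
    unfolding lin_isometry_def Y
  proof (intro conjI ballI allI Pi_I; elim imageE; clarify)
    fix x y c assume x: "x \<in> carrier X"
    show "hadjoint X Y T (T x) \<in> carrier X" using H x by simp
    show "hadjoint X Y T (c \<odot>\<^bsub>Y\<^esub> T x) = c \<odot>\<^bsub>X\<^esub> hadjoint X Y T (T x)"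
      using H[OF x] H[OF X.smult_in[OF x]] by (simp add: hbdd_smult[OF Tb x])
    assume y: "y \<in> carrier X"
    show "hadjoint X Y T (T x \<oplus>\<^bsub>Y\<^esub> T y) = hadjoint X Y T (T x) \<oplus>\<^bsub>X\<^esub> hadjoint X Y T (T y)"
      using H[OF x] H[OF y] H[OF X.add_in[OF x y]] by (simp add: hbdd_add[OF Tb x y])
    show "inn X (hadjoint X Y T (T x)) (hadjoint X Y T (T y)) = inn Y (T x) (T y)"
      using H[OF x] H[OF y] lin_isometry_inn[OF Ti x y] by simp
  qed
qed

section \<open>Measurable fields of Hilbert spaces\<close>

lemma borel_measurable_restrict_lborel: "borel_measurable (restrict_space lborel I) = borel_measurable (restrict_space borel I)"
  by (rule measurable_cong_sets[OF sets_restrict_space_cong refl]) simp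

lemma borel_measurable_cnj [measurable]:
  "f \<in> borel_measurable M \<Longrightarrow> (\<lambda>x. cnj (f x)) \<in> borel_measurable M"
  by (rule borel_measurable_continuous_on[of cnj]) (auto intro: continuous_intros)

lemma (in sip) hnorm_sq_add_le:
  assumes "x \<in> carrier X" "y \<in> carrier X"
  shows "(hnorm X (x \<oplus> y))\<^sup>2 \<le> 2 * (hnorm X x)\<^sup>2 + 2 * (hnorm X y)\<^sup>2"
  using parallelogram[OF assms] zero_le_power2[of "hnorm X (x \<ominus> y)"] by linarith

lemma (in sip) inn_le_sq:
  assumes "x \<in> carrier X" "y \<in> carrier X"
  shows "cmod (inn X x y) \<le> (hnorm X x)\<^sup>2 + (hnorm X y)\<^sup>2"
proof -
  have "cmod (inn X x y) \<le> hnorm X x * hnorm X y" by (rule cauchy_schwarz[OF assms])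
  also have "\<dots> \<le> (hnorm X x)\<^sup>2 + (hnorm X y)\<^sup>2"
    using sum_squares_bound[of "hnorm X x" "hnorm X y"] zero_le_power2[of "hnorm X x"] zero_le_power2[of "hnorm X y"]
      mult_nonneg_nonneg[OF hnorm_nonneg[OF assms(1)] hnorm_nonneg[OF assms(2)]] by linarith
  finally show ?thesis .
qed

lemma (in sip) hcauchy_summable:
  assumes s: "\<And>k. s k \<in> carrier X" and b: "\<And>k. hnorm X (s (Suc k) \<ominus> s k) \<le> b k" "summable b"
  shows "hcauchy X s"
proof -
  have b0: "b k \<ge> 0" for k using order_trans[OF hnorm_nonneg[OF minus_in[OF s s]] b(1)] .
  have le: "hnorm X (s n \<ominus> s m) \<le> (\<Sum>k<n. b k) - (\<Sum>k<m. b k)" if "m \<le> n" for m n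
    using that
  proof (induction n rule: dec_induct)
    case base
    show ?case using s[of m] by (simp add: a_minus_def M.M.r_neg)
  next
    case (step n)
    then show ?case using hnorm_triangle3[OF s s s, of "Suc n" m n] b(1)[of n] by simp
  qed
  have "Cauchy (\<lambda>n. \<Sum>k<n. b k)" using b(2) by (simp add: summable_iff_convergent convergent_Cauchy)
  then show ?thesis unfolding hcauchy_def Cauchy_def dist_real_def
  proof (intro allI impI)
    fix e :: real assume C: "\<forall>e>0. \<exists>M. \<forall>m\<ge>M. \<forall>n\<ge>M. \<bar>(\<Sum>k<m. b k) - (\<Sum>k<n. b k)\<bar> < e" and e: "e > 0"
    then obtain K where K: "\<And>m n. m \<ge> K \<Longrightarrow> n \<ge> K \<Longrightarrow> \<bar>(\<Sum>k<m. b k) - (\<Sum>k<n. b k)\<bar> < e" by blast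
    have "hnorm X (s m \<ominus> s n) < e" if "m \<ge> K" "n \<ge> K" for m n
    proof (cases "n \<le> m")
      case True
      then show ?thesis using le[OF True] K[OF that] by linarith
    next
      case False
      then show ?thesis using le[of m n] K[OF that] hnorm_minus_commute[OF s s, of m n] by linarith
    qed
    then show "\<exists>K. \<forall>m\<ge>K. \<forall>n\<ge>K. hnorm X (s m \<ominus> s n) < e" by blast
  qed
qed

text \<open>A countable field p of orthonormal bases turns measurability of sections into
  measurability of scalar coefficients. The set M is a parameter tied down by \<open>M_eq\<close>,
  so that the locale covers both \<open>sections E I\<close> and \<open>R_sections E e\<close>,
  whose definitions read differently.\<close>

locale mfield =
  fixes I :: "real set" and X :: "real \<Rightarrow> 'a hspace" and p :: "nat \<Rightarrow> real \<Rightarrow> 'a" and M :: "(real \<Rightarrow> 'a) set"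
  assumes I_meas [measurable, simp]: "I \<in> sets borel"
    and hilb_X: "\<alpha> \<in> I \<Longrightarrow> hilb (X \<alpha>)"
    and onb_p: "\<alpha> \<in> I \<Longrightarrow> onb (X \<alpha>) (\<lambda>i. p i \<alpha>)"
    and p_meas: "(\<lambda>\<alpha>. inn (X \<alpha>) (p i \<alpha>) (p j \<alpha>)) \<in> borel_measurable (restrict_space lborel I)"
    and M_eq: "M = {F \<in> (\<Pi>\<^sub>E \<alpha>\<in>I. carrier (X \<alpha>)).
      \<forall>i. (\<lambda>\<alpha>. inn (X \<alpha>) (p i \<alpha>) (F \<alpha>)) \<in> borel_measurable (restrict_space lborel I)}"
begin

abbreviation "\<Lambda> \<equiv> restrict_space lborel I"
abbreviation "l2 \<equiv> l2_sections I X M"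

lemma sip_X: "\<alpha> \<in> I \<Longrightarrow> sip (X \<alpha>)" using hilb_X[of \<alpha>] by (simp add: hilb_def ips_def)
lemma ips_X: "\<alpha> \<in> I \<Longrightarrow> ips (X \<alpha>)" using hilb_X[of \<alpha>] by (simp add: hilb_def)

lemma space_\<Lambda> [simp]: "space \<Lambda> = I" by (simp add: space_restrict_space)

lemma p_in: "\<alpha> \<in> I \<Longrightarrow> p i \<alpha> \<in> carrier (X \<alpha>)" by (rule sip.onb_in[OF sip_X onb_p])

lemma M_in: "F \<in> M \<Longrightarrow> \<alpha> \<in> I \<Longrightarrow> F \<alpha> \<in> carrier (X \<alpha>)" by (auto simp: M_eq PiE_iff)
lemma M_ext: "F \<in> M \<Longrightarrow> F \<in> extensional I" by (auto simp: M_eq PiE_iff)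

lemma M_coeff: "F \<in> M \<Longrightarrow> (\<lambda>\<alpha>. inn (X \<alpha>) (p i \<alpha>) (F \<alpha>)) \<in> borel_measurable \<Lambda>" by (auto simp: M_eq)

lemma MI:
  assumes "\<And>\<alpha>. \<alpha> \<in> I \<Longrightarrow> F \<alpha> \<in> carrier (X \<alpha>)" "\<And>i. (\<lambda>\<alpha>. inn (X \<alpha>) (p i \<alpha>) (F \<alpha>)) \<in> borel_measurable \<Lambda>"
  shows "restrict F I \<in> M"
proof -
  have "(\<lambda>\<alpha>. inn (X \<alpha>) (p i \<alpha>) (restrict F I \<alpha>)) \<in> borel_measurable \<Lambda>" for i
    using assms(2)[of i] by (subst measurable_cong[where g = "\<lambda>\<alpha>. inn (X \<alpha>) (p i \<alpha>) (F \<alpha>)"]) simp_all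
  then show ?thesis using assms(1) by (auto simp: M_eq)
qed

text \<open>Parseval's identity exhibits the inner product as a pointwise limit of finite sums of
  products of coefficients.\<close>

lemma inn_meas:
  assumes F: "F \<in> M" and G: "G \<in> M"
  shows "(\<lambda>\<alpha>. inn (X \<alpha>) (F \<alpha>) (G \<alpha>)) \<in> borel_measurable \<Lambda>"
proof (rule borel_measurable_LIMSEQ_metric)
  show "(\<lambda>\<alpha>. \<Sum>i<n. cnj (inn (X \<alpha>) (p i \<alpha>) (F \<alpha>)) * inn (X \<alpha>) (p i \<alpha>) (G \<alpha>)) \<in> borel_measurable \<Lambda>" for n
    by (intro borel_measurable_sum borel_measurable_times borel_measurable_cnj M_coeff F G)
  show "(\<lambda>n. \<Sum>i<n. cnj (inn (X \<alpha>) (p i \<alpha>) (F \<alpha>)) * inn (X \<alpha>) (p i \<alpha>) (G \<alpha>)) \<longlonglongrightarrow> inn (X \<alpha>) (F \<alpha>) (G \<alpha>)"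
    if "\<alpha> \<in> space \<Lambda>" for \<alpha>
    using sip.parseval[OF sip_X onb_p M_in[OF F] M_in[OF G]] that by (simp add: sums_def)
qed

lemma norm_sq_meas: "F \<in> M \<Longrightarrow> (\<lambda>\<alpha>. (hnorm (X \<alpha>) (F \<alpha>))\<^sup>2) \<in> borel_measurable \<Lambda>"
proof -
  assume F: "F \<in> M"
  have "(\<lambda>\<alpha>. Re (inn (X \<alpha>) (F \<alpha>) (F \<alpha>))) \<in> borel_measurable \<Lambda>"
    using inn_meas[OF F F] by simp
  then show ?thesis
    by (subst measurable_cong[where g = "\<lambda>\<alpha>. Re (inn (X \<alpha>) (F \<alpha>) (F \<alpha>))"]) (simp_all add: sip.hnorm_sq[OF sip_X] M_in[OF F])
qed

lemma M_add: "F \<in> M \<Longrightarrow> G \<in> M \<Longrightarrow> (\<lambda>\<alpha>\<in>I. F \<alpha> \<oplus>\<^bsub>X \<alpha>\<^esub> G \<alpha>) \<in> M"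
proof (rule MI)
  assume FG: "F \<in> M" "G \<in> M"
  show "F \<alpha> \<oplus>\<^bsub>X \<alpha>\<^esub> G \<alpha> \<in> carrier (X \<alpha>)" if "\<alpha> \<in> I" for \<alpha>
    using that by (intro sip.add_in sip_X M_in FG)
  show "(\<lambda>\<alpha>. inn (X \<alpha>) (p i \<alpha>) (F \<alpha> \<oplus>\<^bsub>X \<alpha>\<^esub> G \<alpha>)) \<in> borel_measurable \<Lambda>" for i
    using borel_measurable_add[OF M_coeff[OF FG(1), of i] M_coeff[OF FG(2), of i]]
    by (subst measurable_cong[where g = "\<lambda>\<alpha>. inn (X \<alpha>) (p i \<alpha>) (F \<alpha>) + inn (X \<alpha>) (p i \<alpha>) (G \<alpha>)"])
      (simp_all add: sip.inn_add_right[OF sip_X] M_in FG p_in)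
qed

lemma M_mult: "F \<in> M \<Longrightarrow> c \<in> borel_measurable \<Lambda> \<Longrightarrow> (\<lambda>\<alpha>\<in>I. c \<alpha> \<odot>\<^bsub>X \<alpha>\<^esub> F \<alpha>) \<in> M"
proof (rule MI)
  assume F: "F \<in> M" and c: "c \<in> borel_measurable \<Lambda>"
  show "c \<alpha> \<odot>\<^bsub>X \<alpha>\<^esub> F \<alpha> \<in> carrier (X \<alpha>)" if "\<alpha> \<in> I" for \<alpha>
    using that by (intro sip.smult_in sip_X M_in F)
  show "(\<lambda>\<alpha>. inn (X \<alpha>) (p i \<alpha>) (c \<alpha> \<odot>\<^bsub>X \<alpha>\<^esub> F \<alpha>)) \<in> borel_measurable \<Lambda>" for i
    using borel_measurable_times[OF c M_coeff[OF F, of i]]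
    by (subst measurable_cong[where g = "\<lambda>\<alpha>. c \<alpha> * inn (X \<alpha>) (p i \<alpha>) (F \<alpha>)"])
      (simp_all add: sip.inn_smult_right[OF sip_X] M_in F p_in)
qed

lemma M_smult: "F \<in> M \<Longrightarrow> (\<lambda>\<alpha>\<in>I. c \<odot>\<^bsub>X \<alpha>\<^esub> F \<alpha>) \<in> M"
  using M_mult[of F "\<lambda>_. c"] by simp

lemma M_zero: "(\<lambda>\<alpha>\<in>I. \<zero>\<^bsub>X \<alpha>\<^esub>) \<in> M"
proof (rule MI)
  show "\<zero>\<^bsub>X \<alpha>\<^esub> \<in> carrier (X \<alpha>)" if "\<alpha> \<in> I" for \<alpha> using sip.zero_in[OF sip_X[OF that]] .
  show "(\<lambda>\<alpha>. inn (X \<alpha>) (p i \<alpha>) \<zero>\<^bsub>X \<alpha>\<^esub>) \<in> borel_measurable \<Lambda>" for i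
    by (subst measurable_cong[where g = "\<lambda>\<alpha>. 0"]) (simp_all add: sip.inn_zero_right[OF sip_X] p_in)
qed

lemma M_p: "(\<lambda>\<alpha>\<in>I. p i \<alpha>) \<in> M"
  by (rule MI) (auto simp: p_in p_meas)

lemma M_lim:
  assumes F: "\<And>n::nat. F n \<in> M" and G: "G \<in> extensional I" "\<And>\<alpha>. \<alpha> \<in> I \<Longrightarrow> G \<alpha> \<in> carrier (X \<alpha>)"
    and lim: "\<And>\<alpha>. \<alpha> \<in> I \<Longrightarrow> hlim (X \<alpha>) (\<lambda>n. F n \<alpha>) (G \<alpha>)"
  shows "G \<in> M"
proof -
  have "restrict G I \<in> M"
  proof (rule MI)
    show "(\<lambda>\<alpha>. inn (X \<alpha>) (p i \<alpha>) (G \<alpha>)) \<in> borel_measurable \<Lambda>" for i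
    proof (rule borel_measurable_LIMSEQ_metric)
      show "(\<lambda>\<alpha>. inn (X \<alpha>) (p i \<alpha>) (F n \<alpha>)) \<in> borel_measurable \<Lambda>" for n by (rule M_coeff[OF F])
      show "(\<lambda>n. inn (X \<alpha>) (p i \<alpha>) (F n \<alpha>)) \<longlonglongrightarrow> inn (X \<alpha>) (p i \<alpha>) (G \<alpha>)" if "\<alpha> \<in> space \<Lambda>" for \<alpha>
        using that by (intro sip.hlim_inn_right[OF sip_X] M_in F G p_in lim) auto
    qed
  qed (rule G)
  then show ?thesis using G(1) by (simp add: extensional_restrict)
qed

lemma set_integrable_iff: "set_integrable lborel I f \<longleftrightarrow> integrable \<Lambda> f"
  for f :: "real \<Rightarrow> 'c::{banach, second_countable_topology}"
  unfolding set_integrable_def by (subst integrable_restrict_space) auto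

lemma set_integral_eq: "(LINT \<alpha>:I|lborel. f \<alpha>) = (\<integral>\<alpha>. f \<alpha> \<partial>\<Lambda>)"
  for f :: "real \<Rightarrow> 'c::{banach, second_countable_topology}"
  unfolding set_lebesgue_integral_def by (subst integral_restrict_space) auto

lemma l2_carrier: "f \<in> carrier l2 \<longleftrightarrow> f \<in> M \<and> integrable \<Lambda> (\<lambda>\<alpha>. (hnorm (X \<alpha>) (f \<alpha>))\<^sup>2)"
  by (simp add: l2_sections_def set_integrable_iff)

lemma l2_simps [simp]: "f \<oplus>\<^bsub>l2\<^esub> g = (\<lambda>\<alpha>\<in>I. f \<alpha> \<oplus>\<^bsub>X \<alpha>\<^esub> g \<alpha>)" "c \<odot>\<^bsub>l2\<^esub> f = (\<lambda>\<alpha>\<in>I. c \<odot>\<^bsub>X \<alpha>\<^esub> f \<alpha>)" "\<zero>\<^bsub>l2\<^esub> = (\<lambda>\<alpha>\<in>I. \<zero>\<^bsub>X \<alpha>\<^esub>)"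
  by (simp_all add: l2_sections_def)

lemma l2_inn: "inn l2 f g = (\<integral>\<alpha>. inn (X \<alpha>) (f \<alpha>) (g \<alpha>) \<partial>\<Lambda>)"
  by (simp add: l2_sections_def set_integral_eq)

lemma l2_M: "f \<in> carrier l2 \<Longrightarrow> f \<in> M" by (simp add: l2_carrier)
lemma l2_in: "f \<in> carrier l2 \<Longrightarrow> \<alpha> \<in> I \<Longrightarrow> f \<alpha> \<in> carrier (X \<alpha>)" using M_in l2_M by blast

lemma l2_integrable: "f \<in> carrier l2 \<Longrightarrow> g \<in> carrier l2 \<Longrightarrow> integrable \<Lambda> (\<lambda>\<alpha>. inn (X \<alpha>) (f \<alpha>) (g \<alpha>))"
proof -
  assume fg: "f \<in> carrier l2" "g \<in> carrier l2"
  show ?thesis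
  proof (rule Bochner_Integration.integrable_bound)
    show "integrable \<Lambda> (\<lambda>\<alpha>. (hnorm (X \<alpha>) (f \<alpha>))\<^sup>2 + (hnorm (X \<alpha>) (g \<alpha>))\<^sup>2)"
      using fg by (simp add: l2_carrier)
    show "(\<lambda>\<alpha>. inn (X \<alpha>) (f \<alpha>) (g \<alpha>)) \<in> borel_measurable \<Lambda>" using fg by (intro inn_meas l2_M)
    show "AE \<alpha> in \<Lambda>. norm (inn (X \<alpha>) (f \<alpha>) (g \<alpha>)) \<le> norm ((hnorm (X \<alpha>) (f \<alpha>))\<^sup>2 + (hnorm (X \<alpha>) (g \<alpha>))\<^sup>2)"
      by (rule AE_I2) (use fg in \<open>simp add: sip.inn_le_sq[OF sip_X] l2_in\<close>)
  qed
qed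

lemma l2_bound:
  assumes g: "integrable \<Lambda> g" and f: "f \<in> M" and le: "\<And>\<alpha>. \<alpha> \<in> I \<Longrightarrow> (hnorm (X \<alpha>) (f \<alpha>))\<^sup>2 \<le> g \<alpha>"
  shows "f \<in> carrier l2"
  unfolding l2_carrier
proof (intro conjI f Bochner_Integration.integrable_bound[OF g norm_sq_meas[OF f]] AE_I2)
  fix \<alpha> assume "\<alpha> \<in> space \<Lambda>"
  then show "norm ((hnorm (X \<alpha>) (f \<alpha>))\<^sup>2) \<le> norm (g \<alpha>)" using le[of \<alpha>] by simp
qed

lemma l2_add: "f \<in> carrier l2 \<Longrightarrow> g \<in> carrier l2 \<Longrightarrow> (\<lambda>\<alpha>\<in>I. f \<alpha> \<oplus>\<^bsub>X \<alpha>\<^esub> g \<alpha>) \<in> carrier l2"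
proof -
  assume fg: "f \<in> carrier l2" "g \<in> carrier l2"
  have "integrable \<Lambda> (\<lambda>\<alpha>. 2 * (hnorm (X \<alpha>) (f \<alpha>))\<^sup>2 + 2 * (hnorm (X \<alpha>) (g \<alpha>))\<^sup>2)"
    using fg by (simp add: l2_carrier)
  then show ?thesis
    by (rule l2_bound) (use fg sip.hnorm_sq_add_le[OF sip_X] in \<open>auto simp: M_add l2_M l2_in\<close>)
qed

lemma l2_smult: "f \<in> carrier l2 \<Longrightarrow> (\<lambda>\<alpha>\<in>I. c \<odot>\<^bsub>X \<alpha>\<^esub> f \<alpha>) \<in> carrier l2"
proof -
  assume f: "f \<in> carrier l2"
  have "integrable \<Lambda> (\<lambda>\<alpha>. (cmod c)\<^sup>2 * (hnorm (X \<alpha>) (f \<alpha>))\<^sup>2)"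
    using f by (simp add: l2_carrier)
  then show ?thesis
    by (rule l2_bound) (use f in \<open>simp_all add: M_smult l2_M l2_in sip.hnorm_smult[OF sip_X] power_mult_distrib\<close>)
qed

lemma l2_inn_self: "f \<in> carrier l2 \<Longrightarrow> inn l2 f f = of_real (\<integral>\<alpha>. (hnorm (X \<alpha>) (f \<alpha>))\<^sup>2 \<partial>\<Lambda>)"
proof -
  assume f: "f \<in> carrier l2"
  have "inn l2 f f = (\<integral>\<alpha>. of_real ((hnorm (X \<alpha>) (f \<alpha>))\<^sup>2) \<partial>\<Lambda>)"
    unfolding l2_inn
    by (rule Bochner_Integration.integral_cong[OF refl]) (simp only: space_\<Lambda> sip.inn_self[OF sip_X l2_in[OF f]])
  then show ?thesis by (simp only: integral_complex_of_real)
qed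

lemma sip_l2: "sip l2"
proof -
  have "sip (mk_hspace (carrier l2) (\<lambda>\<alpha>\<in>I. \<zero>\<^bsub>X \<alpha>\<^esub>) (\<lambda>f g. \<lambda>\<alpha>\<in>I. f \<alpha> \<oplus>\<^bsub>X \<alpha>\<^esub> g \<alpha>) (\<lambda>c f. \<lambda>\<alpha>\<in>I. c \<odot>\<^bsub>X \<alpha>\<^esub> f \<alpha>) (inn l2))"
  proof (rule sip_pointwise, goal_cases)
    case (1 k) then show ?case by (rule sip_X)
  next case 2 show ?case
      using l2_in M_ext[OF l2_M] by (intro subsetI) (simp add: PiE_iff)
  next case 3 show ?case
      by (rule l2_bound[of "\<lambda>_. 0"]) (simp_all add: M_zero sip.hnorm_zero[OF sip_X])
  next case (4 f g) then show ?case by (rule l2_add)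
  next case (5 c f) then show ?case by (rule l2_smult)
  next case (6 f g)
    have "inn l2 g f = (\<integral>\<alpha>. cnj (inn (X \<alpha>) (f \<alpha>) (g \<alpha>)) \<partial>\<Lambda>)" unfolding l2_inn
    proof (rule Bochner_Integration.integral_cong[OF refl])
      fix \<alpha> assume "\<alpha> \<in> space \<Lambda>"
      then have \<alpha>: "\<alpha> \<in> I" by simp
      show "inn (X \<alpha>) (g \<alpha>) (f \<alpha>) = cnj (inn (X \<alpha>) (f \<alpha>) (g \<alpha>))"
        by (rule sip.inn_cnj[OF sip_X[OF \<alpha>] l2_in[OF 6(1) \<alpha>] l2_in[OF 6(2) \<alpha>]])
    qed
    also have "\<dots> = cnj (inn l2 f g)" unfolding l2_inn by (rule Bochner_Integration.integral_cnj)
    finally show ?case .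
  next case (7 f g h)
    have "inn l2 f (\<lambda>\<alpha>\<in>I. g \<alpha> \<oplus>\<^bsub>X \<alpha>\<^esub> h \<alpha>) = (\<integral>\<alpha>. inn (X \<alpha>) (f \<alpha>) (g \<alpha>) + inn (X \<alpha>) (f \<alpha>) (h \<alpha>) \<partial>\<Lambda>)" unfolding l2_inn
      by (rule Bochner_Integration.integral_cong[OF refl]) (use 7 in \<open>simp add: sip.inn_add_right[OF sip_X] l2_in\<close>)
    also have "\<dots> = inn l2 f g + inn l2 f h" unfolding l2_inn
      using 7 by (intro Bochner_Integration.integral_add l2_integrable)
    finally show ?case .
  next case (8 c f g)
    have "inn l2 f (\<lambda>\<alpha>\<in>I. c \<odot>\<^bsub>X \<alpha>\<^esub> g \<alpha>) = (\<integral>\<alpha>. c * inn (X \<alpha>) (f \<alpha>) (g \<alpha>) \<partial>\<Lambda>)" unfolding l2_inn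
      by (rule Bochner_Integration.integral_cong[OF refl]) (use 8 in \<open>simp add: sip.inn_smult_right[OF sip_X] l2_in\<close>)
    then show ?case unfolding l2_inn by simp
  next case (9 f)
    show ?case unfolding l2_inn_self[OF 9] by simp
  qed
  then show ?thesis by (simp add: l2_sections_def)
qed

section \<open>The direct integral as a quotient of the square integrable sections, and its
  completeness\<close>

sublocale L: sip l2 by (rule sip_l2)

lemma l2_hnorm_sq: "f \<in> carrier l2 \<Longrightarrow> (hnorm l2 f)\<^sup>2 = (\<integral>\<alpha>. (hnorm (X \<alpha>) (f \<alpha>))\<^sup>2 \<partial>\<Lambda>)"
  by (simp add: L.hnorm_sq l2_inn_self)

lemma AE_\<Lambda>: "(AE \<alpha> in \<Lambda>. P \<alpha>) \<longleftrightarrow> (AE \<alpha> in lborel. \<alpha> \<in> I \<longrightarrow> P \<alpha>)"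
  by (rule AE_restrict_space_iff) simp

lemma hnorm_X_eq_0_iff: "\<alpha> \<in> I \<Longrightarrow> x \<in> carrier (X \<alpha>) \<Longrightarrow> hnorm (X \<alpha>) x = 0 \<longleftrightarrow> x = \<zero>\<^bsub>X \<alpha>\<^esub>"
  using ips.definite[OF ips_X] sip.hnorm_eq_0_iff[OF sip_X] sip.hnorm_zero[OF sip_X] by metis

lemma ae_null_eq: "ae_null_sections I X M = null_vecs l2"
proof -
  have "(AE \<alpha> in lborel. \<alpha> \<in> I \<longrightarrow> f \<alpha> = \<zero>\<^bsub>X \<alpha>\<^esub>) \<longleftrightarrow> inn l2 f f = 0" if f: "f \<in> carrier l2" for f
  proof -
    have "inn l2 f f = 0 \<longleftrightarrow> (\<integral>\<alpha>. (hnorm (X \<alpha>) (f \<alpha>))\<^sup>2 \<partial>\<Lambda>) = 0" by (simp add: l2_inn_self[OF f])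
    also have "\<dots> \<longleftrightarrow> (AE \<alpha> in \<Lambda>. (hnorm (X \<alpha>) (f \<alpha>))\<^sup>2 = 0)"
      using f by (intro integral_nonneg_eq_0_iff_AE) (auto simp: l2_carrier)
    also have "\<dots> \<longleftrightarrow> (AE \<alpha> in \<Lambda>. f \<alpha> = \<zero>\<^bsub>X \<alpha>\<^esub>)"
      by (rule AE_cong) (simp add: hnorm_X_eq_0_iff l2_in[OF f])
    finally show ?thesis by (simp add: AE_\<Lambda>)
  qed
  then show ?thesis by (auto simp: ae_null_sections_def null_vecs_def)
qed

abbreviation "D \<equiv> direct_integral I X M"

lemma D_eq: "D = qspace l2 L.N" by (simp add: direct_integral_def ae_null_eq)
lemma section_class_eq: "section_class I X M f = L.cls f" by (simp add: section_class_def ae_null_eq L.cls_def)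

lemma ips_D: "ips D" unfolding D_eq by (rule L.ips_qspace)
sublocale D: ips D by (rule ips_D)

lemma cls_isometry: "lin_isometry l2 D L.cls" unfolding D_eq by (rule L.cls_isometry)
lemma D_carrier: "carrier D = L.cls ` carrier l2" unfolding D_eq by (rule L.qspace_carrier)
lemma cls_hbdd: "hbdd l2 D L.cls" by (rule lin_isometry_hbdd[OF cls_isometry])

lemma l2_minus: "f \<in> carrier l2 \<Longrightarrow> g \<in> carrier l2 \<Longrightarrow> \<alpha> \<in> I \<Longrightarrow> (f \<ominus>\<^bsub>l2\<^esub> g) \<alpha> = f \<alpha> \<ominus>\<^bsub>X \<alpha>\<^esub> g \<alpha>"
  by (simp add: a_minus_def L.uminus_eq sip.uminus_eq[OF sip_X] l2_in)

lemma cls_cong_AE: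
  assumes "f \<in> carrier l2" "g \<in> carrier l2" "AE \<alpha> in \<Lambda>. f \<alpha> = g \<alpha>"
  shows "L.cls f = L.cls g"
proof -
  have cc: "L.cls f \<in> carrier D" "L.cls g \<in> carrier D" using assms lin_isometry_in[OF cls_isometry] by auto
  have d: "f \<ominus>\<^bsub>l2\<^esub> g \<in> carrier l2" using assms by simp
  have "AE \<alpha> in \<Lambda>. (hnorm (X \<alpha>) ((f \<ominus>\<^bsub>l2\<^esub> g) \<alpha>))\<^sup>2 = 0"
    using assms(3) AE_space
  proof eventually_elim
    case (elim \<alpha>)
    then have \<alpha>: "\<alpha> \<in> I" by simp
    have "f \<alpha> \<ominus>\<^bsub>X \<alpha>\<^esub> g \<alpha> = \<zero>\<^bsub>X \<alpha>\<^esub>" using elim(1) abelian_group.r_neg[of "X \<alpha>" "g \<alpha>"] l2_in[OF assms(2) \<alpha>]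
      Module.module.axioms(2)[OF sip.mod[OF sip_X[OF \<alpha>]]] by (simp add: a_minus_def)
    then show ?case using l2_minus[OF assms(1,2) \<alpha>] sip.hnorm_zero[OF sip_X[OF \<alpha>]] by simp
  qed
  then have "(\<integral>\<alpha>. (hnorm (X \<alpha>) ((f \<ominus>\<^bsub>l2\<^esub> g) \<alpha>))\<^sup>2 \<partial>\<Lambda>) = 0" by (simp add: integral_eq_zero_AE)
  then have "hnorm l2 (f \<ominus>\<^bsub>l2\<^esub> g) = 0" using l2_hnorm_sq[OF d] by simp
  then have "hnorm D (L.cls f \<ominus>\<^bsub>D\<^esub> L.cls g) = 0"
    using hbdd_minus[OF L.sip_axioms D.sip_axioms cls_hbdd assms(1,2)] lin_isometry_hnorm[OF cls_isometry d] by simp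
  then show ?thesis using D.eq_iff_hnorm[OF cc] by simp
qed

text \<open>Riesz-Fischer for fields of Hilbert spaces: a fast subsequence of representatives
  converges in almost every fibre, and Fatou's lemma turns this into convergence of the
  classes.\<close>

lemma hilb_D: "hilb D"
proof -
  have "\<exists>x\<in>carrier D. hlim D c x" if c: "\<And>n. c n \<in> carrier D" "hcauchy D c" for c
  proof -
    have "\<forall>n. \<exists>f. f \<in> carrier l2 \<and> c n = L.cls f" using c(1) unfolding D_carrier by blast
    then obtain f where f: "\<And>n. f n \<in> carrier l2" "\<And>n. c n = L.cls (f n)" by metis
    have cf: "hnorm D (c m \<ominus>\<^bsub>D\<^esub> L.cls h) = hnorm l2 (f m \<ominus>\<^bsub>l2\<^esub> h)" if "h \<in> carrier l2" for m h
      unfolding f(2) hbdd_minus[OF L.sip_axioms D.sip_axioms cls_hbdd f(1) that, symmetric]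
      by (rule lin_isometry_hnorm[OF cls_isometry L.minus_in[OF f(1) that]])
    have "\<forall>k. \<exists>K. \<forall>m\<ge>K. \<forall>n\<ge>K. hnorm l2 (f m \<ominus>\<^bsub>l2\<^esub> f n) < (1/2) ^ k"
    proof
      fix k :: nat
      have "(1/2 :: real) ^ k > 0" by simp
      then show "\<exists>K. \<forall>m\<ge>K. \<forall>n\<ge>K. hnorm l2 (f m \<ominus>\<^bsub>l2\<^esub> f n) < (1/2) ^ k"
        using c(2) unfolding hcauchy_def cf[OF f(1), folded f(2)] by blast
    qed
    then obtain K where K: "\<And>k m n. m \<ge> K k \<Longrightarrow> n \<ge> K k \<Longrightarrow> hnorm l2 (f m \<ominus>\<^bsub>l2\<^esub> f n) < (1/2) ^ k" by metis
    \<comment> \<open>A cumulative sum dominates every earlier threshold, so the index r j is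
      admissible for the k-th estimate whenever k \<le> j.\<close>
    define r where "r k = (\<Sum>j\<le>k. K j)" for k
    have r: "K k \<le> r j" if "k \<le> j" for k j
      unfolding r_def by (rule member_le_sum) (use that in auto)
    define g where "g k = f (r k)" for k
    have g: "g k \<in> carrier l2" for k by (simp add: g_def f)
    have gg: "hnorm l2 (g j \<ominus>\<^bsub>l2\<^esub> g k) < (1/2) ^ k" if "k \<le> j" for j k
      unfolding g_def by (rule K) (use r that in auto)
    have gin: "g k \<alpha> \<in> carrier (X \<alpha>)" if "\<alpha> \<in> I" for k \<alpha> using l2_in[OF g that] .
    define u where "u j k \<alpha> = (hnorm (X \<alpha>) (g j \<alpha> \<ominus>\<^bsub>X \<alpha>\<^esub> g k \<alpha>))\<^sup>2" for j k \<alpha>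
    have u_eq: "u j k \<alpha> = (hnorm (X \<alpha>) ((g j \<ominus>\<^bsub>l2\<^esub> g k) \<alpha>))\<^sup>2" if "\<alpha> \<in> I" for j k \<alpha>
      using that by (simp add: u_def l2_minus[OF g g])
    have u_int: "integrable \<Lambda> (u j k)" for j k
    proof -
      have "integrable \<Lambda> (\<lambda>\<alpha>. (hnorm (X \<alpha>) ((g j \<ominus>\<^bsub>l2\<^esub> g k) \<alpha>))\<^sup>2)"
        using L.minus_in[OF g g, of j k] unfolding l2_carrier by blast
      then show ?thesis by (subst Bochner_Integration.integrable_cong[OF refl u_eq]) simp_all
    qed
    have u_nn: "0 \<le> u j k \<alpha>" for j k \<alpha> by (simp add: u_def)
    have u_le: "(\<integral>\<^sup>+\<alpha>. ennreal (u j k \<alpha>) \<partial>\<Lambda>) \<le> ennreal (((1/2) ^ k)\<^sup>2)" if "k \<le> j" for j k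
    proof -
      have "(\<integral>\<^sup>+\<alpha>. ennreal (u j k \<alpha>) \<partial>\<Lambda>) = ennreal (\<integral>\<alpha>. u j k \<alpha> \<partial>\<Lambda>)"
        by (rule nn_integral_eq_integral[OF u_int]) (simp add: u_nn)
      also have "(\<integral>\<alpha>. u j k \<alpha> \<partial>\<Lambda>) = (hnorm l2 (g j \<ominus>\<^bsub>l2\<^esub> g k))\<^sup>2"
        unfolding l2_hnorm_sq[OF L.minus_in[OF g g]] by (rule Bochner_Integration.integral_cong[OF refl]) (simp add: u_eq)
      also have "ennreal \<dots> \<le> ennreal (((1/2) ^ k)\<^sup>2)"
        using gg[OF that] by (intro ennreal_leI power_mono) (auto intro: L.hnorm_nonneg[OF L.minus_in[OF g g]])
      finally show ?thesis .
    qed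
    \<comment> \<open>The squared increments have integrals at most (1/4)^k, so the weight 2^k
      leaves the sum of the integrals finite; in return, finiteness of S in a fibre forces geometric
      decay of the increments there.\<close>
    define S where "S \<alpha> = suminf (\<lambda>k. ennreal (2 ^ k * u (Suc k) k \<alpha>))" for \<alpha>
    have um [measurable]: "u j k \<in> borel_measurable \<Lambda>" for j k using u_int by (rule borel_measurable_integrable)
    have S_meas [measurable]: "S \<in> borel_measurable \<Lambda>" unfolding S_def by measurable
    have "(\<integral>\<^sup>+\<alpha>. S \<alpha> \<partial>\<Lambda>) = suminf (\<lambda>k. \<integral>\<^sup>+\<alpha>. ennreal (2 ^ k * u (Suc k) k \<alpha>) \<partial>\<Lambda>)"
      unfolding S_def by (rule nn_integral_suminf) measurable
    also have "\<dots> \<le> suminf (\<lambda>k. ennreal ((1/2) ^ k))"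
    proof (rule suminf_le[OF _ summableI summableI])
      fix k
      have "(\<integral>\<^sup>+\<alpha>. ennreal (2 ^ k * u (Suc k) k \<alpha>) \<partial>\<Lambda>) = ennreal (2 ^ k) * (\<integral>\<^sup>+\<alpha>. ennreal (u (Suc k) k \<alpha>) \<partial>\<Lambda>)"
        by (subst nn_integral_cmult[symmetric]) (auto simp: ennreal_mult u_nn)
      also have "\<dots> \<le> ennreal (2 ^ k) * ennreal (((1/2) ^ k)\<^sup>2)" by (intro mult_left_mono u_le) auto
      also have "\<dots> = ennreal (2 ^ k * ((1/2) ^ k)\<^sup>2)" by (rule ennreal_mult[symmetric]) auto
      also have "2 ^ k * ((1/2) ^ k)\<^sup>2 = (1/2 :: real) ^ k"
        by (simp add: power2_eq_square power_divide)
      finally show "(\<integral>\<^sup>+\<alpha>. ennreal (2 ^ k * u (Suc k) k \<alpha>) \<partial>\<Lambda>) \<le> ennreal ((1/2) ^ k)" .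
    qed
    also have "\<dots> = ennreal (suminf (\<lambda>k. (1/2) ^ k))" by (rule suminf_ennreal2) auto
    finally have "(\<integral>\<^sup>+\<alpha>. S \<alpha> \<partial>\<Lambda>) \<noteq> \<infinity>" by (auto simp: top_unique)
    then have S_fin: "AE \<alpha> in \<Lambda>. S \<alpha> \<noteq> \<infinity>" by (intro nn_integral_PInf_AE S_meas)
    \<comment> \<open>Multiplying by this indicator cuts off the null set where S is infinite. The
      limit then exists in every fibre, as \<open>M_lim\<close> requires, and measurability is
      kept.\<close>
    define ind where "ind \<alpha> = (if S \<alpha> = \<infinity> then 0 else 1 :: complex)" for \<alpha>
    have ind: "ind \<in> borel_measurable \<Lambda>" unfolding ind_def by measurable
    define G where "G k = (\<lambda>\<alpha>\<in>I. ind \<alpha> \<odot>\<^bsub>X \<alpha>\<^esub> g k \<alpha>)" for k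
    have G: "G k \<in> M" for k unfolding G_def by (rule M_mult[OF l2_M[OF g] ind])
    have Gg: "G k \<alpha> = g k \<alpha>" if "S \<alpha> \<noteq> \<infinity>" "\<alpha> \<in> I" for k \<alpha>
      using that sip.vsmult_one[OF sip_X gin] by (simp add: G_def ind_def)
    have G0: "G k \<alpha> = \<zero>\<^bsub>X \<alpha>\<^esub>" if "S \<alpha> = \<infinity>" "\<alpha> \<in> I" for k \<alpha>
      using that sip.vsmult_zero[OF sip_X gin] by (simp add: G_def ind_def)
    have cau: "\<exists>x\<in>carrier (X \<alpha>). hlim (X \<alpha>) (\<lambda>k. G k \<alpha>) x" if \<alpha>: "\<alpha> \<in> I" for \<alpha>
    proof (cases "S \<alpha> = \<infinity>")
      case True
      have "hlim (X \<alpha>) (\<lambda>k. G k \<alpha>) \<zero>\<^bsub>X \<alpha>\<^esub>"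
        unfolding G0[OF True \<alpha>] by (rule sip.hlim_const[OF sip_X[OF \<alpha>] sip.zero_in[OF sip_X[OF \<alpha>]]])
      then show ?thesis using sip.zero_in[OF sip_X[OF \<alpha>]] by blast
    next
      case False
      define C where "C = enn2real (S \<alpha>)"
      have SC: "S \<alpha> = ennreal C" using False by (simp add: C_def less_top)
      have C0: "C \<ge> 0" by (simp add: C_def)
      \<comment> \<open>A single term of the series is at most its sum C, which bounds the k-th
        increment by a multiple of (1/2)^(k/2).\<close>
      have "hnorm (X \<alpha>) (g (Suc k) \<alpha> \<ominus>\<^bsub>X \<alpha>\<^esub> g k \<alpha>) \<le> sqrt C * (sqrt (1/2)) ^ k" for k
      proof -
        have "ennreal (2 ^ k * u (Suc k) k \<alpha>) \<le> S \<alpha>"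
          unfolding S_def using sum_le_suminf[OF summableI, of "{k}" "\<lambda>k. ennreal (2 ^ k * u (Suc k) k \<alpha>)"] by simp
        then have "2 ^ k * u (Suc k) k \<alpha> \<le> C" unfolding SC using C0 by (simp add: ennreal_le_iff)
        then have "u (Suc k) k \<alpha> \<le> C * (1/2) ^ k" by (simp add: field_simps)
        then have "sqrt (u (Suc k) k \<alpha>) \<le> sqrt (C * (1/2) ^ k)" by (rule real_sqrt_le_mono)
        then show ?thesis unfolding u_def
          by (simp add: real_sqrt_mult real_sqrt_power sip.hnorm_nonneg[OF sip_X[OF \<alpha>] sip.minus_in[OF sip_X[OF \<alpha>] gin[OF \<alpha>] gin[OF \<alpha>]]])
      qed
      moreover have "summable (\<lambda>k. sqrt C * (sqrt (1/2)) ^ k)"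
        by (intro summable_mult summable_geometric) simp
      ultimately have "hcauchy (X \<alpha>) (\<lambda>k. g k \<alpha>)" by (rule sip.hcauchy_summable[OF sip_X[OF \<alpha>] gin[OF \<alpha>]])
      then show ?thesis using hilb.complete[OF hilb_X[OF \<alpha>], of "\<lambda>k. g k \<alpha>"] gin[OF \<alpha>] Gg[OF False \<alpha>] by simp
    qed
    define F where "F = (\<lambda>\<alpha>\<in>I. SOME x. x \<in> carrier (X \<alpha>) \<and> hlim (X \<alpha>) (\<lambda>k. G k \<alpha>) x)"
    have F: "F \<alpha> \<in> carrier (X \<alpha>)" "hlim (X \<alpha>) (\<lambda>k. G k \<alpha>) (F \<alpha>)" if "\<alpha> \<in> I" for \<alpha>
      using someI_ex[OF cau[OF that, unfolded Bex_def]] that by (simp_all add: F_def)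
    have F_ext: "F \<in> extensional I" unfolding F_def by (rule restrict_extensional)
    have FM: "F \<in> M" by (rule M_lim[OF G F_ext F])
    define H where "H k = (\<lambda>\<alpha>\<in>I. F \<alpha> \<oplus>\<^bsub>X \<alpha>\<^esub> (-1) \<odot>\<^bsub>X \<alpha>\<^esub> g k \<alpha>)" for k
    have HM: "H k \<in> M" for k
      using M_add[OF FM M_smult[OF l2_M[OF g], of "-1"], of k] unfolding H_def by (simp cong: restrict_cong)
    have H_eq: "H k \<alpha> = F \<alpha> \<ominus>\<^bsub>X \<alpha>\<^esub> g k \<alpha>" if "\<alpha> \<in> I" for k \<alpha>
      using that by (simp add: H_def a_minus_def sip.uminus_eq[OF sip_X gin])
    \<comment> \<open>Fatou's lemma in j: the limit section F is as close to g k as the later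
      members of the sequence are.\<close>
    have H_le: "(\<integral>\<^sup>+\<alpha>. ennreal ((hnorm (X \<alpha>) (H k \<alpha>))\<^sup>2) \<partial>\<Lambda>) \<le> ennreal (((1/2) ^ k)\<^sup>2)" for k
    proof -
      have "(\<integral>\<^sup>+\<alpha>. ennreal ((hnorm (X \<alpha>) (H k \<alpha>))\<^sup>2) \<partial>\<Lambda>) = (\<integral>\<^sup>+\<alpha>. liminf (\<lambda>j. ennreal (u j k \<alpha>)) \<partial>\<Lambda>)"
      proof (rule nn_integral_cong_AE)
        show "AE \<alpha> in \<Lambda>. ennreal ((hnorm (X \<alpha>) (H k \<alpha>))\<^sup>2) = liminf (\<lambda>j. ennreal (u j k \<alpha>))"
          using S_fin AE_space
        proof eventually_elim
          case (elim \<alpha>)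
          then have \<alpha>: "\<alpha> \<in> I" by simp
          have hl: "hlim (X \<alpha>) (\<lambda>j. g j \<alpha>) (F \<alpha>)" using F(2)[OF \<alpha>] unfolding Gg[OF elim(1) \<alpha>] .
          interpret A: sip "X \<alpha>" by (rule sip_X[OF \<alpha>])
          have "hlim (X \<alpha>) (\<lambda>j. g j \<alpha> \<ominus>\<^bsub>X \<alpha>\<^esub> g k \<alpha>) (F \<alpha> \<ominus>\<^bsub>X \<alpha>\<^esub> g k \<alpha>)"
            unfolding a_minus_def[of "X \<alpha>" _ "g k \<alpha>"]
            by (intro A.hlim_add A.hlim_const hl A.uminus_in gin[OF \<alpha>] F(1)[OF \<alpha>])
          then have "(\<lambda>j. hnorm (X \<alpha>) (g j \<alpha> \<ominus>\<^bsub>X \<alpha>\<^esub> g k \<alpha>)) \<longlonglongrightarrow> hnorm (X \<alpha>) (F \<alpha> \<ominus>\<^bsub>X \<alpha>\<^esub> g k \<alpha>)"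
            by (intro A.hlim_hnorm A.minus_in gin[OF \<alpha>] F(1)[OF \<alpha>])
          then have "(\<lambda>j. ennreal (u j k \<alpha>)) \<longlonglongrightarrow> ennreal ((hnorm (X \<alpha>) (H k \<alpha>))\<^sup>2)"
            unfolding u_def H_eq[OF \<alpha>] by (intro tendsto_ennrealI tendsto_power)
          then show ?case using lim_imp_Liminf[of sequentially "\<lambda>j. ennreal (u j k \<alpha>)"] by simp
        qed
      qed
      also have "\<dots> \<le> liminf (\<lambda>j. \<integral>\<^sup>+\<alpha>. ennreal (u j k \<alpha>) \<partial>\<Lambda>)" by (rule nn_integral_liminf) measurable
      also have "\<dots> \<le> ennreal (((1/2) ^ k)\<^sup>2)"
      proof -
        have "liminf (\<lambda>j. \<integral>\<^sup>+\<alpha>. ennreal (u j k \<alpha>) \<partial>\<Lambda>) \<le> limsup (\<lambda>j. \<integral>\<^sup>+\<alpha>. ennreal (u j k \<alpha>) \<partial>\<Lambda>)"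
          by (rule Liminf_le_Limsup) simp
        also have "\<dots> \<le> ennreal (((1/2) ^ k)\<^sup>2)"
          by (rule Limsup_bounded) (use u_le in \<open>auto simp: eventually_sequentially\<close>)
        finally show ?thesis .
      qed
      finally show ?thesis .
    qed
    have Hl2: "H k \<in> carrier l2" and H_norm: "hnorm l2 (H k) \<le> (1/2) ^ k" for k
    proof -
      have int: "integrable \<Lambda> (\<lambda>\<alpha>. (hnorm (X \<alpha>) (H k \<alpha>))\<^sup>2)"
      proof (rule integrableI_nonneg[OF norm_sq_meas[OF HM]])
        show "(\<integral>\<^sup>+\<alpha>. ennreal ((hnorm (X \<alpha>) (H k \<alpha>))\<^sup>2) \<partial>\<Lambda>) < \<infinity>"
          using H_le[of k] by (rule le_less_trans) simp
      qed simp
      then show Hk: "H k \<in> carrier l2" unfolding l2_carrier using HM by blast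
      have "ennreal ((hnorm l2 (H k))\<^sup>2) \<le> ennreal (((1/2) ^ k)\<^sup>2)"
        using H_le[of k] unfolding l2_hnorm_sq[OF Hk] by (subst (asm) nn_integral_eq_integral[OF int]) simp_all
      then have "(hnorm l2 (H k))\<^sup>2 \<le> ((1/2) ^ k)\<^sup>2" by (simp add: ennreal_le_iff)
      then show "hnorm l2 (H k) \<le> (1/2) ^ k" by (rule power2_le_imp_le) simp
    qed
    \<comment> \<open>F is square integrable because F - g 0 and g 0 are.\<close>
    have Fl2: "F \<in> carrier l2"
    proof -
      have "(\<lambda>\<alpha>\<in>I. H 0 \<alpha> \<oplus>\<^bsub>X \<alpha>\<^esub> g 0 \<alpha>) = F"
      proof (rule extensionalityI[of _ I])
        fix \<alpha> assume \<alpha>: "\<alpha> \<in> I"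
        have "H 0 \<alpha> \<oplus>\<^bsub>X \<alpha>\<^esub> g 0 \<alpha> = F \<alpha>"
          by (rule ips.vec_eqI[OF ips_X[OF \<alpha>]])
            (simp_all add: H_eq[OF \<alpha>] sip.add_in[OF sip_X[OF \<alpha>]] sip.minus_in[OF sip_X[OF \<alpha>]] F(1)[OF \<alpha>] gin[OF \<alpha>]
              sip.inn_add_right[OF sip_X[OF \<alpha>]] sip.inn_minus_right[OF sip_X[OF \<alpha>]])
        then show "(\<lambda>\<alpha>\<in>I. H 0 \<alpha> \<oplus>\<^bsub>X \<alpha>\<^esub> g 0 \<alpha>) \<alpha> = F \<alpha>" using \<alpha> by simp
      qed (simp_all add: F_ext)
      then show ?thesis using l2_add[OF Hl2 g, of 0 0] by simp
    qed
    have "F \<ominus>\<^bsub>l2\<^esub> g k = H k" for k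
    proof (rule extensionalityI[of _ I])
      show "F \<ominus>\<^bsub>l2\<^esub> g k \<in> extensional I" by (rule M_ext[OF l2_M[OF L.minus_in[OF Fl2 g]]])
    qed (simp_all add: H_eq l2_minus[OF Fl2 g] M_ext[OF HM])
    then have Fg: "hnorm l2 (g k \<ominus>\<^bsub>l2\<^esub> F) \<le> (1/2) ^ k" for k
      using H_norm[of k] L.hnorm_minus_commute[OF Fl2 g, of k] by simp
    have "hlim D c (L.cls F)" unfolding hlim_def
    proof (rule LIMSEQ_I)
      fix e :: real assume "e > 0"
      then obtain k where k: "(1/2) ^ k < e / 2" using real_arch_pow_inv[of "e/2" "1/2"] by auto
      have "norm (hnorm D (c n \<ominus>\<^bsub>D\<^esub> L.cls F) - 0) < e" if n: "n \<ge> K k" for n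
      proof -
        have "hnorm D (c n \<ominus>\<^bsub>D\<^esub> L.cls F) = hnorm l2 (f n \<ominus>\<^bsub>l2\<^esub> F)" by (rule cf[OF Fl2])
        also have "\<dots> \<le> hnorm l2 (f n \<ominus>\<^bsub>l2\<^esub> g k) + hnorm l2 (g k \<ominus>\<^bsub>l2\<^esub> F)"
          by (rule L.hnorm_triangle3[OF f(1) Fl2 g])
        also have "hnorm l2 (f n \<ominus>\<^bsub>l2\<^esub> g k) < (1/2) ^ k" unfolding g_def by (rule K[OF n r]) simp
        finally have "hnorm D (c n \<ominus>\<^bsub>D\<^esub> L.cls F) < e" using Fg[of k] k by simp
        moreover have "hnorm D (c n \<ominus>\<^bsub>D\<^esub> L.cls F) \<ge> 0" unfolding cf[OF Fl2] by (rule L.hnorm_nonneg[OF L.minus_in[OF f(1) Fl2]])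
        ultimately show ?thesis by simp
      qed
      then show "\<exists>N. \<forall>n\<ge>N. norm (hnorm D (c n \<ominus>\<^bsub>D\<^esub> L.cls F) - 0) < e" by blast
    qed
    then show ?thesis using lin_isometry_in[OF cls_isometry Fl2] by blast
  qed
  note * = this
  show ?thesis by (intro hilb.intro hilb_axioms.intro D.ips_axioms) (rule *)
qed

text \<open>A section G orthogonal to all c q_k is tested with c = \<langle>q_k,G\<rangle>, which
  makes the integral of |\<langle>q_k,G\<rangle>|^2 vanish; the bound B k keeps this c square
  integrable. Countability of the index type merges the exceptional null sets, and totality in the
  fibres gives G = 0 almost everywhere.\<close>

lemma D_total:
  fixes q :: "'k::countable \<Rightarrow> real \<Rightarrow> 'a"
  assumes q: "\<And>k. restrict (q k) I \<in> M" and B: "\<And>k \<alpha>. \<alpha> \<in> I \<Longrightarrow> hnorm (X \<alpha>) (q k \<alpha>) \<le> B k"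
    and tot: "\<And>\<alpha>. \<alpha> \<in> I \<Longrightarrow> total (X \<alpha>) (range (\<lambda>k. q k \<alpha>))" and S: "S \<subseteq> carrier D"
    and c: "\<And>k c. c \<in> borel_measurable \<Lambda> \<Longrightarrow> integrable \<Lambda> (\<lambda>\<alpha>. (cmod (c \<alpha>))\<^sup>2) \<Longrightarrow> L.cls (\<lambda>\<alpha>\<in>I. c \<alpha> \<odot>\<^bsub>X \<alpha>\<^esub> q k \<alpha>) \<in> S"
  shows "total D S"
proof (rule hilb.total_if_orthogonal[OF hilb_D S])
  fix x assume x: "x \<in> carrier D" and orth: "\<And>a. a \<in> S \<Longrightarrow> inn D a x = 0"
  obtain G where G: "G \<in> carrier l2" "x = L.cls G" using x D_carrier by auto
  have qin: "q k \<alpha> \<in> carrier (X \<alpha>)" if "\<alpha> \<in> I" for k \<alpha> using M_in[OF q that] that by simp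
  have "AE \<alpha> in \<Lambda>. inn (X \<alpha>) (q k \<alpha>) (G \<alpha>) = 0" for k
  proof -
    define c where "c \<alpha> = inn (X \<alpha>) (q k \<alpha>) (G \<alpha>)" for \<alpha>
    have cm: "c \<in> borel_measurable \<Lambda>"
      using inn_meas[OF q l2_M[OF G(1)], of k] unfolding c_def
      by (subst (asm) measurable_cong[where g = "\<lambda>\<alpha>. inn (X \<alpha>) (q k \<alpha>) (G \<alpha>)"]) simp_all
    have cB: "(cmod (c \<alpha>))\<^sup>2 \<le> (B k)\<^sup>2 * (hnorm (X \<alpha>) (G \<alpha>))\<^sup>2" if "\<alpha> \<in> I" for \<alpha>
    proof -
      have "cmod (c \<alpha>) \<le> hnorm (X \<alpha>) (q k \<alpha>) * hnorm (X \<alpha>) (G \<alpha>)" unfolding c_def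
        by (rule sip.cauchy_schwarz[OF sip_X qin l2_in[OF G(1)]]) fact+
      also have "\<dots> \<le> B k * hnorm (X \<alpha>) (G \<alpha>)"
        by (rule mult_right_mono[OF B[OF that] sip.hnorm_nonneg[OF sip_X[OF that] l2_in[OF G(1) that]]])
      finally show ?thesis unfolding power_mult_distrib[symmetric] by (intro power_mono) auto
    qed
    have ci: "integrable \<Lambda> (\<lambda>\<alpha>. (cmod (c \<alpha>))\<^sup>2)"
    proof (rule Bochner_Integration.integrable_bound)
      show "integrable \<Lambda> (\<lambda>\<alpha>. (B k)\<^sup>2 * (hnorm (X \<alpha>) (G \<alpha>))\<^sup>2)" using G(1) by (simp add: l2_carrier)
      show "(\<lambda>\<alpha>. (cmod (c \<alpha>))\<^sup>2) \<in> borel_measurable \<Lambda>" using cm by measurable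
      show "AE \<alpha> in \<Lambda>. norm ((cmod (c \<alpha>))\<^sup>2) \<le> norm ((B k)\<^sup>2 * (hnorm (X \<alpha>) (G \<alpha>))\<^sup>2)"
        by (rule AE_I2) (use cB in simp)
    qed
    let ?f = "\<lambda>\<alpha>\<in>I. c \<alpha> \<odot>\<^bsub>X \<alpha>\<^esub> q k \<alpha>"
    have f: "?f \<in> carrier l2"
    proof (rule l2_bound)
      show "integrable \<Lambda> (\<lambda>\<alpha>. (B k)\<^sup>2 * (cmod (c \<alpha>))\<^sup>2)" using ci by simp
      have "(\<lambda>\<alpha>\<in>I. c \<alpha> \<odot>\<^bsub>X \<alpha>\<^esub> restrict (q k) I \<alpha>) \<in> M" by (rule M_mult[OF q cm])
      then show "?f \<in> M" by (simp cong: restrict_cong)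
      fix \<alpha> assume \<alpha>: "\<alpha> \<in> I"
      have "(hnorm (X \<alpha>) (q k \<alpha>))\<^sup>2 \<le> (B k)\<^sup>2"
        using B[OF \<alpha>] sip.hnorm_nonneg[OF sip_X[OF \<alpha>] qin[OF \<alpha>]] by (intro power_mono)
      then show "(hnorm (X \<alpha>) (?f \<alpha>))\<^sup>2 \<le> (B k)\<^sup>2 * (cmod (c \<alpha>))\<^sup>2"
        using \<alpha> qin[OF \<alpha>] by (simp add: sip.hnorm_smult[OF sip_X] power_mult_distrib mult.commute[of "(cmod _)\<^sup>2"] mult_right_mono)
    qed
    have "0 = inn D (L.cls ?f) x" using orth[OF c[OF cm ci]] by simp
    also have "\<dots> = inn l2 ?f G" unfolding G(2) by (rule lin_isometry_inn[OF cls_isometry f G(1)])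
    also have "\<dots> = (\<integral>\<alpha>. of_real ((cmod (c \<alpha>))\<^sup>2) \<partial>\<Lambda>)" unfolding l2_inn
    proof (rule Bochner_Integration.integral_cong[OF refl])
      fix \<alpha> assume "\<alpha> \<in> space \<Lambda>"
      then have \<alpha>: "\<alpha> \<in> I" by simp
      then have "inn (X \<alpha>) (?f \<alpha>) (G \<alpha>) = cnj (c \<alpha>) * c \<alpha>"
        using sip.inn_smult_left[OF sip_X[OF \<alpha>] l2_in[OF G(1) \<alpha>] qin[OF \<alpha>]] by (simp add: c_def)
      then show "inn (X \<alpha>) (?f \<alpha>) (G \<alpha>) = of_real ((cmod (c \<alpha>))\<^sup>2)" unfolding cnj_mult_self .
    qed
    also have "\<dots> = of_real (\<integral>\<alpha>. (cmod (c \<alpha>))\<^sup>2 \<partial>\<Lambda>)" by (rule integral_complex_of_real)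
    finally have "complex_of_real (\<integral>\<alpha>. (cmod (c \<alpha>))\<^sup>2 \<partial>\<Lambda>) = 0" by (rule sym)
    then have "(\<integral>\<alpha>. (cmod (c \<alpha>))\<^sup>2 \<partial>\<Lambda>) = 0" by (simp only: of_real_eq_0_iff)
    then have "AE \<alpha> in \<Lambda>. (cmod (c \<alpha>))\<^sup>2 = 0" by (subst (asm) integral_nonneg_eq_0_iff_AE[OF ci]) auto
    then show ?thesis by (simp add: c_def)
  qed
  then have "AE \<alpha> in \<Lambda>. \<forall>k. inn (X \<alpha>) (q k \<alpha>) (G \<alpha>) = 0" by (simp add: AE_all_countable)
  then have "AE \<alpha> in \<Lambda>. G \<alpha> = (\<lambda>\<alpha>\<in>I. \<zero>\<^bsub>X \<alpha>\<^esub>) \<alpha>"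
    using AE_space
  proof eventually_elim
    case (elim \<alpha>)
    then have \<alpha>: "\<alpha> \<in> I" by simp
    have "G \<alpha> = \<zero>\<^bsub>X \<alpha>\<^esub>"
      by (rule ips.total_eqI[OF ips_X[OF \<alpha>] tot[OF \<alpha>] l2_in[OF G(1) \<alpha>] sip.zero_in[OF sip_X[OF \<alpha>]]])
        (use elim(1) in \<open>auto simp: sip.inn_zero_right[OF sip_X[OF \<alpha>] qin[OF \<alpha>]]\<close>)
    then show ?case using \<alpha> by simp
  qed
  then have "x = L.cls (\<lambda>\<alpha>\<in>I. \<zero>\<^bsub>X \<alpha>\<^esub>)" unfolding G(2)
    by (rule cls_cong_AE[OF G(1) L.zero_in[unfolded l2_simps]])
  also have "\<dots> = \<zero>\<^bsub>D\<^esub>" unfolding D_eq L.qspace_zero by simp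
  finally show "x = \<zero>\<^bsub>D\<^esub>" .
qed

end

section \<open>Arveson systems\<close>

lemma unitary_inv:
  assumes "ips X" "sip Y" and T: "unitary X Y T"
  shows "y \<in> carrier Y \<Longrightarrow> inv_into (carrier X) T y \<in> carrier X"
    "y \<in> carrier Y \<Longrightarrow> T (inv_into (carrier X) T y) = y"
    "x \<in> carrier X \<Longrightarrow> inv_into (carrier X) T (T x) = x"
    "unitary Y X (inv_into (carrier X) T)"
proof -
  have Y: "carrier Y = T ` carrier X" using T by (simp add: unitary_def)
  show 1: "inv_into (carrier X) T y \<in> carrier X" and 2: "T (inv_into (carrier X) T y) = y" if "y \<in> carrier Y" for y
    using that unfolding Y by (rule inv_into_into, rule f_inv_into_f)
  have inj: "inj_on T (carrier X)"
    by (rule inj_onI) (metis hadjoint_unitary[OF assms])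
  then show 3: "inv_into (carrier X) T (T x) = x" if "x \<in> carrier X" for x using that by (rule inv_into_f_f)
  interpret X: ips X by fact
  interpret Y: sip Y by fact
  have "hadjoint X Y T y = inv_into (carrier X) T y" if "y \<in> carrier Y" for y
    using hadjoint_unitary[OF assms 1[OF that]] 2[OF that] by simp
  then have "lin_isometry Y X (inv_into (carrier X) T)"
    using hadjoint_isometry[OF assms] by (simp add: lin_isometry_def Pi_iff)
  moreover have "inv_into (carrier X) T ` carrier Y = carrier X"
    using 1 3 by (auto simp: Y image_iff)
  ultimately show "unitary Y X (inv_into (carrier X) T)" by (simp add: unitary_def)
qed

lemma onb_unitary_image:
  assumes "sip X" "sip Y" and T: "unitary X Y T" and u: "onb X u"
  shows "onb Y (\<lambda>i. T (u i))"
proof -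
  have "range (\<lambda>i. T (u i)) = T ` range u" by auto
  then show ?thesis
    using u total_image[OF assms(1-3)] lin_isometry_inn[OF unitary_isometry[OF T]] sip.onb_in[OF assms(1) u]
    unfolding onb_def by simp
qed

subsection \<open>The Borel structure of a separable Hilbert space\<close>

context hilb
begin

lemma topspace_htopology: "topspace (htopology X) = carrier X"
  by (simp add: htopology_def)

lemma hborel_space: "space (hborel X) = carrier X"
  unfolding hborel_def using openin_subset topspace_htopology by (subst space_measure_of) auto

lemma open_in_hborel: "openin (htopology X) U \<Longrightarrow> U \<in> sets (hborel X)"
  unfolding hborel_def using openin_subset topspace_htopology by (subst sets_measure_of) auto

lemma inn_hborel:
  assumes v: "v \<in> carrier X" shows "inn X v \<in> borel_measurable (hborel X)"
proof (rule borel_measurableI)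
  fix S :: "complex set" assume S: "open S"
  have "openin mtopology (inn X v -` S \<inter> carrier X)"
    unfolding openin_mtopology
  proof (intro conjI allI impI)
    fix x assume x: "x \<in> inn X v -` S \<inter> carrier X"
    then obtain \<epsilon> where \<epsilon>: "\<epsilon> > 0" "\<And>z. dist z (inn X v x) < \<epsilon> \<Longrightarrow> z \<in> S" using S by (auto simp: open_dist)
    define r where "r = \<epsilon> / (hnorm X v + 1)"
    have pos: "hnorm X v + 1 > 0" using hnorm_nonneg[OF v] by linarith
    have "mball x r \<subseteq> inn X v -` S \<inter> carrier X"
    proof
      fix y assume y: "y \<in> mball x r"
      then have yc: "y \<in> carrier X" and d: "hnorm X (x \<ominus> y) < r" using x by (auto simp: hdist_def in_mball)
      have "cmod (inn X v y - inn X v x) = cmod (inn X v (x \<ominus> y))" using v x yc by (simp add: norm_minus_commute)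
      also have "\<dots> \<le> hnorm X v * hnorm X (x \<ominus> y)" using v x yc by (intro cauchy_schwarz) auto
      also have "\<dots> \<le> (hnorm X v + 1) * hnorm X (x \<ominus> y)" using v x yc by (intro mult_right_mono) auto
      also have "\<dots> < (hnorm X v + 1) * r" using d pos by (intro mult_strict_left_mono)
      also have "\<dots> = \<epsilon>" using pos by (simp add: r_def)
      finally show "y \<in> inn X v -` S \<inter> carrier X" using \<epsilon>(2) yc by (simp add: dist_norm)
    qed
    moreover have "r > 0" using \<epsilon>(1) pos by (simp add: r_def)
    ultimately show "\<exists>r>0. mball x r \<subseteq> inn X v -` S \<inter> carrier X" by blast
  qed auto
  then show "inn X v -` S \<inter> space (hborel X) \<in> sets (hborel X)"
    unfolding hborel_space by (intro open_in_hborel) (simp add: htopology_def)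
qed

lemma separable_dense:
  assumes "separable_space (htopology X)"
  shows "\<exists>C. countable C \<and> C \<subseteq> carrier X \<and> (\<forall>x\<in>carrier X. \<forall>r>0. \<exists>y\<in>C. hnorm X (x \<ominus> y) < r)"
proof -
  obtain C where C: "countable C" "C \<subseteq> carrier X" "mtopology closure_of C = carrier X"
    using assms unfolding separable_space_def htopology_def by auto
  have "\<exists>y\<in>C. hnorm X (x \<ominus> y) < r" if xr: "x \<in> carrier X" "r > 0" for x r
  proof -
    have "x \<in> mtopology closure_of C" using C(3) xr by simp
    then obtain y where "y \<in> C" "y \<in> mball x r" using xr(2) unfolding metric_closure_of by blast
    then show ?thesis using C(2) xr(1) by (auto simp: hdist_def in_mball)
  qed
  then show ?thesis using C by blast
qed

lemma total_dense:
  assumes C: "C \<subseteq> carrier X" "\<And>x r. x \<in> carrier X \<Longrightarrow> r > 0 \<Longrightarrow> \<exists>y\<in>C. hnorm X (x \<ominus> y) < r"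
  shows "total X C"
  unfolding total_def
proof (intro conjI C(1), intro subsetI)
  fix x assume x: "x \<in> carrier X"
  have "\<forall>n. \<exists>y. y \<in> C \<and> hnorm X (x \<ominus> y) < 1 / real (Suc n)"
  proof
    fix n :: nat
    have "1 / real (Suc n) > 0" by simp
    from C(2)[OF x this] show "\<exists>y. y \<in> C \<and> hnorm X (x \<ominus> y) < 1 / real (Suc n)" by blast
  qed
  then obtain s where s: "\<And>n. s n \<in> C" "\<And>n. hnorm X (x \<ominus> s n) < 1 / real (Suc n)" by metis
  have sc: "s n \<in> carrier X" for n using s(1) C(1) by blast
  have "hlim X s x" unfolding hlim_def
  proof (rule tendsto_0_real_le)
    show "(\<lambda>n. 1 / real (Suc n)) \<longlonglongrightarrow> 0" using LIMSEQ_inverse_real_of_nat by (simp add: inverse_eq_divide)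
    show "hnorm X (s n \<ominus> x) \<le> 1 / real (Suc n)" for n
      using s(2)[of n] hnorm_minus_commute[OF x sc, of n] by simp
  qed (use sc x in simp)
  then show "x \<in> cspan X C" by (rule cspan.lim[OF cspan.base[OF s(1) sc] x])
qed

lemma onb_exists:
  assumes "countable A" "total X A" shows "\<exists>u. onb X u"
proof -
  \<comment> \<open>Adjoining the zero vector makes the set nonempty, so that
    \<open>from_nat_into\<close> enumerates it.\<close>
  let ?A = "insert \<zero> A"
  have "total X ?A" using total_mono[OF assms(2), of ?A] assms(2)
    by (auto simp: total_def intro: cspan.base)
  moreover have "range (from_nat_into ?A) = ?A" using assms(1) by (intro range_from_nat_into) auto
  ultimately show ?thesis using onb_gram_schmidt[of "from_nat_into ?A"] by auto
qed

text \<open>Every open set is a countable union of balls around points of a countable dense set, and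
  the distance of g to such a point is measurable by Parseval's identity. So measurable coefficients
  along one basis give Borel measurability.\<close>

lemma measurable_hborelI:
  assumes sep: "separable_space (htopology X)" and u: "onb X u"
    and g: "\<And>x. x \<in> space M \<Longrightarrow> g x \<in> carrier X"
    and m: "\<And>i. (\<lambda>x. inn X (u i) (g x)) \<in> borel_measurable M"
  shows "g \<in> M \<rightarrow>\<^sub>M hborel X"
  unfolding hborel_def
proof (rule measurable_measure_of)
  show "{U. openin (htopology X) U} \<subseteq> Pow (carrier X)" using openin_subset topspace_htopology by auto
  show "g \<in> space M \<rightarrow> carrier X" using g by auto
  obtain C where C: "countable C" "C \<subseteq> carrier X" "\<And>x r. x \<in> carrier X \<Longrightarrow> r > 0 \<Longrightarrow> \<exists>y\<in>C. hnorm X (x \<ominus> y) < r"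
    using separable_dense[OF sep] by blast
  have meas: "{x \<in> space M. hnorm X (g x \<ominus> c) < r} \<in> sets M" if c: "c \<in> carrier X" for c r
  proof -
    have "(\<lambda>x. (hnorm X (g x \<ominus> c))\<^sup>2) \<in> borel_measurable M"
    proof (rule borel_measurable_LIMSEQ_metric)
      show "(\<lambda>x. \<Sum>i<n. (cmod (inn X (u i) (g x) - inn X (u i) c))\<^sup>2) \<in> borel_measurable M" for n
        using m by measurable
      fix x assume x: "x \<in> space M"
      have "(\<lambda>n. \<Sum>i<n. (cmod (inn X (u i) (g x \<ominus> c)))\<^sup>2) \<longlonglongrightarrow> (hnorm X (g x \<ominus> c))\<^sup>2"
        using parseval_norm[OF u minus_in[OF g[OF x] c]] by (simp add: sums_def)
      then show "(\<lambda>n. \<Sum>i<n. (cmod (inn X (u i) (g x) - inn X (u i) c))\<^sup>2) \<longlonglongrightarrow> (hnorm X (g x \<ominus> c))\<^sup>2"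
        by (simp only: inn_minus_right[OF onb_in[OF u] g[OF x] c])
    qed
    then have "(\<lambda>x. sqrt ((hnorm X (g x \<ominus> c))\<^sup>2)) \<in> borel_measurable M" by measurable
    then have "(\<lambda>x. hnorm X (g x \<ominus> c)) \<in> borel_measurable M"
      by (subst (asm) measurable_cong[where g = "\<lambda>x. hnorm X (g x \<ominus> c)"]) (simp_all add: g c)
    then show ?thesis by measurable
  qed
  fix U assume "U \<in> {U. openin (htopology X) U}"
  then have U: "openin mtopology U" by (simp add: htopology_def)
  then have UX: "U \<subseteq> carrier X" using openin_subset by force
  define J where "J = {(c, n::nat). c \<in> C \<and> mball c (1 / real (Suc n)) \<subseteq> U}"
  have "countable J" by (rule countable_subset[of _ "C \<times> UNIV"]) (use C(1) in \<open>auto simp: J_def\<close>)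
  have U_eq: "U = (\<Union>(c, n)\<in>J. mball c (1 / real (Suc n)))"
  proof
    show "U \<subseteq> (\<Union>(c, n)\<in>J. mball c (1 / real (Suc n)))"
    proof
      fix x assume x: "x \<in> U"
      then have xc: "x \<in> carrier X" using UX by blast
      obtain r where r: "r > 0" "mball x r \<subseteq> U" using U x unfolding openin_mtopology by blast
      \<comment> \<open>With a radius below r/2, a ball around a dense point that contains x stays
        inside the ball of radius r around x.\<close>
      obtain n where n: "inverse (real (Suc n)) < r / 2" using reals_Archimedean[of "r / 2"] r(1) by auto
      obtain c where c: "c \<in> C" "hnorm X (x \<ominus> c) < 1 / real (Suc n)" using C(3)[OF xc, of "1 / real (Suc n)"] by auto
      have cc: "c \<in> carrier X" using c C(2) by blast
      have "mball c (1 / real (Suc n)) \<subseteq> mball x r"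
      proof
        fix y assume "y \<in> mball c (1 / real (Suc n))"
        then have y: "y \<in> carrier X" "hdist X c y < 1 / real (Suc n)" by (auto simp: in_mball)
        have "hdist X x y \<le> hdist X x c + hdist X c y" using triangle[OF xc cc y(1)] .
        also have "\<dots> < r" using y(2) c(2) n xc cc by (simp add: hdist_def inverse_eq_divide)
        finally show "y \<in> mball x r" using xc y(1) by (simp add: in_mball)
      qed
      then have "(c, n) \<in> J" using c(1) r(2) by (auto simp: J_def)
      moreover have "x \<in> mball c (1 / real (Suc n))" using xc cc c(2) hnorm_minus_commute[OF xc cc]
        by (simp add: in_mball hdist_def)
      ultimately show "x \<in> (\<Union>(c, n)\<in>J. mball c (1 / real (Suc n)))" by blast
    qed
  qed (auto simp: J_def)
  have "g -` U \<inter> space M = (\<Union>(c, n)\<in>J. {x \<in> space M. hnorm X (g x \<ominus> c) < 1 / real (Suc n)})"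
  proof -
    have "g x \<in> mball c (1 / real (Suc n)) \<longleftrightarrow> hnorm X (g x \<ominus> c) < 1 / real (Suc n)" if "x \<in> space M" "(c, n) \<in> J" for x c n
    proof -
      have cc: "c \<in> carrier X" using that(2) C(2) by (auto simp: J_def)
      show ?thesis using g[OF that(1)] cc hnorm_minus_commute[OF g[OF that(1)] cc] by (simp add: in_mball hdist_def)
    qed
    then show ?thesis by (subst U_eq) (auto 0 4)
  qed
  also have "\<dots> \<in> sets M"
    by (rule sets.countable_UN'[OF \<open>countable J\<close>]) (use meas C(2) in \<open>auto simp: J_def\<close>)
  finally show "g -` U \<inter> space M \<in> sets M" .
qed

end

subsection \<open>Measurable sections\<close>

locale arveson =
  fixes H0 :: "'h hspace" and E :: "'a arveson"
  assumes sys: "arveson_system H0 E"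
begin

abbreviation "F \<equiv> fib E"
abbreviation "R0 \<equiv> restrict_space borel {0::real<..}"

lemma hilb_F: "t > 0 \<Longrightarrow> hilb (F t)" using sys by (simp add: arveson_system_def hilbert_space_iff)
lemma ips_F: "t > 0 \<Longrightarrow> ips (F t)" using hilb_F[of t] by (simp add: hilb_def)
lemma sip_F: "t > 0 \<Longrightarrow> sip (F t)" using ips_F[of t] by (simp add: ips_def)

sublocale H: hilb H0 using sys by (simp add: arveson_system_def hilbert_space_iff)

lemma H_sep: "separable_space (htopology H0)" using sys unfolding arveson_system_def by blast

definition trivialization where "trivialization = (SOME \<theta>. (\<forall>t>0. unitary (fib E t) H0 (\<theta> t)) \<and>
        (\<lambda>(t, x). (t, \<theta> t x)) \<in> bundle_borel E \<rightarrow>\<^sub>M restrict_space borel {0<..} \<Otimes>\<^sub>M hborel H0 \<and>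
        (\<lambda>(t, y). (t, inv_into (carrier (fib E t)) (\<theta> t) y))
          \<in> restrict_space borel {0<..} \<Otimes>\<^sub>M hborel H0 \<rightarrow>\<^sub>M bundle_borel E)"

lemma trivialization: "t > 0 \<Longrightarrow> unitary (F t) H0 (trivialization t)"
  "(\<lambda>(t, x). (t, trivialization t x)) \<in> bundle_borel E \<rightarrow>\<^sub>M R0 \<Otimes>\<^sub>M hborel H0"
  "(\<lambda>(t, y). (t, inv_into (carrier (F t)) (trivialization t) y)) \<in> R0 \<Otimes>\<^sub>M hborel H0 \<rightarrow>\<^sub>M bundle_borel E"
proof -
  have "\<exists>\<theta>. (\<forall>t>0. unitary (fib E t) H0 (\<theta> t)) \<and>
        (\<lambda>(t, x). (t, \<theta> t x)) \<in> bundle_borel E \<rightarrow>\<^sub>M restrict_space borel {0<..} \<Otimes>\<^sub>M hborel H0 \<and>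
        (\<lambda>(t, y). (t, inv_into (carrier (fib E t)) (\<theta> t) y))
          \<in> restrict_space borel {0<..} \<Otimes>\<^sub>M hborel H0 \<rightarrow>\<^sub>M bundle_borel E"
    using sys unfolding arveson_system_def by blast
  from someI_ex[OF this, folded trivialization_def] show "t > 0 \<Longrightarrow> unitary (F t) H0 (trivialization t)"
  "(\<lambda>(t, x). (t, trivialization t x)) \<in> bundle_borel E \<rightarrow>\<^sub>M R0 \<Otimes>\<^sub>M hborel H0"
  "(\<lambda>(t, y). (t, inv_into (carrier (F t)) (trivialization t) y)) \<in> R0 \<Otimes>\<^sub>M hborel H0 \<rightarrow>\<^sub>M bundle_borel E"
    by blast+
qed

lemmas trivialization_inv = unitary_inv[OF ips_F H.sip_axioms trivialization(1)]

definition "base = (SOME u. onb H0 u)"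

lemma onb_base: "onb H0 base"
proof -
  obtain C where C: "countable C" "C \<subseteq> carrier H0" "\<And>x r. x \<in> carrier H0 \<Longrightarrow> r > 0 \<Longrightarrow> \<exists>y\<in>C. hnorm H0 (x \<ominus>\<^bsub>H0\<^esub> y) < r"
    using H.separable_dense[OF H_sep] by blast
  show ?thesis unfolding base_def by (rule someI_ex[OF H.onb_exists[OF C(1) H.total_dense[OF C(2,3)]]])
qed

text \<open>One fixed basis of \<open>H0\<close> is pulled back through the trivialisation, so the
  inner products of its members do not depend on t, and the coefficients of a section are those of
  its image in \<open>H0\<close>.\<close>

definition "bs i t = inv_into (carrier (F t)) (trivialization t) (base i)"

lemma onb_bs: "t > 0 \<Longrightarrow> onb (F t) (\<lambda>i. bs i t)"
  unfolding bs_def by (rule onb_unitary_image[OF H.sip_axioms sip_F trivialization_inv(4) onb_base])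

lemma bs_in: "t > 0 \<Longrightarrow> bs i t \<in> carrier (F t)" by (rule sip.onb_in[OF sip_F onb_bs])

lemma trivialization_bs: "t > 0 \<Longrightarrow> trivialization t (bs i t) = base i"
  unfolding bs_def by (rule trivialization_inv(2)[OF _ _ H.onb_in[OF onb_base]])

lemma trivialization_in: "t > 0 \<Longrightarrow> x \<in> carrier (F t) \<Longrightarrow> trivialization t x \<in> carrier H0"
  by (rule lin_isometry_in[OF unitary_isometry[OF trivialization(1)]])

lemma bs_coeff: "t > 0 \<Longrightarrow> x \<in> carrier (F t) \<Longrightarrow> inn (F t) (bs i t) x = inn H0 (base i) (trivialization t x)"
  using lin_isometry_inn[OF unitary_isometry[OF trivialization(1)] bs_in[of t i], of x] by (simp add: trivialization_bs)

text \<open>The trivialisation and its inverse are both measurable, so a section is measurable for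
  the Borel bundle exactly if its image in \<open>H0\<close> is, and there the coefficients
  decide.\<close>

lemma sections_eq:
  assumes I: "I \<in> sets borel" "I \<subseteq> {0<..}"
  shows "sections E I = {f \<in> (\<Pi>\<^sub>E \<alpha>\<in>I. carrier (F \<alpha>)).
      \<forall>i. (\<lambda>\<alpha>. inn (F \<alpha>) (bs i \<alpha>) (f \<alpha>)) \<in> borel_measurable (restrict_space lborel I)}"
proof -
  let ?B = "restrict_space borel I"
  have I0: "\<alpha> > 0" if "\<alpha> \<in> I" for \<alpha> using I(2) that by auto
  have "(\<lambda>\<alpha>. (\<alpha>, f \<alpha>)) \<in> ?B \<rightarrow>\<^sub>M bundle_borel E \<longleftrightarrow> (\<forall>i. (\<lambda>\<alpha>. inn (F \<alpha>) (bs i \<alpha>) (f \<alpha>)) \<in> borel_measurable ?B)"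
    if f: "f \<in> (\<Pi>\<^sub>E \<alpha>\<in>I. carrier (F \<alpha>))" for f
  proof -
    have fin: "f \<alpha> \<in> carrier (F \<alpha>)" if "\<alpha> \<in> I" for \<alpha> using f that by (auto simp: PiE_iff)
    have sB: "space ?B = I" by (simp add: space_restrict_space)
    show ?thesis
    proof
      assume m: "(\<lambda>\<alpha>. (\<alpha>, f \<alpha>)) \<in> ?B \<rightarrow>\<^sub>M bundle_borel E"
      have "(\<lambda>\<alpha>. (\<alpha>, trivialization \<alpha> (f \<alpha>))) \<in> ?B \<rightarrow>\<^sub>M R0 \<Otimes>\<^sub>M hborel H0"
        using measurable_compose[OF m trivialization(2)] by simp
      from measurable_compose[OF this measurable_snd]
      have t: "(\<lambda>\<alpha>. trivialization \<alpha> (f \<alpha>)) \<in> ?B \<rightarrow>\<^sub>M hborel H0" by simp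
      show "\<forall>i. (\<lambda>\<alpha>. inn (F \<alpha>) (bs i \<alpha>) (f \<alpha>)) \<in> borel_measurable ?B"
      proof
        fix i
        have "(\<lambda>\<alpha>. inn H0 (base i) (trivialization \<alpha> (f \<alpha>))) \<in> borel_measurable ?B"
          by (rule measurable_compose[OF t H.inn_hborel[OF H.onb_in[OF onb_base]]])
        then show "(\<lambda>\<alpha>. inn (F \<alpha>) (bs i \<alpha>) (f \<alpha>)) \<in> borel_measurable ?B"
          by (subst measurable_cong[where g = "\<lambda>\<alpha>. inn H0 (base i) (trivialization \<alpha> (f \<alpha>))"]) (simp_all add: sB bs_coeff fin I0)
      qed
    next
      assume m: "\<forall>i. (\<lambda>\<alpha>. inn (F \<alpha>) (bs i \<alpha>) (f \<alpha>)) \<in> borel_measurable ?B"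
      have t: "(\<lambda>\<alpha>. trivialization \<alpha> (f \<alpha>)) \<in> ?B \<rightarrow>\<^sub>M hborel H0"
      proof (rule H.measurable_hborelI[OF H_sep onb_base])
        show "trivialization \<alpha> (f \<alpha>) \<in> carrier H0" if "\<alpha> \<in> space ?B" for \<alpha> using that fin I0 by (simp add: sB trivialization_in)
        show "(\<lambda>\<alpha>. inn H0 (base i) (trivialization \<alpha> (f \<alpha>))) \<in> borel_measurable ?B" for i
          using m by (subst measurable_cong[where g = "\<lambda>\<alpha>. inn (F \<alpha>) (bs i \<alpha>) (f \<alpha>)"]) (simp_all add: sB bs_coeff fin I0)
      qed
      have "(\<lambda>\<alpha>. \<alpha>) \<in> ?B \<rightarrow>\<^sub>M R0"
        by (rule measurable_restrict_space2) (use I0 in \<open>auto simp: sB intro: measurable_restrict_space1\<close>)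
      from measurable_compose[OF measurable_Pair[OF this t] trivialization(3)]
      have "(\<lambda>\<alpha>. (\<alpha>, inv_into (carrier (F \<alpha>)) (trivialization \<alpha>) (trivialization \<alpha> (f \<alpha>)))) \<in> ?B \<rightarrow>\<^sub>M bundle_borel E" by simp
      then show "(\<lambda>\<alpha>. (\<alpha>, f \<alpha>)) \<in> ?B \<rightarrow>\<^sub>M bundle_borel E"
        by (subst measurable_cong[where g = "\<lambda>\<alpha>. (\<alpha>, inv_into (carrier (F \<alpha>)) (trivialization \<alpha>) (trivialization \<alpha> (f \<alpha>)))"])
          (simp_all add: sB trivialization_inv(3) fin I0)
    qed
  qed
  then show ?thesis unfolding sections_def borel_measurable_restrict_lborel by blast
qed

lemma mfield_sections:
  assumes I: "I \<in> sets borel" "I \<subseteq> {0<..}"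
  shows "mfield I F bs (sections E I)"
proof (rule mfield.intro)
  have I0: "\<alpha> > 0" if "\<alpha> \<in> I" for \<alpha> using I(2) that by auto
  show "(\<lambda>\<alpha>. inn (F \<alpha>) (bs i \<alpha>) (bs j \<alpha>)) \<in> borel_measurable (restrict_space lborel I)" for i j
    by (subst measurable_cong[where g = "\<lambda>_. inn H0 (base i) (base j)"])
      (simp_all add: space_restrict_space bs_coeff trivialization_bs bs_in I0)
  show "sections E I = {f \<in> (\<Pi>\<^sub>E \<alpha>\<in>I. carrier (F \<alpha>)).
      \<forall>i. (\<lambda>\<alpha>. inn (F \<alpha>) (bs i \<alpha>) (f \<alpha>)) \<in> borel_measurable (restrict_space lborel I)}"
    by (rule sections_eq[OF I])
  show "hilb (F \<alpha>)" "onb (F \<alpha>) (\<lambda>i. bs i \<alpha>)" if "\<alpha> \<in> I" for \<alpha>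
    using I0[OF that] by (simp_all add: hilb_F onb_bs)
qed (rule I)

lemma section_in: "f \<in> sections E I \<Longrightarrow> \<alpha> \<in> I \<Longrightarrow> f \<alpha> \<in> carrier (F \<alpha>)" by (auto simp: sections_def PiE_iff)
lemma section_ext: "f \<in> sections E I \<Longrightarrow> f \<in> extensional I" by (auto simp: sections_def PiE_iff)

section \<open>Restricting, gluing and extending measurable sections\<close>

lemma sections_restrict:
  assumes f: "f \<in> sections E I" and I: "I \<in> sets borel" "I \<subseteq> {0<..}" and J: "J \<in> sets borel" "J \<subseteq> I"
  shows "restrict f J \<in> sections E J"
proof -
  interpret I: mfield I F bs "sections E I" by (rule mfield_sections[OF I])
  interpret J: mfield J F bs "sections E J" by (rule mfield_sections) (use I J in auto)
  show ?thesis
  proof (rule J.MI)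
    show "(\<lambda>\<alpha>. inn (F \<alpha>) (bs i \<alpha>) (f \<alpha>)) \<in> borel_measurable (restrict_space lborel J)" for i
      by (rule measurable_restrict_mono[OF I.M_coeff[OF f] J(2)])
  qed (use section_in[OF f] J in auto)
qed

text \<open>Gluing along a countable cover; extension by zero and the piecewise definition of
  \<open>tilde\<close> go through it.\<close>

lemma sections_UN:
  fixes A :: "nat \<Rightarrow> real set"
  assumes J: "J \<in> sets borel" "J \<subseteq> {0<..}" "J = (\<Union>n. A n)" and A: "\<And>n. A n \<in> sets borel"
    and f: "\<And>n. restrict f (A n) \<in> sections E (A n)"
  shows "restrict f J \<in> sections E J"
proof -
  interpret J: mfield J F bs "sections E J" by (rule mfield_sections) (use J in auto)
  have A': "A n \<subseteq> J" for n using J(3) by auto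
  show ?thesis
  proof (rule J.MI)
    show "f \<alpha> \<in> carrier (F \<alpha>)" if \<alpha>: "\<alpha> \<in> J" for \<alpha>
    proof -
      obtain n where "\<alpha> \<in> A n" using \<alpha> J(3) by auto
      then show ?thesis using section_in[OF f[of n]] by simp
    qed
    fix i
    show "(\<lambda>\<alpha>. inn (F \<alpha>) (bs i \<alpha>) (f \<alpha>)) \<in> borel_measurable (restrict_space lborel J)"
    proof (rule measurable_piecewise_restrict[of "range A"])
      show "\<Omega> \<inter> space (restrict_space lborel J) \<in> sets (restrict_space lborel J)" if "\<Omega> \<in> range A" for \<Omega>
        using that A A' by (auto simp: sets_restrict_space)
      show "space (restrict_space lborel J) \<subseteq> \<Union> (range A)" using J(3) by (simp add: space_restrict_space)
      fix \<Omega> assume "\<Omega> \<in> range A"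
      then obtain n where n: "\<Omega> = A n" by blast
      interpret A: mfield "A n" F bs "sections E (A n)" by (rule mfield_sections) (use A A' J in blast)+
      have "(\<lambda>\<alpha>. inn (F \<alpha>) (bs i \<alpha>) (f \<alpha>)) \<in> borel_measurable (restrict_space lborel (A n))"
        using A.M_coeff[OF f, of i] by (subst (asm) measurable_cong[where g = "\<lambda>\<alpha>. inn (F \<alpha>) (bs i \<alpha>) (f \<alpha>)"]) simp_all
      moreover have "restrict_space (restrict_space lborel J) (A n) = restrict_space lborel (A n)"
        using A A' J(1) by (subst restrict_restrict_space) (auto simp: Int_absorb1)
      ultimately show "(\<lambda>\<alpha>. inn (F \<alpha>) (bs i \<alpha>) (f \<alpha>)) \<in> borel_measurable (restrict_space (restrict_space lborel J) \<Omega>)"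
        by (simp add: n)
    qed simp
  qed
qed

lemma sections_zero: "I \<in> sets borel \<Longrightarrow> I \<subseteq> {0<..} \<Longrightarrow> (\<lambda>\<alpha>\<in>I. \<zero>\<^bsub>F \<alpha>\<^esub>) \<in> sections E I"
  by (rule mfield.M_zero[OF mfield_sections])

text \<open>The measurability axiom for products speaks of sections over the whole half-line, so
  sections over a smaller set are first continued by zero.\<close>

lemma sections_extend:
  assumes f: "f \<in> sections E I" and I: "I \<in> sets borel" "I \<subseteq> {0<..}"
  shows "(\<lambda>\<alpha>\<in>{0<..}. if \<alpha> \<in> I then f \<alpha> else \<zero>\<^bsub>F \<alpha>\<^esub>) \<in> sections E {0<..}"
proof (rule sections_UN[where A = "\<lambda>n. if n = 0 then I else {0<..} - I"])
  let ?f = "\<lambda>\<alpha>. if \<alpha> \<in> I then f \<alpha> else \<zero>\<^bsub>F \<alpha>\<^esub>"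
  have "restrict ?f I = f" using section_ext[OF f] by (auto simp: extensional_def restrict_def)
  moreover have "restrict ?f ({0<..} - I) = (\<lambda>\<alpha>\<in>{0<..} - I. \<zero>\<^bsub>F \<alpha>\<^esub>)" by (auto simp: restrict_def)
  ultimately show "restrict ?f (if n = 0 then I else {0<..} - I) \<in> sections E (if n = 0 then I else {0<..} - I)" for n :: nat
    using f sections_zero[of "{0<..} - I"] I by (cases n) auto
  show "{0<..} = (\<Union>n::nat. if n = 0 then I else {0<..} - I)" using I(2) by (auto intro: exI[of _ 0] exI[of _ 1])
qed (use I in auto)

text \<open>The section is constant in the trivialisation. It lets multiplication by one fixed
  vector be read as multiplication by a section, to which the measurability axiom applies.\<close>

lemma section_through:
  assumes t: "t > 0" and x: "x \<in> carrier (F t)"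
  shows "\<exists>f\<in>sections E {0<..}. f t = x"
proof -
  interpret mfield "{0<..}" F bs "sections E {0<..}" by (rule mfield_sections) auto
  define f where "f s = inv_into (carrier (F s)) (trivialization s) (trivialization t x)" for s
  have fin: "f s \<in> carrier (F s)" and tf: "trivialization s (f s) = trivialization t x" if "s > 0" for s
    unfolding f_def using trivialization_inv(1,2)[OF that that trivialization_in[OF t x]] by simp_all
  have "restrict f {0<..} \<in> sections E {0<..}"
  proof (rule MI)
    show "(\<lambda>s. inn (F s) (bs i s) (f s)) \<in> borel_measurable (restrict_space lborel {0<..})" for i
      by (subst measurable_cong[where g = "\<lambda>_. inn H0 (base i) (trivialization t x)"]) (simp_all add: bs_coeff fin tf)
  qed (simp add: fin)
  moreover have "restrict f {0<..} t = x" using trivialization_inv(3)[OF t t x] t by (simp add: f_def)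
  ultimately show ?thesis by blast
qed

subsection \<open>Products\<close>

lemma tensor_pair_F: "t > 0 \<Longrightarrow> s > 0 \<Longrightarrow> tensor_pair (F t) (F s)"
  by (simp add: tensor_pair_def sip_F)

lemma umap_unitary: "t > 0 \<Longrightarrow> s > 0 \<Longrightarrow> unitary (F t \<otimes>\<^sub>H F s) (F (t + s)) (umap E t s)"
  using sys[unfolded arveson_system_def, THEN conjunct2, THEN conjunct1, rule_format] .

lemmas umap_isometry = unitary_isometry[OF umap_unitary]

lemma aprod_in: "t > 0 \<Longrightarrow> s > 0 \<Longrightarrow> x \<in> carrier (F t) \<Longrightarrow> y \<in> carrier (F s) \<Longrightarrow> r = t + s \<Longrightarrow> aprod E t s x y \<in> carrier (F r)"
  unfolding aprod_def by (simp add: lin_isometry_in[OF umap_isometry] tensor_pair.tens_in[OF tensor_pair_F])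

lemma inn_aprod: "t > 0 \<Longrightarrow> s > 0 \<Longrightarrow> x \<in> carrier (F t) \<Longrightarrow> y \<in> carrier (F s) \<Longrightarrow>
   x' \<in> carrier (F t) \<Longrightarrow> y' \<in> carrier (F s) \<Longrightarrow> r = t + s \<Longrightarrow>
   inn (F r) (aprod E t s x y) (aprod E t s x' y') = inn (F t) x x' * inn (F s) y y'"
  unfolding aprod_def
  by (simp add: lin_isometry_inn[OF umap_isometry] tensor_pair.tens_in[OF tensor_pair_F] tensor_pair.inn_tens[OF tensor_pair_F])

lemma hnorm_aprod: "t > 0 \<Longrightarrow> s > 0 \<Longrightarrow> x \<in> carrier (F t) \<Longrightarrow> y \<in> carrier (F s) \<Longrightarrow> r = t + s \<Longrightarrow>
   hnorm (F r) (aprod E t s x y) = hnorm (F t) x * hnorm (F s) y"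
  unfolding aprod_def
  by (simp add: lin_isometry_hnorm[OF umap_isometry] tensor_pair.tens_in[OF tensor_pair_F] tensor_pair.hnorm_tens[OF tensor_pair_F])

lemma aprod_hbdd_left: "t > 0 \<Longrightarrow> s > 0 \<Longrightarrow> y \<in> carrier (F s) \<Longrightarrow> r = t + s \<Longrightarrow> hbdd (F t) (F r) (\<lambda>x. aprod E t s x y)"
  unfolding aprod_def using hbdd_comp[OF tensor_pair.hbdd_tens_left[OF tensor_pair_F] lin_isometry_hbdd[OF umap_isometry]] by simp

lemma aprod_hbdd_right: "t > 0 \<Longrightarrow> s > 0 \<Longrightarrow> x \<in> carrier (F t) \<Longrightarrow> r = t + s \<Longrightarrow> hbdd (F s) (F r) (aprod E t s x)"
  unfolding aprod_def using hbdd_comp[OF tensor_pair.hbdd_tens_right[OF tensor_pair_F] lin_isometry_hbdd[OF umap_isometry]] by simp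

text \<open>Here the surjectivity of the product maps of the Arveson system enters.\<close>

lemma aprod_total:
  assumes ts: "t > 0" "s > 0" and A: "total (F t) A" and B: "total (F s) B" and r: "r = t + s"
  shows "total (F r) ((\<lambda>(x, y). aprod E t s x y) ` (A \<times> B))"
proof -
  interpret TP: tensor_pair "F t" "F s" by (rule tensor_pair_F[OF ts])
  have "total (F r) (umap E t s ` ((\<lambda>(x, y). tens (F t) (F s) x y) ` (A \<times> B)))"
    unfolding r using ts
    by (intro total_image[OF TP.T.sip_axioms sip_F umap_unitary] TP.total_tens_image A B) auto
  moreover have "umap E t s ` ((\<lambda>(x, y). tens (F t) (F s) x y) ` (A \<times> B)) = (\<lambda>(x, y). aprod E t s x y) ` (A \<times> B)"
    by (auto simp: aprod_def image_iff)
  ultimately show ?thesis by simp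
qed

lemma aprod_assoc: "r > 0 \<Longrightarrow> s > 0 \<Longrightarrow> t > 0 \<Longrightarrow> x \<in> carrier (F r) \<Longrightarrow> y \<in> carrier (F s) \<Longrightarrow> z \<in> carrier (F t) \<Longrightarrow>
    rs = r + s \<Longrightarrow> st = s + t \<Longrightarrow> aprod E rs t (aprod E r s x y) z = aprod E r st x (aprod E s t y z)"
  using sys[unfolded arveson_system_def, THEN conjunct2, THEN conjunct2, THEN conjunct1, rule_format] by simp

lemma aprod_measurable:
  "f \<in> sections E {0<..} \<Longrightarrow> g \<in> sections E {0<..} \<Longrightarrow>
    (\<lambda>(t, s). (t + s, aprod E t s (f t) (g s))) \<in> R0 \<Otimes>\<^sub>M R0 \<rightarrow>\<^sub>M bundle_borel E"
  using sys[unfolded arveson_system_def, THEN conjunct2, THEN conjunct2, THEN conjunct2, THEN conjunct2,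
    THEN conjunct2, THEN conjunct2, THEN conjunct2, THEN conjunct2, rule_format] .

text \<open>The measurability axiom in two variables, pulled back along a splitting \<gamma> =
  a(\<gamma>) + b(\<gamma>) of the parameter.\<close>

lemma aprod_section:
  assumes f: "f \<in> sections E I" "I \<in> sets borel" "I \<subseteq> {0<..}" and g: "g \<in> sections E K" "K \<in> sets borel" "K \<subseteq> {0<..}"
    and J: "J \<in> sets borel"
    and a: "a \<in> borel_measurable borel" "b \<in> borel_measurable borel"
      "\<And>\<gamma>. \<gamma> \<in> J \<Longrightarrow> a \<gamma> \<in> I \<and> b \<gamma> \<in> K \<and> a \<gamma> + b \<gamma> = \<gamma>"
  shows "(\<lambda>\<gamma>\<in>J. aprod E (a \<gamma>) (b \<gamma>) (f (a \<gamma>)) (g (b \<gamma>))) \<in> sections E J"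
proof -
  let ?f = "\<lambda>\<alpha>\<in>{0<..}. if \<alpha> \<in> I then f \<alpha> else \<zero>\<^bsub>F \<alpha>\<^esub>" and ?g = "\<lambda>\<alpha>\<in>{0<..}. if \<alpha> \<in> K then g \<alpha> else \<zero>\<^bsub>F \<alpha>\<^esub>"
  let ?B = "restrict_space borel J"
  have pos: "a \<gamma> > 0" "b \<gamma> > 0" "a \<gamma> \<in> I" "b \<gamma> \<in> K" "a \<gamma> + b \<gamma> = \<gamma>" if "\<gamma> \<in> J" for \<gamma>
    using a(3)[OF that] subsetD[OF f(3), of "a \<gamma>"] subsetD[OF g(3), of "b \<gamma>"] by auto
  have "a \<in> ?B \<rightarrow>\<^sub>M R0" "b \<in> ?B \<rightarrow>\<^sub>M R0"
    by (rule measurable_restrict_space2[OF _ measurable_restrict_space1[OF a(1)]], simp add: space_restrict_space pos)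
      (rule measurable_restrict_space2[OF _ measurable_restrict_space1[OF a(2)]], simp add: space_restrict_space pos)
  from measurable_compose[OF measurable_Pair[OF this] aprod_measurable[OF sections_extend[OF f] sections_extend[OF g]]]
  have "(\<lambda>\<gamma>. (a \<gamma> + b \<gamma>, aprod E (a \<gamma>) (b \<gamma>) (?f (a \<gamma>)) (?g (b \<gamma>)))) \<in> ?B \<rightarrow>\<^sub>M bundle_borel E" by simp
  then have "(\<lambda>\<gamma>. (\<gamma>, (\<lambda>\<gamma>\<in>J. aprod E (a \<gamma>) (b \<gamma>) (f (a \<gamma>)) (g (b \<gamma>))) \<gamma>)) \<in> ?B \<rightarrow>\<^sub>M bundle_borel E"
    by (subst measurable_cong[where g = "\<lambda>\<gamma>. (a \<gamma> + b \<gamma>, aprod E (a \<gamma>) (b \<gamma>) (?f (a \<gamma>)) (?g (b \<gamma>)))"])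
      (simp_all add: space_restrict_space pos)
  moreover have "(\<lambda>\<gamma>\<in>J. aprod E (a \<gamma>) (b \<gamma>) (f (a \<gamma>)) (g (b \<gamma>))) \<in> (\<Pi>\<^sub>E \<alpha>\<in>J. carrier (F \<alpha>))"
    by (auto intro!: aprod_in section_in[OF f(1)] section_in[OF g(1)] pos simp: pos(5)[symmetric])
  ultimately show ?thesis unfolding sections_def by blast
qed

lemma aprod_section_right:
  assumes f: "f \<in> sections E I" "I \<in> sets borel" "I \<subseteq> {0<..}" and s: "s > 0" "y \<in> carrier (F s)"
    and J: "J \<in> sets borel" "\<And>\<gamma>. \<gamma> \<in> J \<Longrightarrow> \<gamma> - s \<in> I"
  shows "(\<lambda>\<gamma>\<in>J. aprod E (\<gamma> - s) s (f (\<gamma> - s)) y) \<in> sections E J"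
proof -
  obtain g where g: "g \<in> sections E {0<..}" "g s = y" using section_through[OF s] by blast
  show ?thesis
    using aprod_section[OF f g(1) _ _ J(1), of "\<lambda>\<gamma>. \<gamma> - s" "\<lambda>_. s"] s J(2) by (simp add: g(2))
qed

lemma aprod_section_left:
  assumes f: "f \<in> sections E I" "I \<in> sets borel" "I \<subseteq> {0<..}" and s: "s > 0" "y \<in> carrier (F s)"
    and J: "J \<in> sets borel" "\<And>\<gamma>. \<gamma> \<in> J \<Longrightarrow> \<gamma> - s \<in> I"
  shows "(\<lambda>\<gamma>\<in>J. aprod E s (\<gamma> - s) y (f (\<gamma> - s))) \<in> sections E J"
proof -
  obtain g where g: "g \<in> sections E {0<..}" "g s = y" using section_through[OF s] by blast
  show ?thesis
    using aprod_section[OF g(1) _ _ f J(1), of "\<lambda>_. s" "\<lambda>\<gamma>. \<gamma> - s"] s J(2) by (simp add: g(2))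
qed

end

section \<open>The unit vector e and its powers\<close>

locale arveson_unit = arveson +
  fixes e assumes e_in: "e \<in> carrier (fib E 1)" and e_norm: "hnorm (fib E 1) e = 1"
begin

lemma inn_e: "inn (F 1) e e = 1"
  using sip.inn_self[OF sip_F e_in] e_norm by simp

lemma epow_in: "n \<ge> 1 \<Longrightarrow> epow E e n \<in> carrier (F (real n))"
  and inn_epow: "n \<ge> 1 \<Longrightarrow> inn (F (real n)) (epow E e n) (epow E e n) = 1"
proof -
  have "n \<ge> 1 \<Longrightarrow> epow E e n \<in> carrier (F (real n)) \<and> inn (F (real n)) (epow E e n) (epow E e n) = 1"
  proof (induction n)
    case (Suc n)
    show ?case
    proof (cases "n = 0")
      case True
      then show ?thesis using e_in inn_e by simp
    next
      case False
      then have "epow E e n \<in> carrier (F (real n))" "inn (F (real n)) (epow E e n) (epow E e n) = 1" using Suc by auto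
      then show ?thesis using False e_in inn_e aprod_in[of "real n" 1 "epow E e n" e "real (Suc n)"]
          inn_aprod[of "real n" 1 "epow E e n" e "epow E e n" e "real (Suc n)"] by simp
    qed
  qed simp
  then show "n \<ge> 1 \<Longrightarrow> epow E e n \<in> carrier (F (real n))" "n \<ge> 1 \<Longrightarrow> inn (F (real n)) (epow E e n) (epow E e n) = 1" by blast+
qed

lemma mult_pow_0 [simp]: "mult_pow E e t x 0 = x" by (simp add: mult_pow_def)

lemma mult_pow_in: "t > 0 \<Longrightarrow> x \<in> carrier (F t) \<Longrightarrow> r = t + real n \<Longrightarrow> mult_pow E e t x n \<in> carrier (F r)"
  by (simp add: mult_pow_def aprod_in epow_in)

lemma inn_mult_pow: "t > 0 \<Longrightarrow> x \<in> carrier (F t) \<Longrightarrow> y \<in> carrier (F t) \<Longrightarrow> r = t + real n \<Longrightarrow>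
    inn (F r) (mult_pow E e t x n) (mult_pow E e t y n) = inn (F t) x y"
  by (simp add: mult_pow_def inn_aprod epow_in inn_epow)

lemma hnorm_mult_pow: "t > 0 \<Longrightarrow> x \<in> carrier (F t) \<Longrightarrow> r = t + real n \<Longrightarrow> hnorm (F r) (mult_pow E e t x n) = hnorm (F t) x"
  by (simp add: hnorm_def inn_mult_pow)

lemma mult_pow_hbdd: "t > 0 \<Longrightarrow> r = t + real n \<Longrightarrow> hbdd (F t) (F r) (\<lambda>x. mult_pow E e t x n)"
proof (cases "n = 0")
  case True
  assume "t > 0" "r = t + real n"
  then show ?thesis using True by (auto simp: hbdd_def intro!: exI[of _ 1])
qed (simp add: mult_pow_def aprod_hbdd_left epow_in)

lemma mult_pow_Suc: "t > 0 \<Longrightarrow> x \<in> carrier (F t) \<Longrightarrow> r = t + real n \<Longrightarrow> mult_pow E e t x (Suc n) = aprod E r 1 (mult_pow E e t x n) e"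
proof (cases "n = 0")
  case False
  assume a: "t > 0" "x \<in> carrier (F t)" "r = t + real n"
  then show ?thesis using False epow_in[of n] e_in aprod_assoc[of t "real n" 1 x "epow E e n" e r "real (Suc n)"]
    by (simp add: mult_pow_def)
qed (simp add: mult_pow_def)

lemma mult_pow_add: "t > 0 \<Longrightarrow> x \<in> carrier (F t) \<Longrightarrow> r = t + real n \<Longrightarrow> mult_pow E e r (mult_pow E e t x n) k = mult_pow E e t x (n + k)"
proof (induction k)
  case (Suc k)
  then show ?case
    using mult_pow_Suc[of r "mult_pow E e t x n" "r + real k" k] mult_pow_Suc[of t x "r + real k" "n + k"] mult_pow_in[of t x r n] by simp
qed simp

text \<open>Associativity, with n = 0 apart because e^0 is not a vector of any fibre.\<close>

lemma aprod_mult_pow: "t > 0 \<Longrightarrow> s > 0 \<Longrightarrow> x \<in> carrier (F t) \<Longrightarrow> y \<in> carrier (F s) \<Longrightarrow> r = s + real n \<Longrightarrow> q = t + s \<Longrightarrow>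
   aprod E t r x (mult_pow E e s y n) = mult_pow E e q (aprod E t s x y) n"
proof (cases "n = 0")
  case False
  assume "t > 0" "s > 0" "x \<in> carrier (F t)" "y \<in> carrier (F s)" "r = s + real n" "q = t + s"
  then show ?thesis using False epow_in[of n] aprod_assoc[of t s "real n" x y "epow E e n" q r] by (simp add: mult_pow_def)
qed (simp add: mult_pow_def)

end

section \<open>The first construction\<close>

lemma lim_eventually_const: "(\<And>m. m \<ge> K \<Longrightarrow> f m = c) \<Longrightarrow> lim f = (c :: complex)" for K :: nat
  by (intro limI tendsto_eventually) (auto simp: eventually_sequentially)

lemma (in sip) smult_zero_vec: "c \<odot> \<zero> = \<zero>"
  using M.smult_r_null[of c] by simp

text \<open>The double family is enumerated by \<open>prod_decode\<close>, since \<open>onb\<close>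
  expects a sequence.\<close>

lemma onb_tens:
  assumes "sip X" "sip Y" and u: "onb X u" and v: "onb Y v"
  shows "onb (X \<otimes>\<^sub>H Y) (\<lambda>n. tens X Y (u (fst (prod_decode n))) (v (snd (prod_decode n))))"
proof -
  interpret XY: tensor_pair X Y using assms by (simp add: tensor_pair_def)
  have r: "range (\<lambda>n. tens X Y (u (fst (prod_decode n))) (v (snd (prod_decode n)))) = (\<lambda>(x, y). tens X Y x y) ` (range u \<times> range v)"
  proof (intro equalityI subsetI)
    fix z assume "z \<in> (\<lambda>(x, y). tens X Y x y) ` (range u \<times> range v)"
    then obtain i j where "z = tens X Y (u i) (v j)" by auto
    then show "z \<in> range (\<lambda>n. tens X Y (u (fst (prod_decode n))) (v (snd (prod_decode n))))"
      by (intro image_eqI[of _ _ "prod_encode (i, j)"]) simp_all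
  qed auto
  have t: "total (X \<otimes>\<^sub>H Y) ((\<lambda>(x, y). tens X Y x y) ` (range u \<times> range v))"
    using u v by (intro XY.total_tens_image) (auto simp: onb_def)
  have i: "inn (X \<otimes>\<^sub>H Y) (tens X Y (u i) (v j)) (tens X Y (u k) (v l)) = inn X (u i) (u k) * inn Y (v j) (v l)" for i j k l
    by (rule XY.inn_tens) (use XY.X.onb_in[OF u] XY.Y.onb_in[OF v] in auto)
  show ?thesis unfolding onb_def r
  proof (intro conjI allI impI t)
    fix m n :: nat assume "m \<noteq> n"
    then have "prod_decode m \<noteq> prod_decode n" by (metis prod_decode_inverse)
    then have "fst (prod_decode m) \<noteq> fst (prod_decode n) \<or> snd (prod_decode m) \<noteq> snd (prod_decode n)"
      by (simp add: prod_eq_iff)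
    then show "inn (X \<otimes>\<^sub>H Y) (tens X Y (u (fst (prod_decode m))) (v (snd (prod_decode m)))) (tens X Y (u (fst (prod_decode n))) (v (snd (prod_decode n)))) = 0"
      unfolding i using u v by (auto simp: onb_def)
  next
    fix n
    show "inn (X \<otimes>\<^sub>H Y) (tens X Y (u (fst (prod_decode n))) (v (snd (prod_decode n)))) (tens X Y (u (fst (prod_decode n))) (v (snd (prod_decode n)))) = 0 \<or>
      inn (X \<otimes>\<^sub>H Y) (tens X Y (u (fst (prod_decode n))) (v (snd (prod_decode n)))) (tens X Y (u (fst (prod_decode n))) (v (snd (prod_decode n)))) = 1"
      unfolding i using u v unfolding onb_def by (metis mult_1 mult_zero_left mult_zero_right)
  qed
qed

context arveson_unit
begin

subsection \<open>The inductive limit\<close>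

abbreviation "Ind \<equiv> ind_limit E e"

lemma Ind_carrier: "s \<in> carrier Ind \<longleftrightarrow> s \<in> (\<Pi>\<^sub>E m\<in>{1..}. carrier (F (real m))) \<and>
    (\<exists>m0\<ge>1. \<forall>m\<ge>m0. s (m + 1) = aprod E (real m) 1 (s m) e)"
  by (simp add: ind_limit_def)

lemma Ind_in: "s \<in> carrier Ind \<Longrightarrow> m \<ge> 1 \<Longrightarrow> s m \<in> carrier (F (real m))"
  by (auto simp: Ind_carrier PiE_iff)

lemma Ind_ev:
  assumes "s \<in> carrier Ind"
  obtains K where "K \<ge> 1" "\<And>m. m \<ge> K \<Longrightarrow> s (m + 1) = aprod E (real m) 1 (s m) e"
  using assms by (auto simp: Ind_carrier)

text \<open>Multiplying both vectors by e preserves their inner product since \<langle>e,e\<rangle>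
  = 1, so the sequence under the \<open>lim\<close> of \<open>ind_limit\<close> is eventually
  constant. Properties of the form can then be checked at one large index.\<close>

lemma Ind_inn_ev:
  assumes s: "s \<in> carrier Ind" and r: "r \<in> carrier Ind"
  obtains K where "K \<ge> 1" "\<And>m. m \<ge> K \<Longrightarrow> inn (F (real m)) (s m) (r m) = inn Ind s r"
proof -
  obtain K where K: "K \<ge> 1" "\<And>m. m \<ge> K \<Longrightarrow> s (m + 1) = aprod E (real m) 1 (s m) e" using Ind_ev[OF s] by blast
  obtain L where L: "L \<ge> 1" "\<And>m. m \<ge> L \<Longrightarrow> r (m + 1) = aprod E (real m) 1 (r m) e" using Ind_ev[OF r] by blast
  define N where "N = max K L"
  have c: "inn (F (real m)) (s m) (r m) = inn (F (real N)) (s N) (r N)" if "m \<ge> N" for m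
    using that
  proof (induction m rule: dec_induct)
    case (step m)
    have m: "m \<ge> K" "m \<ge> L" "m \<ge> 1" using step K(1) by (auto simp: N_def)
    have "inn (F (real (Suc m))) (s (Suc m)) (r (Suc m)) = inn (F (real m)) (s m) (r m) * inn (F 1) e e"
      using K(2)[OF m(1)] L(2)[OF m(2)] m(3) s r by (simp add: inn_aprod Ind_in e_in)
    then show ?case using step.IH by (simp add: inn_e)
  qed simp
  have N: "inn Ind s r = inn (F (real N)) (s N) (r N)"
    unfolding ind_limit_def mk_hspace_simps by (rule lim_eventually_const[of N]) (rule c)
  show ?thesis
  proof (rule that[of N])
    show "N \<ge> 1" using K(1) by (simp add: N_def)
    show "inn (F (real m)) (s m) (r m) = inn Ind s r" if "m \<ge> N" for m unfolding N by (rule c[OF that])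
  qed
qed

lemma Ind_add: "s \<in> carrier Ind \<Longrightarrow> r \<in> carrier Ind \<Longrightarrow> (\<lambda>m\<in>{1..}. s m \<oplus>\<^bsub>F (real m)\<^esub> r m) \<in> carrier Ind"
proof -
  assume s: "s \<in> carrier Ind" and r: "r \<in> carrier Ind"
  obtain K where K: "K \<ge> 1" "\<And>m. m \<ge> K \<Longrightarrow> s (m + 1) = aprod E (real m) 1 (s m) e" using Ind_ev[OF s] by blast
  obtain L where L: "L \<ge> 1" "\<And>m. m \<ge> L \<Longrightarrow> r (m + 1) = aprod E (real m) 1 (r m) e" using Ind_ev[OF r] by blast
  have "s (m+1) \<oplus>\<^bsub>F (real (m+1))\<^esub> r (m+1) = aprod E (real m) 1 (s m \<oplus>\<^bsub>F (real m)\<^esub> r m) e" if "m \<ge> max K L" for m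
  proof -
    have m: "m \<ge> K" "m \<ge> L" "m \<ge> 1" using that K(1) by auto
    show ?thesis unfolding K(2)[OF m(1)] L(2)[OF m(2)]
      by (rule hbdd_add[OF aprod_hbdd_left, symmetric]) (use m s r Ind_in e_in in auto)
  qed
  then have "\<exists>m0\<ge>1. \<forall>m\<ge>m0. (\<lambda>m\<in>{1..}. s m \<oplus>\<^bsub>F (real m)\<^esub> r m) (m + 1) = aprod E (real m) 1 ((\<lambda>m\<in>{1..}. s m \<oplus>\<^bsub>F (real m)\<^esub> r m) m) e"
    using K(1) by (intro exI[of _ "max K L"]) auto
  moreover have "s m \<oplus>\<^bsub>F (real m)\<^esub> r m \<in> carrier (F (real m))" if "m \<ge> 1" for m
    using that s r by (intro sip.add_in[OF sip_F] Ind_in) auto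
  ultimately show ?thesis unfolding Ind_carrier by auto
qed

lemma Ind_smult: "s \<in> carrier Ind \<Longrightarrow> (\<lambda>m\<in>{1..}. c \<odot>\<^bsub>F (real m)\<^esub> s m) \<in> carrier Ind"
proof -
  assume s: "s \<in> carrier Ind"
  obtain K where K: "K \<ge> 1" "\<And>m. m \<ge> K \<Longrightarrow> s (m + 1) = aprod E (real m) 1 (s m) e" using Ind_ev[OF s] by blast
  have "c \<odot>\<^bsub>F (real (m+1))\<^esub> s (m+1) = aprod E (real m) 1 (c \<odot>\<^bsub>F (real m)\<^esub> s m) e" if "m \<ge> K" for m
  proof -
    have m: "m \<ge> K" "m \<ge> 1" using that K(1) by auto
    show ?thesis unfolding K(2)[OF m(1)]
      by (rule hbdd_smult[OF aprod_hbdd_left, symmetric]) (use m s Ind_in e_in in auto)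
  qed
  then have "\<exists>m0\<ge>1. \<forall>m\<ge>m0. (\<lambda>m\<in>{1..}. c \<odot>\<^bsub>F (real m)\<^esub> s m) (m + 1) = aprod E (real m) 1 ((\<lambda>m\<in>{1..}. c \<odot>\<^bsub>F (real m)\<^esub> s m) m) e"
    using K(1) by (intro exI[of _ K]) auto
  moreover have "c \<odot>\<^bsub>F (real m)\<^esub> s m \<in> carrier (F (real m))" if "m \<ge> 1" for m
    using that s by (intro sip.smult_in[OF sip_F] Ind_in) auto
  ultimately show ?thesis unfolding Ind_carrier by auto
qed

lemma Ind_zero: "(\<lambda>m\<in>{1..}. \<zero>\<^bsub>F (real m)\<^esub>) \<in> carrier Ind"
proof -
  have "\<zero>\<^bsub>F (real m + 1)\<^esub> = aprod E (real m) 1 \<zero>\<^bsub>F (real m)\<^esub> e" if "m \<ge> 1" for m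
  proof -
    interpret A: sip "F (real m)" using that by (intro sip_F) simp
    interpret B: sip "F (real m + 1)" using that by (intro sip_F) simp
    have h: "hbdd (F (real m)) (F (real m + 1)) (\<lambda>x. aprod E (real m) 1 x e)"
      using that e_in by (intro aprod_hbdd_left) auto
    show ?thesis using hbdd_smult[OF h A.zero_in, of 0] B.vsmult_zero[OF hbdd_in[OF h A.zero_in]] A.vsmult_zero[OF A.zero_in] by simp
  qed
  then have "\<exists>m0\<ge>1. \<forall>m\<ge>m0. (\<lambda>m\<in>{1..}. \<zero>\<^bsub>F (real m)\<^esub>) (m + 1) = aprod E (real m) 1 ((\<lambda>m\<in>{1..}. \<zero>\<^bsub>F (real m)\<^esub>) m) e"
    by (intro exI[of _ 1]) (simp add: add.commute)
  moreover have "\<zero>\<^bsub>F (real m)\<^esub> \<in> carrier (F (real m))" if "m \<ge> 1" for m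
    using that by (intro sip.zero_in[OF sip_F]) auto
  ultimately show ?thesis unfolding Ind_carrier by auto
qed

lemma sip_Ind: "sip Ind"
proof -
  have "sip (mk_hspace (carrier Ind) (\<lambda>k\<in>{1..}. \<zero>\<^bsub>F (real k)\<^esub>) (\<lambda>f g. \<lambda>k\<in>{1..}. f k \<oplus>\<^bsub>F (real k)\<^esub> g k) (\<lambda>c f. \<lambda>k\<in>{1..}. c \<odot>\<^bsub>F (real k)\<^esub> f k) (inn Ind))"
  proof (rule sip_pointwise, goal_cases)
    case (1 k) then show ?case by (intro sip_F) simp
  next case 2 show ?case by (auto simp: Ind_carrier)
  next case 3 show ?case by (rule Ind_zero)
  next case (4 f g) then show ?case by (rule Ind_add)
  next case (5 c f) then show ?case by (rule Ind_smult)
  next case (6 f g)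
    obtain K where K: "K \<ge> 1" "\<And>m. m \<ge> K \<Longrightarrow> inn (F (real m)) (f m) (g m) = inn Ind f g" using Ind_inn_ev[OF 6] by blast
    obtain L where L: "L \<ge> 1" "\<And>m. m \<ge> L \<Longrightarrow> inn (F (real m)) (g m) (f m) = inn Ind g f" using Ind_inn_ev[OF 6(2,1)] by blast
    define m where "m = max K L"
    have m: "m \<ge> K" "m \<ge> L" "m \<ge> 1" using K(1) by (auto simp: m_def)
    show ?case unfolding K(2)[OF m(1), symmetric] L(2)[OF m(2), symmetric]
      by (rule sip.inn_cnj[OF sip_F Ind_in[OF 6(1)] Ind_in[OF 6(2)]]) (use m in auto)
  next case (7 f g h)
    obtain K where K: "K \<ge> 1" "\<And>m. m \<ge> K \<Longrightarrow> inn (F (real m)) (f m) (g m) = inn Ind f g" using Ind_inn_ev[OF 7(1,2)] by blast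
    obtain L where L: "L \<ge> 1" "\<And>m. m \<ge> L \<Longrightarrow> inn (F (real m)) (f m) (h m) = inn Ind f h" using Ind_inn_ev[OF 7(1,3)] by blast
    obtain N where N: "N \<ge> 1" "\<And>m. m \<ge> N \<Longrightarrow> inn (F (real m)) (f m) ((\<lambda>k\<in>{1..}. g k \<oplus>\<^bsub>F (real k)\<^esub> h k) m) = inn Ind f (\<lambda>k\<in>{1..}. g k \<oplus>\<^bsub>F (real k)\<^esub> h k)"
      using Ind_inn_ev[OF 7(1) Ind_add[OF 7(2,3)]] by blast
    define m where "m = max (max K L) N"
    have m: "m \<ge> K" "m \<ge> L" "m \<ge> N" "m \<ge> 1" using K(1) by (auto simp: m_def)
    show ?case unfolding K(2)[OF m(1), symmetric] L(2)[OF m(2), symmetric] N(2)[OF m(3), symmetric]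
      using m(4) 7 Ind_in by (simp add: sip.inn_add_right[OF sip_F])
  next case (8 c f g)
    obtain K where K: "K \<ge> 1" "\<And>m. m \<ge> K \<Longrightarrow> inn (F (real m)) (f m) (g m) = inn Ind f g" using Ind_inn_ev[OF 8(1,2)] by blast
    obtain N where N: "N \<ge> 1" "\<And>m. m \<ge> N \<Longrightarrow> inn (F (real m)) (f m) ((\<lambda>k\<in>{1..}. c \<odot>\<^bsub>F (real k)\<^esub> g k) m) = inn Ind f (\<lambda>k\<in>{1..}. c \<odot>\<^bsub>F (real k)\<^esub> g k)"
      using Ind_inn_ev[OF 8(1) Ind_smult[OF 8(2)]] by blast
    define m where "m = max K N"
    have m: "m \<ge> K" "m \<ge> N" "m \<ge> 1" using K(1) by (auto simp: m_def)
    show ?case unfolding K(2)[OF m(1), symmetric] N(2)[OF m(2), symmetric]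
      using m(3) 8 Ind_in by (simp add: sip.inn_smult_right[OF sip_F])
  next case (9 f)
    obtain K where K: "K \<ge> 1" "\<And>m. m \<ge> K \<Longrightarrow> inn (F (real m)) (f m) (f m) = inn Ind f f" using Ind_inn_ev[OF 9 9] by blast
    show ?case unfolding K(2)[OF order_refl, symmetric]
      by (rule sip.inn_nonneg[OF sip_F Ind_in[OF 9]]) (use K in auto)
  qed
  then show ?thesis by (simp add: ind_limit_def)
qed

abbreviation "Rb \<equiv> Rbreve E e"

lemma hilb_Rb: "hilb Rb" unfolding Rbreve_def by (rule sip.hilb_completion[OF sip_Ind])

sublocale Rb: hilb Rb by (rule hilb_Rb)

definition "inc m x = (\<lambda>k\<in>{1..}. if m \<le> k then mult_pow E e (real m) x (k - m) else \<zero>\<^bsub>F (real k)\<^esub>)"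

lemma incl_eq: "incl E e m x = to_completion Ind (inc m x)" by (simp add: incl_def inc_def)

lemma inc_in: "m \<ge> 1 \<Longrightarrow> x \<in> carrier (F (real m)) \<Longrightarrow> inc m x \<in> carrier Ind"
proof -
  assume m: "m \<ge> 1" and x: "x \<in> carrier (F (real m))"
  have "inc m x (k + 1) = aprod E (real k) 1 (inc m x k) e" if "k \<ge> m" for k
    using that m x mult_pow_Suc[of "real m" x "real k" "k - m"] by (simp add: inc_def Suc_diff_le)
  moreover have "mult_pow E e (real m) x (k - m) \<in> carrier (F (real k))" if "k \<ge> m" for k
    using that m x by (intro mult_pow_in) auto
  moreover have "\<zero>\<^bsub>F (real k)\<^esub> \<in> carrier (F (real k))" if "k \<ge> 1" for k
    using that by (intro sip.zero_in[OF sip_F]) simp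
  ultimately show ?thesis unfolding Ind_carrier using m by (auto simp: inc_def)
qed

lemma inc_isometry: "m \<ge> 1 \<Longrightarrow> lin_isometry (F (real m)) Ind (inc m)"
  unfolding lin_isometry_def
proof (intro conjI ballI allI Pi_I)
  assume m: "m \<ge> 1"
  fix x y c assume x: "x \<in> carrier (F (real m))"
  show "inc m x \<in> carrier Ind" by (rule inc_in[OF m x])
  have h: "hbdd (F (real m)) (F (real k)) (\<lambda>x. mult_pow E e (real m) x (k - m))" if "k \<ge> m" for k
    using that m by (intro mult_pow_hbdd) auto
  show "inc m (c \<odot>\<^bsub>F (real m)\<^esub> x) = c \<odot>\<^bsub>Ind\<^esub> inc m x"
    using hbdd_smult[OF h x] m
    by (auto simp: inc_def ind_limit_def fun_eq_iff sip.smult_zero_vec[OF sip_F])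
  assume y: "y \<in> carrier (F (real m))"
  show "inc m (x \<oplus>\<^bsub>F (real m)\<^esub> y) = inc m x \<oplus>\<^bsub>Ind\<^esub> inc m y"
    using hbdd_add[OF h x y] m
    by (auto simp: inc_def ind_limit_def fun_eq_iff sip.vadd_zero[OF sip_F sip.zero_in[OF sip_F]])
  obtain K where K: "K \<ge> 1" "\<And>k. k \<ge> K \<Longrightarrow> inn (F (real k)) (inc m x k) (inc m y k) = inn Ind (inc m x) (inc m y)"
    using Ind_inn_ev[OF inc_in[OF m x] inc_in[OF m y]] by blast
  show "inn Ind (inc m x) (inc m y) = inn (F (real m)) x y"
  proof -
    define N where "N = max K m"
    have N: "N \<ge> K" "m \<le> N" "N \<ge> 1" using m by (auto simp: N_def)
    show ?thesis using K(2)[OF N(1)] N(2,3) m x y by (simp add: inc_def inn_mult_pow)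
  qed
qed

lemma incl_isometry: "m \<ge> 1 \<Longrightarrow> lin_isometry (F (real m)) Rb (incl E e m)"
  using lin_isometry_comp[OF inc_isometry sip.to_completion_isometry[OF sip_Ind]]
  unfolding incl_eq[abs_def] Rbreve_def .

lemmas incl_hbdd = lin_isometry_hbdd[OF incl_isometry]
lemma incl_in: "m \<ge> 1 \<Longrightarrow> x \<in> carrier (F (real m)) \<Longrightarrow> incl E e m x \<in> carrier Rb"
  by (rule lin_isometry_in[OF incl_isometry])
lemma inn_incl: "m \<ge> 1 \<Longrightarrow> x \<in> carrier (F (real m)) \<Longrightarrow> y \<in> carrier (F (real m)) \<Longrightarrow> inn Rb (incl E e m x) (incl E e m y) = inn (F (real m)) x y"
  by (rule lin_isometry_inn[OF incl_isometry])

text \<open>Sequences that agree eventually differ by a vector of length zero, which the completion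
  divides out.\<close>

lemma to_completion_Ind_eq:
  assumes s: "s \<in> carrier Ind" and r: "r \<in> carrier Ind" and eq: "\<And>k. k \<ge> K \<Longrightarrow> s k = r k"
  shows "to_completion Ind s = to_completion Ind r"
proof -
  interpret I: sip Ind by (rule sip_Ind)
  note ti = I.to_completion_isometry[folded Rbreve_def]
  have e: "inn Ind s' r' = inn Ind s s" if sr: "s' \<in> {s, r}" "r' \<in> {s, r}" for s' r'
  proof -
    have c: "s' \<in> carrier Ind" "r' \<in> carrier Ind" using sr s r by auto
    obtain M where M: "\<And>m. m \<ge> M \<Longrightarrow> inn (F (real m)) (s' m) (r' m) = inn Ind s' r'" using Ind_inn_ev[OF c] by blast
    obtain M' where M': "\<And>m. m \<ge> M' \<Longrightarrow> inn (F (real m)) (s m) (s m) = inn Ind s s" using Ind_inn_ev[OF s s] by blast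
    define m where "m = max K (max M M')"
    have m: "m \<ge> K" "m \<ge> M" "m \<ge> M'" by (auto simp: m_def)
    show ?thesis using M[OF m(2)] M'[OF m(3)] eq[OF m(1)] sr by auto
  qed
  have "inn Ind (s \<ominus>\<^bsub>Ind\<^esub> r) (s \<ominus>\<^bsub>Ind\<^esub> r) = 0" using e[of s r] e[of r s] e[of r r] s r by simp
  then have "hnorm Ind (s \<ominus>\<^bsub>Ind\<^esub> r) = 0" by (simp add: hnorm_def)
  then have "hnorm Rb (to_completion Ind s \<ominus>\<^bsub>Rb\<^esub> to_completion Ind r) = 0"
    using lin_isometry_hnorm[OF ti I.minus_in[OF s r]] hbdd_minus[OF sip_Ind Rb.sip_axioms lin_isometry_hbdd[OF ti] s r] by simp
  then show ?thesis using Rb.eq_iff_hnorm[OF lin_isometry_in[OF ti s] lin_isometry_in[OF ti r]] by simp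
qed

lemma incl_mult_pow: "m \<ge> 1 \<Longrightarrow> x \<in> carrier (F (real m)) \<Longrightarrow> k = m + n \<Longrightarrow> incl E e k (mult_pow E e (real m) x n) = incl E e m x"
  unfolding incl_eq
proof (rule to_completion_Ind_eq[of _ _ k])
  assume a: "m \<ge> 1" "x \<in> carrier (F (real m))" "k = m + n"
  show "inc k (mult_pow E e (real m) x n) \<in> carrier Ind"
    using a by (intro inc_in mult_pow_in) auto
  show "inc k (mult_pow E e (real m) x n) j = inc m x j" if "j \<ge> k" for j
    using a that mult_pow_add[of "real m" x "real k" n "j - k"] by (simp add: inc_def)
qed (rule inc_in)

text \<open>An eventually coherent sequence has the same class as i_m of its m-th entry, for every m
  past the point of coherence. The free lower bound K lets later arguments stay at levels beyond a
  given threshold.\<close>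

lemma total_incl_ge: "total Rb {incl E e m x |m x. m \<ge> K \<and> m \<ge> 1 \<and> x \<in> carrier (F (real m))}" (is "total Rb ?A")
proof (rule Rb.total_mono[OF sip.total_to_completion[OF sip_Ind, folded Rbreve_def]])
  show "?A \<subseteq> carrier Rb" using incl_in by auto
  show "to_completion Ind ` carrier Ind \<subseteq> cspan Rb ?A"
  proof (rule image_subsetI)
    fix s assume s: "s \<in> carrier Ind"
    obtain L where L: "L \<ge> 1" "\<And>m. m \<ge> L \<Longrightarrow> s (m + 1) = aprod E (real m) 1 (s m) e" using Ind_ev[OF s] by blast
    define m where "m = max K L"
    have m: "m \<ge> K" "m \<ge> L" "m \<ge> 1" using L(1) by (auto simp: m_def)
    have sm: "s m \<in> carrier (F (real m))" by (rule Ind_in[OF s m(3)])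
    have sk: "s k = mult_pow E e (real m) (s m) (k - m)" if "k \<ge> m" for k
      using that
    proof (induction k rule: dec_induct)
      case (step k)
      have "s (k + 1) = aprod E (real k) 1 (s k) e" using L(2)[of k] step m by simp
      then show ?case using mult_pow_Suc[of "real m" "s m" "real k" "k - m"] step m sm by (simp add: Suc_diff_le)
    qed simp
    have "to_completion Ind s = incl E e m (s m)"
      unfolding incl_eq
    proof (rule to_completion_Ind_eq[OF s inc_in[OF m(3) sm], of m])
      fix k assume k: "k \<ge> m"
      have "inc m (s m) k = mult_pow E e (real m) (s m) (k - m)" using k m(3) by (simp add: inc_def)
      then show "s k = inc m (s m) k" using sk[OF k] by (rule trans[OF _ sym, rotated])
    qed
    then show "to_completion Ind s \<in> cspan Rb ?A" using incl_in[OF m(3) sm] m sm by (intro cspan.base) auto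
  qed
qed

lemma total_incl: "total Rb {incl E e m x |m x. m \<ge> 1 \<and> x \<in> carrier (F (real m))}"
  using total_incl_ge[of 1] by simp

lemma incl_raise: "m \<ge> 1 \<Longrightarrow> m \<le> k \<Longrightarrow> x \<in> carrier (F (real m)) \<Longrightarrow> incl E e m x = incl E e k (mult_pow E e (real m) x (k - m))"
  using incl_mult_pow[of m x k "k - m"] by simp

definition "rbase = (SOME u. onb Rb u)"

text \<open>Separability of the inductive limit: bases of the fibres at the positive integers give a
  countable total family.\<close>

lemma onb_rbase: "onb Rb rbase"
proof -
  let ?A = "(\<lambda>(m, i). incl E e (Suc m) (bs i (real (Suc m)))) ` UNIV"
  have "total Rb ?A"
  proof (rule Rb.total_mono[OF total_incl])
    show "?A \<subseteq> carrier Rb" using bs_in by (auto intro!: incl_in)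
    have "incl E e m x \<in> cspan Rb ?A" if m: "m \<ge> 1" and x: "x \<in> carrier (F (real m))" for m x
    proof (rule hbdd_cspan[OF sip_F Rb.sip_axioms incl_hbdd])
      show "x \<in> cspan (F (real m)) (range (\<lambda>i. bs i (real m)))" using onb_bs[of "real m"] m x by (auto simp: onb_def total_def)
      fix a assume "a \<in> range (\<lambda>i. bs i (real m))"
      then obtain i where a: "a = bs i (real m)" by blast
      have "Suc (m - 1) = m" using m by simp
      then have "incl E e m a \<in> ?A" unfolding a by (intro image_eqI[of _ _ "(m - 1, i)"]) simp_all
      moreover have "incl E e m a \<in> carrier Rb" unfolding a using m by (intro incl_in bs_in) auto
      ultimately show "incl E e m a \<in> cspan Rb ?A" by (intro cspan.base)
    qed (use m in auto)
    then show "{incl E e m x |m x. m \<ge> 1 \<and> x \<in> carrier (F (real m))} \<subseteq> cspan Rb ?A" by blast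
  qed
  moreover have "countable ?A" by simp
  ultimately show ?thesis unfolding rbase_def by (intro someI_ex[OF Rb.onb_exists])
qed

lemma tensor_pair_Rb: "t > 0 \<Longrightarrow> tensor_pair (F t) Rb"
  using sip_F Rb.sip_axioms by (simp add: tensor_pair_def)

text \<open>Both vectors are raised to the common level M = max m m', where the inner product of
  products factorises.\<close>

lemma inn_incl_aprod:
  assumes n: "t > 0" and m: "m \<ge> 1" "m' \<ge> 1" and x: "x \<in> carrier (F (real n))" "x' \<in> carrier (F (real n))" "n \<ge> 1"
    and y: "y \<in> carrier (F (real m))" "y' \<in> carrier (F (real m'))"
  shows "inn Rb (incl E e (n + m) (aprod E (real n) (real m) x y)) (incl E e (n + m') (aprod E (real n) (real m') x' y'))
    = inn (F (real n)) x x' * inn Rb (incl E e m y) (incl E e m' y')"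
proof -
  define M where "M = max m m'"
  have M: "m \<le> M" "m' \<le> M" by (auto simp: M_def)
  define z where "z = mult_pow E e (real m) y (M - m)"
  define z' where "z' = mult_pow E e (real m') y' (M - m')"
  have z: "z \<in> carrier (F (real M))" "z' \<in> carrier (F (real M))"
    unfolding z_def z'_def using m M y by (auto intro!: mult_pow_in)
  have "incl E e (n + m) (aprod E (real n) (real m) x y) = incl E e (n + M) (aprod E (real n) (real M) x z)"
    unfolding z_def using x m M y incl_raise[of "n + m" "n + M" "aprod E (real n) (real m) x y"]
    by (simp add: aprod_in aprod_mult_pow[of "real n" "real m" x y "real M" "M - m" "real n + real m"])
  moreover have "incl E e (n + m') (aprod E (real n) (real m') x' y') = incl E e (n + M) (aprod E (real n) (real M) x' z')"
    unfolding z'_def using x m M y incl_raise[of "n + m'" "n + M" "aprod E (real n) (real m') x' y'"]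
    by (simp add: aprod_in aprod_mult_pow[of "real n" "real m'" x' y' "real M" "M - m'" "real n + real m'"])
  moreover have "inn Rb (incl E e m y) (incl E e m' y') = inn (F (real M)) z z'"
    using incl_raise[OF m(1) M(1) y(1)] incl_raise[OF m(2) M(2) y(2)] m M z by (simp add: inn_incl z_def[symmetric] z'_def[symmetric])
  ultimately show ?thesis using x m M z by (simp add: inn_incl aprod_in inn_aprod)
qed

lemma wbreve_props:
  assumes n: "n \<ge> 1"
  shows "unitary (F (real n) \<otimes>\<^sub>H Rb) Rb (wbreve E e n)"
    and "m \<ge> 1 \<Longrightarrow> x \<in> carrier (F (real n)) \<Longrightarrow> y \<in> carrier (F (real m)) \<Longrightarrow>
      wbreve E e n (tens (F (real n)) Rb x (incl E e m y)) = incl E e (n + m) (aprod E (real n) (real m) x y)"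
proof -
  interpret TP: tensor_pair "F (real n)" Rb using n by (intro tensor_pair_Rb) simp
  let ?I = "{(m, x, y). m \<ge> 1 \<and> x \<in> carrier (F (real n)) \<and> y \<in> carrier (F (real m))}"
  let ?a = "\<lambda>(m, x, y). tens (F (real n)) Rb x (incl E e m y)"
  let ?b = "\<lambda>(m, x, y). incl E e (n + m) (aprod E (real n) (real m) x y)"
  interpret G: gram "F (real n) \<otimes>\<^sub>H Rb" Rb ?a ?b ?I
    using n by unfold_locales (auto simp: incl_in aprod_in inn_incl_aprod[OF zero_less_one])
  have t1: "total (F (real n) \<otimes>\<^sub>H Rb) (?a ` ?I)"
  proof -
    have "(\<lambda>(x, y). tens (F (real n)) Rb x y) ` (carrier (F (real n)) \<times> {incl E e m x |m x. m \<ge> 1 \<and> x \<in> carrier (F (real m))}) = ?a ` ?I"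
      by force
    then show ?thesis using TP.total_tens_image[OF TP.X.total_carrier total_incl] by simp
  qed
  have t2: "total Rb (?b ` ?I)"
  \<comment> \<open>From level k = n + 1 on, the complementary level k - n is at least 1, so that
    E_k is the closed span of products of E_n and E_{k-n}.\<close>
  proof (rule Rb.total_mono[OF total_incl_ge[of "n + 1"]])
    show "?b ` ?I \<subseteq> carrier Rb" using G.b_in by auto
    have "incl E e k z \<in> cspan Rb (?b ` ?I)" if k: "k \<ge> n + 1" and z: "z \<in> carrier (F (real k))" for k z
    proof (rule hbdd_cspan[OF sip_F Rb.sip_axioms incl_hbdd])
      let ?S = "(\<lambda>(x, y). aprod E (real n) (real (k - n)) x y) ` (carrier (F (real n)) \<times> carrier (F (real (k - n))))"
      have "total (F (real k)) ?S"
        using n k by (intro aprod_total sip.total_carrier[OF sip_F]) auto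
      then show "z \<in> cspan (F (real k)) ?S" using z by (auto simp: total_def)
      fix a assume "a \<in> ?S"
      then obtain x y where xy: "a = aprod E (real n) (real (k - n)) x y" "x \<in> carrier (F (real n))" "y \<in> carrier (F (real (k - n)))" by auto
      have "?b (k - n, x, y) \<in> cspan Rb (?b ` ?I)"
        by (intro cspan.base imageI G.b_in) (use xy k in auto)
      then show "incl E e k a \<in> cspan Rb (?b ` ?I)" using k by (simp add: xy(1))
    qed (use n k in auto)
    then show "{incl E e m x |m x. m \<ge> n + 1 \<and> m \<ge> 1 \<and> x \<in> carrier (F (real m))} \<subseteq> cspan Rb (?b ` ?I)" by blast
  qed
  have "\<exists>!W. W \<in> extensional (carrier (F (real n) \<otimes>\<^sub>H Rb)) \<and> unitary (F (real n) \<otimes>\<^sub>H Rb) Rb W \<and>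
        (\<forall>i\<in>?I. W (?a i) = ?b i)"
    by (rule G.unitary_ex1[OF TP.hilb_T hilb_Rb t1 t2])
  moreover have "(\<forall>i\<in>?I. W (?a i) = ?b i) \<longleftrightarrow> (\<forall>m\<ge>1. \<forall>x\<in>carrier (fib E (real n)). \<forall>y\<in>carrier (fib E (real m)).
           W (tens (fib E (real n)) (Rbreve E e) x (incl E e m y)) = incl E e (n + m) (aprod E (real n) (real m) x y))" for W
    by auto
  ultimately have ex: "\<exists>!W. W \<in> extensional (carrier (fib E (real n) \<otimes>\<^sub>H Rbreve E e)) \<and>
        unitary (fib E (real n) \<otimes>\<^sub>H Rbreve E e) (Rbreve E e) W \<and>
        (\<forall>m\<ge>1. \<forall>x\<in>carrier (fib E (real n)). \<forall>y\<in>carrier (fib E (real m)).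
           W (tens (fib E (real n)) (Rbreve E e) x (incl E e m y)) =
             incl E e (n + m) (aprod E (real n) (real m) x y))" by simp
  note w = theI'[OF ex, folded wbreve_def]
  from w show "unitary (F (real n) \<otimes>\<^sub>H Rb) Rb (wbreve E e n)" by blast
  from w show "m \<ge> 1 \<Longrightarrow> x \<in> carrier (F (real n)) \<Longrightarrow> y \<in> carrier (F (real m)) \<Longrightarrow>
      wbreve E e n (tens (F (real n)) Rb x (incl E e m y)) = incl E e (n + m) (aprod E (real n) (real m) x y)" by blast
qed

subsection \<open>Comparison of the fibres\<close>

text \<open>\<open>Psi \<beta> m\<close> is the composite of \<open>u\<^sup>*\<^sub>\<beta>\<^sub>,\<^sub>m\<close> with \<open>id \<otimes> i\<^sub>m\<close>.\<close>

definition
  "Psi \<beta> m = (SOME W. lin_isometry (F (\<beta> + real m)) (F \<beta> \<otimes>\<^sub>H Rb) W \<and>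
     (\<forall>x\<in>carrier (F \<beta>). \<forall>y\<in>carrier (F (real m)). W (aprod E \<beta> (real m) x y) = tens (F \<beta>) Rb x (incl E e m y)))"

lemma Psi_props:
  assumes b: "\<beta> > 0" and m: "m \<ge> 1"
  shows "lin_isometry (F (\<beta> + real m)) (F \<beta> \<otimes>\<^sub>H Rb) (Psi \<beta> m)"
    and "x \<in> carrier (F \<beta>) \<Longrightarrow> y \<in> carrier (F (real m)) \<Longrightarrow> Psi \<beta> m (aprod E \<beta> (real m) x y) = tens (F \<beta>) Rb x (incl E e m y)"
proof -
  have bm: "\<beta> + real m > 0" using b by simp
  interpret TP: tensor_pair "F \<beta>" Rb using b by (rule tensor_pair_Rb)
  interpret A: ips "F (\<beta> + real m)" using bm by (rule ips_F)
  let ?I = "carrier (F \<beta>) \<times> carrier (F (real m))"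
  interpret G: gram "F (\<beta> + real m)" "F \<beta> \<otimes>\<^sub>H Rb" "\<lambda>(x, y). aprod E \<beta> (real m) x y" "\<lambda>(x, y). tens (F \<beta>) Rb x (incl E e m y)" ?I
    using b m by unfold_locales (auto simp: aprod_in incl_in inn_aprod inn_incl)
  have "total (F (\<beta> + real m)) ((\<lambda>(x, y). aprod E \<beta> (real m) x y) ` ?I)"
    using b m by (intro aprod_total sip.total_carrier[OF sip_F]) auto
  from G.isometry_ex1[OF TP.hilb_T this]
  have "\<exists>W. lin_isometry (F (\<beta> + real m)) (F \<beta> \<otimes>\<^sub>H Rb) W \<and>
     (\<forall>x\<in>carrier (F \<beta>). \<forall>y\<in>carrier (F (real m)). W (aprod E \<beta> (real m) x y) = tens (F \<beta>) Rb x (incl E e m y))" by auto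
  note w = someI_ex[OF this, folded Psi_def]
  from w show "lin_isometry (F (\<beta> + real m)) (F \<beta> \<otimes>\<^sub>H Rb) (Psi \<beta> m)" by blast
  from w show "x \<in> carrier (F \<beta>) \<Longrightarrow> y \<in> carrier (F (real m)) \<Longrightarrow> Psi \<beta> m (aprod E \<beta> (real m) x y) = tens (F \<beta>) Rb x (incl E e m y)" by blast
qed

lemma Psi_in: "\<beta> > 0 \<Longrightarrow> m \<ge> 1 \<Longrightarrow> z \<in> carrier (F (\<beta> + real m)) \<Longrightarrow> Psi \<beta> m z \<in> carrier (F \<beta> \<otimes>\<^sub>H Rb)"
  by (rule lin_isometry_in[OF Psi_props(1)])

text \<open>On a product x y the factor e^n passes to y by associativity, and there i_k absorbs
  it.\<close>

lemma Psi_mult_pow: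
  assumes b: "\<beta> > 0" and m: "m \<ge> 1" and z: "z \<in> carrier (F (\<beta> + real m))" and k: "k = m + n" and r: "r = \<beta> + real m"
  shows "Psi \<beta> k (mult_pow E e r z n) = Psi \<beta> m z"
proof -
  interpret TP: tensor_pair "F \<beta>" Rb using b by (rule tensor_pair_Rb)
  have bm: "\<beta> + real m > 0" using b by simp
  show ?thesis unfolding r
  proof (rule hbdd_eq[OF sip_F[OF bm] TP.T.ips_axioms _ lin_isometry_hbdd[OF Psi_props(1)[OF b m]] _ _ z])
    show "hbdd (F (\<beta> + real m)) (F \<beta> \<otimes>\<^sub>H Rb) (\<lambda>z. Psi \<beta> k (mult_pow E e (\<beta> + real m) z n))"
      by (rule hbdd_comp[OF mult_pow_hbdd lin_isometry_hbdd[OF Psi_props(1)]]) (use b m k in auto)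
    show "total (F (\<beta> + real m)) ((\<lambda>(x, y). aprod E \<beta> (real m) x y) ` (carrier (F \<beta>) \<times> carrier (F (real m))))"
      using b m by (intro aprod_total sip.total_carrier[OF sip_F]) auto
    fix a assume "a \<in> (\<lambda>(x, y). aprod E \<beta> (real m) x y) ` (carrier (F \<beta>) \<times> carrier (F (real m)))"
    then obtain x y where a: "a = aprod E \<beta> (real m) x y" "x \<in> carrier (F \<beta>)" "y \<in> carrier (F (real m))" by auto
    have eq: "mult_pow E e (\<beta> + real m) a n = aprod E \<beta> (real k) x (mult_pow E e (real m) y n)"
      unfolding a(1) by (rule aprod_mult_pow[symmetric]) (use b m k a in auto)
    have "mult_pow E e (real m) y n \<in> carrier (F (real k))" using m k a by (intro mult_pow_in) auto
    then have "Psi \<beta> k (mult_pow E e (\<beta> + real m) a n) = tens (F \<beta>) Rb x (incl E e k (mult_pow E e (real m) y n))"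
      unfolding eq using m k by (intro Psi_props(2)[OF b _ a(2)]) auto
    also have "\<dots> = Psi \<beta> m a" using b m k a by (simp add: incl_mult_pow Psi_props(2))
    finally show "Psi \<beta> k (mult_pow E e (\<beta> + real m) a n) = Psi \<beta> m a" .
  qed
qed

text \<open>An elementary tensor x \<otimes> i_m(y) is the value at the product x y, and such
  tensors are total even if only m \<ge> K is allowed.\<close>

lemma Psi_total:
  assumes b: "\<beta> > 0"
  shows "total (F \<beta> \<otimes>\<^sub>H Rb) {Psi \<beta> m z |m z. m \<ge> K \<and> m \<ge> 1 \<and> z \<in> carrier (F (\<beta> + real m))}"
proof -
  interpret TP: tensor_pair "F \<beta>" Rb using b by (rule tensor_pair_Rb)
  let ?A = "{Psi \<beta> m z |m z. m \<ge> K \<and> m \<ge> 1 \<and> z \<in> carrier (F (\<beta> + real m))}"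
  show ?thesis
  proof (rule TP.T.total_mono[OF TP.total_tens_image[OF TP.X.total_carrier total_incl_ge[of K]]])
    show A: "?A \<subseteq> carrier (F \<beta> \<otimes>\<^sub>H Rb)" using b Psi_in by auto
    have "tens (F \<beta>) Rb x (incl E e m y) \<in> ?A" if "x \<in> carrier (F \<beta>)" "m \<ge> K" "m \<ge> 1" "y \<in> carrier (F (real m))" for x m y
      using that b Psi_props(2)[OF b that(3,1,4)] aprod_in[of \<beta> "real m" x y "\<beta> + real m"] by force
    then have "(\<lambda>(x, y). tens (F \<beta>) Rb x y) ` (carrier (F \<beta>) \<times> {incl E e m x |m x. K \<le> m \<and> 1 \<le> m \<and> x \<in> carrier (F (real m))}) \<subseteq> ?A" by auto
    also have "\<dots> \<subseteq> cspan (F \<beta> \<otimes>\<^sub>H Rb) ?A" using A by (auto intro: cspan.base)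
    finally show "(\<lambda>(x, y). tens (F \<beta>) Rb x y) ` (carrier (F \<beta>) \<times> {incl E e m x |m x. K \<le> m \<and> 1 \<le> m \<and> x \<in> carrier (F (real m))}) \<subseteq> cspan (F \<beta> \<otimes>\<^sub>H Rb) ?A" .
  qed
qed

text \<open>The third claim replaces the adjoint, the reassociation and \<open>wbreve\<close> by one
  product in E followed by \<open>Psi\<close>; it is the fibrewise link between the two
  constructions. By the second one the norm of the value depends on y through the norm of y alone,
  which later yields bounds uniform in the fibre.\<close>

lemma w_value_hbdd:
  assumes b: "\<beta> > 0" and z: "z \<in> carrier (F (\<beta> + real n))"
  shows "hbdd Rb (F \<beta> \<otimes>\<^sub>H Rb) (w_value E e \<beta> n z)"
    and "y \<in> carrier Rb \<Longrightarrow> hnorm (F \<beta> \<otimes>\<^sub>H Rb) (w_value E e \<beta> n z y) = hnorm (F (\<beta> + real n)) z * hnorm Rb y"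
    and "k \<ge> 1 \<Longrightarrow> x \<in> carrier (F (real k)) \<Longrightarrow> w_value E e \<beta> n z (incl E e k x) = Psi \<beta> (n + k) (aprod E (\<beta> + real n) (real k) z x)"
proof -
  interpret BK: tensor_pair "F \<beta>" Rb using b by (rule tensor_pair_Rb)
  have bn: "\<beta> + real n > 0" using b by simp
  have "hbdd Rb (F \<beta> \<otimes>\<^sub>H Rb) (w_value E e \<beta> n z) \<and>
    (\<forall>y\<in>carrier Rb. hnorm (F \<beta> \<otimes>\<^sub>H Rb) (w_value E e \<beta> n z y) = hnorm (F (\<beta> + real n)) z * hnorm Rb y) \<and>
    (\<forall>k\<ge>1. \<forall>x\<in>carrier (F (real k)). w_value E e \<beta> n z (incl E e k x) = Psi \<beta> (n + k) (aprod E (\<beta> + real n) (real k) z x))"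
  proof (cases "n = 0")
    case True
    then have z': "z \<in> carrier (F \<beta>)" using z by simp
    have "w_value E e \<beta> n z = tens (F \<beta>) Rb z" by (simp add: w_value_def True Let_def fun_eq_iff)
    then show ?thesis using True BK.hbdd_tens_right[OF z'] BK.hnorm_tens[OF z'] b z' Psi_props(2)[OF b] by simp
  next
    case False
    then have n: "n \<ge> 1" "real n > 0" by auto
    interpret BN: tensor_pair "F \<beta>" "F (real n)" by (rule tensor_pair_F[OF b n(2)])
    interpret NK: tensor_pair "F (real n)" Rb by (rule tensor_pair_Rb[OF n(2)])
    interpret BN_K: tensor_pair "F \<beta> \<otimes>\<^sub>H F (real n)" Rb using BN.T.sip_axioms Rb.sip_axioms by (simp add: tensor_pair_def)
    define h where "h = hadjoint (F \<beta> \<otimes>\<^sub>H F (real n)) (F (\<beta> + real n)) (umap E \<beta> (real n))"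
    define A where "A = tensor_assoc (F \<beta>) (F (real n)) Rb"
    define W where "W = id_tensor (F \<beta>) (F (real n) \<otimes>\<^sub>H Rb) Rb (wbreve E e n)"
    have w: "w_value E e \<beta> n z y = W (A (tens (F \<beta> \<otimes>\<^sub>H F (real n)) Rb (h z) y))" for z y
      using False by (simp add: w_value_def Let_def h_def A_def W_def)
    have h: "lin_isometry (F (\<beta> + real n)) (F \<beta> \<otimes>\<^sub>H F (real n)) h" unfolding h_def
      by (rule hadjoint_isometry[OF BN.T.ips_axioms sip_F[OF bn] umap_unitary[OF b n(2)]])
    have A: "lin_isometry ((F \<beta> \<otimes>\<^sub>H F (real n)) \<otimes>\<^sub>H Rb) (F \<beta> \<otimes>\<^sub>H (F (real n) \<otimes>\<^sub>H Rb)) A" unfolding A_def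
      by (rule unitary_isometry[OF tensor_assoc_props(1)[OF sip_F[OF b] sip_F[OF n(2)] Rb.sip_axioms]])
    have W: "lin_isometry (F \<beta> \<otimes>\<^sub>H (F (real n) \<otimes>\<^sub>H Rb)) (F \<beta> \<otimes>\<^sub>H Rb) W" unfolding W_def
      by (rule id_tensor_props(1)[OF sip_F[OF b] NK.T.sip_axioms Rb.sip_axioms unitary_isometry[OF wbreve_props(1)[OF n(1)]]])
    note WA = lin_isometry_comp[OF A W]
    have 1: "hbdd Rb (F \<beta> \<otimes>\<^sub>H Rb) (w_value E e \<beta> n z)"
      using hbdd_comp[OF BN_K.hbdd_tens_right[OF lin_isometry_in[OF h z]] lin_isometry_hbdd[OF WA]] by (simp add: w[abs_def])
    have 2: "hnorm (F \<beta> \<otimes>\<^sub>H Rb) (w_value E e \<beta> n z y) = hnorm (F (\<beta> + real n)) z * hnorm Rb y" if y: "y \<in> carrier Rb" for y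
      unfolding w using lin_isometry_hnorm[OF WA BN_K.tens_in[OF lin_isometry_in[OF h z] y]]
        BN_K.hnorm_tens[OF lin_isometry_in[OF h z] y] lin_isometry_hnorm[OF h z] by simp
    have 3: "w_value E e \<beta> n z (incl E e k x) = Psi \<beta> (n + k) (aprod E (\<beta> + real n) (real k) z x)"
      if k: "k \<ge> 1" and x: "x \<in> carrier (F (real k))" for k x
    \<comment> \<open>By continuity in z it is enough to take z = u v, where the adjoint of
      \<open>umap\<close> returns u \<otimes> v.\<close>
    proof (rule hbdd_eq[OF sip_F[OF bn] BK.T.ips_axioms _ _ _ _ z])
      have ix: "incl E e k x \<in> carrier Rb" by (rule incl_in[OF k x])
      show "hbdd (F (\<beta> + real n)) (F \<beta> \<otimes>\<^sub>H Rb) (\<lambda>z. w_value E e \<beta> n z (incl E e k x))" unfolding w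
        by (rule hbdd_comp[OF hbdd_comp[OF lin_isometry_hbdd[OF h] BN_K.hbdd_tens_left[OF ix]] lin_isometry_hbdd[OF WA]])
      have "hbdd (F (\<beta> + real n)) (F (\<beta> + real (n + k))) (\<lambda>z. aprod E (\<beta> + real n) (real k) z x)"
        by (rule aprod_hbdd_left) (use bn k x in auto)
      from hbdd_comp[OF this lin_isometry_hbdd[OF Psi_props(1)[OF b]]]
      show "hbdd (F (\<beta> + real n)) (F \<beta> \<otimes>\<^sub>H Rb) (\<lambda>z. Psi \<beta> (n + k) (aprod E (\<beta> + real n) (real k) z x))"
        using k by simp
      show "total (F (\<beta> + real n)) ((\<lambda>(x, y). aprod E \<beta> (real n) x y) ` (carrier (F \<beta>) \<times> carrier (F (real n))))"
        using b n by (intro aprod_total sip.total_carrier[OF sip_F]) auto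
      fix a assume "a \<in> (\<lambda>(x, y). aprod E \<beta> (real n) x y) ` (carrier (F \<beta>) \<times> carrier (F (real n)))"
      then obtain u v where a: "a = aprod E \<beta> (real n) u v" "u \<in> carrier (F \<beta>)" "v \<in> carrier (F (real n))" by auto
      have ha: "h a = tens (F \<beta>) (F (real n)) u v"
        unfolding h_def a(1) aprod_def
        by (rule hadjoint_unitary[OF BN.T.ips_axioms sip_F[OF bn] umap_unitary[OF b n(2)] BN.tens_in[OF a(2,3)]])
      have "w_value E e \<beta> n a (incl E e k x) = W (tens (F \<beta>) (F (real n) \<otimes>\<^sub>H Rb) u (tens (F (real n)) Rb v (incl E e k x)))"
        unfolding w ha A_def using tensor_assoc_props(2)[OF sip_F[OF b] sip_F[OF n(2)] Rb.sip_axioms a(2,3) ix] by simp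
      also have "\<dots> = tens (F \<beta>) Rb u (wbreve E e n (tens (F (real n)) Rb v (incl E e k x)))"
        unfolding W_def by (rule id_tensor_props(2)[OF sip_F[OF b] NK.T.sip_axioms Rb.sip_axioms unitary_isometry[OF wbreve_props(1)[OF n(1)]] a(2) NK.tens_in[OF a(3) ix]])
      also have "\<dots> = tens (F \<beta>) Rb u (incl E e (n + k) (aprod E (real n) (real k) v x))"
        unfolding wbreve_props(2)[OF n(1) k a(3) x] ..
      also have "\<dots> = Psi \<beta> (n + k) (aprod E \<beta> (real (n + k)) u (aprod E (real n) (real k) v x))"
        by (rule Psi_props(2)[OF b _ a(2), symmetric]) (use n k a x in \<open>auto intro!: aprod_in\<close>)
      also have "aprod E \<beta> (real (n + k)) u (aprod E (real n) (real k) v x) = aprod E (\<beta> + real n) (real k) a x"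
        unfolding a(1) by (rule aprod_assoc[symmetric]) (use b n k a x in auto)
      finally show "w_value E e \<beta> n a (incl E e k x) = Psi \<beta> (n + k) (aprod E (\<beta> + real n) (real k) a x)" .
    qed
    show ?thesis using 1 2 3 by blast
  qed
  then show "hbdd Rb (F \<beta> \<otimes>\<^sub>H Rb) (w_value E e \<beta> n z)"
    and "y \<in> carrier Rb \<Longrightarrow> hnorm (F \<beta> \<otimes>\<^sub>H Rb) (w_value E e \<beta> n z y) = hnorm (F (\<beta> + real n)) z * hnorm Rb y"
    and "k \<ge> 1 \<Longrightarrow> x \<in> carrier (F (real k)) \<Longrightarrow> w_value E e \<beta> n z (incl E e k x) = Psi \<beta> (n + k) (aprod E (\<beta> + real n) (real k) z x)"
    by blast+
qed

subsection \<open>The field of the first construction\<close>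

sublocale U: mfield "{0<..1}" F bs "sections E {0<..1}" by (rule mfield_sections) auto

definition "rp n \<alpha> = tens (F \<alpha>) Rb (bs (fst (prod_decode n)) \<alpha>) (rbase (snd (prod_decode n)))"

lemma R_field_eq: "R_field E e \<alpha> = F \<alpha> \<otimes>\<^sub>H Rb" by (simp add: R_field_def)

lemma rbase_in: "rbase i \<in> carrier Rb" by (rule Rb.onb_in[OF onb_rbase])

lemma inn_rp: "\<alpha> > 0 \<Longrightarrow> x \<in> carrier (F \<alpha>) \<Longrightarrow> y \<in> carrier Rb \<Longrightarrow>
  inn (R_field E e \<alpha>) (rp n \<alpha>) (tens (F \<alpha>) Rb x y) = inn (F \<alpha>) (bs (fst (prod_decode n)) \<alpha>) x * inn Rb (rbase (snd (prod_decode n))) y"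
  unfolding R_field_eq rp_def by (rule tensor_pair.inn_tens[OF tensor_pair_Rb]) (auto simp: bs_in rbase_in)

text \<open>The countable form of \<open>R_sections\<close>: coefficients are taken along one basis
  only, as \<open>mfield\<close> demands.\<close>

definition "R_sections' = {G \<in> (\<Pi>\<^sub>E \<alpha>\<in>{0<..1}. carrier (R_field E e \<alpha>)).
      \<forall>i. (\<lambda>\<alpha>. inn (R_field E e \<alpha>) (rp i \<alpha>) (G \<alpha>)) \<in> borel_measurable (restrict_space lborel {0<..1})}"

lemma mfield_R': "mfield {0<..1} (R_field E e) rp R_sections'"
proof (rule mfield.intro)
  fix \<alpha> :: real assume \<alpha>: "\<alpha> \<in> {0<..1}"
  then interpret TP: tensor_pair "F \<alpha>" Rb by (intro tensor_pair_Rb) simp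
  show "hilb (R_field E e \<alpha>)" unfolding R_field_eq by (rule TP.hilb_T)
  show "onb (R_field E e \<alpha>) (\<lambda>i. rp i \<alpha>)" unfolding R_field_eq rp_def
    using \<alpha> by (intro onb_tens sip_F onb_bs onb_rbase Rb.sip_axioms) auto
next
  fix i j
  show "(\<lambda>\<alpha>. inn (R_field E e \<alpha>) (rp i \<alpha>) (rp j \<alpha>)) \<in> borel_measurable (restrict_space lborel {0<..1})"
    using U.p_meas[of "fst (prod_decode i)" "fst (prod_decode j)"]
    by (subst measurable_cong[where g = "\<lambda>\<alpha>. inn (F \<alpha>) (bs (fst (prod_decode i)) \<alpha>) (bs (fst (prod_decode j)) \<alpha>) * inn Rb (rbase (snd (prod_decode i))) (rbase (snd (prod_decode j)))"])
      (simp_all add: rp_def[of j] inn_rp bs_in rbase_in space_restrict_space)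
qed (simp_all add: R_sections'_def)

lemma tens_in_R_sections':
  assumes h: "h \<in> sections E {0<..1}" and y: "y \<in> carrier Rb"
  shows "(\<lambda>\<alpha>\<in>{0<..1}. tens (F \<alpha>) Rb (h \<alpha>) y) \<in> R_sections'"
proof (rule mfield.MI[OF mfield_R'])
  show "tens (F \<alpha>) Rb (h \<alpha>) y \<in> carrier (R_field E e \<alpha>)" if "\<alpha> \<in> {0<..1}" for \<alpha>
    unfolding R_field_eq using that y section_in[OF h that] by (intro tensor_pair.tens_in[OF tensor_pair_Rb]) auto
  show "(\<lambda>\<alpha>. inn (R_field E e \<alpha>) (rp i \<alpha>) (tens (F \<alpha>) Rb (h \<alpha>) y)) \<in> borel_measurable (restrict_space lborel {0<..1})" for i
    using U.M_coeff[OF h, of "fst (prod_decode i)"]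
    by (subst measurable_cong[where g = "\<lambda>\<alpha>. inn (F \<alpha>) (bs (fst (prod_decode i)) \<alpha>) (h \<alpha>) * inn Rb (rbase (snd (prod_decode i))) y"])
      (simp_all add: inn_rp y section_in[OF h] space_restrict_space)
qed

text \<open>The elementary tensors h \<otimes> y are themselves measurable sections of the field
  given by the countable basis, and there inner products of measurable sections are
  measurable.\<close>

lemma R_sections_eq: "R_sections E e = R_sections'"
proof (intro equalityI subsetI)
  fix G assume G: "G \<in> R_sections E e"
  have "(\<lambda>\<alpha>. inn (R_field E e \<alpha>) (rp i \<alpha>) (G \<alpha>)) \<in> borel_measurable (restrict_space borel {0<..1})" for i
  proof -
    have "(\<lambda>\<alpha>. inn (R_field E e \<alpha>) (tens (F \<alpha>) Rb ((\<lambda>\<alpha>\<in>{0<..1}. bs (fst (prod_decode i)) \<alpha>) \<alpha>) (rbase (snd (prod_decode i)))) (G \<alpha>)) \<in> borel_measurable (restrict_space borel {0<..1})"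
      using G U.M_p[of "fst (prod_decode i)"] rbase_in unfolding R_sections_def by blast
    then show ?thesis
      by (subst (asm) measurable_cong[where g = "\<lambda>\<alpha>. inn (R_field E e \<alpha>) (rp i \<alpha>) (G \<alpha>)"]) (simp_all add: rp_def space_restrict_space)
  qed
  then show "G \<in> R_sections'" using G unfolding R_sections_def R_sections'_def borel_measurable_restrict_lborel by blast
next
  fix G assume G: "G \<in> R_sections'"
  have "(\<lambda>\<alpha>. inn (R_field E e \<alpha>) (tens (F \<alpha>) Rb (h \<alpha>) y) (G \<alpha>)) \<in> borel_measurable (restrict_space borel {0<..1})"
    if "h \<in> sections E {0<..1}" "y \<in> carrier Rb" for h y
    using mfield.inn_meas[OF mfield_R' tens_in_R_sections'[OF that] G]
    by (subst (asm) measurable_cong[where g = "\<lambda>\<alpha>. inn (R_field E e \<alpha>) (tens (F \<alpha>) Rb (h \<alpha>) y) (G \<alpha>)"])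
      (simp_all add: space_restrict_space borel_measurable_restrict_lborel)
  then show "G \<in> R_sections E e" using G unfolding R_sections_def R_sections'_def by blast
qed

sublocale RF: mfield "{0<..1}" "R_field E e" rp "R_sections E e"
  using mfield_R' by (simp add: R_sections_eq)

section \<open>Elementary tensors as square integrable sections\<close>

definition "ts f y = (\<lambda>\<alpha>\<in>{0<..1}. tens (F \<alpha>) Rb (f \<alpha>) y)"

lemma inn_tens_Rb: "\<alpha> > 0 \<Longrightarrow> x \<in> carrier (F \<alpha>) \<Longrightarrow> y \<in> carrier Rb \<Longrightarrow> x' \<in> carrier (F \<alpha>) \<Longrightarrow> y' \<in> carrier Rb \<Longrightarrow>
  inn (R_field E e \<alpha>) (tens (F \<alpha>) Rb x y) (tens (F \<alpha>) Rb x' y') = inn (F \<alpha>) x x' * inn Rb y y'"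
  unfolding R_field_eq by (rule tensor_pair.inn_tens[OF tensor_pair_Rb])

lemma hnorm_tens_Rb: "\<alpha> > 0 \<Longrightarrow> x \<in> carrier (F \<alpha>) \<Longrightarrow> y \<in> carrier Rb \<Longrightarrow>
  hnorm (R_field E e \<alpha>) (tens (F \<alpha>) Rb x y) = hnorm (F \<alpha>) x * hnorm Rb y"
  unfolding R_field_eq by (rule tensor_pair.hnorm_tens[OF tensor_pair_Rb])

lemma ts_in: "f \<in> carrier U.l2 \<Longrightarrow> y \<in> carrier Rb \<Longrightarrow> ts f y \<in> carrier RF.l2"
proof (rule RF.l2_bound)
  assume f: "f \<in> carrier U.l2" and y: "y \<in> carrier Rb"
  show "integrable (restrict_space lborel {0<..1}) (\<lambda>\<alpha>. (hnorm (F \<alpha>) (f \<alpha>))\<^sup>2 * (hnorm Rb y)\<^sup>2)"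
    using f by (simp add: U.l2_carrier)
  show "ts f y \<in> R_sections E e" unfolding ts_def R_sections_eq by (rule tens_in_R_sections'[OF U.l2_M[OF f] y])
  show "(hnorm (R_field E e \<alpha>) (ts f y \<alpha>))\<^sup>2 \<le> (hnorm (F \<alpha>) (f \<alpha>))\<^sup>2 * (hnorm Rb y)\<^sup>2" if "\<alpha> \<in> {0<..1}" for \<alpha>
    using that U.l2_in[OF f that] y by (simp add: ts_def hnorm_tens_Rb power_mult_distrib)
qed

lemma inn_ts: "f \<in> carrier U.l2 \<Longrightarrow> y \<in> carrier Rb \<Longrightarrow> f' \<in> carrier U.l2 \<Longrightarrow> y' \<in> carrier Rb \<Longrightarrow>
  inn RF.l2 (ts f y) (ts f' y') = inn U.l2 f f' * inn Rb y y'"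
proof -
  assume a: "f \<in> carrier U.l2" "y \<in> carrier Rb" "f' \<in> carrier U.l2" "y' \<in> carrier Rb"
  have "inn RF.l2 (ts f y) (ts f' y') = (\<integral>\<alpha>. inn (F \<alpha>) (f \<alpha>) (f' \<alpha>) * inn Rb y y' \<partial>restrict_space lborel {0<..1})"
    unfolding RF.l2_inn by (rule Bochner_Integration.integral_cong[OF refl]) (use a U.l2_in in \<open>simp add: ts_def inn_tens_Rb\<close>)
  then show ?thesis by (simp add: U.l2_inn)
qed

abbreviation "DE \<equiv> E_integral E 0 1"
abbreviation "DR \<equiv> RF.D"
abbreviation "R \<equiv> R_space E e"

sublocale RR: tensor_pair DE Rb using U.D.sip_axioms Rb.sip_axioms by (simp add: tensor_pair_def)

lemma hilb_R: "hilb R" unfolding R_space_def by (rule RR.hilb_T)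

sublocale R: hilb R by (rule hilb_R)

lemma R_tens_eq: "R_tens E e f y = tens DE Rb (U.L.cls f) y" by (simp add: R_tens_def U.section_class_eq)

lemma cls_in_DE: "f \<in> carrier U.l2 \<Longrightarrow> U.L.cls f \<in> carrier DE" by (rule lin_isometry_in[OF U.cls_isometry])

lemma R_tens_in: "f \<in> carrier U.l2 \<Longrightarrow> y \<in> carrier Rb \<Longrightarrow> R_tens E e f y \<in> carrier R"
  unfolding R_tens_eq R_space_def by (intro RR.tens_in cls_in_DE)

lemma inn_R_tens: "f \<in> carrier U.l2 \<Longrightarrow> y \<in> carrier Rb \<Longrightarrow> f' \<in> carrier U.l2 \<Longrightarrow> y' \<in> carrier Rb \<Longrightarrow>
  inn R (R_tens E e f y) (R_tens E e f' y') = inn U.l2 f f' * inn Rb y y'"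
  unfolding R_tens_eq R_space_def by (simp add: cls_in_DE lin_isometry_inn[OF U.cls_isometry])

lemma total_R_tens:
  assumes "total Rb B" shows "total R ((\<lambda>(f, y). R_tens E e f y) ` (carrier U.l2 \<times> B))"
proof -
  have "(\<lambda>(f, y). R_tens E e f y) ` (carrier U.l2 \<times> B) = (\<lambda>(x, y). tens DE Rb x y) ` (carrier DE \<times> B)"
    unfolding U.D_carrier by (force simp: R_tens_eq)
  then show ?thesis using RR.total_tens_image[OF U.D.total_carrier assms] by (simp add: R_space_def)
qed

lemma cls_RF_in: "f \<in> carrier RF.l2 \<Longrightarrow> RF.L.cls f \<in> carrier DR" by (rule lin_isometry_in[OF RF.cls_isometry])

lemma hnorm_bs: "\<alpha> > 0 \<Longrightarrow> hnorm (F \<alpha>) (bs i \<alpha>) \<le> 1"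
  using onb_bs[of \<alpha>] unfolding onb_def hnorm_def by (metis Re_complex_of_real of_real_0 of_real_1 order_refl real_sqrt_one real_sqrt_zero zero_le_one)

lemma mult_bs_in:
  assumes c: "c \<in> borel_measurable (restrict_space lborel {0<..1})" "integrable (restrict_space lborel {0<..1}) (\<lambda>\<alpha>. (cmod (c \<alpha>))\<^sup>2)"
  shows "(\<lambda>\<alpha>\<in>{0<..1}. c \<alpha> \<odot>\<^bsub>F \<alpha>\<^esub> bs i \<alpha>) \<in> carrier U.l2"
proof (rule U.l2_bound[OF c(2)])
  show "(\<lambda>\<alpha>\<in>{0<..1}. c \<alpha> \<odot>\<^bsub>F \<alpha>\<^esub> bs i \<alpha>) \<in> sections E {0<..1}"
    using U.M_mult[OF U.M_p c(1), of i] by (simp cong: restrict_cong)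
  fix \<alpha> :: real assume \<alpha>: "\<alpha> \<in> {0<..1}"
  have "(hnorm (F \<alpha>) (bs i \<alpha>))\<^sup>2 \<le> 1" using hnorm_bs[of \<alpha> i] sip.hnorm_nonneg[OF sip_F bs_in] \<alpha> by (simp add: power_le_one)
  then show "(hnorm (F \<alpha>) ((\<lambda>\<alpha>\<in>{0<..1}. c \<alpha> \<odot>\<^bsub>F \<alpha>\<^esub> bs i \<alpha>) \<alpha>))\<^sup>2 \<le> (cmod (c \<alpha>))\<^sup>2"
    using \<alpha> by (simp add: sip.hnorm_smult[OF sip_F bs_in] power_mult_distrib mult_left_le)
qed

text \<open>A scalar function times a basis tensor is again an elementary tensor, the scalar being
  moved into the first factor; this is the shape that \<open>D_total\<close> asks for.\<close>

lemma total_ts: "total DR ((\<lambda>(f, y). RF.L.cls (ts f y)) ` (carrier U.l2 \<times> carrier Rb))"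
proof (rule RF.D_total[where q = rp and B = "\<lambda>_. 1"])
  show "restrict (rp k) {0<..1} \<in> R_sections E e" for k by (rule RF.M_p)
  show "hnorm (R_field E e \<alpha>) (rp k \<alpha>) \<le> 1" if "\<alpha> \<in> {0<..1}" for k \<alpha>
    using RF.onb_p[OF that] unfolding onb_def hnorm_def by (metis Re_complex_of_real of_real_0 of_real_1 order_refl real_sqrt_one real_sqrt_zero zero_le_one)
  show "total (R_field E e \<alpha>) (range (\<lambda>k. rp k \<alpha>))" if "\<alpha> \<in> {0<..1}" for \<alpha>
    using RF.onb_p[OF that] by (simp add: onb_def)
  show "(\<lambda>(f, y). RF.L.cls (ts f y)) ` (carrier U.l2 \<times> carrier Rb) \<subseteq> carrier DR"
    using cls_RF_in ts_in by auto
  fix k and c :: "real \<Rightarrow> complex"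
  assume c: "c \<in> borel_measurable (restrict_space lborel {0<..1})" "integrable (restrict_space lborel {0<..1}) (\<lambda>\<alpha>. (cmod (c \<alpha>))\<^sup>2)"
  let ?i = "fst (prod_decode k)" and ?j = "snd (prod_decode k)"
  define f where "f = (\<lambda>\<alpha>\<in>{0<..1}. c \<alpha> \<odot>\<^bsub>F \<alpha>\<^esub> bs ?i \<alpha>)"
  have f: "f \<in> carrier U.l2" unfolding f_def by (rule mult_bs_in[OF c])
  have "(\<lambda>\<alpha>\<in>{0<..1}. c \<alpha> \<odot>\<^bsub>R_field E e \<alpha>\<^esub> rp k \<alpha>) = ts f (rbase ?j)"
    unfolding ts_def rp_def f_def R_field_eq
    by (rule restrict_ext) (simp add: hbdd_smult[OF tensor_pair.hbdd_tens_left[OF tensor_pair_Rb rbase_in] bs_in])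
  then show "RF.L.cls (\<lambda>\<alpha>\<in>{0<..1}. c \<alpha> \<odot>\<^bsub>R_field E e \<alpha>\<^esub> rp k \<alpha>) \<in> (\<lambda>(f, y). RF.L.cls (ts f y)) ` (carrier U.l2 \<times> carrier Rb)"
    using f rbase_in by auto
qed

lemma R_ident_props:
  shows "unitary R DR (R_ident E e)"
    and "f \<in> carrier U.l2 \<Longrightarrow> y \<in> carrier Rb \<Longrightarrow> R_ident E e (R_tens E e f y) = RF.L.cls (ts f y)"
proof -
  let ?I = "carrier U.l2 \<times> carrier Rb"
  interpret G: gram R DR "\<lambda>(f, y). R_tens E e f y" "\<lambda>(f, y). RF.L.cls (ts f y)" ?I
    by unfold_locales (auto simp: R_tens_in cls_RF_in ts_in inn_R_tens lin_isometry_inn[OF RF.cls_isometry] inn_ts)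
  have "\<exists>!W. W \<in> extensional (carrier R) \<and> unitary R DR W \<and> (\<forall>i\<in>?I. W ((\<lambda>(f, y). R_tens E e f y) i) = (\<lambda>(f, y). RF.L.cls (ts f y)) i)"
    by (rule G.unitary_ex1[OF hilb_R RF.hilb_D total_R_tens[OF Rb.total_carrier] total_ts])
  then have ex: "\<exists>!J. J \<in> extensional (carrier (R_space E e)) \<and>
        unitary (R_space E e) (direct_integral {0<..1} (R_field E e) (R_sections E e)) J \<and>
        (\<forall>f\<in>E_l2 E 0 1. \<forall>y\<in>carrier (Rbreve E e).
           J (R_tens E e f y) =
             section_class {0<..1} (R_field E e) (R_sections E e)
               (\<lambda>\<alpha>\<in>{0<..1}. tens (fib E \<alpha>) (Rbreve E e) (f \<alpha>) y))"
    by (simp add: RF.section_class_eq ts_def)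
  note w = theI'[OF ex, folded R_ident_def]
  from w show "unitary R DR (R_ident E e)" by blast
  from w show "f \<in> carrier U.l2 \<Longrightarrow> y \<in> carrier Rb \<Longrightarrow> R_ident E e (R_tens E e f y) = RF.L.cls (ts f y)"
    unfolding RF.section_class_eq ts_def by blast
qed

end

section \<open>The second construction\<close>

subsection \<open>Integrals of eventually periodic functions\<close>

lemma set_integral_shift:
  fixes f :: "real \<Rightarrow> 'b::{banach, second_countable_topology}"
  shows "(LINT \<alpha>:{a + t<..b + t}|lborel. f \<alpha>) = (LINT \<alpha>:{a<..b}|lborel. f (\<alpha> + t))"
proof -
  have "(LINT \<alpha>:{a + t<..b + t}|lborel. f \<alpha>) = (\<integral>x. indicator {a + t<..b + t} (t + 1 * x) *\<^sub>R f (t + 1 * x) \<partial>lborel)"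
    unfolding set_lebesgue_integral_def by (subst lborel_integral_real_affine[of 1 _ t]) simp_all
  also have "\<dots> = (LINT \<alpha>:{a<..b}|lborel. f (\<alpha> + t))" unfolding set_lebesgue_integral_def
    by (rule Bochner_Integration.integral_cong[OF refl]) (simp add: indicator_def add.commute)
  finally show ?thesis .
qed

lemma set_integrable_shift:
  fixes f :: "real \<Rightarrow> 'b::{banach, second_countable_topology}"
  shows "set_integrable lborel {a + t<..b + t} f \<longleftrightarrow> set_integrable lborel {a<..b} (\<lambda>\<alpha>. f (\<alpha> + t))"
proof -
  have "set_integrable lborel {a + t<..b + t} f \<longleftrightarrow> integrable lborel (\<lambda>x. indicator {a + t<..b + t} (t + 1 * x) *\<^sub>R f (t + 1 * x))"
    unfolding set_integrable_def by (subst lborel_integrable_real_affine_iff[of 1 _ t]) simp_all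
  also have "\<dots> \<longleftrightarrow> set_integrable lborel {a<..b} (\<lambda>\<alpha>. f (\<alpha> + t))" unfolding set_integrable_def
    by (rule Bochner_Integration.integrable_cong[OF refl]) (simp add: indicator_def add.commute)
  finally show ?thesis .
qed

text \<open>For the antiderivative J, periodicity gives J(b+1) - J(a+1) = J(b) - J(a); rearranged,
  this is equality of the integrals over windows of length one.\<close>

lemma periodic_integral:
  fixes f :: "real \<Rightarrow> complex"
  assumes int: "\<And>T. T > 0 \<Longrightarrow> set_integrable lborel {0<..T} f"
    and per: "\<And>\<alpha>. \<alpha> \<ge> c \<Longrightarrow> f (\<alpha> + 1) = f \<alpha>" and c: "c \<ge> 0" and ab: "a \<ge> c" "b \<ge> c"
  shows "(LINT \<alpha>:{a<..a+1}|lborel. f \<alpha>) = (LINT \<alpha>:{b<..b+1}|lborel. f \<alpha>)"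
proof -
  define J where "J a = (LINT \<alpha>:{0<..a}|lborel. f \<alpha>)" for a
  have I: "set_integrable lborel {a<..b} f" if "0 \<le> a" for a b
    by (rule set_integrable_subset[OF int[of "max b 1"]]) (use that in auto)
  have J: "(LINT \<alpha>:{a<..b}|lborel. f \<alpha>) = J b - J a" if "0 \<le> a" "a \<le> b" for a b
  proof -
    have "{0<..b} = {0<..a} \<union> {a<..b}" using that by auto
    then have "J b = J a + (LINT \<alpha>:{a<..b}|lborel. f \<alpha>)"
      unfolding J_def by (simp only:) (rule set_integral_Un, use that I in auto)
    then show ?thesis by simp
  qed
  have *: "J (b + 1) - J b = J (a + 1) - J a" if "c \<le> a" "a \<le> b" for a b
  proof -
    have "(LINT \<alpha>:{a+1<..b+1}|lborel. f \<alpha>) = (LINT \<alpha>:{a<..b}|lborel. f \<alpha>)"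
      unfolding set_integral_shift by (rule set_lebesgue_integral_cong) (use that per in auto)
    then have "J (b + 1) - J (a + 1) = J b - J a" using J[of "a+1" "b+1"] J[of a b] that c by simp
    then show ?thesis by (simp add: algebra_simps)
  qed
  show ?thesis
    using J[of a "a+1"] J[of b "b+1"] *[of a b] *[of b a] ab c by (cases "a \<le> b") auto
qed

context arveson_unit
begin

subsection \<open>The space of sections\<close>

abbreviation "S \<equiv> S_space E e"
abbreviation "Sec \<equiv> sections E {0<..}"
abbreviation "L2 J \<equiv> l2_sections J F (sections E J)"

sublocale P: mfield "{0<..}" F bs Sec by (rule mfield_sections) auto

lemma restrict_l2:
  assumes f: "f \<in> Sec" and J: "J \<in> sets borel" "J \<subseteq> {0<..}"
  shows "restrict f J \<in> carrier (L2 J) \<longleftrightarrow> set_integrable lborel J (\<lambda>\<alpha>. (hnorm (F \<alpha>) (f \<alpha>))\<^sup>2)"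
proof -
  interpret J: mfield J F bs "sections E J" by (rule mfield_sections[OF J])
  have "integrable (restrict_space lborel J) (\<lambda>\<alpha>. (hnorm (F \<alpha>) (restrict f J \<alpha>))\<^sup>2) \<longleftrightarrow> integrable (restrict_space lborel J) (\<lambda>\<alpha>. (hnorm (F \<alpha>) (f \<alpha>))\<^sup>2)"
    by (rule Bochner_Integration.integrable_cong[OF refl]) simp
  then show ?thesis unfolding J.l2_carrier J.set_integrable_iff using sections_restrict[OF f _ _ J] by auto
qed

lemma restrict_l2D:
  assumes "f \<in> Sec" "restrict f {0<..T} \<in> carrier (L2 {0<..T})"
  shows "set_integrable lborel {0<..T} (\<lambda>\<alpha>. (hnorm (F \<alpha>) (f \<alpha>))\<^sup>2)"
  by (rule restrict_l2[THEN iffD1, OF assms(1) _ _ assms(2)]) auto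

lemma S_carrier: "f \<in> carrier S \<longleftrightarrow> f \<in> Sec \<and> (\<forall>T>0. set_integrable lborel {0<..T} (\<lambda>\<alpha>. (hnorm (fib E \<alpha>) (f \<alpha>))\<^sup>2)) \<and>
          (\<exists>\<alpha>0>0. \<forall>\<alpha>\<ge>\<alpha>0. f (\<alpha> + 1) = aprod E \<alpha> 1 (f \<alpha>) e)"
  by (simp add: S_space_def)

lemma S_Sec: "f \<in> carrier S \<Longrightarrow> f \<in> Sec" by (simp add: S_carrier)
lemma S_in: "f \<in> carrier S \<Longrightarrow> \<alpha> > 0 \<Longrightarrow> f \<alpha> \<in> carrier (F \<alpha>)" using section_in[OF S_Sec] by simp

lemma S_ev:
  assumes "f \<in> carrier S"
  shows "\<exists>K::nat. K \<ge> 1 \<and> (\<forall>\<alpha>\<ge>real K. f (\<alpha> + 1) = aprod E \<alpha> 1 (f \<alpha>) e)"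
proof -
  obtain a where a: "a > 0" "\<And>\<alpha>. \<alpha> \<ge> a \<Longrightarrow> f (\<alpha> + 1) = aprod E \<alpha> 1 (f \<alpha>) e" using assms by (auto simp: S_carrier)
  obtain K :: nat where K: "a < real K" using reals_Archimedean2 by blast
  have "K \<ge> 1" using K a(1) by (cases K) auto
  then show ?thesis using K a(2) by (intro exI[of _ K]) auto
qed

lemma S_l2:
  assumes f: "f \<in> carrier S" and ab: "0 \<le> a"
  shows "restrict f {a<..b} \<in> carrier (L2 {a<..b})"
proof -
  have "set_integrable lborel {0<..max b 1} (\<lambda>\<alpha>. (hnorm (F \<alpha>) (f \<alpha>))\<^sup>2)" using f by (simp add: S_carrier)
  then have "set_integrable lborel {a<..b} (\<lambda>\<alpha>. (hnorm (F \<alpha>) (f \<alpha>))\<^sup>2)"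
    by (rule set_integrable_subset) (use ab in auto)
  then show ?thesis using ab by (subst restrict_l2[OF S_Sec[OF f]]) auto
qed

lemma mfield_interval: "0 \<le> a \<Longrightarrow> mfield {a<..b} F bs (sections E {a<..b})"
  by (rule mfield_sections) auto

lemma S_int:
  assumes f: "f \<in> carrier S" and g: "g \<in> carrier S" and ab: "0 \<le> a"
  shows "set_integrable lborel {a<..b} (\<lambda>\<alpha>. inn (F \<alpha>) (f \<alpha>) (g \<alpha>))"
proof -
  interpret J: mfield "{a<..b}" F bs "sections E {a<..b}" by (rule mfield_interval[OF ab])
  show ?thesis unfolding J.set_integrable_iff
    using J.l2_integrable[OF S_l2[OF f ab] S_l2[OF g ab]]
    by (subst (asm) Bochner_Integration.integrable_cong[OF refl, where g = "\<lambda>\<alpha>. inn (F \<alpha>) (f \<alpha>) (g \<alpha>)"]) simp_all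
qed

lemma S_inn_l2:
  assumes ab: "0 \<le> a"
  shows "inn (L2 {a<..b}) (restrict f {a<..b}) (restrict g {a<..b}) = (LINT \<alpha>:{a<..b}|lborel. inn (F \<alpha>) (f \<alpha>) (g \<alpha>))"
proof -
  interpret J: mfield "{a<..b}" F bs "sections E {a<..b}" by (rule mfield_interval[OF ab])
  show ?thesis unfolding J.l2_inn J.set_integral_eq by (rule Bochner_Integration.integral_cong[OF refl]) simp
qed

lemma S_inn_ev:
  assumes f: "f \<in> carrier S" and g: "g \<in> carrier S"
  shows "\<exists>K::nat. K \<ge> 1 \<and> (\<forall>a\<ge>real K. (LINT \<alpha>:{a<..a + 1}|lborel. inn (F \<alpha>) (f \<alpha>) (g \<alpha>)) = inn S f g)"
proof -
  obtain K where K: "K \<ge> 1" "\<And>\<alpha>. \<alpha> \<ge> real K \<Longrightarrow> f (\<alpha> + 1) = aprod E \<alpha> 1 (f \<alpha>) e" using S_ev[OF f] by blast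
  obtain L where L: "L \<ge> 1" "\<And>\<alpha>. \<alpha> \<ge> real L \<Longrightarrow> g (\<alpha> + 1) = aprod E \<alpha> 1 (g \<alpha>) e" using S_ev[OF g] by blast
  define N where "N = max K L"
  have N: "N \<ge> 1" "real N \<ge> real K" "real N \<ge> real L" using K(1) by (auto simp: N_def)
  have per: "inn (F (\<alpha> + 1)) (f (\<alpha> + 1)) (g (\<alpha> + 1)) = inn (F \<alpha>) (f \<alpha>) (g \<alpha>)" if "\<alpha> \<ge> real N" for \<alpha>
  proof -
    have a: "\<alpha> \<ge> real K" "\<alpha> \<ge> real L" "\<alpha> > 0" using that N by auto
    show ?thesis unfolding K(2)[OF a(1)] L(2)[OF a(2)] using a(3) S_in[OF f a(3)] S_in[OF g a(3)] e_in
      by (simp add: inn_aprod inn_e)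
  qed
  have c: "(LINT \<alpha>:{a<..a + 1}|lborel. inn (F \<alpha>) (f \<alpha>) (g \<alpha>)) = (LINT \<alpha>:{real N<..real N + 1}|lborel. inn (F \<alpha>) (f \<alpha>) (g \<alpha>))"
    if "a \<ge> real N" for a
    by (rule periodic_integral[of _ "real N"]) (use that per in \<open>auto intro: S_int[OF f g]\<close>)
  have i: "inn S f g = (LINT \<alpha>:{real N<..real N + 1}|lborel. inn (F \<alpha>) (f \<alpha>) (g \<alpha>))"
    unfolding S_space_def mk_hspace_simps by (rule lim_eventually_const[of N]) (rule c, simp)
  show ?thesis unfolding i using N(1) c by blast
qed

lemma S_inn_ev_l2:
  assumes f: "f \<in> carrier S" and g: "g \<in> carrier S"
  shows "\<exists>K::nat. \<forall>m\<ge>K. inn (L2 {real m<..real m + 1}) (restrict f {real m<..real m + 1}) (restrict g {real m<..real m + 1}) = inn S f g"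
proof -
  obtain K where K: "\<And>a. a \<ge> real K \<Longrightarrow> (LINT \<alpha>:{a<..a + 1}|lborel. inn (F \<alpha>) (f \<alpha>) (g \<alpha>)) = inn S f g"
    using S_inn_ev[OF f g] by blast
  show ?thesis by (rule exI[of _ K]) (simp add: S_inn_l2 K)
qed

lemma S_add:
  assumes f: "f \<in> carrier S" and g: "g \<in> carrier S"
  shows "(\<lambda>\<alpha>\<in>{0<..}. f \<alpha> \<oplus>\<^bsub>F \<alpha>\<^esub> g \<alpha>) \<in> carrier S" (is "?h \<in> _")
proof -
  obtain K where K: "K \<ge> 1" "\<And>\<alpha>. \<alpha> \<ge> real K \<Longrightarrow> f (\<alpha> + 1) = aprod E \<alpha> 1 (f \<alpha>) e" using S_ev[OF f] by blast
  obtain L where L: "L \<ge> 1" "\<And>\<alpha>. \<alpha> \<ge> real L \<Longrightarrow> g (\<alpha> + 1) = aprod E \<alpha> 1 (g \<alpha>) e" using S_ev[OF g] by blast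
  have h: "?h \<in> Sec" by (rule P.M_add[OF S_Sec[OF f] S_Sec[OF g]])
  have "set_integrable lborel {0<..T} (\<lambda>\<alpha>. (hnorm (F \<alpha>) (?h \<alpha>))\<^sup>2)" if "T > 0" for T
  proof -
    interpret J: mfield "{0<..T}" F bs "sections E {0<..T}" by (rule mfield_interval) simp
    have "(\<lambda>\<alpha>\<in>{0<..T}. restrict f {0<..T} \<alpha> \<oplus>\<^bsub>F \<alpha>\<^esub> restrict g {0<..T} \<alpha>) \<in> carrier J.l2"
      by (rule J.l2_add[OF S_l2[OF f] S_l2[OF g]]) auto
    moreover have "(\<lambda>\<alpha>\<in>{0<..T}. restrict f {0<..T} \<alpha> \<oplus>\<^bsub>F \<alpha>\<^esub> restrict g {0<..T} \<alpha>) = restrict ?h {0<..T}"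
      by (rule restrict_ext) auto
    ultimately have "restrict ?h {0<..T} \<in> carrier J.l2" by (simp only:)
    then show ?thesis by (rule restrict_l2D[OF h])
  qed
  moreover have "?h (\<alpha> + 1) = aprod E \<alpha> 1 (?h \<alpha>) e" if "\<alpha> \<ge> real (max K L)" for \<alpha>
  proof -
    have a: "\<alpha> \<ge> real K" "\<alpha> \<ge> real L" "\<alpha> > 0" using that K(1) by auto
    have h: "hbdd (F \<alpha>) (F (\<alpha> + 1)) (\<lambda>x. aprod E \<alpha> 1 x e)" by (rule aprod_hbdd_left) (use a(3) e_in in auto)
    show ?thesis using K(2)[OF a(1)] L(2)[OF a(2)] a(3) hbdd_add[OF h S_in[OF f a(3)] S_in[OF g a(3)]] by simp
  qed
  ultimately show ?thesis unfolding S_carrier using h K(1) by (intro conjI allI impI exI[of _ "real (max K L)"]) auto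
qed

lemma S_smult:
  assumes f: "f \<in> carrier S"
  shows "(\<lambda>\<alpha>\<in>{0<..}. c \<odot>\<^bsub>F \<alpha>\<^esub> f \<alpha>) \<in> carrier S" (is "?h \<in> _")
proof -
  obtain K where K: "K \<ge> 1" "\<And>\<alpha>. \<alpha> \<ge> real K \<Longrightarrow> f (\<alpha> + 1) = aprod E \<alpha> 1 (f \<alpha>) e" using S_ev[OF f] by blast
  have h: "?h \<in> Sec" by (rule P.M_smult[OF S_Sec[OF f]])
  have "set_integrable lborel {0<..T} (\<lambda>\<alpha>. (hnorm (F \<alpha>) (?h \<alpha>))\<^sup>2)" if "T > 0" for T
  proof -
    interpret J: mfield "{0<..T}" F bs "sections E {0<..T}" by (rule mfield_interval) simp
    have "(\<lambda>\<alpha>\<in>{0<..T}. c \<odot>\<^bsub>F \<alpha>\<^esub> restrict f {0<..T} \<alpha>) \<in> carrier J.l2"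
      by (rule J.l2_smult[OF S_l2[OF f]]) auto
    moreover have "(\<lambda>\<alpha>\<in>{0<..T}. c \<odot>\<^bsub>F \<alpha>\<^esub> restrict f {0<..T} \<alpha>) = restrict ?h {0<..T}"
      by (rule restrict_ext) auto
    ultimately have "restrict ?h {0<..T} \<in> carrier J.l2" by (simp only:)
    then show ?thesis by (rule restrict_l2D[OF h])
  qed
  moreover have "?h (\<alpha> + 1) = aprod E \<alpha> 1 (?h \<alpha>) e" if "\<alpha> \<ge> real K" for \<alpha>
  proof -
    have a: "\<alpha> > 0" using that K(1) by auto
    have h: "hbdd (F \<alpha>) (F (\<alpha> + 1)) (\<lambda>x. aprod E \<alpha> 1 x e)" by (rule aprod_hbdd_left) (use a e_in in auto)
    show ?thesis using K(2)[OF that] a hbdd_smult[OF h S_in[OF f a]] by simp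
  qed
  ultimately show ?thesis unfolding S_carrier using h K(1) by (intro conjI allI impI exI[of _ "real K"]) auto
qed

lemma aprod_zero: "t > 0 \<Longrightarrow> s > 0 \<Longrightarrow> y \<in> carrier (F s) \<Longrightarrow> r = t + s \<Longrightarrow> aprod E t s \<zero>\<^bsub>F t\<^esub> y = \<zero>\<^bsub>F r\<^esub>"
proof -
  assume a: "t > 0" "s > 0" "y \<in> carrier (F s)" "r = t + s"
  then interpret A: sip "F t" by (intro sip_F) simp
  interpret B: sip "F r" using a by (intro sip_F) simp
  note h = aprod_hbdd_left[OF a]
  show ?thesis using hbdd_smult[OF h A.zero_in, of 0] B.vsmult_zero[OF hbdd_in[OF h A.zero_in]] A.vsmult_zero[OF A.zero_in] by simp
qed

lemma S_zero: "(\<lambda>\<alpha>\<in>{0<..}. \<zero>\<^bsub>F \<alpha>\<^esub>) \<in> carrier S"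
proof -
  have "set_integrable lborel {0<..T} (\<lambda>\<alpha>. (hnorm (F \<alpha>) ((\<lambda>\<alpha>\<in>{0<..}. \<zero>\<^bsub>F \<alpha>\<^esub>) \<alpha>))\<^sup>2)" for T
  proof -
    have "(\<lambda>x. indicator {0<..T} x *\<^sub>R (hnorm (F x) ((\<lambda>\<alpha>\<in>{0<..}. \<zero>\<^bsub>F \<alpha>\<^esub>) x))\<^sup>2) = (\<lambda>_. 0)"
      by (auto simp: indicator_def fun_eq_iff sip.hnorm_zero[OF sip_F])
    then show ?thesis unfolding set_integrable_def by simp
  qed
  then show ?thesis unfolding S_carrier using P.M_zero e_in by (auto intro!: exI[of _ 1] simp: aprod_zero)
qed

lemma restrict_S_ops:
  assumes "0 \<le> a"
  shows "restrict (\<lambda>\<alpha>\<in>{0<..}. f \<alpha> \<oplus>\<^bsub>F \<alpha>\<^esub> g \<alpha>) {a<..b} = restrict f {a<..b} \<oplus>\<^bsub>L2 {a<..b}\<^esub> restrict g {a<..b}"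
    "restrict (\<lambda>\<alpha>\<in>{0<..}. c \<odot>\<^bsub>F \<alpha>\<^esub> f \<alpha>) {a<..b} = c \<odot>\<^bsub>L2 {a<..b}\<^esub> restrict f {a<..b}"
proof -
  interpret J: mfield "{a<..b}" F bs "sections E {a<..b}" by (rule mfield_interval[OF assms])
  show "restrict (\<lambda>\<alpha>\<in>{0<..}. f \<alpha> \<oplus>\<^bsub>F \<alpha>\<^esub> g \<alpha>) {a<..b} = restrict f {a<..b} \<oplus>\<^bsub>L2 {a<..b}\<^esub> restrict g {a<..b}"
    unfolding J.l2_simps by (rule restrict_ext) (use assms in auto)
  show "restrict (\<lambda>\<alpha>\<in>{0<..}. c \<odot>\<^bsub>F \<alpha>\<^esub> f \<alpha>) {a<..b} = c \<odot>\<^bsub>L2 {a<..b}\<^esub> restrict f {a<..b}"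
    unfolding J.l2_simps by (rule restrict_ext) (use assms in auto)
qed

lemma sip_S: "sip S"
proof -
  let ?J = "\<lambda>m::nat. {real m<..real m + 1}"
  have sl: "sip (L2 (?J m))" for m by (rule mfield.sip_l2[OF mfield_interval]) simp
  have l2: "restrict f (?J m) \<in> carrier (L2 (?J m))" if "f \<in> carrier S" for f m using S_l2[OF that] by simp
  have ro: "restrict (\<lambda>\<alpha>\<in>{0<..}. f \<alpha> \<oplus>\<^bsub>F \<alpha>\<^esub> g \<alpha>) (?J m) = restrict f (?J m) \<oplus>\<^bsub>L2 (?J m)\<^esub> restrict g (?J m)"
    "restrict (\<lambda>\<alpha>\<in>{0<..}. c \<odot>\<^bsub>F \<alpha>\<^esub> f \<alpha>) (?J m) = c \<odot>\<^bsub>L2 (?J m)\<^esub> restrict f (?J m)" for f g c m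
    by (rule restrict_S_ops; simp)+
  have "sip (mk_hspace (carrier S) (\<lambda>k\<in>{0<..}. \<zero>\<^bsub>F k\<^esub>) (\<lambda>f g. \<lambda>k\<in>{0<..}. f k \<oplus>\<^bsub>F k\<^esub> g k) (\<lambda>c f. \<lambda>k\<in>{0<..}. c \<odot>\<^bsub>F k\<^esub> f k) (inn S))"
  proof (rule sip_pointwise, goal_cases)
    case (1 k) then show ?case by (intro sip_F) simp
  next case 2 show ?case using S_Sec by (auto simp: sections_def)
  next case 3 show ?case by (rule S_zero)
  next case (4 f g) then show ?case by (rule S_add)
  next case (5 c f) then show ?case by (rule S_smult)
  next case (6 f g)
    obtain K where K: "\<And>m. m \<ge> K \<Longrightarrow> inn (L2 (?J m)) (restrict f (?J m)) (restrict g (?J m)) = inn S f g" using S_inn_ev_l2[OF 6] by blast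
    obtain L where L: "\<And>m. m \<ge> L \<Longrightarrow> inn (L2 (?J m)) (restrict g (?J m)) (restrict f (?J m)) = inn S g f" using S_inn_ev_l2[OF 6(2,1)] by blast
    define m where "m = max K L"
    have m: "m \<ge> K" "m \<ge> L" by (auto simp: m_def)
    show ?case unfolding K[OF m(1), symmetric] L[OF m(2), symmetric]
      by (rule sip.inn_cnj[OF sl l2[OF 6(1)] l2[OF 6(2)]])
  next case (7 f g h)
    obtain K where K: "\<And>m. m \<ge> K \<Longrightarrow> inn (L2 (?J m)) (restrict f (?J m)) (restrict g (?J m)) = inn S f g" using S_inn_ev_l2[OF 7(1,2)] by blast
    obtain L where L: "\<And>m. m \<ge> L \<Longrightarrow> inn (L2 (?J m)) (restrict f (?J m)) (restrict h (?J m)) = inn S f h" using S_inn_ev_l2[OF 7(1,3)] by blast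
    obtain N where N: "\<And>m. m \<ge> N \<Longrightarrow> inn (L2 (?J m)) (restrict f (?J m)) (restrict (\<lambda>k\<in>{0<..}. g k \<oplus>\<^bsub>F k\<^esub> h k) (?J m)) = inn S f (\<lambda>k\<in>{0<..}. g k \<oplus>\<^bsub>F k\<^esub> h k)"
      using S_inn_ev_l2[OF 7(1) S_add[OF 7(2,3)]] by blast
    define m where "m = max (max K L) N"
    have m: "m \<ge> K" "m \<ge> L" "m \<ge> N" by (auto simp: m_def)
    show ?case unfolding K[OF m(1), symmetric] L[OF m(2), symmetric] N[OF m(3), symmetric] ro(1)
      by (rule sip.inn_add_right[OF sl l2[OF 7(1)] l2[OF 7(2)] l2[OF 7(3)]])
  next case (8 c f g)
    obtain K where K: "\<And>m. m \<ge> K \<Longrightarrow> inn (L2 (?J m)) (restrict f (?J m)) (restrict g (?J m)) = inn S f g" using S_inn_ev_l2[OF 8(1,2)] by blast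
    obtain N where N: "\<And>m. m \<ge> N \<Longrightarrow> inn (L2 (?J m)) (restrict f (?J m)) (restrict (\<lambda>k\<in>{0<..}. c \<odot>\<^bsub>F k\<^esub> g k) (?J m)) = inn S f (\<lambda>k\<in>{0<..}. c \<odot>\<^bsub>F k\<^esub> g k)"
      using S_inn_ev_l2[OF 8(1) S_smult[OF 8(2)]] by blast
    define m where "m = max K N"
    have m: "m \<ge> K" "m \<ge> N" by (auto simp: m_def)
    show ?case unfolding K[OF m(1), symmetric] N[OF m(2), symmetric] ro(2)
      by (rule sip.inn_smult_right[OF sl l2[OF 8(1)] l2[OF 8(2)]])
  next case (9 f)
    obtain K where K: "\<And>m. m \<ge> K \<Longrightarrow> inn (L2 (?J m)) (restrict f (?J m)) (restrict f (?J m)) = inn S f f" using S_inn_ev_l2[OF 9 9] by blast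
    show ?case unfolding K[OF order_refl, symmetric] by (rule sip.inn_nonneg[OF sl l2[OF 9]])
  qed
  then show ?thesis by (simp add: S_space_def)
qed

sublocale S: sip S by (rule sip_S)

text \<open>Since the window integrals are eventually constant, length zero means vanishing almost
  everywhere in every late window, and countably many windows cover a half-line.\<close>

lemma N_space_eq: "N_space E e = null_vecs S"
proof -
  have "(\<exists>\<alpha>0>0. AE \<alpha> in lborel. \<alpha> \<ge> \<alpha>0 \<longrightarrow> f \<alpha> = \<zero>\<^bsub>F \<alpha>\<^esub>) \<longleftrightarrow> inn S f f = 0" if f: "f \<in> carrier S" for f
  proof -
    obtain K where K: "\<And>m. m \<ge> K \<Longrightarrow> inn (L2 {real m<..real m + 1}) (restrict f {real m<..real m + 1}) (restrict f {real m<..real m + 1}) = inn S f f"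
      using S_inn_ev_l2[OF f f] by blast
    have ae: "inn S f f = 0 \<longleftrightarrow> (AE \<alpha> in lborel. \<alpha> \<in> {real m<..real m + 1} \<longrightarrow> f \<alpha> = \<zero>\<^bsub>F \<alpha>\<^esub>)" if "m \<ge> K" for m
    proof -
      interpret J: mfield "{real m<..real m + 1}" F bs "sections E {real m<..real m + 1}" by (rule mfield_interval) simp
      have l: "restrict f {real m<..real m + 1} \<in> carrier J.l2" using S_l2[OF f] by simp
      have "inn S f f = 0 \<longleftrightarrow> restrict f {real m<..real m + 1} \<in> null_vecs J.l2" using K[OF that] l by (simp add: null_vecs_def)
      also have "\<dots> \<longleftrightarrow> (AE \<alpha> in lborel. \<alpha> \<in> {real m<..real m + 1} \<longrightarrow> restrict f {real m<..real m + 1} \<alpha> = \<zero>\<^bsub>F \<alpha>\<^esub>)"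
        using l by (simp add: J.ae_null_eq[symmetric] ae_null_sections_def)
      also have "\<dots> \<longleftrightarrow> (AE \<alpha> in lborel. \<alpha> \<in> {real m<..real m + 1} \<longrightarrow> f \<alpha> = \<zero>\<^bsub>F \<alpha>\<^esub>)"
        by (rule AE_cong) auto
      finally show ?thesis .
    qed
    show ?thesis
    proof
      assume "\<exists>\<alpha>0>0. AE \<alpha> in lborel. \<alpha> \<ge> \<alpha>0 \<longrightarrow> f \<alpha> = \<zero>\<^bsub>F \<alpha>\<^esub>"
      then obtain a where a: "a > 0" "AE \<alpha> in lborel. \<alpha> \<ge> a \<longrightarrow> f \<alpha> = \<zero>\<^bsub>F \<alpha>\<^esub>" by blast
      obtain n :: nat where n: "a < real n" using reals_Archimedean2 by blast
      have "AE \<alpha> in lborel. \<alpha> \<in> {real (max K n)<..real (max K n) + 1} \<longrightarrow> f \<alpha> = \<zero>\<^bsub>F \<alpha>\<^esub>"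
        using a(2) by eventually_elim (use n in auto)
      then show "inn S f f = 0" using ae[of "max K n"] by simp
    next
      assume "inn S f f = 0"
      then have "\<forall>m. AE \<alpha> in lborel. m \<ge> K \<longrightarrow> \<alpha> \<in> {real m<..real m + 1} \<longrightarrow> f \<alpha> = \<zero>\<^bsub>F \<alpha>\<^esub>"
        using ae by (metis (mono_tags, lifting) AE_I2 eventually_mono)
      then have "AE \<alpha> in lborel. \<forall>m. m \<ge> K \<longrightarrow> \<alpha> \<in> {real m<..real m + 1} \<longrightarrow> f \<alpha> = \<zero>\<^bsub>F \<alpha>\<^esub>"
        unfolding AE_all_countable .
      then have "AE \<alpha> in lborel. \<alpha> \<ge> real K + 1 \<longrightarrow> f \<alpha> = \<zero>\<^bsub>F \<alpha>\<^esub>"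
      proof eventually_elim
        case (elim \<alpha>)
        show ?case
        proof
          assume \<alpha>: "\<alpha> \<ge> real K + 1"
          \<comment> \<open>The windows are open on the left and closed on the right, hence the
            ceiling minus one.\<close>
          define m where "m = nat (\<lceil>\<alpha>\<rceil> - 1)"
          have "real m = of_int \<lceil>\<alpha>\<rceil> - 1" using \<alpha> by (simp add: m_def)
          then have "m \<ge> K" "\<alpha> \<in> {real m<..real m + 1}" using \<alpha> ceiling_correct[of \<alpha>] by (linarith | auto)+
          then show "f \<alpha> = \<zero>\<^bsub>F \<alpha>\<^esub>" using elim by blast
        qed
      qed
      then show "\<exists>\<alpha>0>0. AE \<alpha> in lborel. \<alpha> \<ge> \<alpha>0 \<longrightarrow> f \<alpha> = \<zero>\<^bsub>F \<alpha>\<^esub>" by (intro exI[of _ "real K + 1"]) auto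
    qed
  qed
  then show ?thesis unfolding N_space_def null_vecs_def by blast
qed

abbreviation "Q \<equiv> qspace S (null_vecs S)"
abbreviation "H \<equiv> H_space E e"

lemma H_eq: "H = completion Q" by (simp add: H_space_def N_space_eq)
lemma hilb_H: "hilb H" unfolding H_eq by (rule sip.hilb_completion[OF S.sip_qspace])

sublocale HH: hilb H by (rule hilb_H)

lemma H_class_eq: "H_class E e f = to_completion Q (S.cls f)" by (simp add: H_class_def N_space_eq S.cls_def)

lemma H_class_isometry: "lin_isometry S H (H_class E e)"
  using lin_isometry_comp[OF S.cls_isometry sip.to_completion_isometry[OF S.sip_qspace]]
  unfolding H_class_eq[abs_def] H_eq .

lemma total_H_class: "total H (H_class E e ` carrier S)"
proof -
  have "H_class E e ` carrier S = to_completion Q ` carrier Q" unfolding S.qspace_carrier by (auto simp: H_class_eq)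
  then show ?thesis using sip.total_to_completion[OF S.sip_qspace] by (simp add: H_eq)
qed

lemma H_class_in: "f \<in> carrier S \<Longrightarrow> H_class E e f \<in> carrier H" by (rule lin_isometry_in[OF H_class_isometry])
lemma inn_H_class: "f \<in> carrier S \<Longrightarrow> g \<in> carrier S \<Longrightarrow> inn H (H_class E e f) (H_class E e g) = inn S f g"
  by (rule lin_isometry_inn[OF H_class_isometry])

subsection \<open>Shifts\<close>

lemma shift_in:
  assumes t: "t > 0" and x: "x \<in> carrier (F t)" and f: "f \<in> carrier S"
  shows "shift_section E t x f \<in> carrier S" (is "?h \<in> _")
proof -
  have "(\<lambda>\<gamma>\<in>{t<..}. aprod E t (\<gamma> - t) x (f (\<gamma> - t))) \<in> sections E {t<..}"
    by (rule aprod_section_left[OF S_Sec[OF f] _ _ t x]) auto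
  from sections_extend[OF this] have "(\<lambda>\<alpha>\<in>{0<..}. if \<alpha> \<in> {t<..} then (\<lambda>\<gamma>\<in>{t<..}. aprod E t (\<gamma> - t) x (f (\<gamma> - t))) \<alpha> else \<zero>\<^bsub>F \<alpha>\<^esub>) \<in> Sec"
    using t by auto
  also have "(\<lambda>\<alpha>\<in>{0<..}. if \<alpha> \<in> {t<..} then (\<lambda>\<gamma>\<in>{t<..}. aprod E t (\<gamma> - t) x (f (\<gamma> - t))) \<alpha> else \<zero>\<^bsub>F \<alpha>\<^esub>) = ?h"
    unfolding shift_section_def by (rule restrict_ext) auto
  finally have h: "?h \<in> Sec" .
  have "set_integrable lborel {0<..T} (\<lambda>\<alpha>. (hnorm (F \<alpha>) (?h \<alpha>))\<^sup>2)" if T: "T > 0" for T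
  proof -
    have "set_integrable lborel {0 + t<..T + t} (\<lambda>\<alpha>. (hnorm (F (\<alpha> - t)) (f (\<alpha> - t)))\<^sup>2)"
      unfolding set_integrable_shift using f T by (simp add: S_carrier)
    then have "set_integrable lborel {t<..T} (\<lambda>\<alpha>. (hnorm (F (\<alpha> - t)) (f (\<alpha> - t)))\<^sup>2)"
      by (rule set_integrable_subset) (use t in auto)
    then have "set_integrable lborel {t<..T} (\<lambda>\<alpha>. (hnorm (F t) x)\<^sup>2 * (hnorm (F (\<alpha> - t)) (f (\<alpha> - t)))\<^sup>2)" by simp
    moreover have "indicator {t<..T} \<alpha> *\<^sub>R ((hnorm (F t) x)\<^sup>2 * (hnorm (F (\<alpha> - t)) (f (\<alpha> - t)))\<^sup>2) =
        indicator {0<..T} \<alpha> *\<^sub>R (hnorm (F \<alpha>) (?h \<alpha>))\<^sup>2" for \<alpha>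
      using t x S_in[OF f, of "\<alpha> - t"] sip.hnorm_zero[OF sip_F, of \<alpha>]
      by (auto simp: indicator_def shift_section_def hnorm_aprod power_mult_distrib)
    ultimately show ?thesis unfolding set_integrable_def by simp
  qed
  moreover obtain K where K: "K \<ge> 1" "\<And>\<alpha>. \<alpha> \<ge> real K \<Longrightarrow> f (\<alpha> + 1) = aprod E \<alpha> 1 (f \<alpha>) e" using S_ev[OF f] by blast
  moreover have "?h (\<alpha> + 1) = aprod E \<alpha> 1 (?h \<alpha>) e" if "\<alpha> \<ge> real K + t" for \<alpha>
  proof -
    have a: "\<alpha> - t \<ge> real K" "\<alpha> - t > 0" using that K(1) by auto
    have "?h (\<alpha> + 1) = aprod E t (\<alpha> - t + 1) x (f ((\<alpha> - t) + 1))" using a t by (simp add: shift_section_def algebra_simps)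
    also have "\<dots> = aprod E t (\<alpha> - t + 1) x (aprod E (\<alpha> - t) 1 (f (\<alpha> - t)) e)" unfolding K(2)[OF a(1)] ..
    also have "\<dots> = aprod E \<alpha> 1 (aprod E t (\<alpha> - t) x (f (\<alpha> - t))) e"
      by (rule aprod_assoc[symmetric]) (use t a x e_in S_in[OF f a(2)] in auto)
    also have "aprod E t (\<alpha> - t) x (f (\<alpha> - t)) = ?h \<alpha>" using a t by (simp add: shift_section_def)
    finally show ?thesis .
  qed
  ultimately show ?thesis unfolding S_carrier using h t by (intro conjI allI impI exI[of _ "real K + t"]) auto
qed

text \<open>The window at a + t for the shifted sections corresponds to the window at a for the
  original ones, and the integrand picks up the constant \<langle>x,x'\<rangle>.\<close>

lemma inn_shift:
  assumes t: "t > 0" and x: "x \<in> carrier (F t)" "x' \<in> carrier (F t)" and f: "f \<in> carrier S" "f' \<in> carrier S"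
  shows "inn S (shift_section E t x f) (shift_section E t x' f') = inn (F t) x x' * inn S f f'"
proof -
  obtain K where K: "K \<ge> 1" "\<And>a. a \<ge> real K \<Longrightarrow> (LINT \<alpha>:{a<..a + 1}|lborel. inn (F \<alpha>) (f \<alpha>) (f' \<alpha>)) = inn S f f'"
    using S_inn_ev[OF f] by blast
  obtain L where L: "L \<ge> 1" "\<And>a. a \<ge> real L \<Longrightarrow> (LINT \<alpha>:{a<..a + 1}|lborel. inn (F \<alpha>) (shift_section E t x f \<alpha>) (shift_section E t x' f' \<alpha>)) = inn S (shift_section E t x f) (shift_section E t x' f')"
    using S_inn_ev[OF shift_in[OF t x(1) f(1)] shift_in[OF t x(2) f(2)]] by blast
  define a where "a = real (max K L)"
  have a: "a \<ge> real K" "a + t \<ge> real L" "a > 0" using t K(1) by (auto simp: a_def)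
  have "inn S (shift_section E t x f) (shift_section E t x' f') = (LINT \<alpha>:{a + t<..(a + 1) + t}|lborel. inn (F \<alpha>) (shift_section E t x f \<alpha>) (shift_section E t x' f' \<alpha>))"
    using L(2)[OF a(2)] by (simp add: algebra_simps)
  also have "\<dots> = (LINT \<alpha>:{a<..a + 1}|lborel. inn (F t) x x' * inn (F \<alpha>) (f \<alpha>) (f' \<alpha>))"
    unfolding set_integral_shift
  proof (rule set_lebesgue_integral_cong)
    show "\<forall>\<alpha>. \<alpha> \<in> {a<..a + 1} \<longrightarrow> inn (F (\<alpha> + t)) (shift_section E t x f (\<alpha> + t)) (shift_section E t x' f' (\<alpha> + t)) = inn (F t) x x' * inn (F \<alpha>) (f \<alpha>) (f' \<alpha>)"
    proof (intro allI impI)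
      fix \<alpha> assume "\<alpha> \<in> {a<..a + 1}"
      then have \<alpha>: "\<alpha> > 0" using a(3) by simp
      show "inn (F (\<alpha> + t)) (shift_section E t x f (\<alpha> + t)) (shift_section E t x' f' (\<alpha> + t)) = inn (F t) x x' * inn (F \<alpha>) (f \<alpha>) (f' \<alpha>)"
        using \<alpha> t x S_in[OF f(1) \<alpha>] S_in[OF f(2) \<alpha>] by (simp add: shift_section_def inn_aprod)
    qed
  qed simp
  also have "\<dots> = inn (F t) x x' * inn S f f'" using K(2)[OF a(1)] by simp
  finally show ?thesis .
qed

lemma tensor_pair_H: "t > 0 \<Longrightarrow> tensor_pair (F t) H"
  using sip_F HH.sip_axioms by (simp add: tensor_pair_def)

lemma v_map_props:
  assumes t: "t > 0"
  shows "lin_isometry (F t \<otimes>\<^sub>H H) H (v_map E e t)"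
    and "x \<in> carrier (F t) \<Longrightarrow> f \<in> carrier S \<Longrightarrow> v_map E e t (tens (F t) H x (H_class E e f)) = H_class E e (shift_section E t x f)"
proof -
  interpret TP: tensor_pair "F t" H by (rule tensor_pair_H[OF t])
  let ?I = "carrier (F t) \<times> carrier S"
  interpret G: gram "F t \<otimes>\<^sub>H H" H "\<lambda>(x, f). tens (F t) H x (H_class E e f)" "\<lambda>(x, f). H_class E e (shift_section E t x f)" ?I
    using t by unfold_locales (auto simp: H_class_in shift_in inn_H_class inn_shift)
  have "(\<lambda>(x, f). tens (F t) H x (H_class E e f)) ` ?I = (\<lambda>(x, h). tens (F t) H x h) ` (carrier (F t) \<times> H_class E e ` carrier S)"
    by force
  then have tot: "total (F t \<otimes>\<^sub>H H) ((\<lambda>(x, f). tens (F t) H x (H_class E e f)) ` ?I)"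
    using TP.total_tens_image[OF TP.X.total_carrier total_H_class] by simp
  have ex: "\<exists>!W. W \<in> extensional (carrier (fib E t \<otimes>\<^sub>H H_space E e)) \<and>
        lin_isometry (fib E t \<otimes>\<^sub>H H_space E e) (H_space E e) W \<and>
        (\<forall>x\<in>carrier (fib E t). \<forall>f\<in>carrier (S_space E e).
           W (tens (fib E t) (H_space E e) x (H_class E e f)) = H_class E e (shift_section E t x f))"
    using G.isometry_ex1[OF hilb_H tot] by simp
  note w = theI'[OF ex, folded v_map_def]
  from w show "lin_isometry (F t \<otimes>\<^sub>H H) H (v_map E e t)" by blast
  from w show "x \<in> carrier (F t) \<Longrightarrow> f \<in> carrier S \<Longrightarrow> v_map E e t (tens (F t) H x (H_class E e f)) = H_class E e (shift_section E t x f)" by blast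
qed

subsection \<open>Eventually periodic extensions\<close>

end

lemma unit_index_eq: "\<alpha> - of_int n \<in> {0<..1} \<Longrightarrow> unit_index \<alpha> = n"
  unfolding unit_index_def
proof (rule the_equality)
  fix k :: int assume a: "\<alpha> - of_int n \<in> {0<..1}" "\<alpha> - of_int k \<in> {0<..1}"
  then have "of_int k < (of_int n :: real) + 1" "of_int n < (of_int k :: real) + 1" by auto
  then show "k = n" by linarith
qed

context arveson_unit
begin

lemma tilde_eq:
  assumes "\<alpha> \<in> {real m + real n<..real m + real n + 1}"
  shows "tilde E e m g \<alpha> = mult_pow E e (\<alpha> - real n) (g (\<alpha> - real n)) n"
proof -
  have "unit_index \<alpha> = int (m + n)" using assms by (intro unit_index_eq) auto
  then show ?thesis using assms by (simp add: tilde_def Let_def nat_add_distrib)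
qed

lemma piece_ex:
  assumes "\<alpha> > real m" obtains n where "\<alpha> \<in> {real m + real n<..real m + real n + 1}"
proof -
  define n where "n = nat (\<lceil>\<alpha> - real m\<rceil> - 1)"
  have "real n = of_int \<lceil>\<alpha> - real m\<rceil> - 1" using assms by (simp add: n_def)
  then show ?thesis using that[of n] ceiling_correct[of "\<alpha> - real m"] by auto
qed

text \<open>At \<alpha> = m the relation fails in general, since \<open>tilde\<close> vanishes there
  but takes the value g(m + 1) one step later; the closed half-line from m + 1 avoids this
  point.\<close>

lemma tilde_step:
  assumes gin: "\<And>\<alpha>. \<alpha> \<in> {real m<..real m + 1} \<Longrightarrow> g \<alpha> \<in> carrier (F \<alpha>)" and a: "\<alpha> \<ge> real m + 1"
  shows "tilde E e m g (\<alpha> + 1) = aprod E \<alpha> 1 (tilde E e m g \<alpha>) e"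
proof -
  obtain n where n: "\<alpha> \<in> {real m + real n<..real m + real n + 1}" using piece_ex[of m \<alpha>] a by auto
  have n': "\<alpha> + 1 \<in> {real m + real (Suc n)<..real m + real (Suc n) + 1}" using n by auto
  have gc: "g (\<alpha> - real n) \<in> carrier (F (\<alpha> - real n))" using n by (intro gin) auto
  have "tilde E e m g (\<alpha> + 1) = mult_pow E e (\<alpha> - real n) (g (\<alpha> - real n)) (Suc n)" unfolding tilde_eq[OF n'] by simp
  also have "\<dots> = aprod E \<alpha> 1 (mult_pow E e (\<alpha> - real n) (g (\<alpha> - real n)) n) e"
    by (rule mult_pow_Suc[OF _ gc]) (use n a in auto)
  finally show ?thesis unfolding tilde_eq[OF n] .
qed

lemma tilde_in:
  assumes g: "g \<in> carrier (L2 {real m<..real m + 1})"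
  shows "tilde E e m g \<in> carrier S" (is "?h \<in> _")
proof -
  interpret J: mfield "{real m<..real m + 1}" F bs "sections E {real m<..real m + 1}" by (rule mfield_interval) simp
  have gs: "g \<in> sections E {real m<..real m + 1}" by (rule J.l2_M[OF g])
  have gin: "g \<alpha> \<in> carrier (F \<alpha>)" if "\<alpha> \<in> {real m<..real m + 1}" for \<alpha> by (rule section_in[OF gs that])
  \<comment> \<open>Piece 0 is where the section vanishes, piece Suc n the n-th translate of the
    initial interval; there the section is g for n = 0 and a product with the fixed vector e^n
    otherwise.\<close>
  let ?A = "\<lambda>k. case k of 0 \<Rightarrow> {0<..real m} | Suc n \<Rightarrow> {real m + real n<..real m + real n + 1}"
  have cov: "{0<..} = (\<Union>k. ?A k)"
  proof (intro equalityI subsetI)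
    fix \<alpha> :: real assume "\<alpha> \<in> {0<..}"
    show "\<alpha> \<in> (\<Union>k. ?A k)"
    proof (cases "\<alpha> \<le> real m")
      case True
      then show ?thesis using \<open>\<alpha> \<in> {0<..}\<close> by (intro UN_I[of 0]) auto
    next
      case False
      then obtain n where "\<alpha> \<in> {real m + real n<..real m + real n + 1}" using piece_ex[of m \<alpha>] by auto
      then show ?thesis by (intro UN_I[of "Suc n"]) auto
    qed
  next
    fix \<alpha> assume "\<alpha> \<in> (\<Union>k. ?A k)"
    then obtain k where "\<alpha> \<in> ?A k" by blast
    then show "\<alpha> \<in> {0<..}" by (cases k) auto
  qed
  have "restrict ?h {0<..} \<in> Sec"
  proof (rule sections_UN[OF _ _ cov])
    show "?A k \<in> sets borel" for k by (cases k) auto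
    show "restrict ?h (?A k) \<in> sections E (?A k)" for k
    proof (cases k)
      case 0
      have "restrict ?h {0<..real m} = (\<lambda>\<alpha>\<in>{0<..real m}. \<zero>\<^bsub>F \<alpha>\<^esub>)" by (rule restrict_ext) (simp add: tilde_def)
      moreover have "(\<lambda>\<alpha>\<in>{0<..real m}. \<zero>\<^bsub>F \<alpha>\<^esub>) \<in> sections E {0<..real m}" by (rule sections_zero) auto
      ultimately show ?thesis using 0 by simp
    next
      case (Suc n)
      show ?thesis
      proof (cases "n = 0")
        case True
        have "restrict ?h {real m<..real m + 1} = restrict g {real m<..real m + 1}"
          by (rule restrict_ext) (use tilde_eq[of _ m 0 g] in simp)
        then show ?thesis using Suc True gs section_ext[OF gs] by (simp add: extensional_restrict)
      next
        case False
        let ?P = "{real m + real n<..real m + real n + 1}"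
        have "(\<lambda>\<gamma>\<in>?P. aprod E (\<gamma> - real n) (real n) (g (\<gamma> - real n)) (epow E e n)) \<in> sections E ?P"
          by (rule aprod_section_right[OF gs]) (use False epow_in[of n] in auto)
        also have "(\<lambda>\<gamma>\<in>?P. aprod E (\<gamma> - real n) (real n) (g (\<gamma> - real n)) (epow E e n)) = restrict ?h ?P"
          by (rule restrict_ext) (use tilde_eq[of _ m n g] False in \<open>simp add: mult_pow_def\<close>)
        finally show ?thesis unfolding Suc nat.case .
      qed
    qed
  qed auto
  moreover have "restrict ?h {0<..} = ?h" by (simp add: tilde_def)
  ultimately have h: "?h \<in> Sec" by simp
  have hn: "hnorm (F \<alpha>) (?h \<alpha>) = hnorm (F (\<alpha> - real n)) (g (\<alpha> - real n))" if \<alpha>: "\<alpha> \<in> {real m + real n<..real m + real n + 1}" for \<alpha> n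
    unfolding tilde_eq[OF \<alpha>] by (rule hnorm_mult_pow) (use \<alpha> in \<open>auto intro!: gin\<close>)
  have "set_integrable lborel {0<..T} (\<lambda>\<alpha>. (hnorm (F \<alpha>) (?h \<alpha>))\<^sup>2)" if T: "T > 0" for T
  proof -
    have p: "set_integrable lborel (?A k) (\<lambda>\<alpha>. (hnorm (F \<alpha>) (?h \<alpha>))\<^sup>2)" for k
    proof (cases k)
      case 0
      have "(\<lambda>x. indicator {0<..real m} x *\<^sub>R (hnorm (F x) (?h x))\<^sup>2) = (\<lambda>_. 0)"
        by (auto simp: indicator_def fun_eq_iff tilde_def sip.hnorm_zero[OF sip_F])
      then show ?thesis using 0 unfolding set_integrable_def by simp
    next
      case (Suc n)
      have "set_integrable lborel {real m<..real m + 1} (\<lambda>\<alpha>. (hnorm (F \<alpha>) (g \<alpha>))\<^sup>2)"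
        using g by (simp add: J.l2_carrier J.set_integrable_iff)
      then have "set_integrable lborel {real m + real n<..real m + 1 + real n} (\<lambda>\<alpha>. (hnorm (F (\<alpha> - real n)) (g (\<alpha> - real n)))\<^sup>2)"
        unfolding set_integrable_shift by simp
      then have "set_integrable lborel {real m + real n<..real m + real n + 1} (\<lambda>\<alpha>. (hnorm (F (\<alpha> - real n)) (g (\<alpha> - real n)))\<^sup>2)"
        by (simp add: algebra_simps)
      then have "set_integrable lborel {real m + real n<..real m + real n + 1} (\<lambda>\<alpha>. (hnorm (F \<alpha>) (?h \<alpha>))\<^sup>2)"
        by (subst set_integrable_cong[OF refl refl]) (use hn in auto)
      then show ?thesis using Suc by simp
    qed
    \<comment> \<open>A bounded interval is covered by finitely many pieces, on each of which the
      integral is finite.\<close>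
    obtain N :: nat where N: "T < real N" using reals_Archimedean2 by blast
    have "set_integrable lborel (\<Union>k\<in>{..Suc N}. ?A k) (\<lambda>\<alpha>. (hnorm (F \<alpha>) (?h \<alpha>))\<^sup>2)"
    proof (rule set_integrable_UN)
      show "?A k \<in> sets lborel" for k by (cases k) auto
    qed (use p in auto)
    then show ?thesis
    proof (rule set_integrable_subset)
      show "{0<..T} \<subseteq> (\<Union>k\<in>{..Suc N}. ?A k)"
      proof
        fix \<alpha> assume \<alpha>: "\<alpha> \<in> {0<..T}"
        then have "\<alpha> \<in> (\<Union>k. ?A k)" unfolding cov[symmetric] by simp
        then obtain k where k: "\<alpha> \<in> ?A k" by blast
        have "k \<le> Suc N"
        proof (cases k)
          case (Suc n)
          then have "real m + real n < \<alpha>" using k by simp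
          then have "real n < real N" using \<alpha> N by auto
          then show ?thesis using Suc by simp
        qed simp
        then show "\<alpha> \<in> (\<Union>k\<in>{..Suc N}. ?A k)" using k by blast
      qed
    qed simp
  qed
  moreover have "?h (\<alpha> + 1) = aprod E \<alpha> 1 (?h \<alpha>) e" if "\<alpha> \<ge> real m + 1" for \<alpha>
    by (rule tilde_step[OF gin that])
  ultimately show ?thesis unfolding S_carrier using h by (intro conjI allI impI exI[of _ "real m + 1"]) auto
qed

section \<open>Comparison of the two constructions\<close>

text \<open>The threshold is an integer m \<ge> 1 so that E_m and i_m are available; \<beta> + m
  lies past it for every \<beta> in (0,1].\<close>

definition "periodic_from m f \<longleftrightarrow> m \<ge> 1 \<and> (\<forall>\<alpha>\<ge>real m. f (\<alpha> + 1) = aprod E \<alpha> 1 (f \<alpha>) e)" for m :: nat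

lemma periodic_from_mono: "periodic_from m f \<Longrightarrow> m \<le> n \<Longrightarrow> periodic_from n f" by (auto simp: periodic_from_def)

lemma periodic_from_ex: "f \<in> carrier S \<Longrightarrow> \<exists>m. periodic_from m f" using S_ev[of f] by (auto simp: periodic_from_def)

lemma periodic_from_step: "periodic_from m f \<Longrightarrow> \<alpha> \<ge> real m \<Longrightarrow> f (\<alpha> + 1) = aprod E \<alpha> 1 (f \<alpha>) e" by (simp add: periodic_from_def)

text \<open>A section that is eventually periodic yields a section of the field \<^const>\<open>R_field\<close>; since
  \<open>f(\<alpha> + 1) = f(\<alpha>) e\<close> is divided out by \<open>Psi\<close>, the choice of \<open>m\<close> is immaterial.\<close>

definition "Tsec f = (\<lambda>\<beta>\<in>{0<..1}. let m = (SOME m. periodic_from m f) in Psi \<beta> m (f (\<beta> + real m)))"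

lemma Psi_periodic_from:
  assumes f: "f \<in> carrier S" and m: "periodic_from m f" and b: "\<beta> > 0" and mn: "m \<le> n"
  shows "Psi \<beta> n (f (\<beta> + real n)) = Psi \<beta> m (f (\<beta> + real m))"
  using mn
proof (induction n rule: dec_induct)
  case (step n)
  have n: "n \<ge> 1" "\<beta> + real n \<ge> real m" "\<beta> + real n > 0" using step m b by (auto simp: periodic_from_def)
  have "f (\<beta> + real (Suc n)) = f ((\<beta> + real n) + 1)" by (simp add: algebra_simps)
  also have "\<dots> = aprod E (\<beta> + real n) 1 (f (\<beta> + real n)) e" by (rule periodic_from_step[OF m n(2)])
  also have "\<dots> = mult_pow E e (\<beta> + real n) (f (\<beta> + real n)) 1" by (simp add: mult_pow_def)
  finally have "Psi \<beta> (Suc n) (f (\<beta> + real (Suc n))) = Psi \<beta> (Suc n) (mult_pow E e (\<beta> + real n) (f (\<beta> + real n)) 1)" by simp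
  also have "\<dots> = Psi \<beta> n (f (\<beta> + real n))" by (rule Psi_mult_pow[OF b n(1) S_in[OF f n(3)]]) auto
  finally show ?case using step.IH by simp
qed simp

lemma Tsec_eq:
  assumes f: "f \<in> carrier S" and m: "periodic_from m f" and b: "\<beta> \<in> {0<..1}"
  shows "Tsec f \<beta> = Psi \<beta> m (f (\<beta> + real m))"
proof -
  define k where "k = (SOME m. periodic_from m f)"
  have k: "periodic_from k f" unfolding k_def by (rule someI[of "\<lambda>m. periodic_from m f", OF m])
  have b0: "\<beta> > 0" using b by simp
  have "Psi \<beta> k (f (\<beta> + real k)) = Psi \<beta> (max k m) (f (\<beta> + real (max k m)))"
    by (rule Psi_periodic_from[OF f k b0, symmetric]) simp
  also have "\<dots> = Psi \<beta> m (f (\<beta> + real m))" by (rule Psi_periodic_from[OF f m b0]) simp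
  finally show ?thesis using b by (simp add: Tsec_def Let_def k_def[symmetric])
qed

lemma Tsec_fibre:
  assumes f: "f \<in> carrier S" "periodic_from m f" and b: "\<beta> \<in> {0<..1}"
  shows "Tsec f \<beta> \<in> carrier (R_field E e \<beta>)"
    and "g \<in> carrier S \<Longrightarrow> periodic_from m g \<Longrightarrow> inn (R_field E e \<beta>) (Tsec f \<beta>) (Tsec g \<beta>) = inn (F (\<beta> + real m)) (f (\<beta> + real m)) (g (\<beta> + real m))"
proof -
  have b0: "\<beta> > 0" "m \<ge> 1" "\<beta> + real m > 0" using b f(2) by (auto simp: periodic_from_def)
  show "Tsec f \<beta> \<in> carrier (R_field E e \<beta>)"
    unfolding Tsec_eq[OF f b] R_field_eq by (rule Psi_in[OF b0(1,2) S_in[OF f(1) b0(3)]])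
  assume g: "g \<in> carrier S" "periodic_from m g"
  show "inn (R_field E e \<beta>) (Tsec f \<beta>) (Tsec g \<beta>) = inn (F (\<beta> + real m)) (f (\<beta> + real m)) (g (\<beta> + real m))"
    unfolding Tsec_eq[OF f b] Tsec_eq[OF g b] R_field_eq
    by (rule lin_isometry_inn[OF Psi_props(1)[OF b0(1,2)] S_in[OF f(1) b0(3)] S_in[OF g(1) b0(3)]])
qed

text \<open>\<open>Psi\<close> is chosen fibre by fibre, so measurability in \<beta> is not visible
  from its construction. Against b_j(\<beta>) \<otimes> i_k(x) the coefficient is
  \<langle>b_j(\<beta>) x, f(\<beta> + k)\<rangle>, an inner product of measurable sections over (k,
  k+1]; linear combinations and limits extend this to all y.\<close>

lemma Tsec_coeff_meas:
  assumes f: "f \<in> carrier S" and y: "y \<in> carrier Rb"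
  shows "(\<lambda>\<beta>. inn (R_field E e \<beta>) (tens (F \<beta>) Rb (bs j \<beta>) y) (Tsec f \<beta>)) \<in> borel_measurable (restrict_space lborel {0<..1})"
proof -
  obtain m where m: "periodic_from m f" using periodic_from_ex[OF f] by blast
  have "y \<in> cspan Rb {incl E e k x |k x. k \<ge> m \<and> k \<ge> 1 \<and> x \<in> carrier (F (real k))}"
    using total_incl_ge[of m] y by (auto simp: total_def)
  then show ?thesis
  proof (induction rule: cspan.induct)
    case zero
    show ?case
    proof (subst measurable_cong[where g = "\<lambda>_. 0"])
      fix \<beta> assume "\<beta> \<in> space (restrict_space lborel {0<..1::real})"
      then have \<beta>: "\<beta> \<in> {0<..1}" by (simp add: space_restrict_space)
      then interpret TP: tensor_pair "F \<beta>" Rb by (intro tensor_pair_Rb) simp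
      have b: "bs j \<beta> \<in> carrier (F \<beta>)" using \<beta> by (intro bs_in) simp
      have "tens (F \<beta>) Rb (bs j \<beta>) \<zero>\<^bsub>Rb\<^esub> = \<zero>\<^bsub>F \<beta> \<otimes>\<^sub>H Rb\<^esub>"
        using hbdd_smult[OF TP.hbdd_tens_right[OF b] Rb.zero_in, of 0] TP.T.vsmult_zero[OF TP.tens_in[OF b Rb.zero_in]]
          Rb.vsmult_zero[OF Rb.zero_in] by simp
      then show "inn (R_field E e \<beta>) (tens (F \<beta>) Rb (bs j \<beta>) \<zero>\<^bsub>Rb\<^esub>) (Tsec f \<beta>) = 0"
        using TP.T.inn_zero_left Tsec_fibre(1)[OF f m \<beta>] by (simp add: R_field_eq)
    qed simp
  next
    case (base y)
    then obtain k x where y: "y = incl E e k x" "k \<ge> m" "k \<ge> 1" "x \<in> carrier (F (real k))" by blast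
    have k: "periodic_from k f" by (rule periodic_from_mono[OF m y(2)])
    let ?J = "{real k<..real k + 1}"
    interpret J: mfield ?J F bs "sections E ?J" by (rule mfield_interval) simp
    have s1: "(\<lambda>\<gamma>\<in>?J. aprod E (\<gamma> - real k) (real k) ((\<lambda>\<alpha>\<in>{0<..1}. bs j \<alpha>) (\<gamma> - real k)) x) \<in> sections E ?J"
      by (rule aprod_section_right[OF U.M_p]) (use y in auto)
    have s2: "restrict f ?J \<in> sections E ?J" by (rule sections_restrict[OF S_Sec[OF f]]) auto
    have sh: "(\<lambda>\<beta>. \<beta> + real k) \<in> restrict_space lborel {0<..1} \<rightarrow>\<^sub>M restrict_space lborel ?J"
      by (rule measurable_restrict_space2) (auto simp: space_restrict_space intro!: measurable_restrict_space1)
    show ?case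
    proof (subst measurable_cong)
      show "(\<lambda>\<beta>. inn (F (\<beta> + real k)) ((\<lambda>\<gamma>\<in>?J. aprod E (\<gamma> - real k) (real k) ((\<lambda>\<alpha>\<in>{0<..1}. bs j \<alpha>) (\<gamma> - real k)) x) (\<beta> + real k)) (restrict f ?J (\<beta> + real k)))
        \<in> borel_measurable (restrict_space lborel {0<..1})"
        by (rule measurable_compose[OF sh J.inn_meas[OF s1 s2]])
      fix \<beta> assume "\<beta> \<in> space (restrict_space lborel {0<..1::real})"
      then have \<beta>: "\<beta> \<in> {0<..1}" "\<beta> > 0" "\<beta> + real k > 0" by (auto simp: space_restrict_space)
      have b: "bs j \<beta> \<in> carrier (F \<beta>)" by (rule bs_in[OF \<beta>(2)])
      have k0: "real k > 0" using y(3) by simp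
      show "inn (R_field E e \<beta>) (tens (F \<beta>) Rb (bs j \<beta>) y) (Tsec f \<beta>) =
        inn (F (\<beta> + real k)) ((\<lambda>\<gamma>\<in>?J. aprod E (\<gamma> - real k) (real k) ((\<lambda>\<alpha>\<in>{0<..1}. bs j \<alpha>) (\<gamma> - real k)) x) (\<beta> + real k)) (restrict f ?J (\<beta> + real k))"
        unfolding y(1) Psi_props(2)[OF \<beta>(2) y(3) b y(4), symmetric] Tsec_eq[OF f k \<beta>(1)] R_field_eq
        using \<beta>(1) lin_isometry_inn[OF Psi_props(1)[OF \<beta>(2) y(3)] aprod_in[OF \<beta>(2) k0 b y(4) refl] S_in[OF f \<beta>(3)]] by simp
    qed
  next
    case (add y z)
    have yz: "y \<in> carrier Rb" "z \<in> carrier Rb" using add.hyps by (blast intro: Rb.cspan_carrier)+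
    show ?case
    proof (subst measurable_cong)
      fix \<beta> assume "\<beta> \<in> space (restrict_space lborel {0<..1::real})"
      then have \<beta>: "\<beta> \<in> {0<..1}" by (simp add: space_restrict_space)
      then interpret TP: tensor_pair "F \<beta>" Rb by (intro tensor_pair_Rb) simp
      have b: "bs j \<beta> \<in> carrier (F \<beta>)" using \<beta> by (intro bs_in) simp
      show "inn (R_field E e \<beta>) (tens (F \<beta>) Rb (bs j \<beta>) (y \<oplus>\<^bsub>Rb\<^esub> z)) (Tsec f \<beta>) =
        inn (R_field E e \<beta>) (tens (F \<beta>) Rb (bs j \<beta>) y) (Tsec f \<beta>) + inn (R_field E e \<beta>) (tens (F \<beta>) Rb (bs j \<beta>) z) (Tsec f \<beta>)"
        using hbdd_add[OF TP.hbdd_tens_right[OF b] yz] Tsec_fibre(1)[OF f m \<beta>] TP.tens_in[OF b yz(1)] TP.tens_in[OF b yz(2)]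
        by (simp add: R_field_eq TP.T.inn_add_left)
    qed (intro borel_measurable_add add.IH)
  next
    case (smult y c)
    have y: "y \<in> carrier Rb" using smult.hyps by (blast intro: Rb.cspan_carrier)
    show ?case
    proof (subst measurable_cong)
      fix \<beta> assume "\<beta> \<in> space (restrict_space lborel {0<..1::real})"
      then have \<beta>: "\<beta> \<in> {0<..1}" by (simp add: space_restrict_space)
      then interpret TP: tensor_pair "F \<beta>" Rb by (intro tensor_pair_Rb) simp
      have b: "bs j \<beta> \<in> carrier (F \<beta>)" using \<beta> by (intro bs_in) simp
      show "inn (R_field E e \<beta>) (tens (F \<beta>) Rb (bs j \<beta>) (c \<odot>\<^bsub>Rb\<^esub> y)) (Tsec f \<beta>) =
        cnj c * inn (R_field E e \<beta>) (tens (F \<beta>) Rb (bs j \<beta>) y) (Tsec f \<beta>)"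
        using hbdd_smult[OF TP.hbdd_tens_right[OF b] y] Tsec_fibre(1)[OF f m \<beta>] TP.tens_in[OF b y]
        by (simp add: R_field_eq TP.T.inn_smult_left)
    qed (intro borel_measurable_times borel_measurable_const smult.IH)
  next
    case (lim s y)
    have s: "\<And>n. s n \<in> carrier Rb" using lim.hyps(1) by (blast intro: Rb.cspan_carrier)
    show ?case
    proof (rule borel_measurable_LIMSEQ_metric[OF lim.IH])
      fix \<beta> assume "\<beta> \<in> space (restrict_space lborel {0<..1::real})"
      then have \<beta>: "\<beta> \<in> {0<..1}" by (simp add: space_restrict_space)
      then interpret TP: tensor_pair "F \<beta>" Rb by (intro tensor_pair_Rb) simp
      have b: "bs j \<beta> \<in> carrier (F \<beta>)" using \<beta> by (intro bs_in) simp
      show "(\<lambda>n. inn (R_field E e \<beta>) (tens (F \<beta>) Rb (bs j \<beta>) (s n)) (Tsec f \<beta>)) \<longlonglongrightarrow> inn (R_field E e \<beta>) (tens (F \<beta>) Rb (bs j \<beta>) y) (Tsec f \<beta>)"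
        unfolding R_field_eq
        by (rule TP.T.hlim_inn_left[OF TP.tens_in[OF b s] TP.tens_in[OF b lim.hyps(2)]
              hbdd_hlim[OF Rb.sip_axioms TP.T.sip_axioms TP.hbdd_tens_right[OF b] s lim.hyps(2,3)]
              Tsec_fibre(1)[OF f m \<beta>, unfolded R_field_eq]])
    qed
  qed
qed

lemma Tsec_in:
  assumes f: "f \<in> carrier S"
  shows "Tsec f \<in> carrier RF.l2"
proof -
  obtain m where m: "periodic_from m f" using periodic_from_ex[OF f] by blast
  have "restrict (Tsec f) {0<..1} \<in> R_sections E e"
  proof (rule RF.MI)
    show "Tsec f \<beta> \<in> carrier (R_field E e \<beta>)" if "\<beta> \<in> {0<..1}" for \<beta> by (rule Tsec_fibre(1)[OF f m that])
    show "(\<lambda>\<beta>. inn (R_field E e \<beta>) (rp i \<beta>) (Tsec f \<beta>)) \<in> borel_measurable (restrict_space lborel {0<..1})" for i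
      unfolding rp_def by (rule Tsec_coeff_meas[OF f rbase_in])
  qed
  moreover have "restrict (Tsec f) {0<..1} = Tsec f" by (simp add: Tsec_def)
  ultimately have M: "Tsec f \<in> R_sections E e" by simp
  have "set_integrable lborel {real m<..1 + real m} (\<lambda>\<alpha>. inn (F \<alpha>) (f \<alpha>) (f \<alpha>))" by (rule S_int[OF f f]) simp
  then have "set_integrable lborel {0 + real m<..1 + real m} (\<lambda>\<alpha>. inn (F \<alpha>) (f \<alpha>) (f \<alpha>))" by simp
  then have i: "integrable (restrict_space lborel {0<..1}) (\<lambda>\<alpha>. inn (F (\<alpha> + real m)) (f (\<alpha> + real m)) (f (\<alpha> + real m)))"
    unfolding set_integrable_shift RF.set_integrable_iff .
  show ?thesis
  proof (rule RF.l2_bound[OF integrable_Re[OF i] M])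
    fix \<beta> :: real assume \<beta>: "\<beta> \<in> {0<..1}"
    interpret A: sip "R_field E e \<beta>" by (rule RF.sip_X[OF \<beta>])
    show "(hnorm (R_field E e \<beta>) (Tsec f \<beta>))\<^sup>2 \<le> Re (inn (F (\<beta> + real m)) (f (\<beta> + real m)) (f (\<beta> + real m)))"
      using A.hnorm_sq[OF Tsec_fibre(1)[OF f m \<beta>]] Tsec_fibre(2)[OF f m \<beta> f m] by simp
  qed
qed

text \<open>In the fibre over \<beta> the inner product is that of f and g at \<beta> + M, so
  integration over (0,1] is one late window of the form on \<open>S_space\<close>.\<close>

lemma inn_Tsec:
  assumes f: "f \<in> carrier S" and g: "g \<in> carrier S"
  shows "inn RF.l2 (Tsec f) (Tsec g) = inn S f g"
proof -
  obtain m where m: "periodic_from m f" using periodic_from_ex[OF f] by blast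
  obtain n where n: "periodic_from n g" using periodic_from_ex[OF g] by blast
  obtain K where K: "K \<ge> 1" "\<And>a. a \<ge> real K \<Longrightarrow> (LINT \<alpha>:{a<..a + 1}|lborel. inn (F \<alpha>) (f \<alpha>) (g \<alpha>)) = inn S f g"
    using S_inn_ev[OF f g] by blast
  define M where "M = max K (max m n)"
  have M: "periodic_from M f" "periodic_from M g" "real M \<ge> real K"
    using periodic_from_mono[OF m] periodic_from_mono[OF n] by (auto simp: M_def)
  have "inn RF.l2 (Tsec f) (Tsec g) = (\<integral>\<alpha>. inn (F (\<alpha> + real M)) (f (\<alpha> + real M)) (g (\<alpha> + real M)) \<partial>restrict_space lborel {0<..1})"
    unfolding RF.l2_inn by (rule Bochner_Integration.integral_cong[OF refl]) (simp add: Tsec_fibre(2)[OF f M(1) _ g M(2)])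
  also have "\<dots> = (LINT \<alpha>:{0 + real M<..1 + real M}|lborel. inn (F \<alpha>) (f \<alpha>) (g \<alpha>))"
    unfolding set_integral_shift RF.set_integral_eq ..
  also have "\<dots> = inn S f g" using K(2)[OF M(3)] by (simp add: add.commute)
  finally show ?thesis .
qed

subsection \<open>The sections belonging to elementary tensors\<close>

definition "gs m f y = (\<lambda>\<alpha>\<in>{real m<..real m + 1}. aprod E (\<alpha> - real m) (real m) (f (\<alpha> - real m)) y)"

lemma gs_in:
  assumes m: "m \<ge> 1" and f: "f \<in> carrier U.l2" and y: "y \<in> carrier (F (real m))"
  shows "gs m f y \<in> carrier (L2 {real m<..real m + 1})"
proof -
  let ?J = "{real m<..real m + 1}"
  interpret J: mfield ?J F bs "sections E ?J" by (rule mfield_interval) simp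
  have s: "gs m f y \<in> sections E ?J" unfolding gs_def
    by (rule aprod_section_right[OF U.l2_M[OF f]]) (use m y in auto)
  have "set_integrable lborel {0<..1} (\<lambda>\<alpha>. (hnorm (F \<alpha>) (f \<alpha>))\<^sup>2)"
    using f by (simp add: U.l2_carrier U.set_integrable_iff)
  then have "set_integrable lborel {0 + real m<..1 + real m} (\<lambda>\<alpha>. (hnorm (F (\<alpha> - real m)) (f (\<alpha> - real m)))\<^sup>2)"
    unfolding set_integrable_shift by simp
  then have "set_integrable lborel ?J (\<lambda>\<alpha>. (hnorm (F (\<alpha> - real m)) (f (\<alpha> - real m)))\<^sup>2)" by (simp add: add.commute)
  then have i: "integrable (restrict_space lborel ?J) (\<lambda>\<alpha>. (hnorm (F (real m)) y)\<^sup>2 * (hnorm (F (\<alpha> - real m)) (f (\<alpha> - real m)))\<^sup>2)"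
    unfolding J.set_integrable_iff by simp
  show ?thesis
  proof (rule J.l2_bound[OF i s])
    fix \<alpha> assume \<alpha>: "\<alpha> \<in> ?J"
    then show "(hnorm (F \<alpha>) (gs m f y \<alpha>))\<^sup>2 \<le> (hnorm (F (real m)) y)\<^sup>2 * (hnorm (F (\<alpha> - real m)) (f (\<alpha> - real m)))\<^sup>2"
      using m y U.l2_in[OF f, of "\<alpha> - real m"] by (simp add: gs_def hnorm_aprod power_mult_distrib)
  qed
qed

lemma tilde_gs_in: "m \<ge> 1 \<Longrightarrow> f \<in> carrier U.l2 \<Longrightarrow> y \<in> carrier (F (real m)) \<Longrightarrow> tilde E e m (gs m f y) \<in> carrier S"
  by (intro tilde_in gs_in)

lemma periodic_from_tilde:
  assumes m: "m \<ge> 1" and f: "f \<in> carrier U.l2" and y: "y \<in> carrier (F (real m))"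
  shows "periodic_from (m + 1) (tilde E e m (gs m f y))"
  unfolding periodic_from_def
proof (intro conjI allI impI)
  interpret J: mfield "{real m<..real m + 1}" F bs "sections E {real m<..real m + 1}" by (rule mfield_interval) simp
  fix \<alpha> assume "\<alpha> \<ge> real (m + 1)"
  then show "tilde E e m (gs m f y) (\<alpha> + 1) = aprod E \<alpha> 1 (tilde E e m (gs m f y) \<alpha>) e"
    using J.l2_in[OF gs_in[OF m f y]] by (intro tilde_step) auto
qed simp

lemma tilde_gs:
  assumes m: "m \<ge> 1" and f: "f \<in> carrier U.l2" and y: "y \<in> carrier (F (real m))" and a: "\<alpha> \<in> {0<..1}" and c: "\<gamma> = \<alpha> + real m + real j"
  shows "tilde E e m (gs m f y) \<gamma> = mult_pow E e (\<alpha> + real m) (aprod E \<alpha> (real m) (f \<alpha>) y) j"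
proof -
  have "\<gamma> \<in> {real m + real j<..real m + real j + 1}" using a c by auto
  from tilde_eq[OF this] show ?thesis using a c by (simp add: gs_def)
qed

lemma periodic_from_shift:
  assumes t: "t > 0" and x: "x \<in> carrier (F t)" and f: "f \<in> carrier S" "periodic_from m f" and M: "real M \<ge> real m + t"
  shows "periodic_from M (shift_section E t x f)"
  unfolding periodic_from_def
proof (intro conjI allI impI)
  have m: "m \<ge> 1" using f(2) by (simp add: periodic_from_def)
  then have "real M > 0" using M t by linarith
  then show "M \<ge> 1" by simp
  fix \<alpha> assume "\<alpha> \<ge> real M"
  then have a: "\<alpha> - t \<ge> real m" "\<alpha> - t > 0" using M m by auto
  have "shift_section E t x f (\<alpha> + 1) = aprod E t (\<alpha> - t + 1) x (f ((\<alpha> - t) + 1))" using a t by (simp add: shift_section_def algebra_simps)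
  also have "\<dots> = aprod E t (\<alpha> - t + 1) x (aprod E (\<alpha> - t) 1 (f (\<alpha> - t)) e)" unfolding periodic_from_step[OF f(2) a(1)] ..
  also have "\<dots> = aprod E \<alpha> 1 (aprod E t (\<alpha> - t) x (f (\<alpha> - t))) e"
    by (rule aprod_assoc[symmetric]) (use t a x e_in S_in[OF f(1) a(2)] in auto)
  also have "aprod E t (\<alpha> - t) x (f (\<alpha> - t)) = shift_section E t x f \<alpha>" using a t by (simp add: shift_section_def)
  finally show "shift_section E t x f (\<alpha> + 1) = aprod E \<alpha> 1 (shift_section E t x f \<alpha>) e" .
qed

lemma Tsec_tilde:
  assumes m: "m \<ge> 1" and f: "f \<in> carrier U.l2" and y: "y \<in> carrier (F (real m))"
  shows "Tsec (tilde E e m (gs m f y)) = ts f (incl E e m y)"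
proof (rule extensionalityI[of _ "{0<..1}"])
  fix \<beta> :: real assume \<beta>: "\<beta> \<in> {0<..1}"
  then have b0: "\<beta> > 0" by simp
  have fb: "f \<beta> \<in> carrier (F \<beta>)" by (rule U.l2_in[OF f \<beta>])
  have z: "aprod E \<beta> (real m) (f \<beta>) y \<in> carrier (F (\<beta> + real m))" by (rule aprod_in[OF b0 _ fb y]) (use m in auto)
  \<comment> \<open>The section is known to be periodic only from m + 1 on, so it is evaluated one
    level up; the extra factor e is then removed by \<open>Psi_mult_pow\<close>.\<close>
  have "Tsec (tilde E e m (gs m f y)) \<beta> = Psi \<beta> (m + 1) (tilde E e m (gs m f y) (\<beta> + real (m + 1)))"
    by (rule Tsec_eq[OF tilde_gs_in[OF m f y] periodic_from_tilde[OF m f y] \<beta>])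
  also have "tilde E e m (gs m f y) (\<beta> + real (m + 1)) = mult_pow E e (\<beta> + real m) (aprod E \<beta> (real m) (f \<beta>) y) 1"
    by (rule tilde_gs[OF m f y \<beta>]) simp
  also have "Psi \<beta> (m + 1) \<dots> = Psi \<beta> m (aprod E \<beta> (real m) (f \<beta>) y)" by (rule Psi_mult_pow[OF b0 m z]) auto
  also have "\<dots> = ts f (incl E e m y) \<beta>" using \<beta> by (simp add: ts_def Psi_props(2)[OF b0 m fb y])
  finally show "Tsec (tilde E e m (gs m f y)) \<beta> = ts f (incl E e m y) \<beta>" .
qed (simp_all add: Tsec_def ts_def)

text \<open>With t + \<alpha> = \<beta> + n, the product x f(\<alpha>) y is regrouped as a product
  of E_{\<beta>+n} with E_k. The right side is exactly what the third part of
  \<open>w_value_hbdd\<close> yields for the first construction.\<close>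

lemma Tsec_shift_tilde:
  assumes t: "t > 0" and x: "x \<in> carrier (F t)" and k: "k \<ge> 1" and f: "f \<in> carrier U.l2" and y: "y \<in> carrier (F (real k))"
    and b: "\<beta> \<in> {0<..1}" and a: "\<alpha> \<in> {0<..1}" and ta: "t + \<alpha> = \<beta> + real n"
  shows "Tsec (shift_section E t x (tilde E e k (gs k f y))) \<beta> = Psi \<beta> (n + k) (aprod E (\<beta> + real n) (real k) (aprod E t \<alpha> x (f \<alpha>)) y)"
proof -
  let ?h = "tilde E e k (gs k f y)"
  have h: "?h \<in> carrier S" by (rule tilde_gs_in[OF k f y])
  have b0: "\<beta> > 0" "\<alpha> > 0" using a b by auto
  have fa: "f \<alpha> \<in> carrier (F \<alpha>)" by (rule U.l2_in[OF f a])
  obtain N :: nat where N: "t < real N" using reals_Archimedean2 by blast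
  \<comment> \<open>More than t further periods, and one more for the late start of
    \<open>tilde\<close>, bring the shifted section into its periodic range; the resulting factor
    e^j is removed again by \<open>Psi_mult_pow\<close>.\<close>
  define j where "j = Suc N"
  define M where "M = n + k + j"
  have M: "periodic_from M (shift_section E t x ?h)"
    by (rule periodic_from_shift[OF t x h periodic_from_tilde[OF k f y]]) (use N in \<open>simp add: M_def j_def\<close>)
  define w where "w = aprod E \<alpha> (real k) (f \<alpha>) y"
  have w: "w \<in> carrier (F (\<alpha> + real k))" unfolding w_def by (rule aprod_in[OF b0(2) _ fa y]) (use k in auto)
  have k0: "real k > 0" using k by simp
  have "Tsec (shift_section E t x ?h) \<beta> = Psi \<beta> M (shift_section E t x ?h (\<beta> + real M))"
    by (rule Tsec_eq[OF shift_in[OF t x h] M b])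
  also have "shift_section E t x ?h (\<beta> + real M) = aprod E t (\<alpha> + real k + real j) x (?h (\<alpha> + real k + real j))"
  proof -
    have "\<beta> + real M - t = \<alpha> + real k + real j" using ta by (simp add: M_def)
    moreover have "\<beta> + real M > t" using calculation b0 k by linarith
    ultimately show ?thesis using t by (simp add: shift_section_def)
  qed
  also have "?h (\<alpha> + real k + real j) = mult_pow E e (\<alpha> + real k) w j" unfolding w_def by (rule tilde_gs[OF k f y a refl])
  also have "aprod E t (\<alpha> + real k + real j) x (mult_pow E e (\<alpha> + real k) w j) = mult_pow E e (\<beta> + real (n + k)) (aprod E t (\<alpha> + real k) x w) j"
    by (rule aprod_mult_pow[OF t _ x w]) (use b0 ta in auto)
  also have "Psi \<beta> M (mult_pow E e (\<beta> + real (n + k)) (aprod E t (\<alpha> + real k) x w) j) = Psi \<beta> (n + k) (aprod E t (\<alpha> + real k) x w)"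
  proof (rule Psi_mult_pow[OF b0(1)])
    show "aprod E t (\<alpha> + real k) x w \<in> carrier (F (\<beta> + real (n + k)))" by (rule aprod_in[OF t _ x w]) (use b0 ta in auto)
  qed (use k in \<open>auto simp: M_def\<close>)
  also have "aprod E t (\<alpha> + real k) x w = aprod E (\<beta> + real n) (real k) (aprod E t \<alpha> x (f \<alpha>)) y"
    unfolding w_def by (rule aprod_assoc[OF t b0(2) k0 x fa y ta[symmetric] refl, symmetric])
  finally show ?thesis .
qed

subsection \<open>The unitary between the two spaces\<close>

lemma cls_Tsec_in: "f \<in> carrier S \<Longrightarrow> RF.L.cls (Tsec f) \<in> carrier DR" by (intro cls_RF_in Tsec_in)

text \<open>The images of the vectors f \<otimes> i_m(y) under \<open>R_ident\<close> are classes of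
  sections \<open>Tsec\<close>, and they are total because \<open>R_ident\<close> is
  unitary.\<close>

lemma total_cls_Tsec: "total DR ((\<lambda>f. RF.L.cls (Tsec f)) ` carrier S)"
proof (rule RF.D.total_mono)
  let ?B = "{incl E e m x |m x. m \<ge> 1 \<and> x \<in> carrier (F (real m))}"
  show "total DR (R_ident E e ` (\<lambda>(f, y). R_tens E e f y) ` (carrier U.l2 \<times> ?B))"
    by (rule total_image[OF R.sip_axioms RF.D.sip_axioms R_ident_props(1) total_R_tens[OF total_incl]])
  show S: "(\<lambda>f. RF.L.cls (Tsec f)) ` carrier S \<subseteq> carrier DR" using cls_Tsec_in by auto
  show "R_ident E e ` (\<lambda>(f, y). R_tens E e f y) ` (carrier U.l2 \<times> ?B) \<subseteq> cspan DR ((\<lambda>f. RF.L.cls (Tsec f)) ` carrier S)"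
  proof
    fix z assume "z \<in> R_ident E e ` (\<lambda>(f, y). R_tens E e f y) ` (carrier U.l2 \<times> ?B)"
    then obtain f m y where z: "z = R_ident E e (R_tens E e f (incl E e m y))" "f \<in> carrier U.l2" "m \<ge> 1" "y \<in> carrier (F (real m))" by auto
    have "z = RF.L.cls (Tsec (tilde E e m (gs m f y)))"
      unfolding z(1) Tsec_tilde[OF z(3,2,4)] by (rule R_ident_props(2)[OF z(2) incl_in[OF z(3,4)]])
    then have "z \<in> (\<lambda>f. RF.L.cls (Tsec f)) ` carrier S" using tilde_gs_in[OF z(3,2,4)] by auto
    then show "z \<in> cspan DR ((\<lambda>f. RF.L.cls (Tsec f)) ` carrier S)" using S by (intro cspan.base) auto
  qed
qed

definition "Tmap = (SOME W. unitary H DR W \<and> (\<forall>f\<in>carrier S. W (H_class E e f) = RF.L.cls (Tsec f)))"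

lemma Tmap_props: "unitary H DR Tmap" "f \<in> carrier S \<Longrightarrow> Tmap (H_class E e f) = RF.L.cls (Tsec f)"
proof -
  interpret G: gram H DR "H_class E e" "\<lambda>f. RF.L.cls (Tsec f)" "carrier S"
    by unfold_locales (auto simp: H_class_in cls_Tsec_in inn_H_class lin_isometry_inn[OF RF.cls_isometry Tsec_in Tsec_in] inn_Tsec)
  have "\<exists>W. unitary H DR W \<and> (\<forall>f\<in>carrier S. W (H_class E e f) = RF.L.cls (Tsec f))"
    using G.unitary_ex1[OF hilb_H RF.hilb_D total_H_class total_cls_Tsec] by blast
  note w = someI_ex[OF this, folded Tmap_def]
  from w show "unitary H DR Tmap" by blast
  from w show "f \<in> carrier S \<Longrightarrow> Tmap (H_class E e f) = RF.L.cls (Tsec f)" by blast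
qed

lemmas Tmap_inv = unitary_inv[OF HH.ips_axioms RF.D.sip_axioms Tmap_props(1)]

definition "V h = inv_into (carrier H) Tmap (R_ident E e h)"

lemma V_unitary: "unitary R H V"
  unfolding V_def[abs_def] by (rule unitary_comp[OF R_ident_props(1) Tmap_inv(4)])

lemmas V_isometry = unitary_isometry[OF V_unitary]
lemmas V_in = lin_isometry_in[OF V_isometry]
lemmas V_inv = unitary_inv[OF R.ips_axioms HH.sip_axioms V_unitary]

lemma Tmap_V: "h \<in> carrier R \<Longrightarrow> Tmap (V h) = R_ident E e h"
  unfolding V_def by (rule Tmap_inv(2)[OF lin_isometry_in[OF unitary_isometry[OF R_ident_props(1)]]])

lemma V_R_tens_incl:
  assumes m: "m \<ge> 1" and f: "f \<in> carrier U.l2" and y: "y \<in> carrier (F (real m))"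
  shows "V (R_tens E e f (incl E e m y)) = H_class E e (tilde E e m (gs m f y))"
  unfolding V_def R_ident_props(2)[OF f incl_in[OF m y]] Tsec_tilde[OF m f y, symmetric] Tmap_props(2)[OF tilde_gs_in[OF m f y], symmetric]
  by (rule Tmap_inv(3)[OF H_class_in[OF tilde_gs_in[OF m f y]]])

lemma V_formula_V: "V_formula E e V"
  unfolding V_formula_def using V_R_tens_incl by (simp add: gs_def)

text \<open>The vectors f \<otimes> i_m(y) are total, so the formula fixes every isometry.\<close>

lemma V_unique:
  assumes "lin_isometry R H V'" "V_formula E e V'" "h \<in> carrier R"
  shows "V' h = V h"
proof (rule hbdd_eq[OF R.sip_axioms HH.ips_axioms lin_isometry_hbdd[OF assms(1)] lin_isometry_hbdd[OF V_isometry] total_R_tens[OF total_incl] _ assms(3)])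
  fix a assume "a \<in> (\<lambda>(f, y). R_tens E e f y) ` (carrier U.l2 \<times> {incl E e m x |m x. 1 \<le> m \<and> x \<in> carrier (F (real m))})"
  then obtain f m y where "a = R_tens E e f (incl E e m y)" "f \<in> carrier U.l2" "m \<ge> 1" "y \<in> carrier (F (real m))" by auto
  then show "V' a = V a" using assms(2) V_formula_V unfolding V_formula_def by simp
qed

subsection \<open>Unitarity of the shifts\<close>

lemma shift_comp:
  assumes ts: "t > 0" "s > 0" and x: "x \<in> carrier (F t)" and y: "y \<in> carrier (F s)" and f: "f \<in> carrier S"
  shows "shift_section E (t + s) (aprod E t s x y) f = shift_section E t x (shift_section E s y f)"
proof (rule extensionalityI[of _ "{0<..}"])
  fix \<alpha> :: real assume \<alpha>: "\<alpha> \<in> {0<..}"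
  \<comment> \<open>Beyond t + s the claim is associativity; between t and t + s the inner section
    vanishes, and x times zero is zero; up to t both sides vanish by definition.\<close>
  consider "\<alpha> > t + s" | "t < \<alpha>" "\<alpha> \<le> t + s" | "\<alpha> \<le> t" by linarith
  then show "shift_section E (t + s) (aprod E t s x y) f \<alpha> = shift_section E t x (shift_section E s y f) \<alpha>"
  proof cases
    case 1
    then have a: "\<alpha> - (t + s) > 0" "\<alpha> - t - s > 0" by auto
    have "aprod E (t + s) (\<alpha> - (t + s)) (aprod E t s x y) (f (\<alpha> - (t + s))) = aprod E t (\<alpha> - t) x (aprod E s (\<alpha> - (t + s)) y (f (\<alpha> - (t + s))))"
      by (rule aprod_assoc[OF ts(1,2) a(1) x y S_in[OF f a(1)]]) auto
    then show ?thesis using \<alpha> 1 ts by (simp add: shift_section_def algebra_simps)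
  next
    case 2
    have h: "hbdd (F (\<alpha> - t)) (F \<alpha>) (aprod E t (\<alpha> - t) x)" by (rule aprod_hbdd_right) (use 2 ts x in auto)
    interpret A: sip "F (\<alpha> - t)" by (rule sip_F) (use 2 in simp)
    interpret B: sip "F \<alpha>" by (rule sip_F) (use \<alpha> in simp)
    have "aprod E t (\<alpha> - t) x \<zero>\<^bsub>F (\<alpha> - t)\<^esub> = \<zero>\<^bsub>F \<alpha>\<^esub>"
      using hbdd_smult[OF h A.zero_in, of 0] B.vsmult_zero[OF hbdd_in[OF h A.zero_in]] A.vsmult_zero[OF A.zero_in] by simp
    then show ?thesis using \<alpha> 2 ts by (simp add: shift_section_def)
  next
    case 3
    then show ?thesis using \<alpha> ts by (simp add: shift_section_def)
  qed
qed (simp_all add: shift_section_def)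

lemma v_comp:
  assumes ts: "t > 0" "s > 0" and x: "x \<in> carrier (F t)" and y: "y \<in> carrier (F s)" and h: "h \<in> carrier H"
  shows "v_map E e (t + s) (tens (F (t + s)) H (aprod E t s x y) h) = v_map E e t (tens (F t) H x (v_map E e s (tens (F s) H y h)))"
proof -
  have ts0: "t + s > 0" using ts by simp
  interpret A: tensor_pair "F t" H by (rule tensor_pair_H[OF ts(1)])
  interpret B: tensor_pair "F s" H by (rule tensor_pair_H[OF ts(2)])
  interpret C: tensor_pair "F (t + s)" H by (rule tensor_pair_H[OF ts0])
  have xy: "aprod E t s x y \<in> carrier (F (t + s))" by (rule aprod_in[OF ts x y refl])
  note vA = lin_isometry_hbdd[OF v_map_props(1)[OF ts(1)]] and vB = lin_isometry_hbdd[OF v_map_props(1)[OF ts(2)]]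
    and vC = lin_isometry_hbdd[OF v_map_props(1)[OF ts0]]
  show ?thesis
  proof (rule hbdd_eq[OF HH.sip_axioms HH.ips_axioms _ _ total_H_class _ h])
    show "hbdd H H (\<lambda>h. v_map E e (t + s) (tens (F (t + s)) H (aprod E t s x y) h))"
      by (rule hbdd_comp[OF C.hbdd_tens_right[OF xy] vC])
    show "hbdd H H (\<lambda>h. v_map E e t (tens (F t) H x (v_map E e s (tens (F s) H y h))))"
      by (rule hbdd_comp[OF hbdd_comp[OF hbdd_comp[OF B.hbdd_tens_right[OF y] vB] A.hbdd_tens_right[OF x]] vA])
    fix a assume "a \<in> H_class E e ` carrier S"
    then obtain f where f: "f \<in> carrier S" "a = H_class E e f" by blast
    show "v_map E e (t + s) (tens (F (t + s)) H (aprod E t s x y) a) = v_map E e t (tens (F t) H x (v_map E e s (tens (F s) H y a)))"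
      unfolding f(2) v_map_props(2)[OF ts0 xy f(1)] v_map_props(2)[OF ts(2) y f(1)] v_map_props(2)[OF ts(1) x shift_in[OF ts(2) y f(1)]]
        shift_comp[OF ts x y f(1)] ..
  qed
qed

text \<open>For an integer shift the point \<alpha> with n + \<alpha> = \<beta> + n is \<beta>
  itself. Hence a scalar function c on the fibres arises by shifting a section built from c b_j, in
  the form required by \<open>D_total\<close>.\<close>

lemma v_nat_unitary:
  assumes n: "n \<ge> 1"
  shows "unitary (F (real n) \<otimes>\<^sub>H H) H (v_map E e (real n))"
proof -
  have n0: "real n > 0" using n by simp
  interpret TP: tensor_pair "F (real n)" H by (rule tensor_pair_H[OF n0])
  note v = v_map_props(1)[OF n0]
  \<comment> \<open>Surjectivity is tested in the direct integral, where totality can be decided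
    fibrewise.\<close>
  define W where "W z = Tmap (v_map E e (real n) z)" for z
  have W: "lin_isometry (F (real n) \<otimes>\<^sub>H H) DR W"
    unfolding W_def[abs_def] by (rule lin_isometry_comp[OF v unitary_isometry[OF Tmap_props(1)]])
  \<comment> \<open>The index type is countable, and \<open>Suc m\<close> keeps every level at least
    1.\<close>
  define q where "q = (\<lambda>(i, j, m, k) \<beta>. Psi \<beta> (n + Suc m) (aprod E (\<beta> + real n) (real (Suc m)) (aprod E (real n) \<beta> (bs i (real n)) (bs j \<beta>)) (bs k (real (Suc m)))))"
  have shift: "RF.L.cls (\<lambda>\<beta>\<in>{0<..1}. Psi \<beta> (n + Suc m) (aprod E (\<beta> + real n) (real (Suc m)) (aprod E (real n) \<beta> (bs i (real n)) (f \<beta>)) (bs k (real (Suc m))))) \<in> W ` carrier (F (real n) \<otimes>\<^sub>H H)"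
    and sec: "(\<lambda>\<beta>\<in>{0<..1}. Psi \<beta> (n + Suc m) (aprod E (\<beta> + real n) (real (Suc m)) (aprod E (real n) \<beta> (bs i (real n)) (f \<beta>)) (bs k (real (Suc m))))) \<in> carrier RF.l2"
    if f: "f \<in> carrier U.l2" for f i m k
  proof -
    let ?h = "tilde E e (Suc m) (gs (Suc m) f (bs k (real (Suc m))))"
    have y: "bs k (real (Suc m)) \<in> carrier (F (real (Suc m)))" and x: "bs i (real n) \<in> carrier (F (real n))"
      using n0 by (auto intro!: bs_in)
    have h: "?h \<in> carrier S" by (rule tilde_gs_in[OF _ f y]) simp
    have eq: "(\<lambda>\<beta>\<in>{0<..1}. Psi \<beta> (n + Suc m) (aprod E (\<beta> + real n) (real (Suc m)) (aprod E (real n) \<beta> (bs i (real n)) (f \<beta>)) (bs k (real (Suc m)))))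
      = Tsec (shift_section E (real n) (bs i (real n)) ?h)"
    proof (rule extensionalityI[of _ "{0<..1}"])
      fix \<beta> :: real assume \<beta>: "\<beta> \<in> {0<..1}"
      show "(\<lambda>\<beta>\<in>{0<..1}. Psi \<beta> (n + Suc m) (aprod E (\<beta> + real n) (real (Suc m)) (aprod E (real n) \<beta> (bs i (real n)) (f \<beta>)) (bs k (real (Suc m))))) \<beta>
        = Tsec (shift_section E (real n) (bs i (real n)) ?h) \<beta>"
        unfolding restrict_apply'[OF \<beta>] by (rule Tsec_shift_tilde[OF n0 x _ f y \<beta> \<beta>, symmetric]) auto
    qed (simp_all add: Tsec_def)
    show "(\<lambda>\<beta>\<in>{0<..1}. Psi \<beta> (n + Suc m) (aprod E (\<beta> + real n) (real (Suc m)) (aprod E (real n) \<beta> (bs i (real n)) (f \<beta>)) (bs k (real (Suc m))))) \<in> carrier RF.l2"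
      unfolding eq by (rule Tsec_in[OF shift_in[OF n0 x h]])
    have "RF.L.cls (Tsec (shift_section E (real n) (bs i (real n)) ?h)) = W (tens (F (real n)) H (bs i (real n)) (H_class E e ?h))"
      unfolding W_def v_map_props(2)[OF n0 x h] by (rule Tmap_props(2)[OF shift_in[OF n0 x h], symmetric])
    then show "RF.L.cls (\<lambda>\<beta>\<in>{0<..1}. Psi \<beta> (n + Suc m) (aprod E (\<beta> + real n) (real (Suc m)) (aprod E (real n) \<beta> (bs i (real n)) (f \<beta>)) (bs k (real (Suc m))))) \<in> W ` carrier (F (real n) \<otimes>\<^sub>H H)"
      unfolding eq using TP.tens_in[OF x H_class_in[OF h]] by blast
  qed
  have bs_l2: "(\<lambda>\<alpha>\<in>{0<..1}. bs j \<alpha>) \<in> carrier U.l2" for j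
  proof -
    \<comment> \<open>The constant scalar 1 is square integrable because the interval has finite
      measure.\<close>
    interpret fm: finite_measure "restrict_space lborel {0<..1::real}"
      by (rule finite_measureI) (simp add: emeasure_restrict_space)
    have "integrable (restrict_space lborel {0<..1::real}) (\<lambda>_. (cmod 1)\<^sup>2)" by (rule fm.integrable_const)
    from mult_bs_in[OF _ this, of j] have "(\<lambda>\<alpha>\<in>{0<..1}. 1 \<odot>\<^bsub>F \<alpha>\<^esub> bs j \<alpha>) \<in> carrier U.l2" by simp
    moreover have "(\<lambda>\<alpha>\<in>{0<..1}. 1 \<odot>\<^bsub>F \<alpha>\<^esub> bs j \<alpha>) = (\<lambda>\<alpha>\<in>{0<..1}. bs j \<alpha>)"
      by (rule restrict_ext) (simp add: sip.vsmult_one[OF sip_F bs_in])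
    ultimately show ?thesis by simp
  qed
  have inF: "aprod E (real n) \<beta> (bs i (real n)) (bs j \<beta>) \<in> carrier (F (\<beta> + real n))" if "\<beta> > 0" for i j \<beta>
    by (rule aprod_in) (use that n0 in \<open>auto intro: bs_in\<close>)
  have inF2: "aprod E (\<beta> + real n) (real (Suc m)) (aprod E (real n) \<beta> (bs i (real n)) (bs j \<beta>)) (bs k (real (Suc m))) \<in> carrier (F (\<beta> + real (n + Suc m)))" if "\<beta> > 0" for i j k m \<beta>
    by (rule aprod_in[OF _ _ inF[OF that] bs_in]) (use that in auto)
  have tot: "total DR (W ` carrier (F (real n) \<otimes>\<^sub>H H))"
  proof (rule RF.D_total[where q = q and B = "\<lambda>_. 1"])
    show "restrict (q l) {0<..1} \<in> R_sections E e" for l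
    proof -
      obtain i j m k where l: "l = (i, j, m, k)" by (cases l) auto
      have "restrict (q l) {0<..1} = (\<lambda>\<beta>\<in>{0<..1}. Psi \<beta> (n + Suc m) (aprod E (\<beta> + real n) (real (Suc m)) (aprod E (real n) \<beta> (bs i (real n)) ((\<lambda>\<alpha>\<in>{0<..1}. bs j \<alpha>) \<beta>)) (bs k (real (Suc m)))))"
        by (rule restrict_ext) (simp add: q_def l)
      then show ?thesis using RF.l2_M[OF sec[OF bs_l2, of m i j k]] by simp
    qed
    show "hnorm (R_field E e \<beta>) (q l \<beta>) \<le> 1" if \<beta>: "\<beta> \<in> {0<..1}" for l \<beta>
    proof -
      obtain i j m k where l: "l = (i, j, m, k)" by (cases l) auto
      have b0: "\<beta> > 0" using \<beta> by simp
      have "hnorm (R_field E e \<beta>) (q l \<beta>) = hnorm (F (real n)) (bs i (real n)) * hnorm (F \<beta>) (bs j \<beta>) * hnorm (F (real (Suc m))) (bs k (real (Suc m)))"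
      proof -
        have p1: "hnorm (F \<beta> \<otimes>\<^sub>H Rb) (q l \<beta>) = hnorm (F (\<beta> + real (n + Suc m))) (aprod E (\<beta> + real n) (real (Suc m)) (aprod E (real n) \<beta> (bs i (real n)) (bs j \<beta>)) (bs k (real (Suc m))))"
          unfolding q_def l prod.case by (rule lin_isometry_hnorm[OF Psi_props(1)[OF b0] inF2[OF b0]]) simp
        have p2: "hnorm (F (\<beta> + real (n + Suc m))) (aprod E (\<beta> + real n) (real (Suc m)) (aprod E (real n) \<beta> (bs i (real n)) (bs j \<beta>)) (bs k (real (Suc m)))) =
           hnorm (F (\<beta> + real n)) (aprod E (real n) \<beta> (bs i (real n)) (bs j \<beta>)) * hnorm (F (real (Suc m))) (bs k (real (Suc m)))"
          by (rule hnorm_aprod[OF _ _ inF[OF b0] bs_in]) (use b0 in auto)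
        have p3: "hnorm (F (\<beta> + real n)) (aprod E (real n) \<beta> (bs i (real n)) (bs j \<beta>)) = hnorm (F (real n)) (bs i (real n)) * hnorm (F \<beta>) (bs j \<beta>)"
          by (rule hnorm_aprod[OF n0 b0 bs_in[OF n0] bs_in[OF b0]]) simp
        show ?thesis unfolding R_field_eq p1 p2 p3 ..
      qed
      also have "\<dots> \<le> 1" using hnorm_bs[OF n0, of i] hnorm_bs[OF b0, of j] hnorm_bs[of "real (Suc m)" k]
          sip.hnorm_nonneg[OF sip_F bs_in, of "real n" i] sip.hnorm_nonneg[OF sip_F bs_in, of \<beta> j] sip.hnorm_nonneg[OF sip_F bs_in, of "real (Suc m)" k] n0 b0
        by (intro mult_le_one mult_nonneg_nonneg) auto
      finally show ?thesis .
    qed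
    show "total (R_field E e \<beta>) (range (\<lambda>l. q l \<beta>))" if \<beta>: "\<beta> \<in> {0<..1}" for \<beta>
    proof -
      have b0: "\<beta> > 0" "\<beta> + real n > 0" using \<beta> by auto
      interpret A: sip "R_field E e \<beta>" by (rule RF.sip_X[OF \<beta>])
      have qin: "q l \<beta> \<in> carrier (R_field E e \<beta>)" for l
      proof -
        obtain i j m k where "l = (i, j, m, k)" by (cases l) auto
        then show ?thesis using Psi_in[OF b0(1) _ inF2[OF b0(1), of m i j k]] by (simp only: q_def R_field_eq prod.case)
      qed
      show ?thesis
      proof (rule A.total_mono[OF Psi_total[OF b0(1), of "n + 1", folded R_field_eq]])
        show "range (\<lambda>l. q l \<beta>) \<subseteq> carrier (R_field E e \<beta>)" using qin by auto
        have "Psi \<beta> M z \<in> cspan (R_field E e \<beta>) (range (\<lambda>l. q l \<beta>))" if M: "M \<ge> n + 1" and z: "z \<in> carrier (F (\<beta> + real M))" for M z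
        proof -
          \<comment> \<open>For M \<ge> n + 1 the level splits as M = n + (m + 1), so E_{\<beta>+M}
            is the closed span of products of basis vectors of E_n, E_\<beta> and E_{m+1}.\<close>
          define m where "m = M - n - 1"
          have Mm: "M = n + Suc m" using M by (simp add: m_def)
          let ?A = "(\<lambda>(x, y). aprod E (real n) \<beta> x y) ` (range (\<lambda>i. bs i (real n)) \<times> range (\<lambda>j. bs j \<beta>))"
          let ?B = "(\<lambda>(x, y). aprod E (\<beta> + real n) (real (Suc m)) x y) ` (?A \<times> range (\<lambda>k. bs k (real (Suc m))))"
          have tb: "total (F s) (range (\<lambda>i. bs i s))" if "s > 0" for s using onb_bs[OF that] by (simp add: onb_def)
          have tA: "total (F (\<beta> + real n)) ?A" by (rule aprod_total[OF n0 b0(1) tb[OF n0] tb[OF b0(1)]]) simp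
          have tB: "total (F (\<beta> + real M)) ?B" by (rule aprod_total[OF b0(2) _ tA tb]) (auto simp: Mm)
          show ?thesis
          proof (rule hbdd_cspan[OF sip_F A.sip_axioms lin_isometry_hbdd[OF Psi_props(1)[OF b0(1), of M], folded R_field_eq]])
            show "z \<in> cspan (F (\<beta> + real M)) ?B" using tB z by (auto simp: total_def)
            fix a assume "a \<in> ?B"
            then obtain i j k where "a = aprod E (\<beta> + real n) (real (Suc m)) (aprod E (real n) \<beta> (bs i (real n)) (bs j \<beta>)) (bs k (real (Suc m)))" by auto
            then have "Psi \<beta> M a = q (i, j, m, k) \<beta>" by (simp add: q_def Mm)
            then show "Psi \<beta> M a \<in> cspan (R_field E e \<beta>) (range (\<lambda>l. q l \<beta>))" using qin[of "(i, j, m, k)"] by (auto intro: cspan.base)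
          qed (use b0 M in auto)
        qed
        then show "{Psi \<beta> m z |m z. n + 1 \<le> m \<and> 1 \<le> m \<and> z \<in> carrier (F (\<beta> + real m))} \<subseteq> cspan (R_field E e \<beta>) (range (\<lambda>l. q l \<beta>))" by blast
      qed
    qed
    show "W ` carrier (F (real n) \<otimes>\<^sub>H H) \<subseteq> carrier DR" using lin_isometry_in[OF W] by auto
    fix l :: "nat \<times> nat \<times> nat \<times> nat" and c :: "real \<Rightarrow> complex"
    assume c: "c \<in> borel_measurable (restrict_space lborel {0<..1})" "integrable (restrict_space lborel {0<..1}) (\<lambda>\<alpha>. (cmod (c \<alpha>))\<^sup>2)"
    obtain i j m k where l: "l = (i, j, m, k)" by (cases l) auto
    have "(\<lambda>\<beta>\<in>{0<..1}. c \<beta> \<odot>\<^bsub>R_field E e \<beta>\<^esub> q l \<beta>) = (\<lambda>\<beta>\<in>{0<..1}. Psi \<beta> (n + Suc m) (aprod E (\<beta> + real n) (real (Suc m)) (aprod E (real n) \<beta> (bs i (real n)) ((\<lambda>\<alpha>\<in>{0<..1}. c \<alpha> \<odot>\<^bsub>F \<alpha>\<^esub> bs j \<alpha>) \<beta>)) (bs k (real (Suc m)))))"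
    proof (rule restrict_ext)
      fix \<beta> :: real assume \<beta>: "\<beta> \<in> {0<..1}"
      then have b0: "\<beta> > 0" "\<beta> + real n > 0" by auto
      have h1: "hbdd (F \<beta>) (F (\<beta> + real n)) (aprod E (real n) \<beta> (bs i (real n)))"
        by (rule aprod_hbdd_right[OF n0 b0(1) bs_in[OF n0]]) simp
      have h2: "hbdd (F (\<beta> + real n)) (F (\<beta> + real (n + Suc m))) (\<lambda>x. aprod E (\<beta> + real n) (real (Suc m)) x (bs k (real (Suc m))))"
        by (rule aprod_hbdd_left[OF b0(2) _ bs_in]) auto
      have h3: "hbdd (F (\<beta> + real (n + Suc m))) (R_field E e \<beta>) (Psi \<beta> (n + Suc m))"
        unfolding R_field_eq by (rule lin_isometry_hbdd[OF Psi_props(1)[OF b0(1)]]) simp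
      \<comment> \<open>The scalar passes through the two multiplications and \<open>Psi\<close> by
        linearity and lands on b_j(\<beta>).\<close>
      note h = hbdd_smult[OF hbdd_comp[OF hbdd_comp[OF h1 h2] h3] bs_in[OF b0(1)], of "c \<beta>" j]
      show "c \<beta> \<odot>\<^bsub>R_field E e \<beta>\<^esub> q l \<beta> = Psi \<beta> (n + Suc m) (aprod E (\<beta> + real n) (real (Suc m)) (aprod E (real n) \<beta> (bs i (real n)) ((\<lambda>\<alpha>\<in>{0<..1}. c \<alpha> \<odot>\<^bsub>F \<alpha>\<^esub> bs j \<alpha>) \<beta>)) (bs k (real (Suc m))))"
        unfolding restrict_apply'[OF \<beta>] h q_def l prod.case ..
    qed
    then show "RF.L.cls (\<lambda>\<beta>\<in>{0<..1}. c \<beta> \<odot>\<^bsub>R_field E e \<beta>\<^esub> q l \<beta>) \<in> W ` carrier (F (real n) \<otimes>\<^sub>H H)"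
      using shift[OF mult_bs_in[OF c, of j], of m i k] by (simp only:)
  qed
  have Wu: "unitary (F (real n) \<otimes>\<^sub>H H) DR W"
    by (rule isometry_surj[OF TP.hilb_T RF.ips_D W tot order_refl])
  have "h \<in> v_map E e (real n) ` carrier (F (real n) \<otimes>\<^sub>H H)" if h: "h \<in> carrier H" for h
  proof -
    have "Tmap h \<in> carrier DR" by (rule lin_isometry_in[OF unitary_isometry[OF Tmap_props(1)] h])
    moreover have "W ` carrier (F (real n) \<otimes>\<^sub>H H) = carrier DR" using Wu unfolding unitary_def by (rule conjunct2)
    ultimately have "Tmap h \<in> W ` carrier (F (real n) \<otimes>\<^sub>H H)" by (simp only:)
    then obtain z where z: "z \<in> carrier (F (real n) \<otimes>\<^sub>H H)" "Tmap h = Tmap (v_map E e (real n) z)"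
      unfolding W_def by (rule imageE)
    have "h = v_map E e (real n) z"
      by (rule trans[OF Tmap_inv(3)[OF h, symmetric] trans[OF arg_cong[where f = "inv_into (carrier H) Tmap", OF z(2)] Tmap_inv(3)[OF lin_isometry_in[OF v z(1)]]]])
    then show ?thesis using z(1) by (rule image_eqI)
  qed
  then have "v_map E e (real n) ` carrier (F (real n) \<otimes>\<^sub>H H) = carrier H" by (intro equalityI subsetI) (auto intro: lin_isometry_in[OF v])
  then show ?thesis unfolding unitary_def by (intro conjI v)
qed

lemma v_unitary:
  assumes t: "t > 0"
  shows "unitary (F t \<otimes>\<^sub>H H) H (v_map E e t)"
proof -
  obtain n :: nat where n: "t < real n" using reals_Archimedean2 by blast
  define s where "s = real n - t"
  have s: "s > 0" "t + s = real n" "n \<ge> 1" using n t by (auto simp: s_def intro: Suc_leI)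
  have n0: "real n > 0" using s(3) by simp
  interpret A: tensor_pair "F t" H by (rule tensor_pair_H[OF t])
  interpret B: tensor_pair "F s" H by (rule tensor_pair_H[OF s(1)])
  interpret C: tensor_pair "F (real n)" H by (rule tensor_pair_H[OF n0])
  let ?P = "(\<lambda>(x, y). aprod E t s x y) ` (carrier (F t) \<times> carrier (F s))"
  \<comment> \<open>Products x y are total in E_n, so the vectors v_n(xy \<otimes> h) are total in
    H; each of them lies in the range of v_t.\<close>
  have tP: "total (F (real n)) ?P" by (rule aprod_total[OF t s(1) A.X.total_carrier B.X.total_carrier s(2)[symmetric]])
  have "total H (v_map E e (real n) ` (\<lambda>(a, h). tens (F (real n)) H a h) ` (?P \<times> carrier H))"
    by (rule total_image[OF C.T.sip_axioms HH.sip_axioms v_nat_unitary[OF s(3)] C.total_tens_image[OF tP HH.total_carrier]])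
  then show ?thesis
  proof (rule isometry_surj[OF A.hilb_T HH.ips_axioms v_map_props(1)[OF t]])
    show "v_map E e (real n) ` (\<lambda>(a, h). tens (F (real n)) H a h) ` (?P \<times> carrier H) \<subseteq> v_map E e t ` carrier (F t \<otimes>\<^sub>H H)"
    proof clarsimp
      fix x y h assume a: "x \<in> carrier (F t)" "y \<in> carrier (F s)" "h \<in> carrier H"
      have "v_map E e (real n) (tens (F (real n)) H (aprod E t s x y) h) = v_map E e t (tens (F t) H x (v_map E e s (tens (F s) H y h)))"
        using v_comp[OF t s(1) a] unfolding s(2) .
      moreover have "v_map E e s (tens (F s) H y h) \<in> carrier H" by (rule lin_isometry_in[OF v_map_props(1)[OF s(1)] B.tens_in[OF a(2,3)]])
      ultimately show "v_map E e (real n) (tens (F (real n)) H (aprod E t s x y) h) \<in> v_map E e t ` carrier (F t \<otimes>\<^sub>H H)"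
        using A.tens_in[OF a(1)] by blast
    qed
  qed
qed

subsection \<open>The maps of the first construction\<close>

text \<open>\<open>inv_into\<close> returns some preimage; surjectivity of \<alpha> \<mapsto>
  \<beta> guarantees t + \<alpha> = \<beta> + n, from which the later computations proceed.\<close>

lemma w_section_index:
  assumes t: "t > 0" and b: "\<beta> \<in> {0<..1}"
  obtains \<alpha> n where "\<alpha> \<in> {0<..1}" "t + \<alpha> = \<beta> + real n"
    "\<And>x f y. w_section E e t x f y \<beta> = w_value E e \<beta> n (aprod E t \<alpha> x (f \<alpha>)) y"
proof -
  let ?\<phi> = "\<lambda>\<alpha>. t + \<alpha> - of_int (unit_index (t + \<alpha>))"
  \<comment> \<open>The integer translate of \<beta> - t that lies in (0,1]; rounding by floor plus
    one excludes 0 and admits 1.\<close>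
  define \<alpha>0 where "\<alpha>0 = \<beta> + of_int (\<lfloor>t - \<beta>\<rfloor> + 1) - t"
  have a0: "\<alpha>0 \<in> {0<..1}"
    using floor_correct[of "t - \<beta>"] unfolding \<alpha>0_def greaterThanAtMost_iff of_int_add of_int_1 by linarith
  have "unit_index (t + \<alpha>0) = \<lfloor>t - \<beta>\<rfloor> + 1" by (rule unit_index_eq) (use b in \<open>simp add: \<alpha>0_def\<close>)
  then have "?\<phi> \<alpha>0 = \<beta>" by (simp add: \<alpha>0_def)
  then have im: "\<beta> \<in> ?\<phi> ` {0<..1}" using a0 by (intro image_eqI[of _ _ \<alpha>0]) simp_all
  define \<alpha> where "\<alpha> = inv_into {0<..1} ?\<phi> \<beta>"
  have a: "\<alpha> \<in> {0<..1}" "?\<phi> \<alpha> = \<beta>" unfolding \<alpha>_def by (rule inv_into_into[OF im], rule f_inv_into_f[OF im])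
  \<comment> \<open>Since t > 0, \<alpha> > 0 and \<beta> \<le> 1, the integer t + \<alpha> -
    \<beta> exceeds -1, so it is nonnegative and unchanged by \<open>nat\<close>.\<close>
  have "of_int (unit_index (t + \<alpha>)) > (-1 :: real)" using a t b unfolding greaterThanAtMost_iff by linarith
  then have n: "unit_index (t + \<alpha>) \<ge> 0" by linarith
  show ?thesis
  proof (rule that[OF a(1)])
    show "t + \<alpha> = \<beta> + real (nat (unit_index (t + \<alpha>)))" using a(2) n by simp
    show "w_section E e t x f y \<beta> = w_value E e \<beta> (nat (unit_index (t + \<alpha>))) (aprod E t \<alpha> x (f \<alpha>)) y" for x f y
      using b unfolding w_section_def Let_def \<alpha>_def by simp
  qed
qed

context
  fixes t :: real and x f
  assumes t: "t > 0" and x: "x \<in> carrier (F t)" and f: "f \<in> carrier U.l2"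
begin

text \<open>The two sections coincide at every point and not merely almost everywhere, so
  measurability and square integrability of \<open>w_section\<close> on vectors i_k(y) are inherited
  from \<open>Tsec\<close>.\<close>

lemma w_section_incl:
  assumes k: "k \<ge> 1" and y: "y \<in> carrier (F (real k))"
  shows "w_section E e t x f (incl E e k y) = Tsec (shift_section E t x (tilde E e k (gs k f y)))"
proof (rule extensionalityI[of _ "{0<..1}"])
  fix \<beta> :: real assume b: "\<beta> \<in> {0<..1}"
  then obtain \<alpha> n where a: "\<alpha> \<in> {0<..1}" "t + \<alpha> = \<beta> + real n"
    "\<And>x f y. w_section E e t x f y \<beta> = w_value E e \<beta> n (aprod E t \<alpha> x (f \<alpha>)) y"
    using w_section_index[OF t] by metis
  have z: "aprod E t \<alpha> x (f \<alpha>) \<in> carrier (F (\<beta> + real n))"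
    by (rule aprod_in[OF t _ x U.l2_in[OF f a(1)]]) (use a in auto)
  show "w_section E e t x f (incl E e k y) \<beta> = Tsec (shift_section E t x (tilde E e k (gs k f y))) \<beta>"
    unfolding a(3) Tsec_shift_tilde[OF t x k f y b a(1,2)]
    by (rule w_value_hbdd(3)[OF _ z k y]) (use b in simp)
qed (simp_all add: w_section_def Tsec_def)

text \<open>The norm of the value is a function of \<beta> times the norm of y; that function is
  read off at i_1(e), which has norm 1.\<close>

lemma w_section_fibre:
  assumes b: "\<beta> \<in> {0<..1}"
  shows "hbdd Rb (R_field E e \<beta>) (\<lambda>y. w_section E e t x f y \<beta>)"
    and "y \<in> carrier Rb \<Longrightarrow> hnorm (R_field E e \<beta>) (w_section E e t x f y \<beta>) = hnorm (R_field E e \<beta>) (w_section E e t x f (incl E e 1 e) \<beta>) * hnorm Rb y"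
proof -
  obtain \<alpha> n where a: "\<alpha> \<in> {0<..1}" "t + \<alpha> = \<beta> + real n"
    "\<And>x f y. w_section E e t x f y \<beta> = w_value E e \<beta> n (aprod E t \<alpha> x (f \<alpha>)) y"
    using w_section_index[OF t b] by metis
  have z: "aprod E t \<alpha> x (f \<alpha>) \<in> carrier (F (\<beta> + real n))"
    by (rule aprod_in[OF t _ x U.l2_in[OF f a(1)]]) (use a in auto)
  have b0: "\<beta> > 0" using b by simp
  note h = w_value_hbdd[OF b0 z, folded R_field_eq]
  show "hbdd Rb (R_field E e \<beta>) (\<lambda>y. w_section E e t x f y \<beta>)" unfolding a(3) by (rule h(1))
  have e: "incl E e 1 e \<in> carrier Rb" by (rule incl_in) (use e_in in auto)
  have "hnorm Rb (incl E e 1 e) = 1"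
    using lin_isometry_hnorm[OF incl_isometry[of 1], of e] e_in e_norm by simp
  then show "y \<in> carrier Rb \<Longrightarrow> hnorm (R_field E e \<beta>) (w_section E e t x f y \<beta>) = hnorm (R_field E e \<beta>) (w_section E e t x f (incl E e 1 e) \<beta>) * hnorm Rb y"
    unfolding a(3) using h(2) e by simp
qed

text \<open>In every fibre the value is bounded and linear in y, so sums, multiples and limits in
  Rbreve become pointwise ones, starting from the vectors i_m(z).\<close>

lemma w_section_measurable:
  assumes y: "y \<in> carrier Rb"
  shows "w_section E e t x f y \<in> R_sections E e"
proof -
  have ext: "w_section E e t x f y \<in> extensional {0<..1}" for y by (simp add: w_section_def)
  note h = w_section_fibre(1)
  have "y \<in> cspan Rb {incl E e m x |m x. m \<ge> 1 \<and> x \<in> carrier (F (real m))}"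
    using total_incl y by (auto simp: total_def)
  then show ?thesis
  proof (induction rule: cspan.induct)
    case zero
    have "w_section E e t x f \<zero>\<^bsub>Rb\<^esub> = (\<lambda>\<beta>\<in>{0<..1}. \<zero>\<^bsub>R_field E e \<beta>\<^esub>)"
    proof (rule extensionalityI[OF ext])
      fix \<beta> :: real assume b: "\<beta> \<in> {0<..1}"
      interpret A: ips "R_field E e \<beta>" by (rule RF.ips_X[OF b])
      have "w_section E e t x f (0 \<odot>\<^bsub>Rb\<^esub> \<zero>\<^bsub>Rb\<^esub>) \<beta> = 0 \<odot>\<^bsub>R_field E e \<beta>\<^esub> w_section E e t x f \<zero>\<^bsub>Rb\<^esub> \<beta>"
        by (rule hbdd_smult[OF h[OF b] Rb.zero_in])
      then show "w_section E e t x f \<zero>\<^bsub>Rb\<^esub> \<beta> = (\<lambda>\<beta>\<in>{0<..1}. \<zero>\<^bsub>R_field E e \<beta>\<^esub>) \<beta>"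
        unfolding Rb.vsmult_zero[OF Rb.zero_in] A.vsmult_zero[OF hbdd_in[OF h[OF b] Rb.zero_in]] using b by simp
    qed simp
    then show ?case using RF.M_zero by (simp only:)
  next
    case (base y)
    then obtain m z where y: "y = incl E e m z" "m \<ge> 1" "z \<in> carrier (F (real m))" by blast
    show ?case unfolding y(1) w_section_incl[OF y(2,3)]
      by (rule RF.l2_M[OF Tsec_in[OF shift_in[OF t x tilde_gs_in[OF y(2) f y(3)]]]])
  next
    case (add y z)
    have c: "y \<in> carrier Rb" "z \<in> carrier Rb" using add.hyps by (auto intro: Rb.cspan_carrier)
    have "w_section E e t x f (y \<oplus>\<^bsub>Rb\<^esub> z) = (\<lambda>\<beta>\<in>{0<..1}. w_section E e t x f y \<beta> \<oplus>\<^bsub>R_field E e \<beta>\<^esub> w_section E e t x f z \<beta>)"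
      by (rule extensionalityI[OF ext]) (simp_all add: hbdd_add[OF h] c)
    then show ?case using RF.M_add[OF add.IH] by (simp only:)
  next
    case (smult y c)
    have c: "y \<in> carrier Rb" using smult.hyps by (auto intro: Rb.cspan_carrier)
    have "w_section E e t x f (c \<odot>\<^bsub>Rb\<^esub> y) = (\<lambda>\<beta>\<in>{0<..1}. c \<odot>\<^bsub>R_field E e \<beta>\<^esub> w_section E e t x f y \<beta>)"
      by (rule extensionalityI[OF ext]) (simp_all add: hbdd_smult[OF h] c)
    then show ?case using RF.M_smult[OF smult.IH] by (simp only:)
  next
    case (lim s y)
    have s: "\<And>n. s n \<in> carrier Rb" using lim.hyps(1) by (blast intro: Rb.cspan_carrier)
    show ?case
    proof (rule RF.M_lim[OF lim.IH ext])
      fix \<beta> :: real assume b: "\<beta> \<in> {0<..1}"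
      show "w_section E e t x f y \<beta> \<in> carrier (R_field E e \<beta>)" by (rule hbdd_in[OF h[OF b] lim.hyps(2)])
      show "hlim (R_field E e \<beta>) (\<lambda>n. w_section E e t x f (s n) \<beta>) (w_section E e t x f y \<beta>)"
        by (rule hbdd_hlim[OF Rb.sip_axioms RF.sip_X[OF b] h[OF b] s lim.hyps(2,3)])
    qed
  qed
qed

text \<open>The squared fibre norm is one integrable function of \<beta> times the squared norm of
  y, so the square root of its integral serves as a bound for all y.\<close>

lemma w_section_cls_hbdd: "hbdd Rb DR (\<lambda>y. RF.L.cls (w_section E e t x f y))"
proof -
  have e: "e \<in> carrier (F (real 1))" "incl E e 1 e \<in> carrier Rb" using e_in by (auto intro: incl_in)
  let ?N = "\<lambda>\<beta>. (hnorm (R_field E e \<beta>) (w_section E e t x f (incl E e 1 e) \<beta>))\<^sup>2"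
  have "w_section E e t x f (incl E e 1 e) \<in> carrier RF.l2"
    unfolding w_section_incl[OF order_refl e(1)]
    by (rule Tsec_in[OF shift_in[OF t x tilde_gs_in[OF order_refl f e(1)]]])
  then have N: "integrable RF.\<Lambda> ?N" by (simp add: RF.l2_carrier)
  have sq: "(hnorm (R_field E e \<beta>) (w_section E e t x f y \<beta>))\<^sup>2 = ?N \<beta> * (hnorm Rb y)\<^sup>2"
    if "y \<in> carrier Rb" "\<beta> \<in> {0<..1}" for y \<beta>
    using w_section_fibre(2)[OF that(2,1)] by (simp add: power_mult_distrib)
  have l2: "w_section E e t x f y \<in> carrier RF.l2" if y: "y \<in> carrier Rb" for y
    by (rule RF.l2_bound[OF integrable_mult_left[where c = "(hnorm Rb y)\<^sup>2", OF N] w_section_measurable[OF y]]) (simp add: sq[OF y])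
  have ext: "w_section E e t x f y \<in> extensional {0<..1}" for y by (simp add: w_section_def)
  note h = w_section_fibre(1)
  have bd: "hnorm RF.l2 (w_section E e t x f y) \<le> sqrt (\<integral>\<beta>. ?N \<beta> \<partial>RF.\<Lambda>) * hnorm Rb y" if y: "y \<in> carrier Rb" for y
  proof -
    have "(hnorm RF.l2 (w_section E e t x f y))\<^sup>2 = (\<integral>\<beta>. ?N \<beta> * (hnorm Rb y)\<^sup>2 \<partial>RF.\<Lambda>)"
      unfolding RF.l2_hnorm_sq[OF l2[OF y]] by (rule Bochner_Integration.integral_cong[OF refl]) (simp add: sq[OF y])
    then have "(hnorm RF.l2 (w_section E e t x f y))\<^sup>2 = (\<integral>\<beta>. ?N \<beta> \<partial>RF.\<Lambda>) * (hnorm Rb y)\<^sup>2" by simp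
    then have "sqrt ((hnorm RF.l2 (w_section E e t x f y))\<^sup>2) = sqrt (\<integral>\<beta>. ?N \<beta> \<partial>RF.\<Lambda>) * sqrt ((hnorm Rb y)\<^sup>2)"
      by (simp only: real_sqrt_mult)
    then show ?thesis using RF.L.hnorm_nonneg[OF l2[OF y]] Rb.hnorm_nonneg[OF y] by simp
  qed
  have "hbdd Rb RF.l2 (w_section E e t x f)"
    unfolding hbdd_def
  proof (intro conjI ballI allI exI[of _ "sqrt (\<integral>\<beta>. ?N \<beta> \<partial>RF.\<Lambda>)"])
    show "w_section E e t x f \<in> carrier Rb \<rightarrow> carrier RF.l2" using l2 by auto
    show "w_section E e t x f (y \<oplus>\<^bsub>Rb\<^esub> z) = w_section E e t x f y \<oplus>\<^bsub>RF.l2\<^esub> w_section E e t x f z"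
      if "y \<in> carrier Rb" "z \<in> carrier Rb" for y z
      by (rule extensionalityI[OF ext]) (simp_all add: hbdd_add[OF h] that)
    show "w_section E e t x f (c \<odot>\<^bsub>Rb\<^esub> y) = c \<odot>\<^bsub>RF.l2\<^esub> w_section E e t x f y" if "y \<in> carrier Rb" for c y
      by (rule extensionalityI[OF ext]) (simp_all add: hbdd_smult[OF h] that)
    show "0 \<le> sqrt (\<integral>\<beta>. ?N \<beta> \<partial>RF.\<Lambda>)" by simp
  qed (rule bd)
  then show "hbdd Rb DR (\<lambda>y. RF.L.cls (w_section E e t x f y))" by (rule hbdd_comp[OF _ RF.cls_hbdd])
qed

end

lemma tensor_pair_R: "t > 0 \<Longrightarrow> tensor_pair (F t) R"
  using sip_F R.sip_axioms by (simp add: tensor_pair_def)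

text \<open>Both sides are bounded and linear in y, and at y = i_m(z) each is the class of
  \<open>Tsec\<close> of the same shifted section.\<close>

lemma Tmap_v_map:
  assumes t: "t > 0" and x: "x \<in> carrier (F t)" and f: "f \<in> carrier U.l2" and y: "y \<in> carrier Rb"
  shows "Tmap (v_map E e t (tens (F t) H x (V (R_tens E e f y)))) = RF.L.cls (w_section E e t x f y)"
proof -
  interpret TP: tensor_pair "F t" H by (rule tensor_pair_H[OF t])
  have "hbdd Rb R (\<lambda>y. R_tens E e f y)"
    unfolding R_tens_eq R_space_def by (rule RR.hbdd_tens_right[OF cls_in_DE[OF f]])
  note 1 = hbdd_comp[OF hbdd_comp[OF hbdd_comp[OF hbdd_comp[OF this lin_isometry_hbdd[OF V_isometry]] TP.hbdd_tens_right[OF x]]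
    lin_isometry_hbdd[OF v_map_props(1)[OF t]]] lin_isometry_hbdd[OF unitary_isometry[OF Tmap_props(1)]]]
  show ?thesis
  proof (rule hbdd_eq[OF Rb.sip_axioms RF.ips_D 1 w_section_cls_hbdd[OF t x f] total_incl _ y])
    fix a assume "a \<in> {incl E e m x |m x. 1 \<le> m \<and> x \<in> carrier (F (real m))}"
    then obtain m z where a: "a = incl E e m z" "m \<ge> 1" "z \<in> carrier (F (real m))" by blast
    note h = tilde_gs_in[OF a(2) f a(3)]
    show "Tmap (v_map E e t (tens (F t) H x (V (R_tens E e f a)))) = RF.L.cls (w_section E e t x f a)"
      unfolding a(1) V_R_tens_incl[OF a(2) f a(3)] v_map_props(2)[OF t x h] Tmap_props(2)[OF shift_in[OF t x h]]
        w_section_incl[OF t x f a(2,3)] ..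
  qed
qed

text \<open>The candidate is the conjugate of v_t by V, which is unitary because v_t is. It meets
  the specification in \<open>w_map\<close>, and no other map does: the specification fixes the
  values on the total vectors x \<otimes> (f \<otimes> y), as \<open>R_ident\<close> is
  injective.\<close>

lemma w_map_props:
  assumes t: "t > 0"
  shows "unitary (F t \<otimes>\<^sub>H R) R (w_map E e t)"
    and "z \<in> carrier (F t \<otimes>\<^sub>H R) \<Longrightarrow> V (w_map E e t z) = v_map E e t (id_tensor (F t) R H V z)"
proof -
  interpret TP: tensor_pair "F t" R by (rule tensor_pair_R[OF t])
  note I = id_tensor_props[OF sip_F[OF t] R.sip_axioms HH.sip_axioms V_isometry]
  define w0 where "w0 z = inv_into (carrier R) V (v_map E e t (id_tensor (F t) R H V z))" for z
  have u0: "unitary (F t \<otimes>\<^sub>H R) R w0"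
    unfolding w0_def[abs_def]
    by (rule unitary_comp[OF unitary_comp[OF id_tensor_unitary[OF sip_F[OF t] R.sip_axioms HH.sip_axioms V_unitary] v_unitary[OF t]] V_inv(4)])
  have Vw0: "V (w0 z) = v_map E e t (id_tensor (F t) R H V z)" if "z \<in> carrier (F t \<otimes>\<^sub>H R)" for z
    unfolding w0_def by (rule V_inv(2)[OF lin_isometry_in[OF v_map_props(1)[OF t] lin_isometry_in[OF I(1) that]]])
  let ?w = "restrict w0 (carrier (F t \<otimes>\<^sub>H R))"
  have w0_in: "w0 z \<in> carrier R" if "z \<in> carrier (F t \<otimes>\<^sub>H R)" for z
    by (rule lin_isometry_in[OF unitary_isometry[OF u0] that])
  have uw: "unitary (F t \<otimes>\<^sub>H R) R ?w"
    using u0 unfolding unitary_def lin_isometry_def by (auto simp: Pi_iff)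
  have R_in: "tens (F t) R x (R_tens E e f y) \<in> carrier (F t \<otimes>\<^sub>H R)"
    if "x \<in> carrier (F t)" "f \<in> carrier U.l2" "y \<in> carrier Rb" for x f y
    by (rule TP.tens_in[OF that(1) R_tens_in[OF that(2,3)]])
  have spec: "R_ident E e (w0 (tens (F t) R x (R_tens E e f y))) = RF.L.cls (w_section E e t x f y)"
    if "x \<in> carrier (F t)" "f \<in> carrier U.l2" "y \<in> carrier Rb" for x f y
    unfolding Tmap_V[OF w0_in[OF R_in[OF that]], symmetric] Vw0[OF R_in[OF that]] I(2)[OF that(1) R_tens_in[OF that(2,3)]]
    by (rule Tmap_v_map[OF t that])
  have "w_map E e t = ?w"
    unfolding w_map_def
  proof (rule the_equality)
    show "?w \<in> extensional (carrier (F t \<otimes>\<^sub>H R)) \<and> unitary (F t \<otimes>\<^sub>H R) R ?w \<and>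
      (\<forall>x\<in>carrier (F t). \<forall>f\<in>E_l2 E 0 1. \<forall>y\<in>carrier Rb.
         R_ident E e (?w (tens (F t) R x (R_tens E e f y))) = section_class {0<..1} (R_field E e) (R_sections E e) (w_section E e t x f y))"
      using uw spec R_in by (simp add: RF.section_class_eq)
    fix W assume W: "W \<in> extensional (carrier (F t \<otimes>\<^sub>H R)) \<and> unitary (F t \<otimes>\<^sub>H R) R W \<and>
      (\<forall>x\<in>carrier (F t). \<forall>f\<in>E_l2 E 0 1. \<forall>y\<in>carrier Rb.
         R_ident E e (W (tens (F t) R x (R_tens E e f y))) = section_class {0<..1} (R_field E e) (R_sections E e) (w_section E e t x f y))"
    then have Wu: "unitary (F t \<otimes>\<^sub>H R) R W" by blast
    show "W = ?w"
    proof (rule extensionalityI[of _ "carrier (F t \<otimes>\<^sub>H R)"])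
      fix z assume z: "z \<in> carrier (F t \<otimes>\<^sub>H R)"
      have "W z = w0 z"
      proof (rule hbdd_eq[OF TP.T.sip_axioms R.ips_axioms lin_isometry_hbdd[OF unitary_isometry[OF Wu]] lin_isometry_hbdd[OF unitary_isometry[OF u0]]
            TP.total_tens_image[OF TP.X.total_carrier total_R_tens[OF Rb.total_carrier]] _ z])
        fix a assume "a \<in> (\<lambda>(x, y). tens (F t) R x y) ` (carrier (F t) \<times> (\<lambda>(f, y). R_tens E e f y) ` (carrier U.l2 \<times> carrier Rb))"
        then obtain x f y where a: "a = tens (F t) R x (R_tens E e f y)" "x \<in> carrier (F t)" "f \<in> carrier U.l2" "y \<in> carrier Rb" by auto
        have "R_ident E e (W a) = R_ident E e (w0 a)"
          using W a(2-4) unfolding a(1) spec[OF a(2-4)] RF.section_class_eq by blast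
        moreover have "W a \<in> carrier R" "w0 a \<in> carrier R"
          unfolding a(1) using lin_isometry_in[OF unitary_isometry[OF Wu] R_in[OF a(2-4)]] w0_in[OF R_in[OF a(2-4)]] by auto
        ultimately show "W a = w0 a"
          using unitary_inv(3)[OF R.ips_axioms RF.D.sip_axioms R_ident_props(1)] by metis
      qed
      then show "W z = ?w z" using z by simp
    qed (use W in auto)
  qed
  then show "unitary (F t \<otimes>\<^sub>H R) R (w_map E e t)"
    and "z \<in> carrier (F t \<otimes>\<^sub>H R) \<Longrightarrow> V (w_map E e t z) = v_map E e t (id_tensor (F t) R H V z)"
    using uw Vw0 by simp_all
qed

text \<open>Applying V turns the claim into \<open>v_comp\<close>; injectivity of V brings it
  back.\<close>

lemma w_assoc:
  assumes t: "t > 0" and s: "s > 0" and x: "x \<in> carrier (F t)" and y: "y \<in> carrier (F s)" and h: "h \<in> carrier R"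
  shows "w_map E e (t + s) (tens (F (t + s)) R (aprod E t s x y) h) = w_map E e t (tens (F t) R x (w_map E e s (tens (F s) R y h)))"
proof -
  have ts: "t + s > 0" using t s by simp
  interpret A: tensor_pair "F t" R by (rule tensor_pair_R[OF t])
  interpret B: tensor_pair "F s" R by (rule tensor_pair_R[OF s])
  interpret C: tensor_pair "F (t + s)" R by (rule tensor_pair_R[OF ts])
  have xy: "aprod E t s x y \<in> carrier (F (t + s))" by (rule aprod_in[OF t s x y refl])
  have V: "V (w_map E e r (tens (F r) R u k)) = v_map E e r (tens (F r) H u (V k))"
    if r: "r > 0" and u: "u \<in> carrier (F r)" and k: "k \<in> carrier R" for r u k
    unfolding w_map_props(2)[OF r tensor_pair.tens_in[OF tensor_pair_R[OF r] u k]]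
      id_tensor_props(2)[OF sip_F[OF r] R.sip_axioms HH.sip_axioms V_isometry u k] ..
  have win: "w_map E e r (tens (F r) R u k) \<in> carrier R"
    if r: "r > 0" and u: "u \<in> carrier (F r)" and k: "k \<in> carrier R" for r u k
    by (rule lin_isometry_in[OF unitary_isometry[OF w_map_props(1)[OF r]] tensor_pair.tens_in[OF tensor_pair_R[OF r] u k]])
  have "V (w_map E e (t + s) (tens (F (t + s)) R (aprod E t s x y) h)) = V (w_map E e t (tens (F t) R x (w_map E e s (tens (F s) R y h))))"
    unfolding V[OF ts xy h] V[OF t x win[OF s y h]] V[OF s y h] by (rule v_comp[OF t s x y V_in[OF h]])
  then show ?thesis using V_inv(3)[OF win[OF ts xy h]] V_inv(3)[OF win[OF t x win[OF s y h]]] by metis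
qed

end

text \<open>The clause quantifying over V' renders "determined by": any isometry with the given
  values on the vectors f \<otimes> i_m(y) is V. The comparison is made on the carrier, since
  functions are arbitrary outside it.\<close>

theorem mainTheorem1:
  fixes H0 :: "'h hspace" and E :: "'a arveson" and e :: 'a
  assumes "arveson_system H0 E"
    and "e \<in> carrier (fib E 1)" and "hnorm (fib E 1) e = 1"
  shows "(\<exists>V.
      unitary (R_space E e) (H_space E e) V \<and> V_formula E e V \<and>
      (\<forall>V'. lin_isometry (R_space E e) (H_space E e) V' \<and> V_formula E e V' \<longrightarrow>
         (\<forall>h\<in>carrier (R_space E e). V' h = V h)) \<and>
      (\<forall>t>0. \<forall>z\<in>carrier (fib E t \<otimes>\<^sub>H R_space E e).
         V (w_map E e t z) =
           v_map E e t (id_tensor (fib E t) (R_space E e) (H_space E e) V z))) \<and>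
    (\<forall>t>0. unitary (fib E t \<otimes>\<^sub>H R_space E e) (R_space E e) (w_map E e t)) \<and>
    (\<forall>t>0. \<forall>s>0. \<forall>x\<in>carrier (fib E t). \<forall>y\<in>carrier (fib E s). \<forall>h\<in>carrier (R_space E e).
       w_map E e (t + s) (tens (fib E (t + s)) (R_space E e) (aprod E t s x y) h) =
         w_map E e t (tens (fib E t) (R_space E e) x
           (w_map E e s (tens (fib E s) (R_space E e) y h)))) \<and>
    (\<forall>t>0. unitary (fib E t \<otimes>\<^sub>H H_space E e) (H_space E e) (v_map E e t))"
proof -
  interpret arveson_unit H0 E e
    by (intro arveson_unit.intro arveson.intro arveson_unit_axioms.intro assms)
  show ?thesis
  proof (intro conjI allI impI ballI exI[of _ V])
    show "unitary R H V" by (rule V_unitary)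
    show "V_formula E e V" by (rule V_formula_V)
    show "V' h = V h" if "lin_isometry R H V' \<and> V_formula E e V'" "h \<in> carrier R" for V' h
      using that by (intro V_unique) auto
    show "V (w_map E e t z) = v_map E e t (id_tensor (F t) R H V z)" if "t > 0" "z \<in> carrier (F t \<otimes>\<^sub>H R)" for t z
      by (rule w_map_props(2)[OF that])
    show "unitary (F t \<otimes>\<^sub>H R) R (w_map E e t)" if "t > 0" for t by (rule w_map_props(1)[OF that])
    show "unitary (F t \<otimes>\<^sub>H H) H (v_map E e t)" if "t > 0" for t by (rule v_unitary[OF that])
    show "w_map E e (t + s) (tens (F (t + s)) R (aprod E t s x y) h) = w_map E e t (tens (F t) R x (w_map E e s (tens (F s) R y h)))"
      if "t > 0" "s > 0" "x \<in> carrier (F t)" "y \<in> carrier (F s)" "h \<in> carrier R" for t s x y h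
      by (rule w_assoc[OF that])
  qed
qed

end
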